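(* Let $\chi:H\to\overline{\mathbf F}_p^\times$ be a character, $\gamma=\{\chi,\chi^s\}$, let $\pi$ be a smooth $\overline{\mathbf F}_p$-representation of $G$, and suppose that $\pi^{I_1}\cong M_\gamma$ as right $\mathcal H$-modules. Then $$\dim\mathrm{Hom}_G(H_0(X,\mathcal V_\gamma),\pi)=1.$$
   Context: All representations are on $\overline{\mathbf F}_p$-vector spaces. $F$ is a non-Archimedean local field with ring of integers $\mathfrak o_F$, maximal ideal $\mathfrak p_F$, fixed uniformiser $\varpi_F$ and residue field $\mathbf F_q$ of characteristic $p$. $G=\mathrm{GL}_2(F)$, $K=\mathrm{GL}_2(\mathfrak o_F)$, $\Gamma=\mathrm{GL}_2(\mathbf F_q)$; $B,H,U\subset\Gamma$ are the upper triangular, diagonal, and unipotent upper triangular matrices. $K_1$ is the kernel of reduction $K\to\Gamma$; $I$, $I_1$ are the preimages of $B$, $U$ in $K$. $\Pi=\begin{pmatrix}0&1\\ \varpi_F&0\end{pmatrix}$, $n_s=\begin{pmatrix}0&-1\\1&0\end{pmatrix}$, $s=\begin{pmatrix}0&1\\1&0\end{pmatrix}$, $\chi^s(h)=\chi(s^{-1}hs)$. Representations of $\Gamma$ are viewed as representations of $K$ via $K/K_1\cong\Gamma$. Hecke algebra: $\mathcal H=\mathrm{End}_G(\text{c-Ind}_{I_1}^G\mathbf 1)$ acts on the right on $\pi^{I_1}\cong\mathrm{Hom}_G(\text{c-Ind}_{I_1}^G\mathbf 1,\pi)$. It is generated by elements $T_{n_s},T_\Pi,T_\Pi^{-1}$,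 $e_\chi$ acting by $vT_{n_s}=\sum_{u\in I_1/K_1}un_s^{-1}v$, $vT_\Pi=\Pi^{-1}v$, $ve_\chi$ = projection to the $\chi$-isotypic part for $I/I_1\cong H$. $M_\gamma$ is the right $\mathcal H$-module with basis $v_1,v_2$, with $v_1T_\Pi=v_2$, $v_2T_\Pi=v_1$, $v_1e_\chi=v_1$, $v_2e_{\chi^s}=v_2$, $v_2T_{n_s}=0$, and $v_1T_{n_s}=-v_1$ if $\chi=\chi^s$, $v_1T_{n_s}=0$ if $\chi\ne\chi^s$. Irreducibles of $\Gamma$: $J_0(\chi)=\{s\}$ if $\chi=\chi^s$, $\emptyset$ otherwise; for $J\subseteq J_0(\chi)$, $\overline J=J_0(\chi)\setminus J$. If $\chi\neq\chi^s$, $\rho_{\chi,\emptyset}$ is the unique irreducible representation of $\Gamma$ on whose (one-dimensional) $U$-invariants $B$ acts by $\chi$. If $\chi=\chi^s=\chi'\circ\det$, $\rho_{\chi,\{s\}}=\chi'\circ\det$, $\rho_{\chi,\emptyset}=\mathrm{St}\otimes\chi'\circ\det$, $\mathrm{St}$ the $q$-dimensional Steinberg representation. $\tilde\rho$ is the extension of $\rho$ to $F^\times K$ with $\varpi_F$ acting trivially. Coefficient systems: $X$ is the Bruhat–Tits tree of $G$ (vertices: homothety classes of $\mathfrak o_F$-lattices in $F^2=\langle v_1,v_2\rangle$); $\sigma_0=[\mathfrak o_Fv_1+\mathfrak o_Fv_2]$, $\sigma_1=\{\sigma_0,[\mathfrak o_Fv_1+\mathfrak p_Fv_2]\}$, with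 $G$-stabilisers $\mathfrak K(\sigma_0)=F^\times K$, $\mathfrak K(\sigma_1)=\langle I,\Pi\rangle$. For a $G$-equivariant coefficient system $\mathcal V$ (vector spaces $V_\sigma$ for simplices $\sigma$, restriction maps $r^{\sigma'}_\sigma:V_{\sigma'}\to V_\sigma$ for $\sigma\subseteq\sigma'$ with $r^\sigma_\sigma=\mathrm{id}$, and compatible maps $g_\sigma:V_\sigma\to V_{g\sigma}$ forming a $G$-action, smooth on stabilisers), $H_0(X,\mathcal V)$ is the cokernel of $\partial:C_1\to C_0$, where $C_0$ is the space of finitely supported $\omega$ on vertices with $\omega(\sigma)\in V_\sigma$, $C_1$ the space of finitely supported $\omega$ on oriented edges with $\omega((\sigma,\sigma'))\in V_{\{\sigma,\sigma'\}}$, $\omega((\sigma',\sigma))=-\omega((\sigma,\sigma'))$, and $\partial(\omega)(\sigma)=\sum_{\sigma'}r^{\{\sigma,\sigma'\}}_\sigma(\omega((\sigma,\sigma')))$ over neighbours $\sigma'$ of $\sigma$; it is a smooth $G$-representation. $\mathcal V_\gamma$: choose $J\subseteq J_0(\chi)$ and nonzero $v_{\chi,J}\in\rho_{\chi,J}^{I_1}$, $v_{\chi^s,\overline J}\in\rho_{\chi^s,\overline J}^{I_1}$. Let $D_0=\tilde\rho_{\chi,J}\oplus\tilde\rho_{\chi^s,\overline J}$ (a representation of $\mathfrak K(\sigma_0)$), $D_1=D_0^{I_1}$ with $F^\times I$-action extended to $\mathfrak K(\sigma_1)$ by $\Pi^{-1}v_{\chi,J}=v_{\chi^s,\overline J}$,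 $\Pi^{-1}v_{\chi^s,\overline J}=v_{\chi,J}$, and $r:D_1\to D_0$ the inclusion. $\mathcal V_\gamma$ is the coefficient system with $V_{g\sigma_i}=\{f\in\text{c-Ind}_{\mathfrak K(\sigma_i)}^GD_i:\mathrm{supp}f\subseteq\mathfrak K(\sigma_i)g^{-1}\}$, $G$ acting by right translation, the restriction map $V_{g\sigma_1}\to V_{g\sigma_0}$ sending $f$ to the element with value $r(f(g^{-1}))$ at $g^{-1}$. It is, up to isomorphism, the unique $G$-equivariant coefficient system with $(V_{\sigma_0},V_{\sigma_1},r^{\sigma_1}_{\sigma_0})\cong(D_0,D_1,r)$, and is independent of the choices up to isomorphism. *)

theory Defs
  imports
    "HOL-Analysis.Determinants"
    "HOL-Algebra.Group"
    "HOL-Computational_Algebra.Polynomial"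
    "HOL-Library.Function_Algebras"
begin

section \<open>Coefficient field, local field, matrix groups\<close>

text \<open>The field \<open>'k\<close> is an algebraic closure of its prime field \<open>F\<^sub>p\<close>, \<open>p = CHAR('k)\<close>.\<close>

definition is_Fp_bar :: "'k::alg_closed_field itself \<Rightarrow> bool" where
  "is_Fp_bar _ \<longleftrightarrow> prime CHAR('k) \<and>
     (\<forall>x::'k. \<exists>P :: int poly. map_poly of_int P \<noteq> (0 :: 'k poly) \<and> poly (map_poly of_int P) x = 0)"

text \<open>
  The field type \<open>'f\<close> with its normalised discrete valuation (the value at \<open>0\<close> is irrelevant), a
  uniformiser, and the reduction map from the ring of integers to the residue field \<open>'q\<close>
  (values of \<open>red\<close> outside the ring of integers are irrelevant).
\<close>

record ('f, 'q) valued_field =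
  val :: "'f \<Rightarrow> int"
  unif :: 'f
  red :: "'f \<Rightarrow> 'q"

definition ints :: "('f::field, 'q) valued_field \<Rightarrow> 'f set" where
  "ints F = {x. x = 0 \<or> val F x \<ge> 0}"

definition ideal_pow :: "('f::field, 'q) valued_field \<Rightarrow> nat \<Rightarrow> 'f set" where
  "ideal_pow F n = {x. x = 0 \<or> val F x \<ge> int n}"

locale nonarch_local_field =
  fixes F :: "('f::field, 'q::{field, finite}) valued_field"
  assumes val_mult: "x \<noteq> 0 \<Longrightarrow> y \<noteq> 0 \<Longrightarrow> val F (x * y) = val F x + val F y"
    and val_add: "x \<noteq> 0 \<Longrightarrow> y \<noteq> 0 \<Longrightarrow> x + y \<noteq> 0 \<Longrightarrow> val F (x + y) \<ge> min (val F x) (val F y)"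
    and unif_nonzero: "unif F \<noteq> 0"
    and val_unif: "val F (unif F) = 1"
    and complete: "(\<And>N. \<exists>M::nat. \<forall>m\<ge>M. \<forall>n\<ge>M. X m - X n \<in> ideal_pow F N) \<Longrightarrow>
          \<exists>L. \<forall>N. \<exists>M::nat. \<forall>n\<ge>M. X n - L \<in> ideal_pow F N"
    and red_one: "red F 1 = 1"
    and red_add: "x \<in> ints F \<Longrightarrow> y \<in> ints F \<Longrightarrow> red F (x + y) = red F x + red F y"
    and red_mult: "x \<in> ints F \<Longrightarrow> y \<in> ints F \<Longrightarrow> red F (x * y) = red F x * red F y"
    and red_surj: "red F ` ints F = UNIV"
    and red_kernel: "x \<in> ints F \<Longrightarrow> red F x = 0 \<longleftrightarrow> x \<in> ideal_pow F 1"

definition GL2 :: "('a::field^2^2) monoid" where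
  "GL2 = \<lparr>carrier = {A. invertible A}, mult = (**), one = mat 1\<rparr>"

definition units_group :: "'a::field monoid" where
  "units_group = \<lparr>carrier = - {0}, mult = (*), one = 1\<rparr>"

definition Borel :: "('q::field^2^2) set" where
  "Borel = {A \<in> carrier GL2. A$2$1 = 0}"

definition Torus :: "('q::field^2^2) set" where
  "Torus = {A \<in> carrier GL2. A$1$2 = 0 \<and> A$2$1 = 0}"

definition Unip :: "('q::field^2^2) set" where
  "Unip = {A. A$1$1 = 1 \<and> A$2$2 = 1 \<and> A$2$1 = 0}"

definition diag_part :: "'q::field^2^2 \<Rightarrow> 'q^2^2" where
  "diag_part A = vector [vector [A$1$1, 0], vector [0, A$2$2]]"

definition K :: "('f::field, 'q) valued_field \<Rightarrow> ('f^2^2) set" where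
  "K F = {A. (\<forall>i j. A$i$j \<in> ints F) \<and>
     (\<exists>A'. A ** A' = mat 1 \<and> A' ** A = mat 1 \<and> (\<forall>i j. A'$i$j \<in> ints F))}"

definition red_mat :: "('f::field, 'q) valued_field \<Rightarrow> 'f^2^2 \<Rightarrow> 'q^2^2" where
  "red_mat F A = (\<chi> i j. red F (A$i$j))"

definition K1 :: "('f::field, 'q::field) valued_field \<Rightarrow> ('f^2^2) set" where
  "K1 F = {A \<in> K F. red_mat F A = mat 1}"

definition Iw :: "('f::field, 'q::field) valued_field \<Rightarrow> ('f^2^2) set" where
  "Iw F = {A \<in> K F. red_mat F A \<in> Borel}"

definition Iw1 :: "('f::field, 'q::field) valued_field \<Rightarrow> ('f^2^2) set" where
  "Iw1 F = {A \<in> K F. red_mat F A \<in> Unip}"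

definition ZI :: "('f::field, 'q::field) valued_field \<Rightarrow> ('f^2^2) set" where
  "ZI F = {mat c ** A | c A. c \<noteq> 0 \<and> A \<in> Iw F}"

definition Pi_mat :: "('f::field, 'q) valued_field \<Rightarrow> 'f^2^2" where
  "Pi_mat F = vector [vector [0, 1], vector [unif F, 0]]"

definition n_s :: "'a::field^2^2" where
  "n_s = vector [vector [0, -1], vector [1, 0]]"

definition s_mat :: "'a::field^2^2" where
  "s_mat = vector [vector [0, 1], vector [1, 0]]"

text \<open>The principal congruence subgroups; they form a neighbourhood basis of the identity in
  \<open>GL\<^sub>2(F)\<close> consisting of open subgroups.\<close>

definition cong_subgroup :: "('f::field, 'q) valued_field \<Rightarrow> nat \<Rightarrow> ('f^2^2) set" where
  "cong_subgroup F n = {A \<in> K F. \<forall>i j. (A - mat 1)$i$j \<in> ideal_pow F n}"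


section \<open>Representations\<close>

text \<open>
  Two styles are used: representations on a whole type (a scalar multiplication together with an
  action), and the record below for representations on subspaces and quotients.
\<close>

locale group_rep = group G + vector_space sc
  for G :: "'g monoid" and sc :: "'k::field \<Rightarrow> 'v::ab_group_add \<Rightarrow> 'v" +
  fixes action :: "'g \<Rightarrow> 'v \<Rightarrow> 'v"
  assumes action_linear: "g \<in> carrier G \<Longrightarrow> Vector_Spaces.linear sc sc (action g)"
    and action_one: "action (one G) v = v"
    and action_mult: "g \<in> carrier G \<Longrightarrow> h \<in> carrier G \<Longrightarrow>
          action (mult G g h) v = action g (action h v)"

definition irreducible_rep ::
  "'g monoid \<Rightarrow> ('k::field \<Rightarrow> 'v::ab_group_add \<Rightarrow> 'v) \<Rightarrow> ('g \<Rightarrow> 'v \<Rightarrow> 'v) \<Rightarrow> bool" where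
  "irreducible_rep G sc action \<longleftrightarrow> group_rep G sc action \<and> (\<exists>v::'v. v \<noteq> 0) \<and>
     (\<forall>W. module.subspace sc W \<and> (\<forall>g\<in>carrier G. action g ` W \<subseteq> W) \<longrightarrow> W = {0} \<or> W = UNIV)"

definition invariants :: "'g set \<Rightarrow> ('g \<Rightarrow> 'v \<Rightarrow> 'v) \<Rightarrow> 'v set" where
  "invariants S action = {v. \<forall>g\<in>S. action g v = v}"

definition smooth_rep :: "('f::field, 'q) valued_field \<Rightarrow> ('k::field \<Rightarrow> 'v::ab_group_add \<Rightarrow> 'v) \<Rightarrow>
    ('f^2^2 \<Rightarrow> 'v \<Rightarrow> 'v) \<Rightarrow> bool" where
  "smooth_rep F sc action \<longleftrightarrow> group_rep GL2 sc action \<and>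
     (\<forall>v. \<exists>n. \<forall>g\<in>cong_subgroup F n. action g v = v)"

record ('g, 'k, 'v) rep =
  rep_space :: "'v set"
  rep_add :: "'v \<Rightarrow> 'v \<Rightarrow> 'v"
  rep_smul :: "'k \<Rightarrow> 'v \<Rightarrow> 'v"
  rep_act :: "'g \<Rightarrow> 'v \<Rightarrow> 'v"

definition rep_on :: "'v::plus set \<Rightarrow> ('k \<Rightarrow> 'v \<Rightarrow> 'v) \<Rightarrow> ('g \<Rightarrow> 'v \<Rightarrow> 'v) \<Rightarrow> ('g, 'k, 'v) rep" where
  "rep_on V sc action = \<lparr>rep_space = V, rep_add = (+), rep_smul = sc, rep_act = action\<rparr>"

definition quot_rep :: "('g, 'k, 'v) rep \<Rightarrow> 'v set \<Rightarrow> ('g, 'k, 'v set) rep" where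
  "quot_rep A W = \<lparr>
     rep_space = {{rep_add A x w | w. w \<in> W} | x. x \<in> rep_space A},
     rep_add = (\<lambda>X Y. {rep_add A x y | x y. x \<in> X \<and> y \<in> Y}),
     rep_smul = (\<lambda>c X. {rep_add A (rep_smul A c x) w | x w. x \<in> X \<and> w \<in> W}),
     rep_act = (\<lambda>g X. rep_act A g ` X)\<rparr>"

definition twist :: "('g \<Rightarrow> 'k) \<Rightarrow> ('g, 'k, 'v) rep \<Rightarrow> ('g, 'k, 'v) rep" where
  "twist \<psi> A = A\<lparr>rep_act := (\<lambda>g v. rep_smul A (\<psi> g) (rep_act A g v))\<rparr>"

text \<open>Equivariant linear maps, normalised to vanish outside the space of \<open>A\<close>, so that they form
  a subspace of the full function space.\<close>

definition Hom_rep :: "'g set \<Rightarrow> ('g, 'k, 'v) rep \<Rightarrow> ('g, 'k, 'w::zero) rep \<Rightarrow> ('v \<Rightarrow> 'w) set" where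
  "Hom_rep S A B = {f.
     (\<forall>x\<in>rep_space A. f x \<in> rep_space B) \<and> (\<forall>x. x \<notin> rep_space A \<longrightarrow> f x = 0) \<and>
     (\<forall>x\<in>rep_space A. \<forall>y\<in>rep_space A. f (rep_add A x y) = rep_add B (f x) (f y)) \<and>
     (\<forall>c. \<forall>x\<in>rep_space A. f (rep_smul A c x) = rep_smul B c (f x)) \<and>
     (\<forall>g\<in>S. \<forall>x\<in>rep_space A. f (rep_act A g x) = rep_act B g (f x))}"

definition iso_rep :: "'g set \<Rightarrow> ('g, 'k, 'v) rep \<Rightarrow> ('g, 'k, 'w::zero) rep \<Rightarrow> bool" where
  "iso_rep S A B \<longleftrightarrow> (\<exists>f\<in>Hom_rep S A B. bij_betw f (rep_space A) (rep_space B))"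

definition fun_scale :: "('k \<Rightarrow> 'v \<Rightarrow> 'v) \<Rightarrow> 'k \<Rightarrow> ('x \<Rightarrow> 'v) \<Rightarrow> 'x \<Rightarrow> 'v" where
  "fun_scale sc c f = (\<lambda>x. sc c (f x))"

text \<open>Right translation.  Functions on \<open>GL\<^sub>2\<close> are extended by zero to all matrices.\<close>

definition rtrans :: "'a::field^2^2 \<Rightarrow> ('a^2^2 \<Rightarrow> 'v) \<Rightarrow> 'a^2^2 \<Rightarrow> 'v" where
  "rtrans g f = (\<lambda>x. f (x ** g))"

text \<open>
  The space of the compact induction of \<open>D\<close> from an open subgroup \<open>S\<close>.  As \<open>S\<close> is open, the
  support is compact modulo \<open>S\<close> iff it consists of finitely many cosets \<open>Sg\<close>.
\<close>

definition c_Ind :: "('f::field, 'q) valued_field \<Rightarrow> ('f^2^2) set \<Rightarrow> 'v::zero set \<Rightarrow>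
    ('f^2^2 \<Rightarrow> 'v \<Rightarrow> 'v) \<Rightarrow> ('f^2^2 \<Rightarrow> 'v) set" where
  "c_Ind F S D action = {f.
     (\<forall>g\<in>carrier GL2. f g \<in> D) \<and> (\<forall>g. g \<notin> carrier GL2 \<longrightarrow> f g = 0) \<and>
     (\<forall>h\<in>S. \<forall>g\<in>carrier GL2. f (h ** g) = action h (f g)) \<and>
     (\<exists>n. \<forall>k\<in>cong_subgroup F n. rtrans k f = f) \<and>
     finite {{h ** g | h. h \<in> S} | g. g \<in> carrier GL2 \<and> f g \<noteq> 0}}"


section \<open>Characters and irreducible representations of \<open>GL\<^sub>2(\<F>\<^sub>q)\<close>\<close>

definition torus_char :: "('q::field^2^2 \<Rightarrow> 'k::field) \<Rightarrow> bool" where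
  "torus_char chi \<longleftrightarrow> chi \<in> hom (GL2\<lparr>carrier := Torus\<rparr>) units_group"

definition conj_s :: "('q::field^2^2 \<Rightarrow> 'k) \<Rightarrow> 'q^2^2 \<Rightarrow> 'k" where
  "conj_s chi h = chi (matrix_inv s_mat ** h ** s_mat)"

text \<open>Characters of the torus are functions on all matrices; only their values on the torus matter.\<close>

definition s_invariant :: "('q::field^2^2 \<Rightarrow> 'k) \<Rightarrow> bool" where
  "s_invariant chi \<longleftrightarrow> (\<forall>h\<in>Torus. chi h = conj_s chi h)"

definition J0 :: "('q::field^2^2 \<Rightarrow> 'k) \<Rightarrow> ('q^2^2) set" where
  "J0 chi = (if s_invariant chi then {s_mat} else {})"

definition Ind_Borel :: "('q::field^2^2, 'k::field, 'q^2^2 \<Rightarrow> 'k) rep" where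
  "Ind_Borel = rep_on {f. (\<forall>g. g \<notin> carrier GL2 \<longrightarrow> f g = 0) \<and>
      (\<forall>b\<in>Borel. \<forall>g\<in>carrier GL2. f (b ** g) = f g)} (fun_scale (*)) rtrans"

definition Steinberg :: "('q::field^2^2, 'k::field, ('q^2^2 \<Rightarrow> 'k) set) rep" where
  "Steinberg = quot_rep Ind_Borel {\<lambda>g. if g \<in> carrier GL2 then c else 0 | c. True}"

definition char_rep :: "('g \<Rightarrow> 'k::field) \<Rightarrow> ('g, 'k, 'k) rep" where
  "char_rep \<psi> = rep_on UNIV (*) (\<lambda>g v. \<psi> g * v)"

text \<open>\<open>is_rho chi J sc action\<close>: the representation of \<open>GL\<^sub>2(\<F>\<^sub>q)\<close> belongs to the isomorphism
  class \<open>\<rho>\<^bsub>chi,J\<^esub>\<close>.\<close>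

definition is_rho :: "('q::field^2^2 \<Rightarrow> 'k::field) \<Rightarrow> ('q^2^2) set \<Rightarrow>
    ('k \<Rightarrow> 'v::ab_group_add \<Rightarrow> 'v) \<Rightarrow> ('q^2^2 \<Rightarrow> 'v \<Rightarrow> 'v) \<Rightarrow> bool" where
  "is_rho chi J sc action \<longleftrightarrow> group_rep GL2 sc action \<and> J \<subseteq> J0 chi \<and>
     (if s_invariant chi then
        \<exists>chi'\<in>hom units_group units_group. (\<forall>h\<in>Torus. chi h = chi' (det h)) \<and>
          (if J = {s_mat}
           then iso_rep (carrier GL2) (char_rep (chi' \<circ> det)) (rep_on UNIV sc action)
           else iso_rep (carrier GL2) (twist (chi' \<circ> det) Steinberg) (rep_on UNIV sc action))
      else
        irreducible_rep GL2 sc action \<and>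
        vector_space.dim sc (invariants Unip action) = 1 \<and>
        (\<forall>b\<in>Borel. \<forall>v\<in>invariants Unip action. action b v = sc (chi (diag_part b)) v))"

definition inflate :: "('f::field, 'q) valued_field \<Rightarrow> ('q^2^2 \<Rightarrow> 'v \<Rightarrow> 'v) \<Rightarrow> 'f^2^2 \<Rightarrow> 'v \<Rightarrow> 'v" where
  "inflate F action k = action (red_mat F k)"

text \<open>Every \<open>g\<close> in \<open>F\<^sup>\<times>K\<close> is \<open>\<varpi>\<^sup>nk\<close> for unique \<open>n\<close> and \<open>k \<in> K\<close>.\<close>

definition tilde :: "('f::field, 'q) valued_field \<Rightarrow> ('q^2^2 \<Rightarrow> 'v \<Rightarrow> 'v) \<Rightarrow> 'f^2^2 \<Rightarrow> 'v \<Rightarrow> 'v" where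
  "tilde F action g = inflate F action (THE k. k \<in> K F \<and> (\<exists>n::int. g = mat (unif F powi n) ** k))"


section \<open>The pro-\<open>p\<close> Iwahori--Hecke algebra and its right modules\<close>

definition c_Ind_triv :: "('f::field, 'q::field) valued_field \<Rightarrow> ('f^2^2, 'k::field, 'f^2^2 \<Rightarrow> 'k) rep" where
  "c_Ind_triv F = rep_on (c_Ind F (Iw1 F) UNIV (\<lambda>_ v. v)) (fun_scale (*)) rtrans"

text \<open>The algebra structure on the following set is pointwise addition, pointwise scalar
  multiplication and composition.\<close>

definition Hecke :: "('f::field, 'q::field) valued_field \<Rightarrow>
    (('f^2^2 \<Rightarrow> 'k::field) \<Rightarrow> 'f^2^2 \<Rightarrow> 'k) set" where
  "Hecke F = Hom_rep (carrier GL2) (c_Ind_triv F) (c_Ind_triv F)"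

definition Hecke_one :: "('f::field, 'q::field) valued_field \<Rightarrow>
    ('f^2^2 \<Rightarrow> 'k::field) \<Rightarrow> 'f^2^2 \<Rightarrow> 'k" where
  "Hecke_one F f = (if f \<in> rep_space (c_Ind_triv F) then f else 0)"

definition ind_Iw1 :: "('f::field, 'q::field) valued_field \<Rightarrow> 'f^2^2 \<Rightarrow> 'k::field" where
  "ind_Iw1 F = (\<lambda>x. if x \<in> Iw1 F then 1 else 0)"

text \<open>
  Frobenius reciprocity identifies an \<open>I\<^sub>1\<close>-invariant vector \<open>v\<close> with the homomorphism
  sending \<open>ind_Iw1\<close> to \<open>v\<close>; the Hecke algebra acts by precomposition.
\<close>

definition frob :: "('f::field, 'q::field) valued_field \<Rightarrow> ('k::field \<Rightarrow> 'v::ab_group_add \<Rightarrow> 'v) \<Rightarrow>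
    ('f^2^2 \<Rightarrow> 'v \<Rightarrow> 'v) \<Rightarrow> 'v \<Rightarrow> ('f^2^2 \<Rightarrow> 'k) \<Rightarrow> 'v" where
  "frob F sc action v =
     (THE \<phi>. \<phi> \<in> Hom_rep (carrier GL2) (c_Ind_triv F) (rep_on UNIV sc action) \<and> \<phi> (ind_Iw1 F) = v)"

definition inv_act :: "('f::field, 'q::field) valued_field \<Rightarrow> ('k::field \<Rightarrow> 'v::ab_group_add \<Rightarrow> 'v) \<Rightarrow>
    ('f^2^2 \<Rightarrow> 'v \<Rightarrow> 'v) \<Rightarrow> 'v \<Rightarrow> (('f^2^2 \<Rightarrow> 'k) \<Rightarrow> 'f^2^2 \<Rightarrow> 'k) \<Rightarrow> 'v" where
  "inv_act F sc action v T = (frob F sc action v \<circ> T) (ind_Iw1 F)"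

text \<open>
  Hecke operators are specified by their value on \<open>ind_Iw1\<close>: if \<open>T\<close> sends it to
  \<open>\<Sum>c\<^sub>g g\<cdot>ind_Iw1\<close>, then \<open>vT = \<Sum>c\<^sub>g gv\<close> on the \<open>I\<^sub>1\<close>-invariants of every smooth representation.
\<close>

definition Hecke_elt :: "('f::field, 'q::field) valued_field \<Rightarrow> ('f^2^2 \<Rightarrow> 'k::field) \<Rightarrow>
    ('f^2^2 \<Rightarrow> 'k) \<Rightarrow> 'f^2^2 \<Rightarrow> 'k" where
  "Hecke_elt F w = (THE T. T \<in> Hecke F \<and> T (ind_Iw1 F) = w)"

definition lcosets :: "('a::field^2^2) set \<Rightarrow> ('a^2^2) set \<Rightarrow> ('a^2^2) set set" where
  "lcosets A N = {{a ** n | n. n \<in> N} | a. a \<in> A}"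

definition T_ns :: "('f::field, 'q::field) valued_field \<Rightarrow> ('f^2^2 \<Rightarrow> 'k::field) \<Rightarrow> 'f^2^2 \<Rightarrow> 'k" where
  "T_ns F = Hecke_elt F
     (\<Sum>C\<in>lcosets (Iw1 F) (K1 F). rtrans ((SOME u. u \<in> C) ** matrix_inv n_s) (ind_Iw1 F))"

definition T_Pi :: "('f::field, 'q::field) valued_field \<Rightarrow> ('f^2^2 \<Rightarrow> 'k::field) \<Rightarrow> 'f^2^2 \<Rightarrow> 'k" where
  "T_Pi F = Hecke_elt F (rtrans (matrix_inv (Pi_mat F)) (ind_Iw1 F))"

text \<open>The projection \<open>v \<mapsto> |H|\<^sup>-\<^sup>1 \<Sum>\<^bsub>h\<^esub> chi(h)\<^sup>-\<^sup>1 hv\<close> to the \<open>chi\<close>-isotypic part, \<open>h\<close> running over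
  \<open>I/I\<^sub>1 \<cong> H\<close>; the order \<open>(q-1)\<^sup>2\<close> of \<open>H\<close> is invertible in \<open>'k\<close>.\<close>

definition e_chi :: "('f::field, 'q::field) valued_field \<Rightarrow> ('q^2^2 \<Rightarrow> 'k::field) \<Rightarrow>
    ('f^2^2 \<Rightarrow> 'k) \<Rightarrow> 'f^2^2 \<Rightarrow> 'k" where
  "e_chi F chi = Hecke_elt F (fun_scale (*) (inverse (of_nat (card (Torus :: ('q^2^2) set))))
     (\<Sum>C\<in>lcosets (Iw F) (Iw1 F). let h = (SOME h. h \<in> C) in
        fun_scale (*) (inverse (chi (diag_part (red_mat F h)))) (rtrans h (ind_Iw1 F))))"

locale right_Hecke_module = vector_space sc
  for F :: "('f::field, 'q::field) valued_field"
    and sc :: "'k::field \<Rightarrow> 'm::ab_group_add \<Rightarrow> 'm" +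
  fixes ract :: "'m \<Rightarrow> (('f^2^2 \<Rightarrow> 'k) \<Rightarrow> 'f^2^2 \<Rightarrow> 'k) \<Rightarrow> 'm"
  assumes ract_linear: "T \<in> Hecke F \<Longrightarrow> Vector_Spaces.linear sc sc (\<lambda>m. ract m T)"
    and ract_add: "S \<in> Hecke F \<Longrightarrow> T \<in> Hecke F \<Longrightarrow> ract m (S + T) = ract m S + ract m T"
    and ract_scale: "T \<in> Hecke F \<Longrightarrow> ract m (fun_scale (fun_scale (*)) c T) = sc c (ract m T)"
    and ract_one: "ract m (Hecke_one F) = m"
    and ract_comp: "S \<in> Hecke F \<Longrightarrow> T \<in> Hecke F \<Longrightarrow> ract m (S \<circ> T) = ract (ract m S) T"

definition is_M_gamma :: "('f::field, 'q::field) valued_field \<Rightarrow> ('q^2^2 \<Rightarrow> 'k::field) \<Rightarrow>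
    ('k \<Rightarrow> 'm::ab_group_add \<Rightarrow> 'm) \<Rightarrow> ('m \<Rightarrow> (('f^2^2 \<Rightarrow> 'k) \<Rightarrow> 'f^2^2 \<Rightarrow> 'k) \<Rightarrow> 'm) \<Rightarrow> bool" where
  "is_M_gamma F chi sc ract \<longleftrightarrow> right_Hecke_module F sc ract \<and>
     (\<exists>v1 v2. v1 \<noteq> v2 \<and> \<not> module.dependent sc {v1, v2} \<and> module.span sc {v1, v2} = UNIV \<and>
        ract v1 (T_Pi F) = v2 \<and> ract v2 (T_Pi F) = v1 \<and>
        ract v1 (e_chi F chi) = v1 \<and> ract v2 (e_chi F (conj_s chi)) = v2 \<and>
        ract v2 (T_ns F) = 0 \<and>
        ract v1 (T_ns F) = (if s_invariant chi then - v1 else 0))"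

text \<open>An isomorphism of right Hecke modules from the \<open>I\<^sub>1\<close>-invariants of a representation
  to the module \<open>(scaleM, ract)\<close>.\<close>

definition invariants_iso :: "('f::field, 'q::field) valued_field \<Rightarrow>
    ('k::field \<Rightarrow> 'v::ab_group_add \<Rightarrow> 'v) \<Rightarrow> ('f^2^2 \<Rightarrow> 'v \<Rightarrow> 'v) \<Rightarrow>
    ('k \<Rightarrow> 'm::ab_group_add \<Rightarrow> 'm) \<Rightarrow> ('m \<Rightarrow> (('f^2^2 \<Rightarrow> 'k) \<Rightarrow> 'f^2^2 \<Rightarrow> 'k) \<Rightarrow> 'm) \<Rightarrow> bool" where
  "invariants_iso F sc action scaleM ract \<longleftrightarrow>
     (let V = invariants (Iw1 F) action in
      \<exists>f. bij_betw f V UNIV \<and>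
        (\<forall>x\<in>V. \<forall>y\<in>V. f (x + y) = f x + f y) \<and>
        (\<forall>c. \<forall>x\<in>V. f (sc c x) = scaleM c (f x)) \<and>
        (\<forall>T\<in>Hecke F. \<forall>x\<in>V. f (inv_act F sc action x T) = ract (f x) T))"


section \<open>The Bruhat--Tits tree\<close>

definition lattice :: "('f::field, 'q) valued_field \<Rightarrow> ('f^2) set \<Rightarrow> bool" where
  "lattice F L \<longleftrightarrow> (\<exists>a b. a \<noteq> b \<and> \<not> vec.dependent {a, b} \<and>
     L = {x *s a + y *s b | x y. x \<in> ints F \<and> y \<in> ints F})"

definition homothety_class :: "('f::field^2) set \<Rightarrow> ('f^2) set set" where
  "homothety_class L = {(\<lambda>v. c *s v) ` L | c. c \<noteq> 0}"

type_synonym 'f vertex = "('f^2) set set"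

definition vertices :: "('f::field, 'q) valued_field \<Rightarrow> 'f vertex set" where
  "vertices F = {homothety_class L | L. lattice F L}"

definition adj :: "('f::field, 'q) valued_field \<Rightarrow> 'f vertex \<Rightarrow> 'f vertex \<Rightarrow> bool" where
  "adj F x y \<longleftrightarrow> x \<in> vertices F \<and> y \<in> vertices F \<and>
     (\<exists>L\<in>x. \<exists>L'\<in>y. (\<lambda>v. unif F *s v) ` L \<subset> L' \<and> L' \<subset> L)"

definition move :: "'f::field^2^2 \<Rightarrow> 'f vertex \<Rightarrow> 'f vertex" where
  "move g x = (\<lambda>L. (*v) g ` L) ` x"

definition vertex0 :: "('f::field, 'q) valued_field \<Rightarrow> 'f vertex" where
  "vertex0 F = homothety_class {vector [x, y] | x y. x \<in> ints F \<and> y \<in> ints F}"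

definition vertex1 :: "('f::field, 'q) valued_field \<Rightarrow> 'f vertex" where
  "vertex1 F = homothety_class {vector [x, y] | x y. x \<in> ints F \<and> y \<in> ideal_pow F 1}"

text \<open>Simplices are sets of vertices: singletons and edges.\<close>

definition \<sigma>0 :: "('f::field, 'q) valued_field \<Rightarrow> 'f vertex set" where
  "\<sigma>0 F = {vertex0 F}"

definition \<sigma>1 :: "('f::field, 'q) valued_field \<Rightarrow> 'f vertex set" where
  "\<sigma>1 F = {vertex0 F, vertex1 F}"

definition stab :: "'f::field vertex set \<Rightarrow> ('f^2^2) set" where
  "stab \<sigma> = {g \<in> carrier GL2. move g ` \<sigma> = \<sigma>}"


section \<open>Coefficient systems and homology\<close>

text \<open>\<open>restr V \<sigma>' \<sigma>\<close> maps the space at \<open>\<sigma>'\<close> to the space at \<open>\<sigma> \<subseteq> \<sigma>'\<close>, and \<open>cact V g \<sigma>\<close> maps the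
  space at \<open>\<sigma>\<close> to the space at \<open>g\<sigma>\<close>.\<close>

record ('f, 'v) coeff_system =
  stalk :: "'f vertex set \<Rightarrow> 'v set"
  restr :: "'f vertex set \<Rightarrow> 'f vertex set \<Rightarrow> 'v \<Rightarrow> 'v"
  cact :: "'f^2^2 \<Rightarrow> 'f vertex set \<Rightarrow> 'v \<Rightarrow> 'v"

definition chains0 :: "('f::field, 'q) valued_field \<Rightarrow> ('f, 'v::ab_group_add) coeff_system \<Rightarrow>
    ('f vertex \<Rightarrow> 'v) set" where
  "chains0 F V = {\<omega>. (\<forall>x\<in>vertices F. \<omega> x \<in> stalk V {x}) \<and> (\<forall>x. x \<notin> vertices F \<longrightarrow> \<omega> x = 0) \<and>
     finite {x. \<omega> x \<noteq> 0}}"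

definition chains1 :: "('f::field, 'q) valued_field \<Rightarrow> ('f, 'v::ab_group_add) coeff_system \<Rightarrow>
    ('f vertex \<times> 'f vertex \<Rightarrow> 'v) set" where
  "chains1 F V = {\<omega>. (\<forall>x y. adj F x y \<longrightarrow> \<omega> (x, y) \<in> stalk V {x, y}) \<and>
     (\<forall>x y. \<not> adj F x y \<longrightarrow> \<omega> (x, y) = 0) \<and> (\<forall>x y. \<omega> (y, x) = - \<omega> (x, y)) \<and>
     finite {e. \<omega> e \<noteq> 0}}"

definition boundary :: "('f::field, 'q) valued_field \<Rightarrow> ('f, 'v::ab_group_add) coeff_system \<Rightarrow>
    ('f vertex \<times> 'f vertex \<Rightarrow> 'v) \<Rightarrow> 'f vertex \<Rightarrow> 'v" where
  "boundary F V \<omega> x = (\<Sum>y \<in> {y. adj F x y \<and> \<omega> (x, y) \<noteq> 0}. restr V {x, y} {x} (\<omega> (x, y)))"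

definition H0 :: "('f::field, 'q) valued_field \<Rightarrow> ('k \<Rightarrow> 'v::ab_group_add \<Rightarrow> 'v) \<Rightarrow>
    ('f, 'v) coeff_system \<Rightarrow> ('f^2^2, 'k, ('f vertex \<Rightarrow> 'v) set) rep" where
  "H0 F sc V = quot_rep
     (rep_on (chains0 F V) (fun_scale sc)
        (\<lambda>g \<omega> x. let y = move (matrix_inv g) x in cact V g {y} (\<omega> y)))
     (boundary F V ` chains1 F V)"


section \<open>The diagram \<open>D\<^sub>1 \<rightarrow> D\<^sub>0\<close> and the coefficient system \<open>V\<^sub>\<gamma>\<close>\<close>

text \<open>Throughout, \<open>(scaleA, actA)\<close> and \<open>(scaleB, actB)\<close> are the two irreducible representations of
  \<open>GL\<^sub>2(\<F>\<^sub>q)\<close> and \<open>vA\<close>, \<open>vB\<close> the chosen invariant vectors; \<open>D\<^sub>0\<close> is the product type \<open>'a \<times> 'b\<close>.\<close>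

definition prod_scale :: "('k \<Rightarrow> 'a \<Rightarrow> 'a) \<Rightarrow> ('k \<Rightarrow> 'b \<Rightarrow> 'b) \<Rightarrow> 'k \<Rightarrow> 'a \<times> 'b \<Rightarrow> 'a \<times> 'b" where
  "prod_scale scaleA scaleB c = map_prod (scaleA c) (scaleB c)"

definition D0_act :: "('f::field, 'q) valued_field \<Rightarrow> ('q^2^2 \<Rightarrow> 'a \<Rightarrow> 'a) \<Rightarrow> ('q^2^2 \<Rightarrow> 'b \<Rightarrow> 'b) \<Rightarrow>
    'f^2^2 \<Rightarrow> 'a \<times> 'b \<Rightarrow> 'a \<times> 'b" where
  "D0_act F actA actB g = map_prod (tilde F actA g) (tilde F actB g)"

definition D1 :: "('f::field, 'q::field) valued_field \<Rightarrow> ('q^2^2 \<Rightarrow> 'a \<Rightarrow> 'a) \<Rightarrow>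
    ('q^2^2 \<Rightarrow> 'b \<Rightarrow> 'b) \<Rightarrow> ('a \<times> 'b) set" where
  "D1 F actA actB = invariants (Iw1 F) (D0_act F actA actB)"

text \<open>The action of \<open>\<Pi>\<^sup>-\<^sup>1\<close> on \<open>D\<^sub>1\<close>, which is spanned by \<open>(vA, 0)\<close> and \<open>(0, vB)\<close>.\<close>

definition D1_swap :: "('k \<Rightarrow> 'a \<Rightarrow> 'a) \<Rightarrow> ('k \<Rightarrow> 'b \<Rightarrow> 'b) \<Rightarrow> 'a \<Rightarrow> 'b \<Rightarrow> 'a \<times> 'b \<Rightarrow> 'a \<times> 'b" where
  "D1_swap scaleA scaleB vA vB d =
     (THE d'. \<exists>a b. d = (scaleA a vA, scaleB b vB) \<and> d' = (scaleA b vA, scaleB a vB))"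

text \<open>The stabiliser of \<open>\<sigma>1\<close> is the disjoint union of \<open>F\<^sup>\<times>I\<close> and \<open>F\<^sup>\<times>I\<Pi>\<^sup>-\<^sup>1\<close>.\<close>

definition D1_act :: "('f::field, 'q::field) valued_field \<Rightarrow>
    ('k \<Rightarrow> 'a \<Rightarrow> 'a) \<Rightarrow> ('q^2^2 \<Rightarrow> 'a \<Rightarrow> 'a) \<Rightarrow> 'a \<Rightarrow>
    ('k \<Rightarrow> 'b \<Rightarrow> 'b) \<Rightarrow> ('q^2^2 \<Rightarrow> 'b \<Rightarrow> 'b) \<Rightarrow> 'b \<Rightarrow> 'f^2^2 \<Rightarrow> 'a \<times> 'b \<Rightarrow> 'a \<times> 'b" where
  "D1_act F scaleA actA vA scaleB actB vB g d =
     (if g \<in> ZI F then D0_act F actA actB g d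
      else D0_act F actA actB (g ** Pi_mat F) (D1_swap scaleA scaleB vA vB d))"

text \<open>In the restriction map, \<open>x = \<kappa>g\<^sup>-\<^sup>1\<close> with \<open>\<kappa>\<close> in the stabiliser of \<open>\<sigma>0\<close>, so the value
  at \<open>x\<close> is forced by the value \<open>f (g\<^sup>-\<^sup>1)\<close> at \<open>g\<^sup>-\<^sup>1\<close>; it does not depend on the choice of \<open>g\<close>.\<close>

definition V_gamma :: "('f::field, 'q::field) valued_field \<Rightarrow>
    ('k \<Rightarrow> 'a::ab_group_add \<Rightarrow> 'a) \<Rightarrow> ('q^2^2 \<Rightarrow> 'a \<Rightarrow> 'a) \<Rightarrow> 'a \<Rightarrow>
    ('k \<Rightarrow> 'b::ab_group_add \<Rightarrow> 'b) \<Rightarrow> ('q^2^2 \<Rightarrow> 'b \<Rightarrow> 'b) \<Rightarrow> 'b \<Rightarrow>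
    ('f, 'f^2^2 \<Rightarrow> 'a \<times> 'b) coeff_system" where
  "V_gamma F scaleA actA vA scaleB actB vB = \<lparr>
     stalk = (\<lambda>\<tau>. {f. \<exists>g\<in>carrier GL2.
        \<tau> = move g ` \<sigma>0 F \<and>
          f \<in> c_Ind F (stab (\<sigma>0 F)) UNIV (D0_act F actA actB) \<and>
          {x. f x \<noteq> 0} \<subseteq> {\<kappa> ** matrix_inv g | \<kappa>. \<kappa> \<in> stab (\<sigma>0 F)} \<or>
        \<tau> = move g ` \<sigma>1 F \<and>
          f \<in> c_Ind F (stab (\<sigma>1 F)) (D1 F actA actB) (D1_act F scaleA actA vA scaleB actB vB) \<and>
          {x. f x \<noteq> 0} \<subseteq> {\<kappa> ** matrix_inv g | \<kappa>. \<kappa> \<in> stab (\<sigma>1 F)}}),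
     restr = (\<lambda>\<tau> \<sigma> f. if \<tau> = \<sigma> then f else
        (let g = (SOME g. g \<in> carrier GL2 \<and> \<tau> = move g ` \<sigma>1 F \<and> \<sigma> = move g ` \<sigma>0 F) in
         (\<lambda>x. if x ** g \<in> stab (\<sigma>0 F)
              then D0_act F actA actB (x ** g) (f (matrix_inv g)) else 0))),
     cact = (\<lambda>g \<sigma>. rtrans g)\<rparr>"

end

theory Submission
  imports Defs
begin

text \<open>
  A homomorphism from \<open>H\<^sub>0\<close> of the coefficient system to \<open>\<pi>\<close> is the same as a linear map \<open>\<psi> : D\<^sub>0 \<rightarrow> \<pi>\<close>
  that commutes with \<open>F\<^sup>\<times>K\<close>, and with \<open>\<Pi>\<close> on \<open>D\<^sub>1\<close>.  It is determined by its value at \<open>(vA, 0)\<close>, which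
  lies in the two-dimensional space \<open>\<pi>\<^bsup>I\<^sub>1\<^esup>\<close>, has weight \<open>\<chi>\<close> and is an eigenvector of
  \<open>T = \<Sum>\<^bsub>u\<in>U\<^esub> u n\<^sub>s\<^sup>-\<^sup>1\<close> with the same eigenvalue as \<open>vA\<close>.  The description of the module \<open>M\<^sub>\<gamma>\<close> shows
  that such vectors form a line, so at most one \<open>\<psi>\<close> exists up to scalars.  For existence, take a vector
  \<open>w\<close> on that line and consider the submodule of \<open>\<rho> \<times> \<pi>\<^bsup>K\<^sub>1\<^esup>\<close> generated by \<open>(vA, w)\<close> under
  \<open>GL\<^sub>2(\<F>\<^sub>q)\<close>.  If it meets \<open>0 \<times> \<pi>\<^bsup>K\<^sub>1\<^esup>\<close> trivially, it is the graph of a homomorphism sending \<open>vA\<close> to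
  \<open>w\<close>.  When \<open>\<chi> = \<chi>\<^sup>s\<close>, the eigenvalue of \<open>T\<close> determines this submodule explicitly; otherwise the
  intersection would contain a nonzero \<open>U\<close>-invariant vector, \<open>U\<close> being a \<open>p\<close>-group, whereas the weights
  \<open>\<chi> \<noteq> \<chi>\<^sup>s\<close> and \<open>T (vA, w) = 0\<close> force every \<open>U\<close>-invariant vector of the submodule to be a multiple of
  \<open>(vA, w)\<close>.
\<close>

text \<open>The space \<open>D_0\<close> has two summands, yet only one scalar is free: equivariance
  under \<open>Pi\<close> on \<open>D_1\<close> ties the value at \<open>(0, vB)\<close> to the
  value at \<open>(vA, 0)\<close>, and the exchange of \<open>v1\<close> and \<open>v2\<close> by
  \<open>T_Pi\<close> is the matching symmetry of the module. The same exchange makes the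
  uniformiser, which is the square of \<open>Pi\<close>, fix the vectors in question, as the
  extension \<open>tilde\<close> demands.

  The eigenvalues -1 and 0 of T come from q = 0 in the coefficient field. On a twisted Steinberg
  representation T is -1 because the indicators of all points of the projective line add up to a
  constant function; on a character it is q = 0. If chi equals its conjugate, the weights cannot
  separate the two vectors of the module and only these eigenvalues do, so the choice of
  \<open>J\<close> decides which of them is paired with \<open>vA\<close>.

  If chi differs from its conjugate, the irreducible representation is known only through its
  \<open>U\<close>-invariants. There is no presentation on which to define a map by generators and
  relations; the submodule generated by a pair takes its place.\<close>

declare One_nat_def [simp del]

section \<open>Two-by-two matrices\<close>

definition mat2 :: "'a::zero \<Rightarrow> 'a \<Rightarrow> 'a \<Rightarrow> 'a \<Rightarrow> 'a^2^2" where
  "mat2 a b c d = vector [vector [a, b], vector [c, d]]"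

lemma mat2_nth [simp]:
  "mat2 a b c d $ 1 $ 1 = a" "mat2 a b c d $ 1 $ 2 = b"
  "mat2 a b c d $ 2 $ 1 = c" "mat2 a b c d $ 2 $ 2 = d"
  by (simp_all add: mat2_def)

lemma mat_eq2_iff: "(A :: 'a^2^2) = B \<longleftrightarrow>
    A$1$1 = B$1$1 \<and> A$1$2 = B$1$2 \<and> A$2$1 = B$2$1 \<and> A$2$2 = B$2$2"
  by (auto simp: vec_eq_iff forall_2)

lemma mat2_eta: "mat2 (A$1$1) (A$1$2) (A$2$1) (A$2$2) = A"
  by (simp add: mat_eq2_iff)

lemma mult2_nth:
  "((A :: 'a::semiring_1^2^2) ** B) $ i $ j = A$i$1 * B$1$j + A$i$2 * B$2$j"
  by (simp add: matrix_matrix_mult_def sum_2)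

lemma mult2_diff_right: "A ** (B - C) = A ** B - A ** C"
  and mult2_diff_left: "(B - C) ** A = B ** A - C ** A" for A :: "'a::ring_1^2^2"
  by (simp_all add: mat_eq2_iff mult2_nth algebra_simps)

lemma mat2_mult [simp]: "mat2 a b c d ** mat2 a' b' c' d' =
    mat2 (a * a' + b * c') (a * b' + b * d') (c * a' + d * c') (c * b' + d * d')"
  for a :: "'a::semiring_1"
  by (simp add: mat_eq2_iff mult2_nth)

lemma mat2_eq_iff [simp]:
  "mat2 a b c d = mat2 a' b' c' d' \<longleftrightarrow> a = a' \<and> b = b' \<and> c = c' \<and> d = d'"
  by (simp add: mat_eq2_iff)

lemma mat_conv_mat2: "mat c = mat2 c 0 0 c"
  by (simp add: mat_eq2_iff mat_def)

lemma det_mat2 [simp]: "det (mat2 a b c d) = a * d - b * c"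
  by (simp add: det_2)

lemma GL2_iff: "A \<in> carrier GL2 \<longleftrightarrow> det A \<noteq> 0"
  by (simp add: GL2_def invertible_det_nz)

lemma mat2_in_GL2 [simp]: "mat2 a b c d \<in> carrier GL2 \<longleftrightarrow> a * d - b * c \<noteq> 0"
  by (simp add: GL2_iff)

lemma GL2_simps [simp]: "mult GL2 = (**)" "one GL2 = mat 1"
  by (simp_all add: GL2_def)

lemma GL2_mult [simp]: "A \<in> carrier GL2 \<Longrightarrow> B \<in> carrier GL2 \<Longrightarrow> A ** B \<in> carrier GL2"
  by (simp add: GL2_iff det_mul)

lemma invertible_matrix_inv:
  assumes "invertible A" shows "A ** matrix_inv A = mat 1 \<and> matrix_inv A ** A = mat 1"
  using assms unfolding invertible_def matrix_inv_def by (rule someI_ex)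

lemma GL2_inv [simp]: "A \<in> carrier GL2 \<Longrightarrow> matrix_inv A ** A = mat 1"
    "A \<in> carrier GL2 \<Longrightarrow> A ** matrix_inv A = mat 1"
  by (simp_all add: GL2_def invertible_matrix_inv)

lemma matrix_inv_eqI: "A ** B = mat 1 \<Longrightarrow> matrix_inv A = B" for A :: "'a::field^'n^'n"
  by (metis matrix_left_right_inverse invertible_matrix_inv invertible_def matrix_mul_assoc matrix_mul_lid matrix_mul_rid)

lemma GL2_inv_closed [simp]: "A \<in> carrier GL2 \<Longrightarrow> matrix_inv A \<in> carrier GL2"
  using GL2_inv[of A] by (metis (no_types) GL2_iff det_I det_mul mult_eq_0_iff zero_neq_one)

lemma GL2_inv_inv [simp]: "A \<in> carrier GL2 \<Longrightarrow> matrix_inv (matrix_inv A) = A"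
  by (simp add: matrix_inv_eqI)

lemma GL2_cancel [simp]:
  "A \<in> carrier GL2 \<Longrightarrow> matrix_inv A ** (A ** B) = B"
  "A \<in> carrier GL2 \<Longrightarrow> A ** (matrix_inv A ** B) = B"
  "A \<in> carrier GL2 \<Longrightarrow> (B ** A) ** matrix_inv A = B"
  "A \<in> carrier GL2 \<Longrightarrow> (B ** matrix_inv A) ** A = B"
  by (simp_all add: matrix_mul_assoc) (simp_all add: matrix_mul_assoc[symmetric])

lemma matrix_inv_mult: "A \<in> carrier GL2 \<Longrightarrow> B \<in> carrier GL2 \<Longrightarrow>
    matrix_inv (A ** B) = matrix_inv B ** matrix_inv A"
  by (rule matrix_inv_eqI) (metis GL2_cancel(2) GL2_inv(2) matrix_mul_assoc)

lemma matrix_inv_one [simp]: "matrix_inv (mat 1 :: 'a::field^2^2) = mat 1"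
  by (rule matrix_inv_eqI) simp

lemma matrix_inv_mat2: "a * d - b * c \<noteq> 0 \<Longrightarrow> matrix_inv (mat2 a b c d) =
    mat2 (d / (a * d - b * c)) (- b / (a * d - b * c)) (- c / (a * d - b * c)) (a / (a * d - b * c))"
  for a :: "'a::field"
  by (rule matrix_inv_eqI) (simp add: mat_conv_mat2 mult.commute flip: diff_divide_distrib)

lemma GL2_mult_iff: "B \<in> carrier GL2 \<Longrightarrow> A ** B \<in> carrier GL2 \<longleftrightarrow> A \<in> carrier GL2"
  by (simp add: GL2_iff det_mul)

lemma GL2_mat_iff [simp]: "mat c \<in> carrier GL2 \<longleftrightarrow> c \<noteq> 0"
  by (simp add: mat_conv_mat2)

lemma mat_mult_commute: "mat c ** A = A ** mat c" for A :: "'a::field^2^2"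
  by (simp add: mat_eq2_iff mat_conv_mat2 mult2_nth mult.commute)

lemma mat_mult_mat: "mat c ** mat d = (mat (c * d) :: 'a::field^2^2)"
  by (simp add: mat_conv_mat2)

lemma group_GL2: "group (GL2 :: ('a::field^2^2) monoid)"
proof (rule groupI)
  fix x :: "'a^2^2" assume "x \<in> carrier GL2"
  then show "\<exists>y\<in>carrier GL2. y \<otimes>\<^bsub>GL2\<^esub> x = \<one>\<^bsub>GL2\<^esub>"
    by (intro bexI[of _ "matrix_inv x"]) simp_all
qed (simp_all add: matrix_mul_assoc)

lemma group_rep_GL2D:
  assumes "group_rep GL2 sc action"
  shows "vector_space sc"
    and "action (mat 1) v = v"
    and "g \<in> carrier GL2 \<Longrightarrow> h \<in> carrier GL2 \<Longrightarrow> action (g ** h) v = action g (action h v)"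
    and "g \<in> carrier GL2 \<Longrightarrow> action g (v + w) = action g v + action g w"
    and "g \<in> carrier GL2 \<Longrightarrow> action g (sc c v) = sc c (action g v)"
    and "g \<in> carrier GL2 \<Longrightarrow> action g 0 = 0"
    and "g \<in> carrier GL2 \<Longrightarrow> action g (v - w) = action g v - action g w"
    and "g \<in> carrier GL2 \<Longrightarrow> action g (- v) = - action g v"
    and "g \<in> carrier GL2 \<Longrightarrow> action g (sum f X) = (\<Sum>x\<in>X. action g (f x))"
    and "g \<in> carrier GL2 \<Longrightarrow> action (matrix_inv g) (action g v) = v"
    and "g \<in> carrier GL2 \<Longrightarrow> action g (action (matrix_inv g) v) = v"
proof -
  interpret group_rep GL2 sc action by fact
  show "vector_space sc" by unfold_locales
  show one: "action (mat 1) v = v" for v using action_one by simp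
  show mult: "g \<in> carrier GL2 \<Longrightarrow> h \<in> carrier GL2 \<Longrightarrow> action (g ** h) v = action g (action h v)"
    for g h v using action_mult by simp
  show "g \<in> carrier GL2 \<Longrightarrow> action (matrix_inv g) (action g v) = v"
    "g \<in> carrier GL2 \<Longrightarrow> action g (action (matrix_inv g) v) = v"
    by (simp_all flip: mult add: one)
  assume g: "g \<in> carrier GL2"
  interpret l: Vector_Spaces.linear sc sc "action g" using action_linear g .
  show "action g (v + w) = action g v + action g w" "action g (sc c v) = sc c (action g v)"
    "action g 0 = 0" "action g (v - w) = action g v - action g w" "action g (- v) = - action g v"
    "action g (sum f X) = (\<Sum>x\<in>X. action g (f x))"
    by (simp_all add: l.add l.scale l.diff l.neg l.sum)
qed

section \<open>The Weyl element and the Borel, diagonal and unipotent subgroups\<close>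

lemma n_s_conv: "n_s = mat2 0 (-1) 1 0" and s_mat_conv: "s_mat = mat2 0 1 1 0"
  and Pi_conv: "Pi_mat F = mat2 0 1 (unif F) 0"
  and diag_part_conv: "diag_part A = mat2 (A$1$1) 0 0 (A$2$2)"
  by (simp_all add: n_s_def s_mat_def mat2_def Pi_mat_def diag_part_def)

lemma inv_n_s: "matrix_inv n_s = (mat2 0 1 (-1) 0 :: 'a::field^2^2)"
  by (simp add: n_s_conv matrix_inv_mat2)

lemma inv_s_mat: "matrix_inv s_mat = (mat2 0 1 1 0 :: 'a::field^2^2)"
  by (simp add: s_mat_conv matrix_inv_mat2)

lemma conj_s_mat2: "conj_s chi (mat2 a b c d) = chi (mat2 d c b a)"
  unfolding conj_s_def inv_s_mat by (simp add: s_mat_conv)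

lemma conj_s_conj_s [simp]: "conj_s (conj_s chi) = chi"
  by (metis (no_types) conj_s_mat2 mat2_eta ext)

lemma Borel_mult: "A \<in> Borel \<Longrightarrow> B \<in> Borel \<Longrightarrow> A ** B \<in> Borel"
  by (simp add: Borel_def mult2_nth)

lemma Borel_iff: "A \<in> Borel \<longleftrightarrow> A$2$1 = 0 \<and> A$1$1 \<noteq> 0 \<and> A$2$2 \<noteq> 0"
  by (auto simp: Borel_def GL2_iff det_2)

lemma Borel_inv: "A \<in> Borel \<Longrightarrow> matrix_inv A \<in> Borel"
proof -
  assume "A \<in> Borel"
  then have "matrix_inv (mat2 (A$1$1) (A$1$2) (A$2$1) (A$2$2)) \<in> Borel"
    by (simp add: Borel_iff matrix_inv_mat2)
  then show ?thesis by (simp add: mat2_eta)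
qed

lemma Borel_GL2: "A \<in> Borel \<Longrightarrow> A \<in> carrier GL2" by (simp add: Borel_def)

lemma Unip_iff: "A \<in> Unip \<longleftrightarrow> (\<exists>t. A = mat2 1 t 0 1)"
  by (auto simp: Unip_def mat_eq2_iff)

lemma Unip_mult: "A \<in> Unip \<Longrightarrow> B \<in> Unip \<Longrightarrow> A ** B \<in> Unip"
  by (auto simp: Unip_iff)

lemma Unip_inv: "A \<in> Unip \<Longrightarrow> matrix_inv A \<in> Unip"
  by (auto simp: Unip_iff matrix_inv_mat2)

lemma Unip_Borel: "A \<in> Unip \<Longrightarrow> A \<in> Borel"
  by (auto simp: Unip_iff Borel_iff)

lemma Torus_iff: "d \<in> Torus \<longleftrightarrow> (\<exists>a b. a \<noteq> 0 \<and> b \<noteq> 0 \<and> d = mat2 a 0 0 b)"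
proof
  assume "d \<in> Torus"
  then show "\<exists>a b. a \<noteq> 0 \<and> b \<noteq> 0 \<and> d = mat2 a 0 0 b"
    by (intro exI[of _ "d$1$1"] exI[of _ "d$2$2"]) (auto simp: Torus_def GL2_iff det_2 mat_eq2_iff)
qed (auto simp: Torus_def)

lemma Torus_Borel: "d \<in> Torus \<Longrightarrow> d \<in> Borel"
  by (auto simp: Torus_iff Borel_iff)

lemma diag_part_Torus: "b \<in> Borel \<Longrightarrow> diag_part b \<in> Torus" "d \<in> Torus \<Longrightarrow> diag_part d = d"
  by (auto simp: Torus_iff Borel_iff diag_part_conv)

text \<open>Taking the diagonal is the quotient map from \<open>B\<close> to \<open>B/U = H\<close>.
  It is multiplicative because the lower left entries vanish.\<close>

lemma diag_part_mult: "b \<in> Borel \<Longrightarrow> c \<in> Borel \<Longrightarrow> diag_part (b ** c) = diag_part b ** diag_part c"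
  by (simp add: diag_part_conv mult2_nth Borel_iff)

lemma diag_part_one_iff: "b \<in> Borel \<Longrightarrow> diag_part b = mat 1 \<longleftrightarrow> b \<in> Unip"
  by (auto simp: diag_part_conv Unip_def Borel_iff mat_conv_mat2)

lemma Unip_bij: "bij_betw (\<lambda>t. mat2 1 t 0 1) UNIV (Unip :: ('a::field^2^2) set)"
  by (rule bij_betw_imageI) (auto simp: inj_def Unip_iff)

section \<open>The local field and the maximal compact subgroup\<close>

context nonarch_local_field
begin

lemma val_one [simp]: "val F 1 = 0"
  using val_mult[of 1 1] by simp

lemma val_minus [simp]: "val F (- x) = val F x"
proof (cases "x = 0")
  case False
  have "val F (-1) = 0" using val_mult[of "-1" "-1"] by simp
  then show ?thesis using val_mult[of "-1" x] False by simp
qed simp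

lemma val_inverse: "x \<noteq> 0 \<Longrightarrow> val F (inverse x) = - val F x"
  using val_mult[of x "inverse x"] by simp

lemma val_divide: "x \<noteq> 0 \<Longrightarrow> y \<noteq> 0 \<Longrightarrow> val F (x / y) = val F x - val F y"
  by (simp add: divide_inverse val_mult val_inverse)

lemma val_power: "x \<noteq> 0 \<Longrightarrow> val F (x ^ n) = int n * val F x"
  by (induction n) (simp_all add: val_mult algebra_simps)

lemma val_powi: "val F (unif F powi n) = n"
  using val_power[OF unif_nonzero] val_unif unif_nonzero
  by (cases "n \<ge> 0") (auto simp: power_int_def val_inverse power_inverse val_power)

lemma ideal_0 [simp]: "0 \<in> ideal_pow F n" by (simp add: ideal_pow_def)

lemma ideal_zero_eq: "ideal_pow F 0 = ints F"
  by (simp add: ideal_pow_def ints_def)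

lemma ideal_add: "x \<in> ideal_pow F n \<Longrightarrow> y \<in> ideal_pow F n \<Longrightarrow> x + y \<in> ideal_pow F n"
  using val_add[of x y] by (cases "x = 0"; cases "y = 0"; cases "x + y = 0") (auto simp: ideal_pow_def)

lemma ideal_minus: "x \<in> ideal_pow F n \<Longrightarrow> - x \<in> ideal_pow F n"
  by (auto simp: ideal_pow_def)

lemma ideal_diff: "x \<in> ideal_pow F n \<Longrightarrow> y \<in> ideal_pow F n \<Longrightarrow> x - y \<in> ideal_pow F n"
  using ideal_add[of x n "-y"] ideal_minus by simp

lemma ideal_mult: "x \<in> ideal_pow F m \<Longrightarrow> y \<in> ideal_pow F n \<Longrightarrow> x * y \<in> ideal_pow F (m + n)"
  by (cases "x = 0"; cases "y = 0") (auto simp: ideal_pow_def val_mult)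

lemma ideal_antimono: "m \<le> n \<Longrightarrow> x \<in> ideal_pow F n \<Longrightarrow> x \<in> ideal_pow F m"
  by (auto simp: ideal_pow_def)

lemma ints_0 [simp, intro]: "0 \<in> ints F" and ints_1 [simp, intro]: "1 \<in> ints F"
  by (simp_all add: ints_def)

lemma ints_add [intro]: "x \<in> ints F \<Longrightarrow> y \<in> ints F \<Longrightarrow> x + y \<in> ints F"
  using ideal_add[of x 0 y] by (simp add: ideal_zero_eq)

lemma ints_diff [intro]: "x \<in> ints F \<Longrightarrow> y \<in> ints F \<Longrightarrow> x - y \<in> ints F"
  using ideal_diff[of x 0 y] by (simp add: ideal_zero_eq)

lemma ints_minus [intro]: "x \<in> ints F \<Longrightarrow> - x \<in> ints F"
  using ideal_minus[of x 0] by (simp add: ideal_zero_eq)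

lemma ints_mult [intro]: "x \<in> ints F \<Longrightarrow> y \<in> ints F \<Longrightarrow> x * y \<in> ints F"
  using ideal_mult[of x 0 y 0] by (simp add: ideal_zero_eq)

lemma ideal_ints: "x \<in> ideal_pow F n \<Longrightarrow> x \<in> ints F"
  using ideal_antimono[of 0 n x] by (simp add: ideal_zero_eq)

lemma unif_ideal [simp]: "unif F \<in> ideal_pow F 1" and unif_ints [simp]: "unif F \<in> ints F"
  by (simp_all add: ideal_pow_def ints_def val_unif)

lemma ideal_1_iff: "x \<in> ideal_pow F 1 \<longleftrightarrow> (\<exists>y\<in>ints F. x = unif F * y)"
proof
  assume x: "x \<in> ideal_pow F 1"
  have "x / unif F \<in> ints F"
    using x unif_nonzero val_unif by (cases "x = 0") (auto simp: ints_def ideal_pow_def val_divide)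
  moreover have "x = unif F * (x / unif F)" using unif_nonzero by simp
  ultimately show "\<exists>y\<in>ints F. x = unif F * y" by blast
next
  assume "\<exists>y\<in>ints F. x = unif F * y"
  then show "x \<in> ideal_pow F 1"
    using ideal_mult[OF unif_ideal, of _ 0] by (auto simp: ideal_zero_eq)
qed

lemma red_0 [simp]: "red F 0 = 0"
  using red_add[OF ints_0 ints_0] by (metis add_0 add_cancel_left_left)

lemma red_minus: "x \<in> ints F \<Longrightarrow> red F (- x) = - red F x"
  using red_add[of x "-x"] by (simp add: ints_minus eq_neg_iff_add_eq_0 add.commute)

lemma red_diff: "x \<in> ints F \<Longrightarrow> y \<in> ints F \<Longrightarrow> red F (x - y) = red F x - red F y"
  using red_add[of x "-y"] by (simp add: ints_minus red_minus)

lemma red_eq_iff: "x \<in> ints F \<Longrightarrow> y \<in> ints F \<Longrightarrow> red F x = red F y \<longleftrightarrow> x - y \<in> ideal_pow F 1"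
  using red_kernel[of "x - y"] by (simp add: red_diff ints_diff)

lemma unit_iff: "x \<in> ints F \<Longrightarrow> red F x \<noteq> 0 \<longleftrightarrow> x \<noteq> 0 \<and> val F x = 0"
  by (subst red_kernel) (auto simp: ints_def ideal_pow_def)

lemma unit_inverse_ints: "x \<in> ints F \<Longrightarrow> red F x \<noteq> 0 \<Longrightarrow> inverse x \<in> ints F"
  by (auto simp: unit_iff) (simp add: ints_def val_inverse)

section \<open>The group \<open>K F\<close> and reduction modulo the maximal ideal\<close>

lemma det_ints: "(\<And>i j. A$i$j \<in> ints F) \<Longrightarrow> det (A :: 'f^2^2) \<in> ints F"
  by (auto simp: det_2)

text \<open>The determinants of a matrix in \<open>K F\<close> and of its inverse have nonnegative
  valuations with sum zero. Conversely, the adjugate divided by a unit determinant is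
  integral.\<close>

lemma K_iff: "A \<in> K F \<longleftrightarrow> (\<forall>i j. A$i$j \<in> ints F) \<and> det A \<noteq> 0 \<and> val F (det A) = 0"
proof
  assume A: "A \<in> K F"
  then obtain A' where A': "A ** A' = mat 1" "\<forall>i j. A'$i$j \<in> ints F" "\<forall>i j. A$i$j \<in> ints F"
    by (auto simp: K_def)
  then have "det A * det A' = 1" by (simp flip: det_mul)
  moreover from this have "det A \<noteq> 0" "det A' \<noteq> 0" by auto
  ultimately have "val F (det A) + val F (det A') = 0"
    using val_mult[of "det A" "det A'"] by simp
  moreover have "val F (det A) \<ge> 0" "val F (det A') \<ge> 0"
    using det_ints[of A] det_ints[of A'] A' \<open>det A \<noteq> 0\<close> \<open>det A' \<noteq> 0\<close> by (auto simp: ints_def)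
  ultimately show "(\<forall>i j. A$i$j \<in> ints F) \<and> det A \<noteq> 0 \<and> val F (det A) = 0"
    using A' \<open>det A \<noteq> 0\<close> by auto
next
  assume A: "(\<forall>i j. A$i$j \<in> ints F) \<and> det A \<noteq> 0 \<and> val F (det A) = 0"
  let ?d = "inverse (det A)"
  let ?B = "mat2 (A$2$2 * ?d) (- A$1$2 * ?d) (- A$2$1 * ?d) (A$1$1 * ?d)"
  have d: "?d \<in> ints F" using A by (auto simp: ints_def val_inverse)
  have "A ** ?B = mat 1"
    using A unfolding mat_eq2_iff mat_conv_mat2 mult2_nth mat2_nth
    by (simp add: det_2 mult.commute flip: divide_inverse diff_divide_distrib)
  then have "A ** ?B = mat 1 \<and> ?B ** A = mat 1" by (simp add: matrix_left_right_inverse)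
  moreover have "\<forall>i j. ?B$i$j \<in> ints F"
    using A d by (auto simp: forall_2)
  ultimately show "A \<in> K F" using A unfolding K_def by blast
qed

lemma K_ints: "A \<in> K F \<Longrightarrow> A$i$j \<in> ints F" by (simp add: K_iff)

lemma K_GL2: "A \<in> K F \<Longrightarrow> A \<in> carrier GL2" by (simp add: K_iff GL2_iff)

lemma mult_ints: "(\<And>i j. A$i$j \<in> ints F) \<Longrightarrow> (\<And>i j. B$i$j \<in> ints F) \<Longrightarrow>
    ((A :: 'f^2^2) ** B)$i$j \<in> ints F"
  unfolding mult2_nth by (intro ints_add ints_mult)

lemma K_mult: "A \<in> K F \<Longrightarrow> B \<in> K F \<Longrightarrow> A ** B \<in> K F"
  by (simp add: K_iff det_mul val_mult mult_ints)

lemma K_one: "mat 1 \<in> K F"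
  by (simp add: K_iff) (simp add: mat_def)

lemma K_inv: "A \<in> K F \<Longrightarrow> matrix_inv A \<in> K F"
proof -
  assume A: "A \<in> K F"
  then obtain A' where A': "A ** A' = mat 1" "A' ** A = mat 1" "\<forall>i j. A'$i$j \<in> ints F"
    by (auto simp: K_def)
  then have "A' \<in> K F" using A by (auto simp: K_def)
  then show ?thesis using A' by (simp add: matrix_inv_eqI)
qed

lemma red_mat_mult: "(\<And>i j. A$i$j \<in> ints F) \<Longrightarrow> (\<And>i j. B$i$j \<in> ints F) \<Longrightarrow>
    red_mat F (A ** B) = red_mat F A ** red_mat F B"
  by (simp add: mat_eq2_iff mult2_nth red_mat_def red_add red_mult ints_mult)

lemma red_mat_mult_K: "A \<in> K F \<Longrightarrow> B \<in> K F \<Longrightarrow> red_mat F (A ** B) = red_mat F A ** red_mat F B"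
  by (simp add: red_mat_mult K_ints)

lemma red_mat_one [simp]: "red_mat F (mat 1) = mat 1"
  by (simp add: mat_eq2_iff red_mat_def mat_def red_one)

lemma red_mat_mat2: "red_mat F (mat2 a b c d) = mat2 (red F a) (red F b) (red F c) (red F d)"
  by (simp add: mat_eq2_iff red_mat_def)

lemma red_mat_nth: "red_mat F A $ i $ j = red F (A$i$j)"
  by (simp add: red_mat_def)

lemma det_red_mat: "(\<And>i j. A$i$j \<in> ints F) \<Longrightarrow> det (red_mat F A) = red F (det A)"
  by (simp add: det_2 red_mat_nth red_diff red_mult ints_mult)

text \<open>An integral element is a unit exactly when its residue is nonzero, so invertibility over
  the integers can be tested on the reduction. This is why an arbitrary entrywise lift of an
  invertible matrix lies in \<open>K F\<close>.\<close>

lemma K_iff_red: "A \<in> K F \<longleftrightarrow> (\<forall>i j. A$i$j \<in> ints F) \<and> red_mat F A \<in> carrier GL2"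
  by (auto simp: K_iff GL2_iff det_red_mat) (metis unit_iff det_ints red_0)+

lemma red_mat_GL2: "A \<in> K F \<Longrightarrow> red_mat F A \<in> carrier GL2"
  by (simp add: K_iff_red)

lemma red_mat_inv: "A \<in> K F \<Longrightarrow> red_mat F (matrix_inv A) = matrix_inv (red_mat F A)"
  using red_mat_mult_K[of A "matrix_inv A"] K_inv[of A]
  by (simp add: K_GL2 matrix_inv_eqI)

lemma red_mat_surj: "g \<in> carrier GL2 \<Longrightarrow> \<exists>A\<in>K F. red_mat F A = g"
proof -
  assume g: "g \<in> carrier GL2"
  have "\<exists>x\<in>ints F. red F x = y" for y using red_surj by (metis UNIV_I imageE)
  then obtain l where l: "\<And>y. l y \<in> ints F" "\<And>y. red F (l y) = y" by metis
  let ?A = "\<chi> i j. l (g$i$j)"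
  have "red_mat F ?A = g" by (simp add: mat_eq2_iff red_mat_nth l)
  moreover from this have "?A \<in> K F" using g by (simp add: K_iff_red l)
  ultimately show ?thesis by blast
qed

section \<open>Congruence subgroups\<close>

lemma K1_iff: "A \<in> K1 F \<longleftrightarrow> A \<in> K F \<and> red_mat F A = mat 1"
  by (simp add: K1_def)

lemma cong_subgroup_1: "cong_subgroup F 1 = K1 F"
proof -
  have "red_mat F A = mat 1 \<longleftrightarrow> (\<forall>i j. (A - mat 1)$i$j \<in> ideal_pow F 1)" if "A \<in> K F" for A
  proof -
    have "red F (A$i$j) = red F ((mat 1 :: 'f^2^2)$i$j) \<longleftrightarrow> (A - mat 1)$i$j \<in> ideal_pow F 1" for i j
      using red_eq_iff[of "A$i$j" "(mat 1 :: 'f^2^2)$i$j"] K_ints[OF that] K_ints[OF K_one] by simp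
    moreover have "red_mat F A = mat 1 \<longleftrightarrow> (\<forall>i j. red_mat F A$i$j = red_mat F (mat 1)$i$j)"
      by (simp add: vec_eq_iff)
    ultimately show ?thesis by (simp only: red_mat_nth)
  qed
  then show ?thesis by (auto simp: cong_subgroup_def K1_def)
qed

lemma cong_subgroup_antimono: "m \<le> n \<Longrightarrow> cong_subgroup F n \<subseteq> cong_subgroup F m"
  using ideal_antimono by (auto simp: cong_subgroup_def)

text \<open>For a positive level, congruence to the identity already forces the reduction to be the
  identity, hence membership in \<open>K F\<close>. At level 0 the congruence only says that the
  entries are integral.\<close>

lemma cong_subgroupI:
  assumes "n \<ge> 1" "\<And>i j. (A - mat 1)$i$j \<in> ideal_pow F n"
  shows "A \<in> cong_subgroup F n"
proof -
  have 1: "(A - mat 1)$i$j \<in> ideal_pow F 1" for i j using assms ideal_antimono by blast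
  have int: "A$i$j \<in> ints F" for i j
    using ints_add[OF ideal_ints[OF 1[of i j]] K_ints[OF K_one, of i j]] by simp
  have "red F (A$i$j) = red F ((mat 1 :: 'f^2^2)$i$j)" for i j
    using red_eq_iff[of "A$i$j" "(mat 1 :: 'f^2^2)$i$j"] int K_ints[OF K_one] 1[of i j] by simp
  then have "red_mat F A = red_mat F (mat 1)" by (simp only: vec_eq_iff red_mat_nth) simp
  then have "A \<in> K F" using int by (simp add: K_iff_red)
  then show ?thesis using assms by (simp add: cong_subgroup_def)
qed

text \<open>Conjugation is continuous: the entries of \<open>g\<close> and of its inverse have
  valuations at least \<open>- e\<close> and \<open>- e'\<close>, so conjugation lowers the level of
  a congruence by at most \<open>e + e'\<close>.\<close>

lemma cong_subgroup_conj:
  assumes g: "g \<in> carrier GL2"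
  shows "\<exists>m. \<forall>k\<in>cong_subgroup F m. g ** k ** matrix_inv g \<in> cong_subgroup F n"
proof -
  have bound: "\<exists>e. \<forall>i j. A$i$j = 0 \<or> val F (A$i$j) \<ge> - int e" for A :: "'f^2^2"
    by (rule exI[of _ "\<Sum>i\<in>UNIV. \<Sum>j\<in>UNIV. nat \<bar>val F (A$i$j)\<bar>"]) (auto simp: sum_2 forall_2)
  obtain e where e: "\<And>i j. g$i$j = 0 \<or> val F (g$i$j) \<ge> - int e" using bound by metis
  obtain e' where e': "\<And>i j. matrix_inv g$i$j = 0 \<or> val F (matrix_inv g$i$j) \<ge> - int e'"
    using bound by metis
  \<comment> \<open>The level \<open>Suc n\<close> instead of \<open>n\<close> makes
    \<open>cong_subgroupI\<close> applicable when \<open>n = 0\<close>; the surplus is dropped at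
    the end by monotonicity.\<close>
  have *: "x * y * z \<in> ideal_pow F (Suc n)"
    if "x = 0 \<or> val F x \<ge> - int e" "y \<in> ideal_pow F (Suc n + e + e')" "z = 0 \<or> val F z \<ge> - int e'" for x y z
    using that by (cases "x = 0"; cases "y = 0"; cases "z = 0") (auto simp: ideal_pow_def val_mult)
  show ?thesis
  proof (intro exI ballI)
    fix k assume k: "k \<in> cong_subgroup F (Suc n + e + e')"
    then have kk: "(k - mat 1)$i$j \<in> ideal_pow F (Suc n + e + e')" for i j
      by (simp add: cong_subgroup_def)
    have eq: "g ** k ** matrix_inv g - mat 1 = g ** (k - mat 1) ** matrix_inv g"
      using g by (simp add: mult2_diff_right mult2_diff_left)
    have "(g ** (k - mat 1) ** matrix_inv g)$i$j \<in> ideal_pow F (Suc n)" for i j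
      unfolding mult2_nth distrib_right
      by (intro ideal_add * e e' kk)
    then have "g ** k ** matrix_inv g \<in> cong_subgroup F (Suc n)"
      unfolding eq[symmetric] by (intro cong_subgroupI) auto
    then show "g ** k ** matrix_inv g \<in> cong_subgroup F n"
      using cong_subgroup_antimono[of n "Suc n"] by auto
  qed
qed

section \<open>The Iwahori subgroups and their normalising element \<open>Pi_mat F\<close>\<close>

lemma Iw_iff: "A \<in> Iw F \<longleftrightarrow> A \<in> K F \<and> A$2$1 \<in> ideal_pow F 1"
proof -
  have "red_mat F A \<in> Borel \<longleftrightarrow> A$2$1 \<in> ideal_pow F 1" if "A \<in> K F"
    using that red_kernel[of "A$2$1"] by (simp add: Borel_def K_iff_red red_mat_nth)
  then show ?thesis by (auto simp: Iw_def)
qed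

lemma Iw_K: "A \<in> Iw F \<Longrightarrow> A \<in> K F" by (simp add: Iw_def)

lemma Iw_mult: "A \<in> Iw F \<Longrightarrow> B \<in> Iw F \<Longrightarrow> A ** B \<in> Iw F"
  by (simp add: Iw_def K_mult red_mat_mult_K Borel_mult)

lemma Iw1_Iw: "A \<in> Iw1 F \<Longrightarrow> A \<in> Iw F"
  by (simp add: Iw_def Iw1_def Unip_Borel)

lemma Iw1_K: "A \<in> Iw1 F \<Longrightarrow> A \<in> K F"
  by (simp add: Iw1_def)

lemma Iw1_GL2: "A \<in> Iw1 F \<Longrightarrow> A \<in> carrier GL2"
  by (simp add: Iw1_def K_GL2)

lemma Iw1_mult: "A \<in> Iw1 F \<Longrightarrow> B \<in> Iw1 F \<Longrightarrow> A ** B \<in> Iw1 F"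
  by (simp add: Iw1_def K_mult red_mat_mult_K Unip_mult)

lemma Iw1_inv: "A \<in> Iw1 F \<Longrightarrow> matrix_inv A \<in> Iw1 F"
  by (simp add: Iw1_def K_inv red_mat_inv Unip_inv)

lemma K1_Iw1: "A \<in> K1 F \<Longrightarrow> A \<in> Iw1 F"
  by (simp add: Iw1_def K1_def Unip_def mat_def)

lemma Pi_GL2 [simp]: "Pi_mat F \<in> carrier GL2"
  using unif_nonzero by (simp add: Pi_conv)

lemma inv_Pi: "matrix_inv (Pi_mat F) = mat2 0 (inverse (unif F)) 1 0"
  using unif_nonzero by (simp add: Pi_conv matrix_inv_mat2 field_simps)

text \<open>The diagonal entries are exchanged, and the off-diagonal ones are exchanged up to the
  uniformiser. Hence \<open>Pi_mat F\<close> normalises both Iwahori subgroups and turns chi into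
  its conjugate on the quotient \<open>H\<close>.\<close>

lemma Pi_conj: "matrix_inv (Pi_mat F) ** A ** Pi_mat F =
    mat2 (A$2$2) (A$2$1 / unif F) (unif F * A$1$2) (A$1$1)"
proof -
  have "matrix_inv (Pi_mat F) ** mat2 (A$1$1) (A$1$2) (A$2$1) (A$2$2) ** Pi_mat F =
      mat2 (A$2$2) (A$2$1 / unif F) (unif F * A$1$2) (A$1$1)"
    using unif_nonzero unfolding inv_Pi by (simp add: Pi_conv field_simps)
  then show ?thesis by (simp add: mat2_eta)
qed

lemma Pi_conj_Iw:
  assumes "A \<in> Iw F" shows "matrix_inv (Pi_mat F) ** A ** Pi_mat F \<in> Iw F"
proof -
  obtain y where y: "y \<in> ints F" "A$2$1 = unif F * y" using assms by (auto simp: Iw_iff ideal_1_iff)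
  have d: "det (matrix_inv (Pi_mat F) ** A ** Pi_mat F) = det A"
    using unif_nonzero by (simp add: Pi_conj det_2 field_simps)
  show ?thesis using assms y unif_nonzero
    unfolding Iw_iff K_iff d by (simp add: Pi_conj forall_2 ideal_1_iff ints_mult)
qed

lemma Pi_conj_Iw1:
  assumes "A \<in> Iw1 F" shows "matrix_inv (Pi_mat F) ** A ** Pi_mat F \<in> Iw1 F"
proof -
  have "matrix_inv (Pi_mat F) ** A ** Pi_mat F \<in> Iw F" using assms Iw1_Iw Pi_conj_Iw by blast
  then show ?thesis using assms by (simp add: Iw1_def Iw_def Pi_conj red_mat_mat2 Unip_def Borel_def red_mat_nth)
qed

lemma Pi_Pi: "Pi_mat F ** Pi_mat F = mat (unif F)"
  by (simp add: Pi_conv mat_conv_mat2)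

end

section \<open>The tree\<close>

lemma mult_vec2_nth: "((A :: 'a::semiring_1^2^2) *v v) $ i = A$i$1 * v$1 + A$i$2 * v$2"
  by (simp add: matrix_vector_mult_def sum_2)

lemma vec2_eq_iff: "(v :: 'a^2) = w \<longleftrightarrow> v$1 = w$1 \<and> v$2 = w$2"
  by (simp add: vec_eq_iff forall_2)

lemma mat_mult_vec: "mat c *v v = c *s v" for v :: "'a::field^2"
  by (simp add: vec2_eq_iff mult_vec2_nth mat_conv_mat2)

lemma image_mult_vec: "(*v) A ` (*v) B ` L = (*v) (A ** B) ` L" for A :: "'a::field^2^2"
  by (simp add: image_image matrix_vector_mul_assoc)

lemma inj_mult_vec: "g \<in> carrier GL2 \<Longrightarrow> inj ((*v) g)"
  by (rule inj_on_inverseI[of _ "(*v) (matrix_inv g)"]) (simp add: matrix_vector_mul_assoc)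

lemma inj_image_psubset_iff: "inj f \<Longrightarrow> f ` A \<subset> f ` B \<longleftrightarrow> A \<subset> B"
  by (simp add: psubset_eq inj_image_subset_iff inj_image_eq_iff)

lemma homothety_class_alt: "homothety_class L = {(*v) (mat c) ` L | c. c \<noteq> 0}"
  by (simp add: homothety_class_def mat_mult_vec)

lemma homothety_class_self: "L \<in> homothety_class L"
  unfolding homothety_class_alt by (rule CollectI, rule exI[of _ 1]) simp

lemma homothety_class_scale:
  assumes "c \<noteq> 0" shows "homothety_class ((*v) (mat c) ` L) = homothety_class L"
proof (intro Set.set_eqI iffI)
  fix M assume "M \<in> homothety_class ((*v) (mat c) ` L)"
  then obtain d where "d \<noteq> 0" "M = (*v) (mat (d * c)) ` L"
    by (auto simp: homothety_class_alt image_mult_vec mat_mult_mat)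
  then show "M \<in> homothety_class L" using assms unfolding homothety_class_alt
    by (intro CollectI exI[of _ "d * c"]) simp
next
  fix M assume "M \<in> homothety_class L"
  then obtain d where "d \<noteq> 0" "M = (*v) (mat d) ` L" by (auto simp: homothety_class_alt)
  then show "M \<in> homothety_class ((*v) (mat c) ` L)" using assms unfolding homothety_class_alt
    by (intro CollectI exI[of _ "d / c"]) (simp add: image_mult_vec mat_mult_mat)
qed

lemma homothety_class_eq_iff:
  "homothety_class L = homothety_class L' \<longleftrightarrow> (\<exists>c. c \<noteq> 0 \<and> L' = (*v) (mat c) ` L)"
proof
  assume "homothety_class L = homothety_class L'"
  then have "L' \<in> homothety_class L" using homothety_class_self by simp
  then show "\<exists>c. c \<noteq> 0 \<and> L' = (*v) (mat c) ` L" by (auto simp: homothety_class_alt)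
qed (auto simp: homothety_class_scale)

lemma move_homothety_class: "move g (homothety_class L) = homothety_class ((*v) g ` L)"
proof -
  have "(*v) g ` (*v) (mat c) ` L = (*v) (mat c) ` (*v) g ` L" for c
    by (simp add: image_mult_vec mat_mult_commute)
  then show ?thesis unfolding move_def homothety_class_alt by blast
qed

lemma move_mult: "move (g ** h) x = move g (move h x)"
  by (simp add: move_def image_image matrix_vector_mul_assoc)

lemma move_one [simp]: "move (mat 1) x = x"
  by (simp add: move_def)

lemma move_inv [simp]: "g \<in> carrier GL2 \<Longrightarrow> move (matrix_inv g) (move g x) = x"
  "g \<in> carrier GL2 \<Longrightarrow> move g (move (matrix_inv g) x) = x"
  by (simp_all flip: move_mult)

lemma move_inj: "g \<in> carrier GL2 \<Longrightarrow> move g x = move g y \<longleftrightarrow> x = y"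
  by (metis move_inv(1))

lemma move_eq_iff: "g \<in> carrier GL2 \<Longrightarrow> move g x = y \<longleftrightarrow> x = move (matrix_inv g) y"
  by auto

context nonarch_local_field
begin

definition O2 :: "('f^2) set" where "O2 = {v. v$1 \<in> ints F \<and> v$2 \<in> ints F}"

lemma O2_eq: "{vector [x, y] | x y. x \<in> ints F \<and> y \<in> ints F} = O2"
proof (intro Set.set_eqI iffI)
  fix v assume "v \<in> O2"
  then show "v \<in> {vector [x, y] | x y. x \<in> ints F \<and> y \<in> ints F}"
    by (intro CollectI exI[of _ "v$1"] exI[of _ "v$2"]) (simp add: O2_def vec2_eq_iff)
qed (auto simp: O2_def)

lemma vertex0_eq: "vertex0 F = homothety_class O2"
  by (simp add: vertex0_def O2_eq)

lemma Pi_O2: "(*v) (Pi_mat F) ` O2 = {v :: 'f^2. v$1 \<in> ints F \<and> v$2 \<in> ideal_pow F 1}"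
proof (intro Set.set_eqI iffI)
  fix v assume v: "v \<in> {v :: 'f^2. v$1 \<in> ints F \<and> v$2 \<in> ideal_pow F 1}"
  then obtain y where "y \<in> ints F" "v$2 = unif F * y" by (auto simp: ideal_1_iff)
  then show "v \<in> (*v) (Pi_mat F) ` O2" using v
    by (intro image_eqI[of _ _ "vector [y, v$1]"])
      (auto simp: O2_def vec2_eq_iff mult_vec2_nth Pi_conv)
qed (auto simp: O2_def mult_vec2_nth Pi_conv ideal_1_iff)

text \<open>Since \<open>Pi_mat F\<close> maps the standard lattice onto the lattice defining
  \<open>vertex1 F\<close>, the second end of the base edge is a translate of the first, and
  questions about it become questions about \<open>vertex0 F\<close> after conjugation.\<close>

lemma vertex1_eq: "vertex1 F = move (Pi_mat F) (vertex0 F)"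
proof -
  have "{vector [x, y] | x y. x \<in> ints F \<and> y \<in> ideal_pow F 1} =
      {v :: 'f^2. v$1 \<in> ints F \<and> v$2 \<in> ideal_pow F 1}" (is "?A = ?B")
  proof (intro Set.set_eqI iffI)
    fix v assume "v \<in> ?B"
    then show "v \<in> ?A"
      by (intro CollectI exI[of _ "v$1"] exI[of _ "v$2"]) (simp add: vec2_eq_iff)
  qed auto
  then show ?thesis by (simp add: vertex1_def vertex0_eq move_homothety_class Pi_O2)
qed

section \<open>Stabilisers of the base vertex and of the base edge\<close>

lemma K_image_O2: "k \<in> K F \<Longrightarrow> (*v) k ` O2 = O2"
proof -
  have sub: "(*v) k ` O2 \<subseteq> O2" if "k \<in> K F" for k
    using that by (auto simp: O2_def mult_vec2_nth K_ints intro!: ints_add ints_mult)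
  assume k: "k \<in> K F"
  have "(*v) k ` (*v) (matrix_inv k) ` O2 \<subseteq> (*v) k ` O2"
    using sub[OF K_inv[OF k]] by (rule image_mono)
  then show "(*v) k ` O2 = O2" using sub[OF k] by (simp add: image_mult_vec K_GL2[OF k])
qed

lemma image_O2_eq_iff:
  assumes g: "g \<in> carrier GL2" shows "(*v) g ` O2 = O2 \<longleftrightarrow> g \<in> K F"
proof
  assume *: "(*v) g ` O2 = O2"
  \<comment> \<open>The columns of \<open>h\<close> are the images of the standard basis
    vectors.\<close>
  have ent: "h$i$j \<in> ints F" if "(*v) h ` O2 = O2" for h i j
  proof -
    have "(\<chi> l. if l = j then 1 else 0) \<in> O2" by (simp add: O2_def)
    then have "h *v (\<chi> l. if l = j then 1 else 0) \<in> O2" using that by blast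
    moreover have "h *v (\<chi> l. if l = j then 1 else 0) = (\<chi> l. h$l$j)"
      using exhaust_2[of j] by (auto simp: vec2_eq_iff mult_vec2_nth)
    ultimately show ?thesis using exhaust_2[of i] by (auto simp: O2_def)
  qed
  have "(*v) (matrix_inv g) ` O2 = O2"
    using arg_cong[OF *, of "(`) ((*v) (matrix_inv g))"] g by (simp add: image_mult_vec)
  then show "g \<in> K F" using ent[OF *] ent g
    unfolding K_def by (intro CollectI conjI exI[of _ "matrix_inv g"]) auto
qed (rule K_image_O2)

lemma move_vertex0_eq_iff:
  assumes g: "g \<in> carrier GL2"
  shows "move g (vertex0 F) = vertex0 F \<longleftrightarrow> (\<exists>c k. c \<noteq> 0 \<and> k \<in> K F \<and> g = mat c ** k)"
proof
  assume "move g (vertex0 F) = vertex0 F"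
  then obtain c where c: "c \<noteq> 0" "(*v) (mat c) ` (*v) g ` O2 = O2"
    by (auto simp: vertex0_eq move_homothety_class homothety_class_eq_iff)
  then have "mat c ** g \<in> K F"
    using image_O2_eq_iff[of "mat c ** g"] g by (simp add: image_mult_vec)
  moreover have "mat (inverse c) ** (mat c ** g) = g"
    using c by (simp add: matrix_mul_assoc mat_mult_mat)
  ultimately show "\<exists>c k. c \<noteq> 0 \<and> k \<in> K F \<and> g = mat c ** k"
    using c by (metis inverse_nonzero_iff_nonzero)
next
  assume "\<exists>c k. c \<noteq> 0 \<and> k \<in> K F \<and> g = mat c ** k"
  then obtain c k where "c \<noteq> 0" "k \<in> K F" "g = mat c ** k" by blast
  then show "move g (vertex0 F) = vertex0 F"
    by (simp add: vertex0_eq move_homothety_class K_image_O2 homothety_class_scale flip: image_mult_vec)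
qed

lemma K_fix: "k \<in> K F \<Longrightarrow> move k (vertex0 F) = vertex0 F"
  using move_vertex0_eq_iff[OF K_GL2] by (metis matrix_mul_lid zero_neq_one)

lemma scalar_fix: "c \<noteq> 0 \<Longrightarrow> move (mat c) (vertex0 F) = vertex0 F"
  using move_vertex0_eq_iff[of "mat c"] K_one by (metis GL2_mat_iff matrix_mul_rid)

lemma move_Pi_vertex1: "move (Pi_mat F) (vertex1 F) = vertex0 F"
  by (simp add: vertex1_eq Pi_Pi scalar_fix unif_nonzero flip: move_mult)

lemma det_mat_mult: "det (mat c ** A) = c * c * det A" for A :: "'a::field^2^2"
  by (simp add: det_mul mat_conv_mat2)

text \<open>A parity argument: every element of the stabiliser of \<open>vertex0 F\<close> has a
  determinant of even valuation, whereas the determinant of \<open>Pi_mat F\<close> has valuation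
  1.\<close>

lemma vertex0_neq_vertex1: "vertex0 F \<noteq> vertex1 F"
proof
  assume "vertex0 F = vertex1 F"
  then obtain c k where c: "c \<noteq> 0" "k \<in> K F" "Pi_mat F = mat c ** k"
    using move_vertex0_eq_iff[of "Pi_mat F"] by (auto simp: vertex1_eq)
  then have "- unif F = c * c * det k" by (metis Pi_conv det_mat2 det_mat_mult mult_1 mult_zero_left diff_0)
  then have "val F (unif F) = val F (c * c * det k)" by (metis val_minus)
  then show False using c val_unif by (simp add: val_mult K_iff) presburger
qed

text \<open>After conjugation by \<open>Pi_mat F\<close> the question is whether the conjugate of
  \<open>k\<close> is a scalar times an element of \<open>K F\<close>. Comparing determinants, the
  scalar is a unit, so the conjugate is integral; its entry \<open>k$2$1 / unif F\<close> then gives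
  the Iwahori condition.\<close>

lemma move_vertex1_eq_iff:
  assumes k: "k \<in> K F" shows "move k (vertex1 F) = vertex1 F \<longleftrightarrow> k \<in> Iw F"
proof -
  let ?h = "matrix_inv (Pi_mat F) ** k ** Pi_mat F"
  have h: "?h \<in> carrier GL2" using K_GL2[OF k] by simp
  have "move k (vertex1 F) = vertex1 F \<longleftrightarrow> move ?h (vertex0 F) = vertex0 F"
    by (simp add: vertex1_eq move_mult) (metis Pi_GL2 move_inv)
  also have "\<dots> \<longleftrightarrow> k \<in> Iw F"
  proof
    assume "move ?h (vertex0 F) = vertex0 F"
    then obtain c l where c: "c \<noteq> 0" "l \<in> K F" "?h = mat c ** l"
      using move_vertex0_eq_iff[OF h] by auto
    have "det ?h = det k" using unif_nonzero by (simp add: Pi_conj det_2 field_simps)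
    then have "val F (det k) = val F (c * c * det l)" using c by (metis det_mat_mult)
    then have "val F c = 0" using c k by (simp add: val_mult K_iff)
    then have "mat c \<in> K F" using c by (simp add: K_iff mat_conv_mat2 forall_2 ints_def val_mult)
    then have "?h \<in> K F" using c K_mult by simp
    then have "?h$1$2 \<in> ints F" by (rule K_ints)
    then have "k$2$1 / unif F \<in> ints F" by (simp add: Pi_conj)
    then have "k$2$1 \<in> ideal_pow F 1" using unif_nonzero
      unfolding ideal_1_iff by (intro bexI[of _ "k$2$1 / unif F"]) simp_all
    then show "k \<in> Iw F" using k by (simp add: Iw_iff)
  next
    assume "k \<in> Iw F"
    then show "move ?h (vertex0 F) = vertex0 F" using Pi_conj_Iw Iw_K K_fix by blast
  qed
  finally show ?thesis .
qed

text \<open>So \<open>ZI F\<close> consists of the elements that do not flip the base edge, which is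
  the geometric content of the case distinction in \<open>D1_act\<close>.\<close>

lemma ZI_iff:
  assumes g: "g \<in> carrier GL2"
  shows "g \<in> ZI F \<longleftrightarrow> move g (vertex0 F) = vertex0 F \<and> move g (vertex1 F) = vertex1 F"
proof -
  have scalar: "move (mat c ** k) (vertex1 F) = vertex1 F \<longleftrightarrow> move k (vertex1 F) = vertex1 F"
    if "c \<noteq> 0" "k \<in> carrier GL2" for c k
    using that scalar_fix[of c]
    by (simp add: vertex1_eq move_mult move_eq_iff) (metis GL2_mat_iff mat_mult_commute move_inv(1) move_mult)
  show ?thesis
  proof
    assume "g \<in> ZI F"
    then obtain c k where "c \<noteq> 0" "k \<in> Iw F" "g = mat c ** k" by (auto simp: ZI_def)
    then show "move g (vertex0 F) = vertex0 F \<and> move g (vertex1 F) = vertex1 F"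
      using scalar[of c k] Iw_K K_GL2 move_vertex1_eq_iff move_vertex0_eq_iff[OF g] by blast
  next
    assume a: "move g (vertex0 F) = vertex0 F \<and> move g (vertex1 F) = vertex1 F"
    then obtain c k where "c \<noteq> 0" "k \<in> K F" "g = mat c ** k"
      using move_vertex0_eq_iff[OF g] by auto
    then show "g \<in> ZI F"
      using a scalar[of c k] K_GL2 move_vertex1_eq_iff unfolding ZI_def by blast
  qed
qed

lemma stab0_iff: "g \<in> stab (\<sigma>0 F) \<longleftrightarrow> g \<in> carrier GL2 \<and> move g (vertex0 F) = vertex0 F"
  by (auto simp: stab_def \<sigma>0_def)

lemma stab1_iff: "g \<in> stab (\<sigma>1 F) \<longleftrightarrow> g \<in> carrier GL2 \<and>
    (move g (vertex0 F) = vertex0 F \<and> move g (vertex1 F) = vertex1 F \<or>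
     move g (vertex0 F) = vertex1 F \<and> move g (vertex1 F) = vertex0 F)"
  by (auto simp: stab_def \<sigma>1_def doubleton_eq_iff)

text \<open>The two vectors of a lattice basis are the columns of a matrix that carries the standard
  lattice to the given one.\<close>

lemma vertices_eq: "vertices F = {move g (vertex0 F) | g. g \<in> carrier GL2}"
proof -
  have "lattice F L \<longleftrightarrow> (\<exists>g\<in>carrier GL2. L = (*v) g ` O2)" for L
  proof
    assume "lattice F L"
    then obtain a b where ab: "a \<noteq> b" "\<not> vec.dependent {a, b}"
      "L = {x *s a + y *s b | x y. x \<in> ints F \<and> y \<in> ints F}" by (auto simp: lattice_def)
    let ?g = "mat2 (a$1) (b$1) (a$2) (b$2)"
    have lin: "x *s a + y *s b = 0 \<Longrightarrow> x = 0 \<and> y = 0" for x y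
      using vec.independentD[OF ab(2), of "{a, b}" "\<lambda>v. if v = a then x else y" a]
        vec.independentD[OF ab(2), of "{a, b}" "\<lambda>v. if v = a then x else y" b] ab(1) by auto
    have "det ?g \<noteq> 0"
    proof
      assume "det ?g = 0"
      then have d: "a$1 * b$2 = b$1 * a$2" by simp
      then have "b$1 *s a + (- a$1) *s b = 0" "b$2 *s a + (- a$2) *s b = 0"
        by (simp_all add: vec2_eq_iff algebra_simps)
      from lin[OF this(1)] lin[OF this(2)] have "a = b" by (simp add: vec2_eq_iff)
      with ab(1) show False by simp
    qed
    moreover have "L = (*v) ?g ` O2"
    proof (intro Set.set_eqI iffI)
      fix v assume "v \<in> L"
      then obtain x y where xy: "v = x *s a + y *s b" "x \<in> ints F" "y \<in> ints F" using ab by auto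
      then show "v \<in> (*v) ?g ` O2"
        by (intro image_eqI[of _ _ "vector [x, y]"])
          (auto simp: O2_def vec2_eq_iff mult_vec2_nth algebra_simps)
    next
      fix v assume "v \<in> (*v) ?g ` O2"
      then obtain w where w: "w \<in> O2" "v = ?g *v w" by auto
      then have "v = w$1 *s a + w$2 *s b" by (simp add: vec2_eq_iff mult_vec2_nth mult.commute)
      then show "v \<in> L" using w(1) unfolding ab(3) O2_def by blast
    qed
    ultimately show "\<exists>g\<in>carrier GL2. L = (*v) g ` O2"
      by (intro bexI[of _ ?g]) (simp_all only: GL2_iff not_False_eq_True)
  next
    assume "\<exists>g\<in>carrier GL2. L = (*v) g ` O2"
    then obtain g where g: "g \<in> carrier GL2" "L = (*v) g ` O2" by blast
    define a b where "a = g *v vector [1, 0]" and "b = g *v vector [0, 1]"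
    have comb: "x *s a + y *s b = g *v vector [x, y]" for x y
      by (simp add: a_def b_def vec2_eq_iff mult_vec2_nth algebra_simps)
    have lin: "x = 0 \<and> y = 0" if "x *s a + y *s b = 0" for x y
    proof -
      have "g *v vector [x, y] = g *v 0" using that comb by simp
      then have "vector [x, y] = (0 :: 'f^2)" using inj_mult_vec[OF g(1)] by (rule injD[rotated])
      then show ?thesis by (simp add: vec2_eq_iff)
    qed
    have ne: "a \<noteq> b" using lin[of 1 "-1"] by (auto simp: vec2_eq_iff)
    moreover have "\<not> vec.dependent {a, b}"
    proof
      assume "vec.dependent {a, b}"
      then obtain u where "\<exists>v\<in>{a, b}. u v \<noteq> 0" "(\<Sum>v\<in>{a, b}. u v *s v) = 0"
        using vec.dependent_finite[of "{a, b}"] by auto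
      then show False using lin[of "u a" "u b"] ne by auto
    qed
    moreover have "L = {x *s a + y *s b | x y. x \<in> ints F \<and> y \<in> ints F}"
      unfolding comb g(2) O2_eq[symmetric] by blast
    ultimately show "lattice F L" unfolding lattice_def by (intro exI[of _ a] exI[of _ b] conjI)
  qed
  then show ?thesis
    by (auto simp: vertices_def vertex0_eq move_homothety_class)
qed

lemma move_vertices: "g \<in> carrier GL2 \<Longrightarrow> x \<in> vertices F \<Longrightarrow> move g x \<in> vertices F"
  by (auto simp: vertices_eq simp flip: move_mult)

text \<open>Transitivity on oriented edges. A lattice \<open>L'\<close> strictly between
  \<open>unif F\<close> times \<open>L\<close> and \<open>L\<close> becomes, in coordinates with
  \<open>L\<close> standard, a lattice containing a primitive vector. An element of
  \<open>K F\<close> moves this vector to the first basis vector, and then the lattice can only be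
  the image of \<open>O2\<close> under \<open>Pi_mat F\<close>.\<close>

lemma adj_iff: "adj F x y \<longleftrightarrow>
    (\<exists>g\<in>carrier GL2. x = move g (vertex0 F) \<and> y = move g (vertex1 F))"
proof
  assume "\<exists>g\<in>carrier GL2. x = move g (vertex0 F) \<and> y = move g (vertex1 F)"
  then obtain g where g: "g \<in> carrier GL2" "x = move g (vertex0 F)" "y = move g (vertex1 F)" by blast
  let ?M = "(*v) (Pi_mat F) ` O2"
  have "(*v) (mat (unif F)) ` O2 \<subset> ?M"
  proof
    show "(*v) (mat (unif F)) ` O2 \<subseteq> ?M"
      unfolding Pi_O2 by (auto simp: mat_mult_vec O2_def ideal_1_iff ints_mult)
    have "vector [1, 0] \<in> ?M" by (simp add: Pi_O2)
    moreover have "vector [1, 0] \<notin> (*v) (mat (unif F)) ` O2"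
      using red_kernel[OF ints_1] red_one
      by (auto simp: mat_mult_vec O2_def vec2_eq_iff ideal_1_iff)
    ultimately show "(*v) (mat (unif F)) ` O2 \<noteq> ?M" by blast
  qed
  moreover have "?M \<subset> O2"
  proof
    show "?M \<subseteq> O2" unfolding Pi_O2 using ideal_ints by (auto simp: O2_def)
    have "vector [0, 1] \<in> O2" by (simp add: O2_def)
    moreover have "vector [0, 1] \<notin> ?M" using red_kernel[OF ints_1] red_one by (simp add: Pi_O2)
    ultimately show "?M \<noteq> O2" by blast
  qed
  ultimately have "(*v) g ` (*v) (mat (unif F)) ` O2 \<subset> (*v) g ` ?M" "(*v) g ` ?M \<subset> (*v) g ` O2"
    by (simp_all only: inj_image_psubset_iff[OF inj_mult_vec[OF g(1)]])
  then have "(\<lambda>v. unif F *s v) ` (*v) g ` O2 \<subset> (*v) g ` ?M \<and> (*v) g ` ?M \<subset> (*v) g ` O2"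
    by (simp add: image_mult_vec flip: mat_mult_vec mat_mult_commute)
  moreover have "(*v) g ` O2 \<in> x" "(*v) g ` ?M \<in> y"
    by (simp_all add: g vertex0_eq vertex1_eq move_homothety_class homothety_class_self)
  moreover have "x \<in> vertices F" "y \<in> vertices F"
    using g by (auto simp: vertices_eq vertex1_eq simp flip: move_mult)
  ultimately show "adj F x y" unfolding adj_def
    by (intro conjI bexI[of _ "(*v) g ` O2"] bexI[of _ "(*v) g ` ?M"]) simp_all
next
  assume "adj F x y"
  then obtain L L' where x: "x \<in> vertices F" and y: "y \<in> vertices F" and L: "L \<in> x" and L': "L' \<in> y"
    and sub: "(\<lambda>v. unif F *s v) ` L \<subset> L'" "L' \<subset> L" by (auto simp: adj_def)
  have lat: "\<exists>g\<in>carrier GL2. M = (*v) g ` O2 \<and> z = move g (vertex0 F)"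
    if z: "z \<in> vertices F" "M \<in> z" for z M
  proof -
    obtain g where g: "g \<in> carrier GL2" "z = homothety_class ((*v) g ` O2)"
      using z by (auto simp: vertices_eq vertex0_eq move_homothety_class)
    then obtain c where c: "c \<noteq> 0" "M = (*v) (mat c) ` (*v) g ` O2"
      using z by (auto simp: homothety_class_alt)
    then show ?thesis using g
      by (intro bexI[of _ "mat c ** g"])
        (simp_all add: vertex0_eq move_homothety_class homothety_class_scale flip: image_mult_vec)
  qed
  obtain g where g: "g \<in> carrier GL2" "L = (*v) g ` O2" "x = move g (vertex0 F)"
    using lat[OF x L] by blast
  obtain h where h: "h \<in> carrier GL2" "L' = (*v) h ` O2" "y = move h (vertex0 F)"
    using lat[OF y L'] by blast
  define m where "m = matrix_inv g ** h"
  have m: "m \<in> carrier GL2" "h = g ** m" using g h by (simp_all add: m_def)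
  have sub1: "(*v) (mat (unif F)) ` O2 \<subset> (*v) m ` O2" and sub2: "(*v) m ` O2 \<subset> O2"
  proof -
    have eq: "L' = (*v) g ` (*v) m ` O2" "(\<lambda>v. unif F *s v) ` L = (*v) g ` (*v) (mat (unif F)) ` O2"
      by (simp_all add: g h m image_mult_vec flip: mat_mult_vec mat_mult_commute)
    show "(*v) (mat (unif F)) ` O2 \<subset> (*v) m ` O2" "(*v) m ` O2 \<subset> O2"
      using sub unfolding eq by (simp_all only: g(2) inj_image_psubset_iff[OF inj_mult_vec[OF g(1)]])
  qed
  have comb: "s *s v + t *s w \<in> (*v) r ` O2"
    if vw: "v \<in> (*v) r ` O2" "w \<in> (*v) r ` O2" and st: "s \<in> ints F" "t \<in> ints F" for r v w s t
  proof -
    obtain v' w' where "v' \<in> O2" "w' \<in> O2" "v = r *v v'" "w = r *v w'" using vw by auto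
    moreover from this have "s *s v + t *s w = r *v (s *s v' + t *s w')"
      by (simp add: matrix_vector_right_distrib vector_scalar_commute)
    ultimately show ?thesis using st
      by (intro image_eqI[of _ _ "s *s v' + t *s w'"]) (auto simp: O2_def ints_mult ints_add)
  qed
  obtain a where a: "a \<in> (*v) m ` O2" "a \<notin> (*v) (mat (unif F)) ` O2" using sub1 by blast
  have aO: "a \<in> O2" using a sub2 by blast
  have prim: "red F (a$1) \<noteq> 0 \<or> red F (a$2) \<noteq> 0"
  proof (rule ccontr)
    assume "\<not> ?thesis"
    then obtain u v where "u \<in> ints F" "v \<in> ints F" "a$1 = unif F * u" "a$2 = unif F * v"
      using aO by (auto simp: O2_def red_kernel ideal_1_iff)
    then have "a \<in> (*v) (mat (unif F)) ` O2"
      by (intro image_eqI[of _ _ "vector [u, v]"]) (auto simp: vec2_eq_iff mat_mult_vec O2_def)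
    with a show False by simp
  qed
  \<comment> \<open>A unit entry of \<open>a\<close> allows \<open>a\<close> to be completed to a
    matrix in \<open>K F\<close> with first column \<open>a\<close>.\<close>
  obtain k where k: "k \<in> K F" "a = k *v vector [1, 0]"
  proof (cases "red F (a$1) = 0")
    case False
    then show ?thesis using aO that[of "mat2 (a$1) 0 (a$2) 1"]
      by (auto simp: K_iff_red red_mat_mat2 forall_2 O2_def vec2_eq_iff mult_vec2_nth red_one)
  next
    case True
    then show ?thesis using aO prim that[of "mat2 (a$1) 1 (a$2) 0"]
      by (auto simp: K_iff_red red_mat_mat2 forall_2 O2_def vec2_eq_iff mult_vec2_nth red_one)
  qed
  note kG = K_GL2[OF k(1)]
  define n where "n = matrix_inv k ** m"
  have n: "n \<in> carrier GL2" "m = k ** n" using m kG by (simp_all add: n_def)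
  have e1: "vector [1, 0] \<in> (*v) n ` O2"
    using a(1) k(2) inj_mult_vec[OF kG] unfolding n(2) by (auto simp: inj_image_mem_iff simp flip: image_mult_vec)
  have pn: "(*v) (mat (unif F)) ` O2 \<subseteq> (*v) n ` O2"
  proof -
    have "(*v) (mat (unif F)) ` O2 = (*v) (matrix_inv k) ` (*v) (mat (unif F)) ` O2"
      using K_image_O2[OF K_inv[OF k(1)]] by (simp add: image_mult_vec flip: mat_mult_commute)
        (metis image_mult_vec mat_mult_commute)
    also have "\<dots> \<subseteq> (*v) (matrix_inv k) ` (*v) m ` O2" using sub1 by blast
    finally show ?thesis by (simp add: image_mult_vec n_def)
  qed
  have nO: "(*v) n ` O2 \<subset> O2"
  proof -
    have "(*v) k ` (*v) n ` O2 \<subset> (*v) k ` O2" using sub2 K_image_O2[OF k(1)] by (simp add: n(2) image_mult_vec)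
    then show ?thesis by (simp only: inj_image_psubset_iff[OF inj_mult_vec[OF kG]])
  qed
  have "(*v) n ` O2 = (*v) (Pi_mat F) ` O2"
  proof (intro Set.set_eqI iffI)
    fix v assume v: "v \<in> (*v) n ` O2"
    then have vO: "v \<in> O2" using nO by blast
    show "v \<in> (*v) (Pi_mat F) ` O2"
    proof (rule ccontr)
      assume "v \<notin> (*v) (Pi_mat F) ` O2"
      \<comment> \<open>If the second coordinate were a unit, \<open>v\<close> and the first basis
        vector would together give the second one, and the lattice would be all of
        \<open>O2\<close>.\<close>
      then have u: "red F (v$2) \<noteq> 0" using vO unfolding Pi_O2 by (auto simp: O2_def red_kernel)
      then have i: "inverse (v$2) \<in> ints F" "v$2 \<noteq> 0" using vO unit_inverse_ints by (auto simp: O2_def)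
      then have "inverse (v$2) *s v + (- inverse (v$2) * v$1) *s vector [1, 0] \<in> (*v) n ` O2"
        using vO by (intro comb v e1) (auto simp: O2_def)
      moreover have "inverse (v$2) *s v + (- inverse (v$2) * v$1) *s vector [1, 0] = vector [0, 1]"
        using i by (simp add: vec2_eq_iff)
      ultimately have e2: "vector [0, 1] \<in> (*v) n ` O2" by simp
      have "w \<in> (*v) n ` O2" if "w \<in> O2" for w
      proof -
        have "w = w$1 *s vector [1, 0] + w$2 *s vector [0, 1]" by (simp add: vec2_eq_iff)
        then show ?thesis using comb[OF e1 e2, of "w$1" "w$2"] that by (simp add: O2_def)
      qed
      with nO show False by blast
    qed
  next
    fix v assume "v \<in> (*v) (Pi_mat F) ` O2"
    then obtain y where y: "v$1 \<in> ints F" "y \<in> ints F" "v$2 = unif F * y"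
      unfolding Pi_O2 by (auto simp: ideal_1_iff)
    have "vector [0, v$2] \<in> (*v) (mat (unif F)) ` O2"
      using y by (intro image_eqI[of _ _ "vector [0, y]"]) (auto simp: vec2_eq_iff mat_mult_vec O2_def)
    then have "v$1 *s vector [1, 0] + 1 *s vector [0, v$2] \<in> (*v) n ` O2"
      using pn y by (intro comb e1) auto
    moreover have "v$1 *s vector [1, 0] + 1 *s vector [0, v$2] = v" by (simp add: vec2_eq_iff)
    ultimately show "v \<in> (*v) n ` O2" by simp
  qed
  then have "L' = (*v) (g ** k ** Pi_mat F) ` O2"
    by (simp add: h(2) m(2) n(2) flip: image_mult_vec)
  then have "y = move (g ** k) (vertex1 F)"
    using h by (simp add: vertex1_eq vertex0_eq move_homothety_class image_mult_vec)
  moreover have "x = move (g ** k) (vertex0 F)" using g k K_fix by (simp add: move_mult)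
  ultimately show "\<exists>g\<in>carrier GL2. x = move g (vertex0 F) \<and> y = move g (vertex1 F)"
    using g kG GL2_mult by blast
qed

end

lemma rep_on_sel: "rep_space (rep_on V s a) = V" "rep_add (rep_on V s a) = (+)"
    "rep_smul (rep_on V s a) = s" "rep_act (rep_on V s a) = a"
  by (simp_all add: rep_on_def)

section \<open>Homomorphisms out of a quotient representation\<close>

text \<open>\<open>C\<close> and \<open>W\<close> are subsets of one type, because chains form only
  a part of a function space. \<open>S\<close> is a bare set without inverses;
  \<open>W_act_surj\<close> takes their place, ensuring that the image of a coset under the action
  is a full coset.\<close>

locale stable_subspace =
  fixes C W :: "'x::ab_group_add set" and s :: "'k \<Rightarrow> 'x \<Rightarrow> 'x" and a :: "'g \<Rightarrow> 'x \<Rightarrow> 'x"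
    and S :: "'g set"
  assumes C_add: "x \<in> C \<Longrightarrow> y \<in> C \<Longrightarrow> x + y \<in> C"
    and C_scale: "x \<in> C \<Longrightarrow> s c x \<in> C"
    and C_act: "g \<in> S \<Longrightarrow> x \<in> C \<Longrightarrow> a g x \<in> C"
    and W_sub: "W \<subseteq> C" and W_0: "0 \<in> W"
    and W_add: "x \<in> W \<Longrightarrow> y \<in> W \<Longrightarrow> x + y \<in> W"
    and W_neg: "x \<in> W \<Longrightarrow> - x \<in> W"
    and W_scale: "x \<in> W \<Longrightarrow> s c x \<in> W"
    and W_act: "g \<in> S \<Longrightarrow> x \<in> W \<Longrightarrow> a g x \<in> W"
    and W_act_surj: "g \<in> S \<Longrightarrow> x \<in> W \<Longrightarrow> \<exists>y\<in>W. a g y = x"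
    and s_add: "s c (x + y) = s c x + s c y"
    and a_add: "g \<in> S \<Longrightarrow> a g (x + y) = a g x + a g y"
begin

abbreviation "Q \<equiv> quot_rep (rep_on C s a) W"

definition coset :: "'x \<Rightarrow> 'x set" where "coset x = {x + w | w. w \<in> W}"

lemma coset_self: "x \<in> coset x"
  unfolding coset_def using W_0 by force

lemma coset_eq_iff: "coset x = coset y \<longleftrightarrow> x - y \<in> W"
proof
  assume "coset x = coset y"
  then have "x \<in> coset y" using coset_self by blast
  then show "x - y \<in> W" by (auto simp: coset_def)
next
  have sub: "coset x \<subseteq> coset y" if "x - y \<in> W" for x y
  proof
    fix z assume "z \<in> coset x"
    then obtain w where "w \<in> W" "z = x + w" by (auto simp: coset_def)
    then show "z \<in> coset y" using that unfolding coset_def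
      by (intro CollectI exI[of _ "(x - y) + w"]) (simp add: W_add)
  qed
  assume "x - y \<in> W"
  with sub[of x y] sub[of y x] W_neg[of "x - y"] show "coset x = coset y" by simp
qed

lemma Q_space: "rep_space Q = coset ` C"
  by (auto simp: quot_rep_def rep_on_def coset_def)

lemma Q_add: "rep_add Q (coset x) (coset y) = coset (x + y)"
proof (intro Set.set_eqI iffI)
  fix z assume "z \<in> rep_add Q (coset x) (coset y)"
  then obtain w w' where "w \<in> W" "w' \<in> W" "z = x + w + (y + w')"
    by (auto simp: quot_rep_def rep_on_def coset_def)
  then show "z \<in> coset (x + y)" unfolding coset_def
    by (intro CollectI exI[of _ "w + w'"]) (simp add: W_add)
next
  fix z assume "z \<in> coset (x + y)"
  then obtain w where "w \<in> W" "z = x + (y + w)" by (auto simp: coset_def add.assoc)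
  moreover from this have "y + w \<in> coset y" by (auto simp: coset_def)
  ultimately show "z \<in> rep_add Q (coset x) (coset y)"
    using coset_self by (auto simp: quot_rep_def rep_on_def)
qed

lemma Q_smul: "rep_smul Q c (coset x) = coset (s c x)"
proof (intro Set.set_eqI iffI)
  fix z assume "z \<in> rep_smul Q c (coset x)"
  then obtain w w' where "w \<in> W" "w' \<in> W" "z = s c x + s c w + w'"
    by (auto simp: quot_rep_def rep_on_def coset_def s_add)
  then show "z \<in> coset (s c x)" unfolding coset_def
    by (intro CollectI exI[of _ "s c w + w'"]) (simp add: W_add W_scale add.assoc)
next
  fix z assume "z \<in> coset (s c x)"
  then obtain w where "w \<in> W" "z = s c x + w" by (auto simp: coset_def)
  then show "z \<in> rep_smul Q c (coset x)"
    using coset_self by (auto simp: quot_rep_def rep_on_def)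
qed

lemma Q_act: "g \<in> S \<Longrightarrow> rep_act Q g (coset x) = coset (a g x)"
proof (intro Set.set_eqI iffI)
  fix z assume "g \<in> S" "z \<in> rep_act Q g (coset x)"
  then obtain w where "w \<in> W" "z = a g x + a g w"
    by (auto simp: quot_rep_def rep_on_def coset_def a_add)
  then show "z \<in> coset (a g x)" unfolding coset_def
    using W_act \<open>g \<in> S\<close> by (intro CollectI exI[of _ "a g w"]) simp
next
  fix z assume g: "g \<in> S" and "z \<in> coset (a g x)"
  then obtain w where "w \<in> W" "z = a g x + w" by (auto simp: coset_def)
  moreover obtain w' where "w' \<in> W" "a g w' = w" using W_act_surj g \<open>w \<in> W\<close> by blast
  ultimately have "x + w' \<in> coset x" "z = a g (x + w')" using g by (auto simp: coset_def a_add)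
  then show "z \<in> rep_act Q g (coset x)" by (auto simp: quot_rep_def rep_on_def)
qed

lemma Hom_Q_iff: "f \<in> Hom_rep S Q (rep_on UNIV sc act) \<longleftrightarrow>
    (\<forall>X. X \<notin> coset ` C \<longrightarrow> f X = 0) \<and>
    (\<forall>x\<in>C. \<forall>y\<in>C. f (coset (x + y)) = f (coset x) + f (coset y)) \<and>
    (\<forall>c. \<forall>x\<in>C. f (coset (s c x)) = sc c (f (coset x))) \<and>
    (\<forall>g\<in>S. \<forall>x\<in>C. f (coset (a g x)) = act g (f (coset x)))"
  by (simp add: Hom_rep_def Q_space Q_add Q_smul Q_act rep_on_sel cong: ball_cong)

lemma quotient_hom:
  fixes h :: "'x \<Rightarrow> 'v::ab_group_add"
  assumes add: "\<And>x y. x \<in> C \<Longrightarrow> y \<in> C \<Longrightarrow> h (x + y) = h x + h y"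
    and scale: "\<And>c x. x \<in> C \<Longrightarrow> h (s c x) = sc c (h x)"
    and act: "\<And>g x. g \<in> S \<Longrightarrow> x \<in> C \<Longrightarrow> h (a g x) = act g (h x)"
    and van: "\<And>x. x \<in> W \<Longrightarrow> h x = 0"
  shows "\<exists>f\<in>Hom_rep S Q (rep_on UNIV sc act). \<forall>x\<in>C. f (coset x) = h x"
proof -
  define f where "f X = (if X \<in> coset ` C then h (SOME x. x \<in> X) else 0)" for X
  have f: "f (coset x) = h x" if "x \<in> C" for x
  proof -
    have "(SOME y. y \<in> coset x) \<in> coset x" using coset_self by (metis someI)
    then obtain w where "w \<in> W" "(SOME y. y \<in> coset x) = x + w" by (auto simp: coset_def)
    then show ?thesis using that van add W_sub by (auto simp: f_def)
  qed
  moreover have "f \<in> Hom_rep S Q (rep_on UNIV sc act)"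
    unfolding Hom_Q_iff by (auto simp: f C_add C_scale C_act add scale act) (simp add: f_def)
  ultimately show ?thesis by blast
qed

end

section \<open>The coefficient system of a diagram\<close>

text \<open>For an action \<open>a\<close> of \<open>S\<close> this is the function supported on the
  coset of \<open>matrix_inv g\<close> with value \<open>d\<close> there. It behaves like a formal
  translate of \<open>d\<close> by \<open>g\<close>: right translation by \<open>h\<close> replaces
  \<open>g\<close> by \<open>h ** g\<close>, and an element of \<open>S\<close> on the right of
  \<open>g\<close> can be moved onto \<open>d\<close>.\<close>

definition coset_fun :: "('f::field^2^2) set \<Rightarrow> ('f^2^2 \<Rightarrow> 'd \<Rightarrow> 'd) \<Rightarrow> 'f^2^2 \<Rightarrow> 'd \<Rightarrow> 'f^2^2 \<Rightarrow> 'd::zero"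
  where "coset_fun S a g d = (\<lambda>x. if x ** g \<in> S then a (x ** g) d else 0)"

lemma rtrans_coset_fun: "rtrans h (coset_fun S a g d) = coset_fun S a (h ** g) d"
  by (simp add: rtrans_def coset_fun_def matrix_mul_assoc cong: if_cong)

text \<open>The common features of \<open>D_0\<close> with the vertex stabiliser and of
  \<open>D_1\<close> with the edge stabiliser. That \<open>K1 F\<close> lies in \<open>S\<close> and
  acts trivially makes every \<open>coset_fun\<close> invariant under some congruence subgroup,
  hence an element of the compact induction.\<close>

locale coset_action = nonarch_local_field F + vector_space sd
  for F :: "('f::field, 'q::{field, finite}) valued_field"
    and sd :: "'k::field \<Rightarrow> 'd::ab_group_add \<Rightarrow> 'd" +
  fixes S :: "('f^2^2) set" and D :: "'d set" and a :: "'f^2^2 \<Rightarrow> 'd \<Rightarrow> 'd"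
  assumes S_GL2: "g \<in> S \<Longrightarrow> g \<in> carrier GL2"
    and S_one: "mat 1 \<in> S"
    and S_mult: "g \<in> S \<Longrightarrow> h \<in> S \<Longrightarrow> g ** h \<in> S"
    and S_inv: "g \<in> S \<Longrightarrow> matrix_inv g \<in> S"
    and S_K1: "k \<in> K1 F \<Longrightarrow> k \<in> S"
    and D_subspace: "subspace D"
    and act_closed: "g \<in> S \<Longrightarrow> d \<in> D \<Longrightarrow> a g d \<in> D"
    and act_mult: "g \<in> S \<Longrightarrow> h \<in> S \<Longrightarrow> d \<in> D \<Longrightarrow> a (g ** h) d = a g (a h d)"
    and act_add: "g \<in> S \<Longrightarrow> d \<in> D \<Longrightarrow> d' \<in> D \<Longrightarrow> a g (d + d') = a g d + a g d'"
    and act_scale: "g \<in> S \<Longrightarrow> d \<in> D \<Longrightarrow> a g (sd c d) = sd c (a g d)"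
    and act_K1: "k \<in> K1 F \<Longrightarrow> d \<in> D \<Longrightarrow> a k d = d"
begin

lemma D_0: "0 \<in> D" and D_add: "d \<in> D \<Longrightarrow> d' \<in> D \<Longrightarrow> d + d' \<in> D"
  and D_scale: "d \<in> D \<Longrightarrow> sd c d \<in> D"
  using D_subspace by (auto simp: subspace_def)

lemma act_one: "d \<in> D \<Longrightarrow> a (mat 1) d = d"
  by (rule act_K1) (simp_all add: K1_def K_one)

lemma act_zero: "g \<in> S \<Longrightarrow> a g 0 = 0"
  using act_scale[OF _ D_0, of g 0] by simp

lemma act_minus: "g \<in> S \<Longrightarrow> d \<in> D \<Longrightarrow> a g (- d) = - a g d"
  using act_scale[of g d "-1"] by simp

lemma S_mult_iff: "h \<in> S \<Longrightarrow> g ** h \<in> S \<longleftrightarrow> g \<in> S"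
  by (metis S_GL2 GL2_cancel(3) S_inv S_mult)

lemma S_mult_iff': "h \<in> S \<Longrightarrow> h ** g \<in> S \<longleftrightarrow> g \<in> S"
  by (metis S_GL2 GL2_cancel(1) S_inv S_mult)

lemma coset_fun_mult: "h \<in> S \<Longrightarrow> d \<in> D \<Longrightarrow> coset_fun S a (g ** h) d = coset_fun S a g (a h d)"
  by (auto simp: coset_fun_def fun_eq_iff matrix_mul_assoc S_mult_iff act_mult)

lemma coset_fun_inv: "g \<in> carrier GL2 \<Longrightarrow> d \<in> D \<Longrightarrow> coset_fun S a g d (matrix_inv g) = d"
  by (simp add: coset_fun_def S_one act_one)

lemma coset_fun_add: "d \<in> D \<Longrightarrow> d' \<in> D \<Longrightarrow>
    coset_fun S a g (d + d') = coset_fun S a g d + coset_fun S a g d'"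
  by (auto simp: coset_fun_def fun_eq_iff act_add)

lemma coset_fun_scale: "d \<in> D \<Longrightarrow> coset_fun S a g (sd c d) = fun_scale sd c (coset_fun S a g d)"
  by (auto simp: coset_fun_def fun_eq_iff act_scale fun_scale_def)

lemma coset_fun_zero: "coset_fun S a g 0 = 0"
  by (auto simp: coset_fun_def fun_eq_iff act_zero)

lemma coset_fun_minus: "d \<in> D \<Longrightarrow> coset_fun S a g (- d) = - coset_fun S a g d"
  by (simp add: coset_fun_def fun_eq_iff act_minus)

text \<open>An equivariant function supported on one coset is determined by its value at
  \<open>matrix_inv g\<close>, and every value in \<open>D\<close> occurs. This replaces the stalks
  of the coefficient system by copies of \<open>D\<close>.\<close>

lemma c_Ind_one_coset:
  assumes g: "g \<in> carrier GL2"
  shows "f \<in> c_Ind F S D a \<and> {x. f x \<noteq> 0} \<subseteq> {\<kappa> ** matrix_inv g | \<kappa>. \<kappa> \<in> S} \<longleftrightarrow>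
    f \<in> coset_fun S a g ` D"
proof
  assume f: "f \<in> c_Ind F S D a \<and> {x. f x \<noteq> 0} \<subseteq> {\<kappa> ** matrix_inv g | \<kappa>. \<kappa> \<in> S}"
  have "f x = coset_fun S a g (f (matrix_inv g)) x" for x
  proof (cases "x ** g \<in> S")
    case True
    then have "f (x ** g ** matrix_inv g) = a (x ** g) (f (matrix_inv g))"
      using f GL2_inv_closed[OF g] unfolding c_Ind_def by blast
    then show ?thesis using True g by (simp add: coset_fun_def)
  next
    case False
    have "f x = 0"
    proof (rule ccontr)
      assume "f x \<noteq> 0"
      then obtain \<kappa> where "\<kappa> \<in> S" "x = \<kappa> ** matrix_inv g" using f by auto
      then show False using False g by simp
    qed
    then show ?thesis using False by (simp add: coset_fun_def)
  qed
  moreover have "f (matrix_inv g) \<in> D" using f g by (simp add: c_Ind_def)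
  ultimately show "f \<in> coset_fun S a g ` D" by blast
next
  assume "f \<in> coset_fun S a g ` D"
  then obtain d where d: "d \<in> D" "f = coset_fun S a g d" by blast
  have GL: "x \<in> carrier GL2" if "x ** g \<in> S" for x
    using S_GL2[OF that] GL2_mult_iff[OF g] by simp
  have supp: "{x. f x \<noteq> 0} \<subseteq> {\<kappa> ** matrix_inv g | \<kappa>. \<kappa> \<in> S}"
  proof
    fix x assume "x \<in> {x. f x \<noteq> 0}"
    then have "x ** g \<in> S" by (auto simp: d coset_fun_def split: if_splits)
    then show "x \<in> {\<kappa> ** matrix_inv g | \<kappa>. \<kappa> \<in> S}"
      using g by (intro CollectI exI[of _ "x ** g"]) simp
  qed
  \<comment> \<open>A deep congruence subgroup is conjugated by \<open>g\<close> into
    \<open>K1 F\<close>, which acts trivially on \<open>d\<close>.\<close>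
  obtain m where m: "\<And>k. k \<in> cong_subgroup F m \<Longrightarrow> matrix_inv g ** k ** g \<in> K1 F"
    using cong_subgroup_conj[of "matrix_inv g" 1] g by (auto simp: cong_subgroup_1)
  have smooth: "rtrans k f = f" if "k \<in> cong_subgroup F m" for k
  proof -
    let ?l = "matrix_inv g ** k ** g"
    have "g ** ?l = k ** g" using g by (simp flip: matrix_mul_assoc)
    then have "rtrans k f = coset_fun S a (g ** ?l) d" by (simp add: d rtrans_coset_fun)
    also have "\<dots> = f"
      using m[OF that] S_K1 d by (simp add: coset_fun_mult act_K1)
    finally show ?thesis .
  qed
  have "{{h ** x | h. h \<in> S} | x. x \<in> carrier GL2 \<and> f x \<noteq> 0} \<subseteq> {{h ** matrix_inv g | h. h \<in> S}}"
  proof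
    fix X assume "X \<in> {{h ** x | h. h \<in> S} | x. x \<in> carrier GL2 \<and> f x \<noteq> 0}"
    then obtain x where "f x \<noteq> 0" "X = {h ** x | h. h \<in> S}" by auto
    then obtain \<kappa> where k: "\<kappa> \<in> S" "X = {h ** (\<kappa> ** matrix_inv g) | h. h \<in> S}" using supp by blast
    have "X = {h ** matrix_inv g | h. h \<in> S}"
    proof (intro Set.set_eqI iffI)
      fix y assume "y \<in> X"
      then obtain h where "h \<in> S" "y = h ** (\<kappa> ** matrix_inv g)" using k by auto
      then show "y \<in> {h ** matrix_inv g | h. h \<in> S}"
        using k by (intro CollectI exI[of _ "h ** \<kappa>"]) (simp add: S_mult matrix_mul_assoc)
    next
      fix y assume "y \<in> {h ** matrix_inv g | h. h \<in> S}"
      then obtain h where "h \<in> S" "y = h ** matrix_inv g" by auto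
      then show "y \<in> X" using k S_GL2[OF k(1)] unfolding k(2)
        by (intro CollectI exI[of _ "h ** matrix_inv \<kappa>"])
          (simp add: S_mult S_inv flip: matrix_mul_assoc)
    qed
    then show "X \<in> {{h ** matrix_inv g | h. h \<in> S}}" by simp
  qed
  then have "finite {{h ** x | h. h \<in> S} | x. x \<in> carrier GL2 \<and> f x \<noteq> 0}"
    by (rule finite_subset) simp
  moreover have "f (h ** x) = a h (f x)" if "h \<in> S" for h x
    using that d by (simp add: coset_fun_def S_mult_iff' act_mult act_zero flip: matrix_mul_assoc)
  moreover have "f x \<in> D" for x using d by (simp add: coset_fun_def act_closed D_0)
  moreover have "f x = 0" if "x \<notin> carrier GL2" for x using that GL by (auto simp: d coset_fun_def)
  ultimately have "f \<in> c_Ind F S D a" using smooth unfolding c_Ind_def by blast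
  then show "f \<in> c_Ind F S D a \<and> {x. f x \<noteq> 0} \<subseteq> {\<kappa> ** matrix_inv g | \<kappa>. \<kappa> \<in> S}"
    using supp by blast
qed

end

text \<open>The construction of \<open>V_gamma\<close> for an arbitrary diagram, so that the
  homology can be studied without reference to the irreducible representations that enter
  \<open>D_0\<close>.\<close>

definition diagram_system :: "('f::field, 'q::field) valued_field \<Rightarrow> ('f^2^2 \<Rightarrow> 'd \<Rightarrow> 'd) \<Rightarrow>
    'd set \<Rightarrow> ('f^2^2 \<Rightarrow> 'd \<Rightarrow> 'd) \<Rightarrow> ('f, 'f^2^2 \<Rightarrow> 'd::ab_group_add) coeff_system" where
  "diagram_system F a0 E a1 = \<lparr>
     stalk = (\<lambda>\<tau>. {f. \<exists>g\<in>carrier GL2.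
        \<tau> = move g ` \<sigma>0 F \<and> f \<in> c_Ind F (stab (\<sigma>0 F)) UNIV a0 \<and>
          {x. f x \<noteq> 0} \<subseteq> {\<kappa> ** matrix_inv g | \<kappa>. \<kappa> \<in> stab (\<sigma>0 F)} \<or>
        \<tau> = move g ` \<sigma>1 F \<and> f \<in> c_Ind F (stab (\<sigma>1 F)) E a1 \<and>
          {x. f x \<noteq> 0} \<subseteq> {\<kappa> ** matrix_inv g | \<kappa>. \<kappa> \<in> stab (\<sigma>1 F)}}),
     restr = (\<lambda>\<tau> \<sigma> f. if \<tau> = \<sigma> then f else
        (let g = (SOME g. g \<in> carrier GL2 \<and> \<tau> = move g ` \<sigma>1 F \<and> \<sigma> = move g ` \<sigma>0 F) in
         (\<lambda>x. if x ** g \<in> stab (\<sigma>0 F) then a0 (x ** g) (f (matrix_inv g)) else 0))),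
     cact = (\<lambda>g \<sigma>. rtrans g)\<rparr>"

lemma V_gamma_eq: "V_gamma F scaleA actA vA scaleB actB vB =
    diagram_system F (D0_act F actA actB) (D1 F actA actB) (D1_act F scaleA actA vA scaleB actB vB)"
  by (simp add: V_gamma_def diagram_system_def)

text \<open>Opposite pairs are removed two at a time. Reindexing by the swap would only show that
  twice the sum vanishes, which says nothing in characteristic 2.\<close>

lemma sum_alternating:
  fixes f :: "'x \<times> 'x \<Rightarrow> 'v::ab_group_add"
  assumes "finite A" "\<And>x y. (x, y) \<in> A \<Longrightarrow> (y, x) \<in> A \<and> x \<noteq> y \<and> f (x, y) + f (y, x) = 0"
  shows "sum f A = 0"
  using assms
proof (induction "card A" arbitrary: A rule: less_induct)
  case less
  show ?case
  proof (cases "A = {}")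
    case False
    then obtain x y where xy: "(x, y) \<in> A" by auto
    let ?P = "{(x, y), (y, x)}"
    have P: "?P \<subseteq> A" "x \<noteq> y" "f (x, y) + f (y, x) = 0" using less.prems(2)[OF xy] xy by auto
    have card: "card (A - ?P) < card A" using xy less.prems(1) by (intro psubset_card_mono) auto
    have alt: "(v, u) \<in> A - ?P \<and> u \<noteq> v \<and> f (u, v) + f (v, u) = 0" if "(u, v) \<in> A - ?P" for u v
      using less.prems(2)[of u v] that by auto
    have "sum f (A - ?P) = 0" using card finite_Diff[OF less.prems(1)] alt by (rule less.hyps)
    moreover have "sum f ?P = 0" using P by simp
    ultimately show ?thesis using sum.subset_diff[OF P(1) less.prems(1), of f] by simp
  qed simp
qed

text \<open>The map from \<open>D_1\<close> to \<open>D_0\<close> is an inclusion, so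
  \<open>E\<close> is a subset of the type carrying \<open>D_0\<close>. The assumption
  \<open>a1_eq_a0\<close> is the equivariance of this inclusion under the elements fixing both base
  simplices.\<close>

locale diagram =
  A0: coset_action F sd "stab (\<sigma>0 F)" UNIV a0 + A1: coset_action F sd "stab (\<sigma>1 F)" E a1
  for F :: "('f::field, 'q::{field, finite}) valued_field"
    and sd :: "'k::field \<Rightarrow> 'd::ab_group_add \<Rightarrow> 'd"
    and a0 E a1 +
  assumes a1_eq_a0: "g \<in> stab (\<sigma>0 F) \<Longrightarrow> g \<in> stab (\<sigma>1 F) \<Longrightarrow> d \<in> E \<Longrightarrow> a1 g d = a0 g d"
begin

abbreviation "x0 \<equiv> vertex0 F"
abbreviation "x1 \<equiv> vertex1 F"
abbreviation "S0 \<equiv> stab (\<sigma>0 F)"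
abbreviation "S1 \<equiv> stab (\<sigma>1 F)"
abbreviation "V \<equiv> diagram_system F a0 E a1"
abbreviation "t0 \<equiv> coset_fun S0 a0"
abbreviation "t1 \<equiv> coset_fun S1 a1"
abbreviation "Pm \<equiv> Pi_mat F"

lemmas stab0_iff = A0.stab0_iff and stab1_iff = A0.stab1_iff
  and adj_iff = A0.adj_iff and vertices_eq = A0.vertices_eq
  and x0_neq_x1 = A0.vertex0_neq_vertex1

lemma Pi_moves [simp]: "move Pm x0 = x1" "move Pm x1 = x0"
  by (simp_all add: A0.vertex1_eq flip: A0.vertex1_eq A0.move_Pi_vertex1)
    (metis A0.move_Pi_vertex1 A0.vertex1_eq)

lemma Pi_S1: "Pm \<in> S1" "matrix_inv Pm \<in> S1"
  using A1.S_inv by (auto simp: stab1_iff)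

lemma move_x0_E:
  assumes "g \<in> carrier GL2" "h \<in> carrier GL2" "move g x0 = move h x0"
  obtains \<kappa> where "\<kappa> \<in> S0" "h = g ** \<kappa>"
proof
  show "matrix_inv g ** h \<in> S0" using assms by (simp add: stab0_iff move_mult flip: assms(3))
qed (use assms in simp)

lemma move_pair_E:
  assumes "g \<in> carrier GL2" "h \<in> carrier GL2" "{move g x0, move g x1} = {move h x0, move h x1}"
  obtains \<kappa> where "\<kappa> \<in> S1" "h = g ** \<kappa>"
proof
  have "move h x0 = move g x0 \<and> move h x1 = move g x1 \<or> move h x0 = move g x1 \<and> move h x1 = move g x0"
    using assms(3) by (auto simp: doubleton_eq_iff)
  then show "matrix_inv g ** h \<in> S1" using assms(1,2) by (auto simp: stab1_iff move_mult)
qed (use assms in simp)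

text \<open>The definition of the stalk allows every matrix carrying the base vertex to the given
  one. Two such matrices differ by an element of the stabiliser, which can be moved onto the
  vector.\<close>

lemma stalk_vertex:
  assumes g: "g \<in> carrier GL2" shows "stalk V {move g x0} = range (t0 g)"
proof (intro Set.set_eqI iffI)
  fix f assume "f \<in> stalk V {move g x0}"
  then obtain h where h: "h \<in> carrier GL2" and
    "{move g x0} = move h ` \<sigma>0 F \<and> f \<in> c_Ind F S0 UNIV a0 \<and>
      {x. f x \<noteq> 0} \<subseteq> {\<kappa> ** matrix_inv h | \<kappa>. \<kappa> \<in> S0} \<or> {move g x0} = move h ` \<sigma>1 F"
    by (auto simp: diagram_system_def)
  moreover have "{move g x0} \<noteq> move h ` \<sigma>1 F"
  proof
    assume "{move g x0} = move h ` \<sigma>1 F"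
    then have "move h x0 = move h x1" by (auto simp: \<sigma>1_def doubleton_eq_iff)
    with h x0_neq_x1 show False by (simp add: move_inj)
  qed
  ultimately have e: "move g x0 = move h x0" and "f \<in> c_Ind F S0 UNIV a0 \<and>
      {x. f x \<noteq> 0} \<subseteq> {\<kappa> ** matrix_inv h | \<kappa>. \<kappa> \<in> S0}" by (auto simp: \<sigma>0_def)
  then have "f \<in> t0 h ` UNIV" using A0.c_Ind_one_coset[OF h] by simp
  moreover obtain \<kappa> where "\<kappa> \<in> S0" "h = g ** \<kappa>" using move_x0_E[OF g h e] .
  ultimately show "f \<in> range (t0 g)" by (auto simp: A0.coset_fun_mult)
next
  fix f assume "f \<in> range (t0 g)"
  then have "f \<in> c_Ind F S0 UNIV a0 \<and> {x. f x \<noteq> 0} \<subseteq> {\<kappa> ** matrix_inv g | \<kappa>. \<kappa> \<in> S0}"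
    using A0.c_Ind_one_coset[OF g] by blast
  then show "f \<in> stalk V {move g x0}" using g
    by (simp add: diagram_system_def) (auto simp: \<sigma>0_def)
qed

lemma stalk_edge:
  assumes g: "g \<in> carrier GL2" shows "stalk V {move g x0, move g x1} = t1 g ` E"
proof (intro Set.set_eqI iffI)
  fix f assume "f \<in> stalk V {move g x0, move g x1}"
  then obtain h where h: "h \<in> carrier GL2" and
    "{move g x0, move g x1} = move h ` \<sigma>1 F \<and> f \<in> c_Ind F S1 E a1 \<and>
      {x. f x \<noteq> 0} \<subseteq> {\<kappa> ** matrix_inv h | \<kappa>. \<kappa> \<in> S1} \<or> {move g x0, move g x1} = move h ` \<sigma>0 F"
    by (auto simp: diagram_system_def)
  moreover have "{move g x0, move g x1} \<noteq> move h ` \<sigma>0 F"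
  proof
    assume "{move g x0, move g x1} = move h ` \<sigma>0 F"
    then have "move g x0 = move g x1" by (auto simp: \<sigma>0_def doubleton_eq_iff)
    with g x0_neq_x1 show False by (simp add: move_inj)
  qed
  ultimately have e: "{move g x0, move g x1} = {move h x0, move h x1}" and "f \<in> c_Ind F S1 E a1 \<and>
      {x. f x \<noteq> 0} \<subseteq> {\<kappa> ** matrix_inv h | \<kappa>. \<kappa> \<in> S1}" by (auto simp: \<sigma>1_def)
  then have "f \<in> t1 h ` E" using A1.c_Ind_one_coset[OF h] by simp
  moreover obtain \<kappa> where "\<kappa> \<in> S1" "h = g ** \<kappa>" using move_pair_E[OF g h e] .
  ultimately show "f \<in> t1 g ` E" by (auto simp: A1.coset_fun_mult A1.act_closed)
next
  fix f assume "f \<in> t1 g ` E"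
  then have "f \<in> c_Ind F S1 E a1 \<and> {x. f x \<noteq> 0} \<subseteq> {\<kappa> ** matrix_inv g | \<kappa>. \<kappa> \<in> S1}"
    using A1.c_Ind_one_coset[OF g] by blast
  then show "f \<in> stalk V {move g x0, move g x1}" using g
    by (simp add: diagram_system_def) (auto simp: \<sigma>1_def)
qed

text \<open>The restriction map is defined through a chosen matrix \<open>h\<close>. It differs from
  \<open>g\<close> by an element \<open>\<kappa>\<close> of both stabilisers, on which
  \<open>a0\<close> and \<open>a1\<close> agree, so the choice does not matter and the translate of
  \<open>d\<close> by \<open>g\<close> restricts to the translate of \<open>d\<close> by
  \<open>g\<close>.\<close>

lemma restr_edge:
  assumes g: "g \<in> carrier GL2" and d: "d \<in> E"
  shows "restr V {move g x0, move g x1} {move g x0} (t1 g d) = t0 g d"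
proof -
  have ne: "{move g x0, move g x1} \<noteq> {move g x0}"
    using g x0_neq_x1 by (auto simp: doubleton_eq_iff move_inj)
  define h where "h = (SOME h. h \<in> carrier GL2 \<and> {move g x0, move g x1} = move h ` \<sigma>1 F \<and>
      {move g x0} = move h ` \<sigma>0 F)"
  have "\<exists>h. h \<in> carrier GL2 \<and> {move g x0, move g x1} = move h ` \<sigma>1 F \<and> {move g x0} = move h ` \<sigma>0 F"
    using g by (intro exI[of _ g]) (simp add: \<sigma>0_def \<sigma>1_def)
  then have h: "h \<in> carrier GL2" "{move g x0, move g x1} = {move h x0, move h x1}" "move g x0 = move h x0"
    unfolding h_def by (auto dest!: someI_ex simp: \<sigma>0_def \<sigma>1_def)
  obtain \<kappa> where k: "\<kappa> \<in> S0" "h = g ** \<kappa>" using move_x0_E[OF g h(1,3)] .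
  obtain \<kappa>' where "\<kappa>' \<in> S1" "h = g ** \<kappa>'" using move_pair_E[OF g h(1,2)] .
  then have k1: "\<kappa> \<in> S1" using k g by (metis GL2_cancel(1))
  define d' where "d' = a1 (matrix_inv \<kappa>) d"
  have d': "d' \<in> E" "a1 \<kappa> d' = d"
    using k1 d A1.S_inv A1.act_closed A1.act_one
    by (simp_all add: d'_def flip: A1.act_mult) (simp add: A1.S_GL2 A1.act_one)
  have "t1 g d = t1 h d'" using k k1 d' by (simp add: A1.coset_fun_mult)
  then have "restr V {move g x0, move g x1} {move g x0} (t1 g d) = t0 h d'"
    using ne by (simp add: diagram_system_def Let_def A1.coset_fun_inv[OF h(1) d'(1)] coset_fun_def[of S0]
        cong: if_cong flip: h_def)
  also have "\<dots> = t0 g d" using k k1 d' a1_eq_a0[of \<kappa> d'] by (simp add: A0.coset_fun_mult)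
  finally show ?thesis .
qed

lemma adjE:
  assumes "adj F x y"
  obtains g where "g \<in> carrier GL2" "x = move g x0" "y = move g x1"
  using assms adj_iff by blast

lemma adj_sym: "adj F x y \<Longrightarrow> adj F y x"
proof -
  assume "adj F x y"
  then obtain g where "g \<in> carrier GL2" "x = move g x0" "y = move g x1" by (rule adjE)
  then show "adj F y x" unfolding adj_iff
    by (intro bexI[of _ "g ** Pm"]) (simp_all add: move_mult A0.Pi_GL2)
qed

lemma adj_neq: "adj F x y \<Longrightarrow> x \<noteq> y"
  using x0_neq_x1 by (auto elim!: adjE simp: move_inj)

lemma adj_vertices: "adj F x y \<Longrightarrow> x \<in> vertices F"
  by (auto elim!: adjE simp: vertices_eq)

lemma adj_move: "g \<in> carrier GL2 \<Longrightarrow> adj F (move g x) (move g y) \<longleftrightarrow> adj F x y"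
proof -
  have imp: "adj F (move g x) (move g y)" if "g \<in> carrier GL2" "adj F x y" for g x y
    using that(2) that(1) by (elim adjE) (auto simp: adj_iff simp flip: move_mult intro: GL2_mult)
  assume "g \<in> carrier GL2"
  then show ?thesis using imp[of g x y] imp[of "matrix_inv g" "move g x" "move g y"] by auto
qed

lemma restr_props:
  assumes xy: "adj F x y" and f: "f \<in> stalk V {x, y}"
  shows "restr V {x, y} {x} f \<in> stalk V {x}"
    and "f' \<in> stalk V {x, y} \<Longrightarrow> restr V {x, y} {x} (f + f') = restr V {x, y} {x} f + restr V {x, y} {x} f'"
    and "restr V {x, y} {x} (fun_scale sd c f) = fun_scale sd c (restr V {x, y} {x} f)"
    and "h \<in> carrier GL2 \<Longrightarrow>
      restr V {move h x, move h y} {move h x} (rtrans h f) = rtrans h (restr V {x, y} {x} f)"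
    and "h \<in> carrier GL2 \<Longrightarrow> rtrans h f \<in> stalk V {move h x, move h y}"
    and "f' \<in> stalk V {x, y} \<Longrightarrow> f + f' \<in> stalk V {x, y}"
    and "fun_scale sd c f \<in> stalk V {x, y}"
proof -
  obtain g where g: "g \<in> carrier GL2" "x = move g x0" "y = move g x1" using xy by (rule adjE)
  note s = stalk_edge[OF g(1), folded g(2,3)] and r = restr_edge[OF g(1), folded g(2,3)]
  obtain d where d: "d \<in> E" "f = t1 g d" using f s by auto
  show "restr V {x, y} {x} f \<in> stalk V {x}" using d r stalk_vertex[OF g(1)] g by simp
  show "fun_scale sd c f \<in> stalk V {x, y}"
    using d by (simp add: s A1.D_scale flip: A1.coset_fun_scale)
  show "restr V {x, y} {x} (fun_scale sd c f) = fun_scale sd c (restr V {x, y} {x} f)"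
    using d r by (simp add: A1.D_scale A0.coset_fun_scale flip: A1.coset_fun_scale)
  show "f + f' \<in> stalk V {x, y}" if "f' \<in> stalk V {x, y}"
    using d that by (auto simp: s A1.D_add simp flip: A1.coset_fun_add)
  show "restr V {x, y} {x} (f + f') = restr V {x, y} {x} f + restr V {x, y} {x} f'"
    if "f' \<in> stalk V {x, y}"
    using d that r by (auto simp: s A1.D_add A0.coset_fun_add simp flip: A1.coset_fun_add)
  assume h: "h \<in> carrier GL2"
  show "restr V {move h x, move h y} {move h x} (rtrans h f) = rtrans h (restr V {x, y} {x} f)"
    using restr_edge[of "h ** g" d] g h d r by (simp add: rtrans_coset_fun move_mult)
  show "rtrans h f \<in> stalk V {move h x, move h y}"
    using stalk_edge[of "h ** g"] g h d by (simp add: rtrans_coset_fun move_mult)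
qed

lemma stalk_vertex_props:
  assumes x: "x \<in> vertices F"
  shows "0 \<in> stalk V {x}"
    and "f \<in> stalk V {x} \<Longrightarrow> f' \<in> stalk V {x} \<Longrightarrow> f + f' \<in> stalk V {x}"
    and "f \<in> stalk V {x} \<Longrightarrow> fun_scale sd c f \<in> stalk V {x}"
    and "f \<in> stalk V {x} \<Longrightarrow> h \<in> carrier GL2 \<Longrightarrow> rtrans h f \<in> stalk V {move h x}"
proof -
  obtain g where g: "g \<in> carrier GL2" "x = move g x0" using x by (auto simp: vertices_eq)
  note s = stalk_vertex[OF g(1), folded g(2)]
  show "0 \<in> stalk V {x}" unfolding s by (rule range_eqI[of _ _ 0]) (simp add: A0.coset_fun_zero)
  show "f + f' \<in> stalk V {x}" if "f \<in> stalk V {x}" "f' \<in> stalk V {x}"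
    using that unfolding s by (auto simp flip: A0.coset_fun_add)
  show "fun_scale sd c f \<in> stalk V {x}" if "f \<in> stalk V {x}"
    using that unfolding s by (auto simp flip: A0.coset_fun_scale)
  show "rtrans h f \<in> stalk V {move h x}" if "f \<in> stalk V {x}" "h \<in> carrier GL2"
    using that stalk_vertex[of "h ** g"] g unfolding s by (auto simp: rtrans_coset_fun move_mult)
qed

lemma stalk_edge_0: "adj F x y \<Longrightarrow> 0 \<in> stalk V {x, y}"
  by (elim adjE) (use A1.D_0 in \<open>auto simp: stalk_edge A1.coset_fun_zero intro!: image_eqI[of _ _ 0]\<close>)

lemma restr_0: "adj F x y \<Longrightarrow> restr V {x, y} {x} 0 = 0"
  using restr_props(2)[OF _ stalk_edge_0 stalk_edge_0] by fastforce

section \<open>Chains, the boundary map and the group action on them\<close>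

abbreviation "C0 \<equiv> chains0 F V"
abbreviation "C1 \<equiv> chains1 F V"
abbreviation "bd \<equiv> boundary F V"
abbreviation "cscale \<equiv> fun_scale (fun_scale sd)"

definition chain_act :: "'f^2^2 \<Rightarrow> ('f vertex \<Rightarrow> 'f^2^2 \<Rightarrow> 'd) \<Rightarrow> 'f vertex \<Rightarrow> 'f^2^2 \<Rightarrow> 'd" where
  "chain_act g \<omega> = (\<lambda>x. rtrans g (\<omega> (move (matrix_inv g) x)))"

definition chain1_act :: "'f^2^2 \<Rightarrow> ('f vertex \<times> 'f vertex \<Rightarrow> 'f^2^2 \<Rightarrow> 'd) \<Rightarrow>
    'f vertex \<times> 'f vertex \<Rightarrow> 'f^2^2 \<Rightarrow> 'd" where
  "chain1_act g \<omega> = (\<lambda>(x, y). rtrans g (\<omega> (move (matrix_inv g) x, move (matrix_inv g) y)))"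

lemma H0_eq: "H0 F (fun_scale sd) V = quot_rep (rep_on C0 cscale chain_act) (bd ` C1)"
proof -
  have "cact V = (\<lambda>g \<sigma>. rtrans g)" by (simp add: diagram_system_def)
  then show ?thesis by (simp add: H0_def chain_act_def[abs_def])
qed

lemma C0_iff: "\<omega> \<in> C0 \<longleftrightarrow> (\<forall>x\<in>vertices F. \<omega> x \<in> stalk V {x}) \<and>
    (\<forall>x. x \<notin> vertices F \<longrightarrow> \<omega> x = 0) \<and> finite {x. \<omega> x \<noteq> 0}"
  by (simp add: chains0_def)

lemma C1_iff: "\<omega> \<in> C1 \<longleftrightarrow> (\<forall>x y. adj F x y \<longrightarrow> \<omega> (x, y) \<in> stalk V {x, y}) \<and>
    (\<forall>x y. \<not> adj F x y \<longrightarrow> \<omega> (x, y) = 0) \<and> (\<forall>x y. \<omega> (y, x) = - \<omega> (x, y)) \<and>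
    finite {e. \<omega> e \<noteq> 0}"
  by (simp add: chains1_def)

lemma C1D:
  assumes "\<omega> \<in> C1"
  shows "adj F x y \<Longrightarrow> \<omega> (x, y) \<in> stalk V {x, y}" "\<not> adj F x y \<Longrightarrow> \<omega> (x, y) = 0"
    "\<omega> (y, x) = - \<omega> (x, y)" "finite {e. \<omega> e \<noteq> 0}"
  using assms unfolding C1_iff by blast+

lemma C1I:
  assumes "\<And>x y. adj F x y \<Longrightarrow> \<omega> (x, y) \<in> stalk V {x, y}" "\<And>x y. \<not> adj F x y \<Longrightarrow> \<omega> (x, y) = 0"
    "\<And>x y. \<omega> (y, x) = - \<omega> (x, y)" "finite {e. \<omega> e \<noteq> 0}"
  shows "\<omega> \<in> C1"
  unfolding C1_iff using assms by blast

lemma finite_nbrs: "\<omega> \<in> C1 \<Longrightarrow> finite {y. \<omega> (x, y) \<noteq> 0}"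
proof -
  assume "\<omega> \<in> C1"
  then have "finite (snd ` {e. \<omega> e \<noteq> 0})" using C1D(4) by blast
  then show ?thesis by (rule finite_subset[rotated]) force
qed

text \<open>The index set in \<open>boundary\<close> varies with the chain. Linearity needs one
  finite set that serves several chains; the additional terms are restrictions of 0.\<close>

lemma bd_sum:
  assumes "finite A" "A \<subseteq> {y. adj F x y}" "{y. adj F x y \<and> \<omega> (x, y) \<noteq> 0} \<subseteq> A"
  shows "bd \<omega> x = (\<Sum>y\<in>A. restr V {x, y} {x} (\<omega> (x, y)))"
  unfolding boundary_def using assms by (intro sum.mono_neutral_left) (auto simp: restr_0)

lemma fun_scale_0 [simp]: "fun_scale sd c 0 = (0 :: 'x \<Rightarrow> 'd)"
  by (simp add: fun_scale_def fun_eq_iff)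

lemma fun_scale_minus: "fun_scale sd c (- f) = - fun_scale sd c f" for f :: "'x \<Rightarrow> 'd"
  by (simp add: fun_scale_def fun_eq_iff)

lemma cscale_apply: "cscale c \<omega> x = fun_scale sd c (\<omega> x)"
  by (simp add: fun_scale_def)

lemma C1_add: "\<omega> \<in> C1 \<Longrightarrow> \<omega>' \<in> C1 \<Longrightarrow> \<omega> + \<omega>' \<in> C1"
proof (rule C1I)
  assume w: "\<omega> \<in> C1" "\<omega>' \<in> C1"
  show "finite {e. (\<omega> + \<omega>') e \<noteq> 0}"
    by (rule finite_subset[of _ "{e. \<omega> e \<noteq> 0} \<union> {e. \<omega>' e \<noteq> 0}"])
      (use C1D(4)[OF w(1)] C1D(4)[OF w(2)] in auto)
  show "(\<omega> + \<omega>') (y, x) = - (\<omega> + \<omega>') (x, y)" for x y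
    using C1D(3)[OF w(1), of y x] C1D(3)[OF w(2), of y x] by simp
  show "(\<omega> + \<omega>') (x, y) = 0" if "\<not> adj F x y" for x y
    using C1D(2)[OF w(1) that] C1D(2)[OF w(2) that] by simp
qed (simp_all add: C1D(1) restr_props(6))

lemma C1_scale: "\<omega> \<in> C1 \<Longrightarrow> cscale c \<omega> \<in> C1"
proof (rule C1I)
  assume w: "\<omega> \<in> C1"
  show "finite {e. cscale c \<omega> e \<noteq> 0}"
    by (rule finite_subset[OF _ C1D(4)[OF w]]) (auto simp: cscale_apply)
  show "cscale c \<omega> (y, x) = - cscale c \<omega> (x, y)" for x y
    using C1D(3)[OF w, of y x] by (simp add: cscale_apply fun_scale_minus)
  show "cscale c \<omega> (x, y) = 0" if "\<not> adj F x y" for x y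
    using C1D(2)[OF w that] by (simp add: cscale_apply)
qed (simp_all add: C1D(1) restr_props(7) cscale_apply)

lemma bd_add: "\<omega> \<in> C1 \<Longrightarrow> \<omega>' \<in> C1 \<Longrightarrow> bd (\<omega> + \<omega>') = bd \<omega> + bd \<omega>'"
proof
  fix x assume w: "\<omega> \<in> C1" "\<omega>' \<in> C1"
  let ?A = "{y. adj F x y} \<inter> ({y. \<omega> (x, y) \<noteq> 0} \<union> {y. \<omega>' (x, y) \<noteq> 0})"
  have "finite ?A" using w finite_nbrs by simp
  then have "bd \<omega>'' x = (\<Sum>y\<in>?A. restr V {x, y} {x} (\<omega>'' (x, y)))"
    if "\<omega>'' \<in> {\<omega>, \<omega>', \<omega> + \<omega>'}" for \<omega>'' using that by (intro bd_sum) auto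
  moreover have "restr V {x, y} {x} ((\<omega> + \<omega>') (x, y)) =
      restr V {x, y} {x} (\<omega> (x, y)) + restr V {x, y} {x} (\<omega>' (x, y))" if "y \<in> ?A" for y
    using that w restr_props(2) by (simp add: C1D(1))
  ultimately show "bd (\<omega> + \<omega>') x = (bd \<omega> + bd \<omega>') x" by (simp add: sum.distrib)
qed

lemma sum_fun_scale: "fun_scale sd c (sum f A) = (\<Sum>x\<in>A. fun_scale sd c (f x))"
  by (induction A rule: infinite_finite_induct) (auto simp: fun_scale_def fun_eq_iff A0.scale_right_distrib)

lemma bd_scale: "\<omega> \<in> C1 \<Longrightarrow> bd (cscale c \<omega>) = cscale c (bd \<omega>)"
proof
  fix x assume w: "\<omega> \<in> C1"
  let ?A = "{y. adj F x y} \<inter> {y. \<omega> (x, y) \<noteq> 0}"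
  have "finite ?A" using w finite_nbrs by simp
  then have "bd \<omega>'' x = (\<Sum>y\<in>?A. restr V {x, y} {x} (\<omega>'' (x, y)))"
    if "\<omega>'' \<in> {\<omega>, cscale c \<omega>}" for \<omega>''
    using that by (intro bd_sum) (auto simp: cscale_apply)
  moreover have "restr V {x, y} {x} (cscale c \<omega> (x, y)) =
      fun_scale sd c (restr V {x, y} {x} (\<omega> (x, y)))" if "y \<in> ?A" for y
    using that w restr_props(3) by (simp add: C1D(1) cscale_apply)
  ultimately show "bd (cscale c \<omega>) x = cscale c (bd \<omega>) x"
    by (simp add: cscale_apply sum_fun_scale)
qed

lemma rtrans_rtrans: "rtrans g (rtrans h f) = rtrans (g ** h) f"
  by (simp add: rtrans_def matrix_mul_assoc)

lemma rtrans_simps [simp]: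
  "rtrans (mat 1) f = f" "rtrans g 0 = 0" "rtrans g (f + f') = rtrans g f + rtrans g f'"
  "rtrans g (- f) = - rtrans g f" "rtrans g (fun_scale s c f) = fun_scale s c (rtrans g f)"
  for f :: "'f^2^2 \<Rightarrow> 'd"
  by (simp_all add: rtrans_def fun_eq_iff fun_scale_def)

lemma rtrans_sum: "rtrans g (sum f A) = (\<Sum>x\<in>A. rtrans g (f x))" for f :: "_ \<Rightarrow> 'f^2^2 \<Rightarrow> 'd"
proof (induction A rule: infinite_finite_induct)
  case (insert x A)
  then show ?case by (simp only: sum.insert rtrans_simps not_False_eq_True)
qed (simp_all only: sum.infinite sum.empty rtrans_simps not_False_eq_True)

lemma rtrans_eq_0 [simp]: "g \<in> carrier GL2 \<Longrightarrow> rtrans g f = 0 \<longleftrightarrow> f = 0" for f :: "'f^2^2 \<Rightarrow> 'd"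
  using rtrans_rtrans[of "matrix_inv g" g f] by auto

lemma finite_vimage_move: "g \<in> carrier GL2 \<Longrightarrow> finite {x. P x} \<Longrightarrow> finite {x. P (move g x)}"
  using finite_vimageI[of "{x. P x}" "move g"] by (simp add: inj_def move_inj vimage_def)

lemma C1_act: "g \<in> carrier GL2 \<Longrightarrow> \<omega> \<in> C1 \<Longrightarrow> chain1_act g \<omega> \<in> C1"
proof -
  assume g: "g \<in> carrier GL2" and w: "\<omega> \<in> C1"
  let ?i = "matrix_inv g"
  have i: "?i \<in> carrier GL2" using g by simp
  have "{e. chain1_act g \<omega> e \<noteq> 0} = (\<lambda>(x, y). (move ?i x, move ?i y)) -` {e. \<omega> e \<noteq> 0}"
    using g by (auto simp: chain1_act_def)
  moreover have "inj (\<lambda>(x, y). (move ?i x, move ?i y))"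
    using i by (auto simp: inj_def move_inj)
  ultimately have "finite {e. chain1_act g \<omega> e \<noteq> 0}"
    using finite_vimageI[OF C1D(4)[OF w]] by metis
  moreover have "chain1_act g \<omega> (x, y) \<in> stalk V {x, y}" if "adj F x y" for x y
    using restr_props(5)[of "move ?i x" "move ?i y" "\<omega> (move ?i x, move ?i y)" g] C1D(1)[OF w] i g that
    by (simp add: chain1_act_def adj_move)
  moreover have "chain1_act g \<omega> (x, y) = 0" if "\<not> adj F x y" for x y
    using C1D(2)[OF w] that i by (simp add: chain1_act_def adj_move)
  moreover have "chain1_act g \<omega> (y, x) = - chain1_act g \<omega> (x, y)" for x y
    using C1D(3)[OF w, of "move ?i y" "move ?i x"] by (simp add: chain1_act_def)
  ultimately show ?thesis by (intro C1I)
qed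

lemma bd_act: "g \<in> carrier GL2 \<Longrightarrow> \<omega> \<in> C1 \<Longrightarrow> bd (chain1_act g \<omega>) = chain_act g (bd \<omega>)"
proof
  fix x assume g: "g \<in> carrier GL2" and w: "\<omega> \<in> C1"
  let ?i = "matrix_inv g"
  have i: "?i \<in> carrier GL2" using g by simp
  let ?A = "{y. adj F (move ?i x) y \<and> \<omega> (move ?i x, y) \<noteq> 0}"
  have "finite ?A" using finite_nbrs[OF w] by simp
  then have "bd (chain1_act g \<omega>) x =
      (\<Sum>y\<in>move g ` ?A. restr V {x, y} {x} (chain1_act g \<omega> (x, y)))"
  proof (intro bd_sum subsetI)
    fix y assume "y \<in> {y. adj F x y \<and> chain1_act g \<omega> (x, y) \<noteq> 0}"
    then show "y \<in> move g ` ?A" using g i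
      by (intro image_eqI[of _ _ "move ?i y"]) (auto simp: adj_move chain1_act_def)
  next
    fix y assume "y \<in> move g ` ?A"
    then obtain z where "y = move g z" "adj F (move ?i x) z" by auto
    then show "y \<in> {y. adj F x y}" using adj_move[OF g, of "move ?i x" z] g by simp
  qed simp
  also have "\<dots> = (\<Sum>y\<in>?A. restr V {x, move g y} {x} (chain1_act g \<omega> (x, move g y)))"
    by (rule sum.reindex[unfolded o_def]) (use g in \<open>auto simp: inj_on_def move_inj\<close>)
  also have "\<dots> = (\<Sum>y\<in>?A. rtrans g (restr V {move ?i x, y} {move ?i x} (\<omega> (move ?i x, y))))"
  proof (rule sum.cong)
    fix y assume "y \<in> ?A"
    then show "restr V {x, move g y} {x} (chain1_act g \<omega> (x, move g y)) =
        rtrans g (restr V {move ?i x, y} {move ?i x} (\<omega> (move ?i x, y)))"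
      using restr_props(4)[of "move ?i x" y "\<omega> (move ?i x, y)" g] C1D(1)[OF w] g
      by (simp add: chain1_act_def)
  qed simp
  also have "\<dots> = chain_act g (bd \<omega>) x"
    by (simp add: chain_act_def boundary_def rtrans_sum)
  finally show "bd (chain1_act g \<omega>) x = chain_act g (bd \<omega>) x" .
qed

lemma C0_sum_stalk: "x \<in> vertices F \<Longrightarrow> (\<And>y. y \<in> A \<Longrightarrow> f y \<in> stalk V {x}) \<Longrightarrow> sum f A \<in> stalk V {x}"
  by (induction A rule: infinite_finite_induct) (simp_all add: stalk_vertex_props)

lemma bd_C0: "\<omega> \<in> C1 \<Longrightarrow> bd \<omega> \<in> C0"
proof -
  assume w: "\<omega> \<in> C1"
  have "bd \<omega> x \<in> stalk V {x}" if "x \<in> vertices F" for x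
    unfolding boundary_def by (intro C0_sum_stalk that) (auto simp: C1D(1)[OF w] restr_props(1))
  moreover have "bd \<omega> x = 0" if "x \<notin> vertices F" for x
    unfolding boundary_def using that adj_vertices by (intro sum.neutral) auto
  moreover have "finite {x. bd \<omega> x \<noteq> 0}"
  proof (rule finite_subset)
    show "{x. bd \<omega> x \<noteq> 0} \<subseteq> fst ` {e. \<omega> e \<noteq> 0}"
    proof
      fix x assume "x \<in> {x. bd \<omega> x \<noteq> 0}"
      then have "{y. adj F x y \<and> \<omega> (x, y) \<noteq> 0} \<noteq> {}" unfolding boundary_def by (metis (mono_tags, lifting) mem_Collect_eq sum.empty)
      then show "x \<in> fst ` {e. \<omega> e \<noteq> 0}" by force
    qed
  qed (use C1D(4)[OF w] in simp)
  ultimately show ?thesis unfolding C0_iff by blast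
qed

lemma C0_add: "\<omega> \<in> C0 \<Longrightarrow> \<omega>' \<in> C0 \<Longrightarrow> \<omega> + \<omega>' \<in> C0"
proof -
  assume w: "\<omega> \<in> C0" "\<omega>' \<in> C0"
  have "finite {e. (\<omega> + \<omega>') e \<noteq> 0}"
    by (rule finite_subset[of _ "{e. \<omega> e \<noteq> 0} \<union> {e. \<omega>' e \<noteq> 0}"]) (use w in \<open>auto simp: C0_iff\<close>)
  then show ?thesis using w stalk_vertex_props(2) unfolding C0_iff by simp
qed

lemma C0_scale: "\<omega> \<in> C0 \<Longrightarrow> cscale c \<omega> \<in> C0"
proof -
  assume w: "\<omega> \<in> C0"
  have "finite {x. cscale c \<omega> x \<noteq> 0}"
    by (rule finite_subset[of _ "{x. \<omega> x \<noteq> 0}"]) (use w in \<open>auto simp: C0_iff cscale_apply\<close>)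
  then show ?thesis using w stalk_vertex_props(3) unfolding C0_iff cscale_apply by simp
qed

lemma C0_act: "g \<in> carrier GL2 \<Longrightarrow> \<omega> \<in> C0 \<Longrightarrow> chain_act g \<omega> \<in> C0"
proof -
  assume g: "g \<in> carrier GL2" and w: "\<omega> \<in> C0"
  let ?i = "matrix_inv g"
  have i: "?i \<in> carrier GL2" using g by simp
  have v: "move ?i x \<in> vertices F \<longleftrightarrow> x \<in> vertices F" for x
    using A0.move_vertices[OF i, of x] A0.move_vertices[OF g, of "move ?i x"] g by auto
  have "finite {x. chain_act g \<omega> x \<noteq> 0}"
    using w g finite_vimage_move[OF i, of "\<lambda>x. \<omega> x \<noteq> 0"] by (simp add: chain_act_def C0_iff)
  moreover have "chain_act g \<omega> x \<in> stalk V {x}" if "x \<in> vertices F" for x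
    using stalk_vertex_props(4)[of "move ?i x" "\<omega> (move ?i x)" g] that v w g
    by (simp add: chain_act_def C0_iff)
  moreover have "chain_act g \<omega> x = 0" if "x \<notin> vertices F" for x
    using that v w by (simp add: chain_act_def C0_iff)
  ultimately show ?thesis unfolding C0_iff by blast
qed

lemma chain_act_inv: "g \<in> carrier GL2 \<Longrightarrow> chain_act g (chain_act (matrix_inv g) \<omega>) = \<omega>"
  by (simp add: chain_act_def rtrans_rtrans)

sublocale H: stable_subspace C0 "bd ` C1" cscale chain_act "carrier GL2"
proof
  show "0 \<in> bd ` C1"
  proof (rule image_eqI[of _ _ 0])
    show "(0 :: _ \<Rightarrow> 'f^2^2 \<Rightarrow> 'd) \<in> C1" by (rule C1I) (simp_all add: stalk_edge_0)
  qed (simp add: boundary_def fun_eq_iff)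
  show "- x \<in> bd ` C1" if "x \<in> bd ` C1" for x
  proof -
    from that obtain \<omega> where w: "\<omega> \<in> C1" "x = bd \<omega>" by blast
    have "- x = cscale (-1) x" by (simp add: fun_scale_def fun_eq_iff)
    then show ?thesis using w C1_scale bd_scale by (metis image_eqI)
  qed
  show "\<exists>y\<in>bd ` C1. chain_act g y = x" if "g \<in> carrier GL2" "x \<in> bd ` C1" for g x
  proof (rule bexI)
    show "chain_act g (chain_act (matrix_inv g) x) = x" using that chain_act_inv by simp
    show "chain_act (matrix_inv g) x \<in> bd ` C1"
      using that by (auto simp: C1_act simp flip: bd_act)
  qed
  show "cscale c (x + y) = cscale c x + cscale c y" for c x y
    by (simp add: fun_scale_def fun_eq_iff A0.scale_right_distrib)
  show "chain_act g (x + y) = chain_act g x + chain_act g y" for g x y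
    by (simp add: chain_act_def fun_eq_iff rtrans_def)
qed (auto simp: C0_add C0_scale C0_act bd_C0 C1_add C1_scale C1_act simp flip: bd_add bd_scale bd_act)

end

section \<open>Chains supported on one vertex or on the base edge\<close>

context diagram
begin

definition single :: "'f vertex \<Rightarrow> ('f^2^2 \<Rightarrow> 'd) \<Rightarrow> 'f vertex \<Rightarrow> 'f^2^2 \<Rightarrow> 'd" where
  "single x f = (\<lambda>y. if y = x then f else 0)"

lemma single_C0: "x \<in> vertices F \<Longrightarrow> f \<in> stalk V {x} \<Longrightarrow> single x f \<in> C0"
proof -
  assume "x \<in> vertices F" "f \<in> stalk V {x}"
  moreover have "finite {y. single x f y \<noteq> 0}"
    by (rule finite_subset[of _ "{x}"]) (auto simp: single_def)
  ultimately show ?thesis unfolding C0_iff by (auto simp: single_def stalk_vertex_props(1))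
qed

lemma chain_act_single:
  "g \<in> carrier GL2 \<Longrightarrow> chain_act g (single x f) = single (move g x) (rtrans g f)"
  by (rule ext) (auto simp: chain_act_def single_def move_eq_iff)

lemma C0_decomp: "\<omega> \<in> C0 \<Longrightarrow> \<omega> = (\<Sum>x\<in>{x. \<omega> x \<noteq> 0}. single x (\<omega> x))"
proof
  fix y assume "\<omega> \<in> C0"
  then have fin: "finite {x. \<omega> x \<noteq> 0}" by (simp add: C0_iff)
  have "(\<Sum>x\<in>A. single x (\<omega> x)) y = (if y \<in> A then \<omega> y else 0)" if "finite A" for A
    using that by (induction A) (auto simp: single_def)
  from this[OF fin] show "\<omega> y = (\<Sum>x\<in>{x. \<omega> x \<noteq> 0}. single x (\<omega> x)) y" by simp
qed

text \<open>Chains are finite sums of chains on one vertex. The vanishing form is made for the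
  difference of two homomorphisms.\<close>

lemma C0_additive_eq_0:
  fixes k :: "('f vertex \<Rightarrow> 'f^2^2 \<Rightarrow> 'd) \<Rightarrow> 'v::ab_group_add"
  assumes add: "\<And>\<omega> \<omega>'. \<omega> \<in> C0 \<Longrightarrow> \<omega>' \<in> C0 \<Longrightarrow> k (\<omega> + \<omega>') = k \<omega> + k \<omega>'"
    and single: "\<And>x u. x \<in> vertices F \<Longrightarrow> u \<in> stalk V {x} \<Longrightarrow> k (single x u) = 0"
    and w: "\<omega> \<in> C0"
  shows "k \<omega> = 0"
proof -
  have sum: "(\<Sum>x\<in>A. single x (\<omega> x)) \<in> C0 \<and> k (\<Sum>x\<in>A. single x (\<omega> x)) = 0"
    if "finite A" "A \<subseteq> vertices F" for A
    using that
  proof (induction A)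
    case empty
    have z: "0 \<in> C0" using H.W_0 H.W_sub by blast
    have "k 0 = 0" using add[OF z z] by simp
    with z show ?case unfolding sum.empty by (rule conjI)
  next
    case (insert x A)
    have x: "x \<in> vertices F" and A: "A \<subseteq> vertices F" using insert.prems by auto
    note IH = insert.IH[OF A]
    have u: "\<omega> x \<in> stalk V {x}" using x w by (simp add: C0_iff)
    note s = single_C0[OF x u] and IH1 = IH[THEN conjunct1] and IH2 = IH[THEN conjunct2]
    have "k (single x (\<omega> x) + (\<Sum>x\<in>A. single x (\<omega> x))) = 0"
      unfolding add[OF s IH1] single[OF x u] IH2 by (rule add_0)
    with C0_add[OF s IH1] show ?case unfolding sum.insert[OF insert(1,2)] by (rule conjI)
  qed
  have "finite {x. \<omega> x \<noteq> 0}" "{x. \<omega> x \<noteq> 0} \<subseteq> vertices F" using w by (auto simp: C0_iff)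
  from sum[OF this, THEN conjunct2] show ?thesis unfolding C0_decomp[OF w, symmetric] .
qed

definition edge_chain :: "'d \<Rightarrow> 'f vertex \<times> 'f vertex \<Rightarrow> 'f^2^2 \<Rightarrow> 'd" where
  "edge_chain d = (\<lambda>e. if e = (x0, x1) then t1 (mat 1) d else if e = (x1, x0) then - t1 (mat 1) d else 0)"

lemma adj_x0_x1: "adj F x0 x1" "adj F x1 x0"
proof -
  show "adj F x0 x1" unfolding adj_iff by (rule bexI[of _ "mat 1"]) simp_all
  then show "adj F x1 x0" by (rule adj_sym)
qed

lemma t1_stalk: "d \<in> E \<Longrightarrow> t1 (mat 1) d \<in> stalk V {x0, x1}"
  using stalk_edge[of "mat 1"] by simp

lemma edge_chain_C1: "d \<in> E \<Longrightarrow> edge_chain d \<in> C1"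
proof (rule C1I)
  assume d: "d \<in> E"
  have "- t1 (mat 1) d = t1 (mat 1) (- d)" using d by (simp add: A1.coset_fun_minus)
  moreover have "- d \<in> E" using A1.D_scale[OF d, of "-1"] by simp
  ultimately have m: "- t1 (mat 1) d \<in> stalk V {x0, x1}" using t1_stalk by simp
  show "edge_chain d (x, y) \<in> stalk V {x, y}" if "adj F x y" for x y
    using stalk_edge_0[OF that] t1_stalk[OF d] m by (auto simp: edge_chain_def insert_commute)
  show "edge_chain d (x, y) = 0" if "\<not> adj F x y" for x y
    using that adj_x0_x1 by (auto simp: edge_chain_def)
  show "edge_chain d (y, x) = - edge_chain d (x, y)" for x y
    using x0_neq_x1 by (auto simp: edge_chain_def)
  show "finite {e. edge_chain d e \<noteq> 0}"
    by (rule finite_subset[of _ "{(x0, x1), (x1, x0)}"]) (auto simp: edge_chain_def)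
qed

text \<open>At the second end the value has to be written relative to the matrix \<open>Pm\<close>
  that carries \<open>x0\<close> to \<open>x1\<close>: the translate of \<open>d\<close> by the
  identity is the translate by \<open>Pm\<close> of the image of \<open>d\<close> under the inverse
  of \<open>Pm\<close>. This is the origin of the condition on \<open>Pm\<close> in
  \<open>diagram_hom\<close>.\<close>

lemma bd_edge_chain:
  assumes d: "d \<in> E"
  shows "bd (edge_chain d) = single x0 (t0 (mat 1) d) - single x1 (t0 Pm (a1 (matrix_inv Pm) d))"
proof
  fix x
  let ?d' = "a1 (matrix_inv Pm) d"
  have d': "?d' \<in> E" using d A1.act_closed Pi_S1 by simp
  have r0: "restr V {x0, x1} {x0} (t1 (mat 1) d) = t0 (mat 1) d"
    using restr_edge[of "mat 1" d] d by simp
  have "t1 (mat 1) d = t1 Pm ?d'"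
    using d Pi_S1 by (simp add: A1.coset_fun_mult[symmetric] A0.Pi_GL2)
  moreover have "- t1 Pm ?d' = t1 Pm (- ?d')" using d' by (simp add: A1.coset_fun_minus)
  moreover have "- ?d' \<in> E" using A1.D_scale[OF d', of "-1"] by simp
  ultimately have r1: "restr V {x1, x0} {x1} (- t1 (mat 1) d) = - t0 Pm ?d'"
    using restr_edge[of Pm "- ?d'"] by (simp add: A0.Pi_GL2 A0.coset_fun_minus)
  have "bd (edge_chain d) x = (\<Sum>y\<in>(if x = x0 then {x1} else if x = x1 then {x0} else {}).
      restr V {x, y} {x} (edge_chain d (x, y)))"
    using adj_x0_x1 by (intro bd_sum) (auto simp: edge_chain_def split: if_splits)
  then show "bd (edge_chain d) x = (single x0 (t0 (mat 1) d) - single x1 (t0 Pm ?d')) x"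
    using r0 r1 x0_neq_x1 by (auto simp: single_def edge_chain_def)
qed

end

section \<open>Homomorphisms from the homology to a representation\<close>

locale diagram_target = diagram F sd a0 E a1
  for F :: "('f::field, 'q::{field, finite}) valued_field"
    and sd :: "'k::field \<Rightarrow> 'd::ab_group_add \<Rightarrow> 'd" and a0 E a1 +
  fixes sc :: "'k \<Rightarrow> 'v::ab_group_add \<Rightarrow> 'v" and action :: "'f^2^2 \<Rightarrow> 'v \<Rightarrow> 'v"
  assumes pi: "group_rep GL2 sc action"
begin

lemmas rep = group_rep_GL2D[OF pi]

sublocale pi: vector_space sc by (rule rep(1))

text \<open>A homomorphism from the diagram to the representation. The last clause is equivariance
  under \<open>Pm\<close> on \<open>E\<close>, in the form in which the boundary of an edge produces
  it.\<close>

definition diagram_hom :: "('d \<Rightarrow> 'v) \<Rightarrow> bool" where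
  "diagram_hom \<psi> \<longleftrightarrow> (\<forall>d d'. \<psi> (d + d') = \<psi> d + \<psi> d') \<and> (\<forall>c d. \<psi> (sd c d) = sc c (\<psi> d)) \<and>
     (\<forall>g\<in>S0. \<forall>d. \<psi> (a0 g d) = action g (\<psi> d)) \<and>
     (\<forall>d\<in>E. \<psi> d = action Pm (\<psi> (a1 (matrix_inv Pm) d)))"

abbreviation "HomH \<equiv> Hom_rep (carrier GL2) (H0 F (fun_scale sd) V) (rep_on UNIV sc action)"

definition local_value :: "('d \<Rightarrow> 'v) \<Rightarrow> 'f vertex \<Rightarrow> ('f^2^2 \<Rightarrow> 'd) \<Rightarrow> 'v" where
  "local_value \<psi> x f = (let g = (SOME g. g \<in> carrier GL2 \<and> x = move g x0)
     in action g (\<psi> (f (matrix_inv g))))"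

definition total :: "('d \<Rightarrow> 'v) \<Rightarrow> ('f vertex \<Rightarrow> 'f^2^2 \<Rightarrow> 'd) \<Rightarrow> 'v" where
  "total \<psi> \<omega> = (\<Sum>x\<in>{x. \<omega> x \<noteq> 0}. local_value \<psi> x (\<omega> x))"

context
  fixes \<psi> assumes \<psi>: "diagram_hom \<psi>"
begin

lemma psi: "\<psi> (d + d') = \<psi> d + \<psi> d'" "\<psi> (sd c d) = sc c (\<psi> d)"
    "g \<in> S0 \<Longrightarrow> \<psi> (a0 g d) = action g (\<psi> d)"
    "d \<in> E \<Longrightarrow> action Pm (\<psi> (a1 (matrix_inv Pm) d)) = \<psi> d"
  using \<psi> unfolding diagram_hom_def by metis+

text \<open>Equivariance under the stabiliser of \<open>x0\<close> makes the value independent of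
  the matrix chosen in \<open>local_value\<close>.\<close>

lemma local_value_t0:
  assumes g: "g \<in> carrier GL2"
  shows "local_value \<psi> (move g x0) (t0 g d) = action g (\<psi> d)"
proof -
  define h where "h = (SOME h. h \<in> carrier GL2 \<and> move g x0 = move h x0)"
  have h: "h \<in> carrier GL2" "move g x0 = move h x0"
    unfolding h_def using someI[of "\<lambda>h. h \<in> carrier GL2 \<and> move g x0 = move h x0" g] g by auto
  obtain \<kappa> where k: "\<kappa> \<in> S0" "g = h ** \<kappa>" using move_x0_E[OF h(1) g h(2)[symmetric]] .
  have "local_value \<psi> (move g x0) (t0 g d) = action h (\<psi> (t0 h (a0 \<kappa> d) (matrix_inv h)))"
    unfolding local_value_def h_def[symmetric] Let_def using k by (simp add: A0.coset_fun_mult)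
  then show ?thesis using k h by (simp add: A0.coset_fun_inv psi A0.S_GL2 rep(3))
qed

lemma local_value_add:
  assumes "x \<in> vertices F" "f \<in> stalk V {x}" "f' \<in> stalk V {x}"
  shows "local_value \<psi> x (f + f') = local_value \<psi> x f + local_value \<psi> x f'"
proof -
  obtain g where g: "g \<in> carrier GL2" "x = move g x0" using assms by (auto simp: vertices_eq)
  then obtain d d' where "f = t0 g d" "f' = t0 g d'" using assms stalk_vertex by auto
  then show ?thesis using g by (simp add: local_value_t0 psi rep(4) flip: A0.coset_fun_add)
qed

lemma local_value_scale:
  assumes "x \<in> vertices F" "f \<in> stalk V {x}"
  shows "local_value \<psi> x (fun_scale sd c f) = sc c (local_value \<psi> x f)"
proof -
  obtain g where g: "g \<in> carrier GL2" "x = move g x0" using assms by (auto simp: vertices_eq)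
  then obtain d where "f = t0 g d" using assms stalk_vertex by auto
  then show ?thesis using g by (simp add: local_value_t0 psi rep(5) flip: A0.coset_fun_scale)
qed

lemma local_value_0: "x \<in> vertices F \<Longrightarrow> local_value \<psi> x 0 = 0"
  using local_value_add[OF _ stalk_vertex_props(1) stalk_vertex_props(1)] by fastforce

lemma local_value_act:
  assumes "x \<in> vertices F" "f \<in> stalk V {x}" "h \<in> carrier GL2"
  shows "local_value \<psi> (move h x) (rtrans h f) = action h (local_value \<psi> x f)"
proof -
  obtain g where g: "g \<in> carrier GL2" "x = move g x0" using assms by (auto simp: vertices_eq)
  then obtain d where "f = t0 g d" using assms stalk_vertex by auto
  then show ?thesis using g assms local_value_t0[of "h ** g" d]
    by (simp add: local_value_t0 rtrans_coset_fun move_mult rep(3))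
qed

lemma local_value_sum:
  assumes "x \<in> vertices F" "\<And>y. y \<in> A \<Longrightarrow> f y \<in> stalk V {x}"
  shows "local_value \<psi> x (sum f A) = (\<Sum>y\<in>A. local_value \<psi> x (f y))"
  using assms(2)
proof (induction A rule: infinite_finite_induct)
  case (insert y A)
  have "sum f (insert y A) = f y + sum f A" using insert by (intro sum.insert)
  then have "local_value \<psi> x (sum f (insert y A)) = local_value \<psi> x (f y + sum f A)"
    by (rule arg_cong)
  also have "\<dots> = local_value \<psi> x (f y) + local_value \<psi> x (sum f A)"
    using insert by (intro local_value_add[OF assms(1)] C0_sum_stalk[OF assms(1)]) auto
  also have "\<dots> = (\<Sum>y\<in>insert y A. local_value \<psi> x (f y))" using insert by simp
  finally show ?case .
qed (simp_all add: local_value_0[OF assms(1)])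

lemma C0_supp: "\<omega> \<in> C0 \<Longrightarrow> {x. \<omega> x \<noteq> 0} \<subseteq> vertices F" "\<omega> \<in> C0 \<Longrightarrow> finite {x. \<omega> x \<noteq> 0}"
  by (auto simp: C0_iff)

lemma total_sum:
  "finite A \<Longrightarrow> A \<subseteq> vertices F \<Longrightarrow> {x. \<omega> x \<noteq> 0} \<subseteq> A \<Longrightarrow>
    total \<psi> \<omega> = (\<Sum>x\<in>A. local_value \<psi> x (\<omega> x))"
  unfolding total_def by (intro sum.mono_neutral_left) (auto simp: local_value_0)

lemma total_add: "\<omega> \<in> C0 \<Longrightarrow> \<omega>' \<in> C0 \<Longrightarrow> total \<psi> (\<omega> + \<omega>') = total \<psi> \<omega> + total \<psi> \<omega>'"
proof -
  assume w: "\<omega> \<in> C0" "\<omega>' \<in> C0"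
  let ?A = "{x. \<omega> x \<noteq> 0} \<union> {x. \<omega>' x \<noteq> 0}"
  have A: "finite ?A" "?A \<subseteq> vertices F" using w C0_supp by auto
  then have "total \<psi> \<omega>'' = (\<Sum>x\<in>?A. local_value \<psi> x (\<omega>'' x))" if "\<omega>'' \<in> {\<omega>, \<omega>', \<omega> + \<omega>'}" for \<omega>''
    using that by (intro total_sum) auto
  moreover have "local_value \<psi> x ((\<omega> + \<omega>') x) = local_value \<psi> x (\<omega> x) + local_value \<psi> x (\<omega>' x)"
    if "x \<in> ?A" for x
  proof -
    have "x \<in> vertices F" using that A by blast
    then show ?thesis using w by (simp add: local_value_add C0_iff)
  qed
  ultimately show ?thesis by (simp add: sum.distrib)
qed

lemma total_scale: "\<omega> \<in> C0 \<Longrightarrow> total \<psi> (cscale c \<omega>) = sc c (total \<psi> \<omega>)"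
proof -
  assume w: "\<omega> \<in> C0"
  let ?A = "{x. \<omega> x \<noteq> 0}"
  have A: "finite ?A" "?A \<subseteq> vertices F" using w C0_supp by auto
  then have "total \<psi> (cscale c \<omega>) = (\<Sum>x\<in>?A. local_value \<psi> x (cscale c \<omega> x))"
    by (intro total_sum) (auto simp: cscale_apply)
  also have "\<dots> = (\<Sum>x\<in>?A. sc c (local_value \<psi> x (\<omega> x)))"
  proof (rule sum.cong)
    fix x assume "x \<in> ?A"
    then have "x \<in> vertices F" using A by blast
    then show "local_value \<psi> x (cscale c \<omega> x) = sc c (local_value \<psi> x (\<omega> x))"
      using w by (simp add: local_value_scale C0_iff cscale_apply)
  qed simp
  finally show ?thesis by (simp add: total_def pi.scale_sum_right)
qed

lemma total_act: "g \<in> carrier GL2 \<Longrightarrow> \<omega> \<in> C0 \<Longrightarrow> total \<psi> (chain_act g \<omega>) = action g (total \<psi> \<omega>)"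
proof -
  assume g: "g \<in> carrier GL2" and w: "\<omega> \<in> C0"
  have "{x. chain_act g \<omega> x \<noteq> 0} = move g ` {x. \<omega> x \<noteq> 0}"
    using g by (auto simp: chain_act_def image_iff) (metis move_inv(2))
  then have "total \<psi> (chain_act g \<omega>) = (\<Sum>x\<in>move g ` {x. \<omega> x \<noteq> 0}. local_value \<psi> x (chain_act g \<omega> x))"
    by (simp add: total_def)
  also have "\<dots> = (\<Sum>x\<in>{x. \<omega> x \<noteq> 0}. local_value \<psi> (move g x) (chain_act g \<omega> (move g x)))"
    by (rule sum.reindex[unfolded o_def]) (use g in \<open>auto simp: inj_on_def move_inj\<close>)
  also have "\<dots> = (\<Sum>x\<in>{x. \<omega> x \<noteq> 0}. action g (local_value \<psi> x (\<omega> x)))"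
  proof (rule sum.cong)
    fix x assume "x \<in> {x. \<omega> x \<noteq> 0}"
    then have "x \<in> vertices F" using w C0_supp by blast
    then show "local_value \<psi> (move g x) (chain_act g \<omega> (move g x)) = action g (local_value \<psi> x (\<omega> x))"
      using w g by (simp add: chain_act_def local_value_act C0_iff)
  qed simp
  finally show ?thesis using g by (simp add: total_def rep(9))
qed

text \<open>The total becomes a sum over oriented edges. The two orientations of the translate by
  \<open>g\<close> of the base edge contribute the image under \<open>g\<close> of
  \<open>\<psi> d\<close> and the negative of the image under \<open>g ** Pm\<close> of
  \<open>\<psi> d'\<close>; they cancel by the last clause of \<open>diagram_hom\<close>.\<close>

lemma total_bd: "\<omega> \<in> C1 \<Longrightarrow> total \<psi> (bd \<omega>) = 0"
proof -
  assume w: "\<omega> \<in> C1"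
  let ?f = "\<lambda>(x, y). local_value \<psi> x (restr V {x, y} {x} (\<omega> (x, y)))"
  let ?B = "\<lambda>x. {y. adj F x y \<and> \<omega> (x, y) \<noteq> 0}"
  let ?A = "fst ` {e. \<omega> e \<noteq> 0}"
  have adj: "adj F x y" if "\<omega> (x, y) \<noteq> 0" for x y using C1D(2)[OF w] that by blast
  have vert: "?A \<subseteq> vertices F"
  proof
    fix x assume "x \<in> ?A"
    then obtain y where "\<omega> (x, y) \<noteq> 0" by auto
    then show "x \<in> vertices F" using adj adj_vertices by blast
  qed
  have fin: "finite ?A" "\<And>x. finite (?B x)" using C1D(4)[OF w] finite_nbrs[OF w] by auto
  have "{x. bd \<omega> x \<noteq> 0} \<subseteq> ?A"
  proof
    fix x assume "x \<in> {x. bd \<omega> x \<noteq> 0}"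
    then have "?B x \<noteq> {}" unfolding boundary_def by (metis (mono_tags, lifting) mem_Collect_eq sum.empty)
    then show "x \<in> ?A" by force
  qed
  then have "total \<psi> (bd \<omega>) = (\<Sum>x\<in>?A. local_value \<psi> x (bd \<omega> x))" using fin vert by (intro total_sum)
  also have "\<dots> = (\<Sum>x\<in>?A. \<Sum>y\<in>?B x. ?f (x, y))"
    unfolding boundary_def using vert
    by (intro sum.cong refl) (auto intro!: local_value_sum simp: C1D(1)[OF w] restr_props(1))
  also have "\<dots> = sum ?f (Sigma ?A ?B)" using fin by (simp add: sum.Sigma)
  also have "Sigma ?A ?B = {e. \<omega> e \<noteq> 0}" using adj by (force simp: image_iff)
  also have "sum ?f {e. \<omega> e \<noteq> 0} = 0"
  proof (rule sum_alternating[OF C1D(4)[OF w]])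
    fix x y assume "(x, y) \<in> {e. \<omega> e \<noteq> 0}"
    then have ne: "\<omega> (x, y) \<noteq> 0" by simp
    obtain g where g: "g \<in> carrier GL2" "x = move g x0" "y = move g x1" using adj[OF ne] by (rule adjE)
    obtain d where d: "d \<in> E" "\<omega> (x, y) = t1 g d"
      using C1D(1)[OF w adj[OF ne]] stalk_edge[OF g(1)] g by auto
    define d' where "d' = a1 (matrix_inv Pm) d"
    have d': "d' \<in> E" "- d' \<in> E" using d A1.act_closed Pi_S1 A1.D_scale[of d' "-1"] by (auto simp: d'_def)
    have "t1 g d = t1 (g ** Pm) d'"
      using d Pi_S1 g by (simp add: d'_def A1.coset_fun_mult[symmetric] A0.Pi_GL2)
    then have wyx: "\<omega> (y, x) = t1 (g ** Pm) (- d')"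
      using C1D(3)[OF w, of y x] d d' by (simp add: A1.coset_fun_minus)
    have gP: "g ** Pm \<in> carrier GL2" "y = move (g ** Pm) x0" "x = move (g ** Pm) x1"
      using g A0.Pi_GL2 by (simp_all add: move_mult)
    have "?f (x, y) = action g (\<psi> d)"
      using d g by (simp add: restr_edge local_value_t0)
    moreover have "?f (y, x) = action (g ** Pm) (\<psi> (- d'))"
      using wyx gP(1) d' local_value_t0[OF gP(1), of "- d'"] restr_edge[OF gP(1) d'(2)]
      by (simp flip: gP(2,3))
    moreover have "\<psi> (- d') = - \<psi> d'" using psi(2)[of "-1" d'] by simp
    moreover have "action (g ** Pm) (- \<psi> d') = - action g (\<psi> d)"
      using psi(4)[OF d(1)] g by (simp add: rep(3) rep(8) A0.Pi_GL2 d'_def)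
    moreover have "\<omega> (y, x) \<noteq> 0" using C1D(3)[OF w, of y x] ne by simp
    ultimately show "(y, x) \<in> {e. \<omega> e \<noteq> 0} \<and> x \<noteq> y \<and> ?f (x, y) + ?f (y, x) = 0"
      using adj_neq[OF adj[OF ne]] by simp
  qed
  finally show ?thesis .
qed

lemma total_hom: "\<exists>f\<in>HomH. \<forall>\<omega>\<in>C0. f (H.coset \<omega>) = total \<psi> \<omega>"
  unfolding H0_eq by (rule H.quotient_hom) (auto simp: total_add total_scale total_act total_bd)

lemma total_single: "total \<psi> (single x0 (t0 (mat 1) d)) = \<psi> d"
proof -
  have "total \<psi> (single x0 (t0 (mat 1) d)) = (\<Sum>x\<in>{x0}. local_value \<psi> x (single x0 (t0 (mat 1) d) x))"
    by (rule total_sum) (use adj_vertices[OF adj_x0_x1(1)] in \<open>auto simp: single_def\<close>)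
  then show ?thesis using local_value_t0[of "mat 1" d] by (simp add: single_def rep(2))
qed

end

lemma x0_vertex: "x0 \<in> vertices F"
  using adj_vertices[OF adj_x0_x1(1)] .

lemma t0_stalk: "t0 (mat 1) d \<in> stalk V {x0}"
  using stalk_vertex[of "mat 1"] by simp

lemma HomH_iff: "f \<in> HomH \<longleftrightarrow> (\<forall>X. X \<notin> H.coset ` C0 \<longrightarrow> f X = 0) \<and>
    (\<forall>x\<in>C0. \<forall>y\<in>C0. f (H.coset (x + y)) = f (H.coset x) + f (H.coset y)) \<and>
    (\<forall>c. \<forall>x\<in>C0. f (H.coset (cscale c x)) = sc c (f (H.coset x))) \<and>
    (\<forall>g\<in>carrier GL2. \<forall>x\<in>C0. f (H.coset (chain_act g x)) = action g (f (H.coset x)))"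
  unfolding H0_eq by (rule H.Hom_Q_iff)

lemma HomH_add: "f \<in> HomH \<Longrightarrow> \<omega> \<in> C0 \<Longrightarrow> \<omega>' \<in> C0 \<Longrightarrow>
    f (H.coset (\<omega> + \<omega>')) = f (H.coset \<omega>) + f (H.coset \<omega>')"
  and HomH_act: "f \<in> HomH \<Longrightarrow> g \<in> carrier GL2 \<Longrightarrow> \<omega> \<in> C0 \<Longrightarrow>
    f (H.coset (chain_act g \<omega>)) = action g (f (H.coset \<omega>))"
  unfolding HomH_iff by blast+

text \<open>The group is transitive on vertices, so the translates of chains on \<open>x0\<close>
  span all chains.\<close>

lemma HomH_determined:
  assumes f: "f \<in> HomH" and f': "f' \<in> HomH"
    and eq: "\<And>d. f (H.coset (single x0 (t0 (mat 1) d))) = f' (H.coset (single x0 (t0 (mat 1) d)))"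
  shows "f = f'"
proof -
  define k where "k \<omega> = f (H.coset \<omega>) - f' (H.coset \<omega>)" for \<omega>
  have add: "k (\<omega> + \<omega>') = k \<omega> + k \<omega>'" if w: "\<omega> \<in> C0" "\<omega>' \<in> C0" for \<omega> \<omega>'
    using HomH_add[OF f w] HomH_add[OF f' w] by (simp add: k_def)
  have single: "k (single x u) = 0" if x: "x \<in> vertices F" and u: "u \<in> stalk V {x}" for x u
  proof -
    obtain g where g: "g \<in> carrier GL2" "x = move g x0" using x by (auto simp: vertices_eq)
    then obtain d where d: "u = t0 g d" using u stalk_vertex by auto
    have "single x u = chain_act g (single x0 (t0 (mat 1) d))"
      unfolding d g(2) using g(1) by (simp add: chain_act_single rtrans_coset_fun)
    moreover have "single x0 (t0 (mat 1) d) \<in> C0" by (intro single_C0 x0_vertex t0_stalk)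
    ultimately show ?thesis
      using HomH_act[OF f g(1)] HomH_act[OF f' g(1)] eq[of d] by (simp add: k_def)
  qed
  have "f X = f' X" for X
  proof (cases "X \<in> H.coset ` C0")
    case True
    then obtain \<omega> where w: "\<omega> \<in> C0" "X = H.coset \<omega>" by (elim imageE)
    have "k \<omega> = 0" by (rule C0_additive_eq_0[of k, OF add single w(1)])
    then show ?thesis unfolding w(2) k_def by simp
  qed (use f f' in \<open>simp add: HomH_iff\<close>)
  then show ?thesis by (rule ext)
qed

text \<open>Equivariance under \<open>Pm\<close> holds because the chain of \<open>d\<close> on
  \<open>x0\<close> and the corresponding chain on \<open>x1\<close> differ by the boundary of
  \<open>edge_chain d\<close>, hence agree in homology.\<close>

lemma restrict_hom:
  assumes f: "f \<in> HomH"
  shows "diagram_hom (\<lambda>d. f (H.coset (single x0 (t0 (mat 1) d))))"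
proof -
  let ?s = "\<lambda>d. single x0 (t0 (mat 1) d)"
  have C: "?s d \<in> C0" for d by (intro single_C0 x0_vertex t0_stalk)
  have "?s (d + d') = ?s d + ?s d'" for d d'
    by (auto simp: single_def A0.coset_fun_add)
  then have add: "f (H.coset (?s (d + d'))) = f (H.coset (?s d)) + f (H.coset (?s d'))" for d d'
    using f C unfolding HomH_iff by simp
  have "?s (sd c d) = cscale c (?s d)" for c d
    by (rule ext) (simp add: single_def A0.coset_fun_scale cscale_apply)
  then have scale: "f (H.coset (?s (sd c d))) = sc c (f (H.coset (?s d)))" for c d
    using f C unfolding HomH_iff by simp
  have "?s (a0 g d) = chain_act g (?s d)" if "g \<in> S0" for g d
    using that A0.coset_fun_mult[of g d "mat 1"]
    by (simp add: chain_act_single A0.S_GL2 rtrans_coset_fun stab0_iff)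
  then have act: "f (H.coset (?s (a0 g d))) = action g (f (H.coset (?s d)))" if "g \<in> S0" for g d
    using f C that A0.S_GL2 unfolding HomH_iff by simp
  have "f (H.coset (?s d)) = action Pm (f (H.coset (?s (a1 (matrix_inv Pm) d))))" if d: "d \<in> E" for d
  proof -
    have "chain_act Pm (?s (a1 (matrix_inv Pm) d)) = single x1 (t0 Pm (a1 (matrix_inv Pm) d))"
      by (simp add: chain_act_single A0.Pi_GL2 rtrans_coset_fun)
    then have "?s d - chain_act Pm (?s (a1 (matrix_inv Pm) d)) = bd (edge_chain d)"
      using bd_edge_chain[OF d] by simp
    then have "H.coset (?s d) = H.coset (chain_act Pm (?s (a1 (matrix_inv Pm) d)))"
      using edge_chain_C1[OF d] by (simp add: H.coset_eq_iff)
    then show ?thesis using f C A0.Pi_GL2 unfolding HomH_iff by simp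
  qed
  then show ?thesis unfolding diagram_hom_def using add scale act by blast
qed

text \<open>Restriction to chains on \<open>x0\<close> identifies the two kinds of homomorphisms:
  \<open>total\<close> supplies the extension, and \<open>HomH_determined\<close> its
  uniqueness.\<close>

theorem dim_HomH_eq_1:
  assumes \<psi>: "diagram_hom \<psi>" and nz: "\<psi> d0 \<noteq> 0"
    and unique: "\<And>\<phi>. diagram_hom \<phi> \<Longrightarrow> \<exists>c. \<forall>d. \<phi> d = sc c (\<psi> d)"
  shows "vector_space.dim (fun_scale sc) HomH = 1"
proof -
  interpret fs: vector_space "fun_scale sc :: 'k \<Rightarrow> ('x \<Rightarrow> 'v) \<Rightarrow> 'x \<Rightarrow> 'v"
    by unfold_locales (simp_all add: fun_scale_def fun_eq_iff pi.scale_right_distrib pi.scale_left_distrib)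
  obtain f where f: "f \<in> HomH" "\<And>\<omega>. \<omega> \<in> C0 \<Longrightarrow> f (H.coset \<omega>) = total \<psi> \<omega>"
    using total_hom[OF \<psi>] by blast
  have C: "single x0 (t0 (mat 1) d) \<in> C0" for d by (intro single_C0 x0_vertex t0_stalk)
  have fs: "f (H.coset (single x0 (t0 (mat 1) d))) = \<psi> d" for d
    using f(2)[OF C] total_single[OF \<psi>] by simp
  show ?thesis
  proof (rule fs.dim_unique)
    show "{f} \<subseteq> HomH" using f by simp
    have "f \<noteq> 0" using fs[of d0] nz by auto
    then show "fs.independent {f}" by simp
    show "HomH \<subseteq> fs.span {f}"
    proof
      fix h assume h: "h \<in> HomH"
      obtain c where c: "\<And>d. h (H.coset (single x0 (t0 (mat 1) d))) = sc c (\<psi> d)"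
        using unique[OF restrict_hom[OF h]] by blast
      have "fun_scale sc c f \<in> HomH"
        using f(1) unfolding HomH_iff
        by (simp add: fun_scale_def pi.scale_right_distrib rep(5) mult.commute)
      then have "h = fun_scale sc c f"
        using h c fs by (intro HomH_determined) (simp_all add: fun_scale_def)
      then show "h \<in> fs.span {f}" by (simp add: fs.span_base fs.span_scale)
    qed
  qed simp
qed

end

section \<open>Frobenius reciprocity and the Hecke operators\<close>

context nonarch_local_field
begin

definition rcos :: "'f^2^2 \<Rightarrow> ('f^2^2) set" where "rcos g = {h ** g | h. h \<in> Iw1 F}"

definition left_inv :: "('f^2^2 \<Rightarrow> 'v) \<Rightarrow> bool" where
  "left_inv \<phi> \<longleftrightarrow> (\<forall>h\<in>Iw1 F. \<forall>g\<in>carrier GL2. \<phi> (h ** g) = \<phi> g)"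

definition csupp :: "('f^2^2 \<Rightarrow> 'v::zero) \<Rightarrow> ('f^2^2) set set" where
  "csupp \<phi> = {rcos g | g. g \<in> carrier GL2 \<and> \<phi> g \<noteq> 0}"

definition rcos_rep :: "('f^2^2) set \<Rightarrow> 'f^2^2" where "rcos_rep X = (SOME g. g \<in> X)"

text \<open>For a left invariant function of finite support modulo \<open>Iw1 F\<close> this is its
  sum over the right cosets of \<open>Iw1 F\<close>; the representatives do not matter.\<close>

definition csum :: "('f^2^2 \<Rightarrow> 'v::comm_monoid_add) \<Rightarrow> 'v" where
  "csum \<phi> = (\<Sum>X\<in>csupp \<phi>. \<phi> (rcos_rep X))"

lemma Iw1_one: "mat 1 \<in> Iw1 F"
  by (rule K1_Iw1) (simp add: K1_def K_one)

lemma rcos_self: "g \<in> rcos g"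
  unfolding rcos_def using Iw1_one by (intro CollectI exI[of _ "mat 1"]) simp

lemma rcos_rep: obtains h where "h \<in> Iw1 F" "rcos_rep (rcos g) = h ** g"
proof -
  have "rcos_rep (rcos g) \<in> rcos g" unfolding rcos_rep_def by (rule someI[of "\<lambda>x. x \<in> rcos g", OF rcos_self])
  then show thesis using that by (auto simp: rcos_def)
qed

lemma rcos_mult: "h \<in> Iw1 F \<Longrightarrow> rcos (h ** g) = rcos g"
proof (intro Set.set_eqI iffI)
  fix x assume h: "h \<in> Iw1 F" and "x \<in> rcos (h ** g)"
  then obtain h' where "h' \<in> Iw1 F" "x = h' ** (h ** g)" by (auto simp: rcos_def)
  then show "x \<in> rcos g" using h Iw1_mult unfolding rcos_def
    by (intro CollectI exI[of _ "h' ** h"]) (simp add: matrix_mul_assoc)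
next
  fix x assume h: "h \<in> Iw1 F" and "x \<in> rcos g"
  then obtain h' where "h' \<in> Iw1 F" "x = h' ** g" by (auto simp: rcos_def)
  then show "x \<in> rcos (h ** g)" using h Iw1_mult Iw1_inv Iw1_GL2[OF h] unfolding rcos_def
    by (intro CollectI exI[of _ "h' ** matrix_inv h"]) (simp flip: matrix_mul_assoc)
qed

lemma rcos_eq_iff: "g \<in> carrier GL2 \<Longrightarrow> rcos x = rcos g \<longleftrightarrow> x ** matrix_inv g \<in> Iw1 F"
proof
  assume g: "g \<in> carrier GL2" and "rcos x = rcos g"
  then have "x \<in> rcos g" using rcos_self[of x] by simp
  then show "x ** matrix_inv g \<in> Iw1 F" using g by (auto simp: rcos_def)
next
  assume "g \<in> carrier GL2" "x ** matrix_inv g \<in> Iw1 F"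
  then show "rcos x = rcos g" using rcos_mult[of "x ** matrix_inv g" g] by simp
qed

lemma rcos_translate: "{x ** g | x. x \<in> rcos y} = rcos (y ** g)"
  by (auto simp: rcos_def matrix_mul_assoc)

lemma left_inv_rep: "left_inv \<phi> \<Longrightarrow> g \<in> carrier GL2 \<Longrightarrow> \<phi> (rcos_rep (rcos g)) = \<phi> g"
  by (rule rcos_rep[of g]) (simp add: left_inv_def)

lemma csum_alt:
  assumes "left_inv \<phi>" "finite A" "A \<subseteq> rcos ` carrier GL2" "csupp \<phi> \<subseteq> A"
  shows "csum \<phi> = (\<Sum>X\<in>A. \<phi> (rcos_rep X))"
  unfolding csum_def
proof (rule sum.mono_neutral_left[OF assms(2,4)], rule ballI)
  fix X assume X: "X \<in> A - csupp \<phi>"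
  then obtain g where "X = rcos g" "g \<in> carrier GL2" using assms(3) by blast
  then show "\<phi> (rcos_rep X) = 0" using X left_inv_rep[OF assms(1), of g] by (auto simp: csupp_def)
qed

lemma csupp_rcos: "csupp \<phi> \<subseteq> rcos ` carrier GL2"
  by (auto simp: csupp_def)

lemma csum_add:
  assumes "left_inv \<phi>" "left_inv \<phi>'" "finite (csupp \<phi>)" "finite (csupp \<phi>')"
  shows "csum (\<lambda>x. \<phi> x + \<phi>' x) = csum \<phi> + csum \<phi>'"
proof -
  let ?A = "csupp \<phi> \<union> csupp \<phi>'"
  have A: "finite ?A" "?A \<subseteq> rcos ` carrier GL2" using assms csupp_rcos by auto
  have "csupp (\<lambda>x. \<phi> x + \<phi>' x) \<subseteq> ?A" by (auto simp: csupp_def)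
  moreover have "left_inv (\<lambda>x. \<phi> x + \<phi>' x)" using assms by (simp add: left_inv_def)
  ultimately show ?thesis using A assms csum_alt[OF assms(1) A] csum_alt[OF assms(2) A]
    csum_alt[OF _ A, of "\<lambda>x. \<phi> x + \<phi>' x"] by (simp add: sum.distrib)
qed

lemma csum_linear:
  assumes "left_inv \<phi>" "finite (csupp \<phi>)" "L 0 = 0" "\<And>x y. L (x + y) = L x + L y"
  shows "csum (\<lambda>x. L (\<phi> x)) = L (csum \<phi>)"
proof -
  have "csupp (\<lambda>x. L (\<phi> x)) \<subseteq> csupp \<phi>" using assms by (auto simp: csupp_def)
  moreover have "left_inv (\<lambda>x. L (\<phi> x))" using assms by (simp add: left_inv_def)
  ultimately have "csum (\<lambda>x. L (\<phi> x)) = (\<Sum>X\<in>csupp \<phi>. L (\<phi> (rcos_rep X)))"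
    using assms csupp_rcos by (intro csum_alt)
  also have "\<dots> = L (\<Sum>X\<in>csupp \<phi>. \<phi> (rcos_rep X))"
    using assms(2) by (induction rule: finite_induct) (simp_all add: assms)
  finally show ?thesis by (simp add: csum_def)
qed

text \<open>Right translation by \<open>g\<close> permutes the right cosets of
  \<open>Iw1 F\<close>.\<close>

lemma csum_translate:
  assumes inv: "left_inv \<phi>" and g: "g \<in> carrier GL2" and fin: "finite (csupp \<phi>)"
  shows "csum (\<lambda>x. \<phi> (x ** g)) = csum \<phi>" "csupp (\<lambda>x. \<phi> (x ** g)) = (\<lambda>X. {x ** matrix_inv g | x. x \<in> X}) ` csupp \<phi>"
proof -
  let ?t = "\<lambda>X. {x ** matrix_inv g | x. x \<in> X}"
  show supp: "csupp (\<lambda>x. \<phi> (x ** g)) = ?t ` csupp \<phi>"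
  proof (intro Set.set_eqI iffI)
    fix X assume "X \<in> csupp (\<lambda>x. \<phi> (x ** g))"
    then obtain y where y: "y \<in> carrier GL2" "\<phi> (y ** g) \<noteq> 0" "X = rcos y" by (auto simp: csupp_def)
    then show "X \<in> ?t ` csupp \<phi>" using g
      by (intro image_eqI[of _ _ "rcos (y ** g)"]) (auto simp: rcos_translate csupp_def)
  next
    fix X assume "X \<in> ?t ` csupp \<phi>"
    then obtain y where y: "y \<in> carrier GL2" "\<phi> y \<noteq> 0" "X = rcos (y ** matrix_inv g)"
      by (auto simp: csupp_def rcos_translate)
    then show "X \<in> csupp (\<lambda>x. \<phi> (x ** g))" using g unfolding csupp_def
      by (intro CollectI exI[of _ "y ** matrix_inv g"]) simp
  qed
  have "inj_on ?t (csupp \<phi>)"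
  proof (rule inj_on_inverseI)
    fix X assume "X \<in> csupp \<phi>"
    then obtain y where "X = rcos y" by (auto simp: csupp_def)
    then show "{x ** g | x. x \<in> ?t X} = X" using g by (simp add: rcos_translate)
  qed
  then have "csum (\<lambda>x. \<phi> (x ** g)) = (\<Sum>X\<in>csupp \<phi>. \<phi> (rcos_rep (?t X) ** g))"
    unfolding csum_def supp by (simp add: sum.reindex)
  also have "\<dots> = csum \<phi>" unfolding csum_def
  proof (rule sum.cong)
    fix X assume "X \<in> csupp \<phi>"
    then obtain y where y: "y \<in> carrier GL2" "X = rcos y" by (auto simp: csupp_def)
    obtain h where "h \<in> Iw1 F" "rcos_rep (rcos (y ** matrix_inv g)) = h ** (y ** matrix_inv g)"
      by (rule rcos_rep)
    then have "\<phi> (rcos_rep (?t X) ** g) = \<phi> y"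
      using y g inv by (simp add: rcos_translate left_inv_def flip: matrix_mul_assoc)
    then show "\<phi> (rcos_rep (?t X) ** g) = \<phi> (rcos_rep X)" using y inv by (simp add: left_inv_rep)
  qed simp
  finally show "csum (\<lambda>x. \<phi> (x ** g)) = csum \<phi>" .
qed

section \<open>The compact induction of the trivial character of \<open>Iw1 F\<close>\<close>

abbreviation cInd :: "('f^2^2 \<Rightarrow> 'k::field) set" where
  "cInd \<equiv> c_Ind F (Iw1 F) UNIV (\<lambda>_ v. v)"

lemma cInd_iff: "f \<in> cInd \<longleftrightarrow> (\<forall>g. g \<notin> carrier GL2 \<longrightarrow> f g = 0) \<and> left_inv f \<and>
    (\<exists>n. \<forall>k\<in>cong_subgroup F n. rtrans k f = f) \<and> finite (csupp f)"
  by (simp add: c_Ind_def left_inv_def csupp_def rcos_def)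

lemma cInd_add: "f \<in> cInd \<Longrightarrow> f' \<in> cInd \<Longrightarrow> f + f' \<in> cInd"
proof -
  assume f: "f \<in> cInd" "f' \<in> cInd"
  obtain n where n: "\<And>k. k \<in> cong_subgroup F n \<Longrightarrow> rtrans k f = f" using f(1) by (auto simp: cInd_iff)
  obtain n' where n': "\<And>k. k \<in> cong_subgroup F n' \<Longrightarrow> rtrans k f' = f'" using f(2) by (auto simp: cInd_iff)
  have "rtrans k (f + f') = f + f'" if "k \<in> cong_subgroup F (max n n')" for k
  proof -
    have "rtrans k (f + f') = rtrans k f + rtrans k f'" by (simp add: rtrans_def fun_eq_iff)
    moreover have "k \<in> cong_subgroup F n" "k \<in> cong_subgroup F n'"
      using that cong_subgroup_antimono[of n "max n n'"] cong_subgroup_antimono[of n' "max n n'"] by auto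
    ultimately show ?thesis using n n' by simp
  qed
  moreover have "csupp (f + f') \<subseteq> csupp f \<union> csupp f'" by (auto simp: csupp_def)
  then have "finite (csupp (f + f'))" by (rule finite_subset) (use f in \<open>simp add: cInd_iff\<close>)
  ultimately show ?thesis using f unfolding cInd_iff by (auto simp: left_inv_def)
qed

lemma cInd_scale: "f \<in> cInd \<Longrightarrow> fun_scale (*) c f \<in> cInd"
proof -
  assume f: "f \<in> cInd"
  obtain n where "\<And>k. k \<in> cong_subgroup F n \<Longrightarrow> rtrans k f = f" using f by (auto simp: cInd_iff)
  moreover have "rtrans k (fun_scale (*) c f) = fun_scale (*) c (rtrans k f)" for k
    by (simp add: rtrans_def fun_scale_def)
  ultimately have "\<exists>n. \<forall>k\<in>cong_subgroup F n. rtrans k (fun_scale (*) c f) = fun_scale (*) c f"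
    by (intro exI[of _ n]) simp
  moreover have "csupp (fun_scale (*) c f) \<subseteq> csupp f" by (auto simp: csupp_def fun_scale_def)
  then have "finite (csupp (fun_scale (*) c f))" by (rule finite_subset) (use f in \<open>simp add: cInd_iff\<close>)
  moreover have "left_inv (fun_scale (*) c f)" "\<forall>g. g \<notin> carrier GL2 \<longrightarrow> fun_scale (*) c f g = 0"
    using f by (simp_all add: cInd_iff left_inv_def fun_scale_def)
  ultimately show ?thesis unfolding cInd_iff by blast
qed

lemma cInd_rtrans: "g \<in> carrier GL2 \<Longrightarrow> f \<in> cInd \<Longrightarrow> rtrans g f \<in> cInd"
proof -
  assume g: "g \<in> carrier GL2" and f: "f \<in> cInd"
  obtain n where n: "\<And>k. k \<in> cong_subgroup F n \<Longrightarrow> rtrans k f = f" using f by (auto simp: cInd_iff)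
  obtain m where m: "\<And>k. k \<in> cong_subgroup F m \<Longrightarrow> matrix_inv g ** k ** g \<in> cong_subgroup F n"
    using cong_subgroup_conj[of "matrix_inv g" n] g by auto
  have "rtrans k (rtrans g f) = rtrans g f" if "k \<in> cong_subgroup F m" for k
  proof -
    have "rtrans k (rtrans g f) = rtrans g (rtrans (matrix_inv g ** k ** g) f)"
      using g by (simp add: rtrans_def matrix_mul_assoc)
    then show ?thesis using n m[OF that] by simp
  qed
  moreover have "csupp (rtrans g f) = (\<lambda>X. {x ** matrix_inv g | x. x \<in> X}) ` csupp f"
    using csum_translate(2)[of f g] f g by (simp add: cInd_iff rtrans_def)
  moreover have "left_inv (rtrans g f)"
    using f g by (simp add: cInd_iff left_inv_def rtrans_def flip: matrix_mul_assoc)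
  ultimately show ?thesis using f g unfolding cInd_iff by (auto simp: rtrans_def GL2_mult_iff)
qed

lemma cInd_0: "0 \<in> cInd"
  unfolding cInd_iff by (auto simp: left_inv_def csupp_def rtrans_def)

lemma cInd_sum: "(\<And>x. x \<in> A \<Longrightarrow> f x \<in> cInd) \<Longrightarrow> sum f A \<in> cInd"
proof (induction A rule: infinite_finite_induct)
  case (insert x A)
  then show ?case unfolding sum.insert[OF insert(1,2)] by (intro cInd_add) auto
qed (unfold sum.infinite sum.empty, rule cInd_0, rule cInd_0)

lemma rtrans_Iw1_ind: "h \<in> Iw1 F \<Longrightarrow> rtrans h (ind_Iw1 F) = ind_Iw1 F"
proof -
  assume h: "h \<in> Iw1 F"
  have "x ** h \<in> Iw1 F \<longleftrightarrow> x \<in> Iw1 F" for x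
    using h Iw1_mult Iw1_inv by (metis GL2_cancel(3) Iw1_GL2)
  then show ?thesis by (simp add: rtrans_def ind_Iw1_def)
qed

lemma ind_cInd: "(ind_Iw1 F :: 'f^2^2 \<Rightarrow> 'k::field) \<in> cInd"
proof -
  have "h ** x \<in> Iw1 F \<longleftrightarrow> x \<in> Iw1 F" if "h \<in> Iw1 F" for h x
    using that Iw1_mult Iw1_inv by (metis GL2_cancel(1) Iw1_GL2)
  then have "left_inv (ind_Iw1 F :: 'f^2^2 \<Rightarrow> 'k)" by (simp add: left_inv_def ind_Iw1_def)
  moreover have "rtrans k (ind_Iw1 F) = (ind_Iw1 F :: 'f^2^2 \<Rightarrow> 'k)" if "k \<in> cong_subgroup F 1" for k
    using that by (intro rtrans_Iw1_ind K1_Iw1) (simp add: cong_subgroup_1)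
  moreover have "csupp (ind_Iw1 F :: 'f^2^2 \<Rightarrow> 'k) \<subseteq> {rcos (mat 1)}"
    using rcos_mult[of _ "mat 1"] by (auto simp: csupp_def ind_Iw1_def split: if_splits)
  then have "finite (csupp (ind_Iw1 F :: 'f^2^2 \<Rightarrow> 'k))" by (rule finite_subset) simp
  ultimately show ?thesis unfolding cInd_iff by (auto simp: ind_Iw1_def Iw1_GL2)
qed

text \<open>The translates of \<open>ind_Iw1 F\<close> span: \<open>f\<close> is the sum, over the
  cosets in its support with representatives \<open>x\<close>, of \<open>f x\<close> times the
  translate of the indicator function by the inverse of \<open>x\<close>.\<close>

lemma cInd_additive_eq_0:
  fixes k :: "('f^2^2 \<Rightarrow> 'k::field) \<Rightarrow> 'v::ab_group_add"
  assumes add: "\<And>f f'. f \<in> cInd \<Longrightarrow> f' \<in> cInd \<Longrightarrow> k (f + f') = k f + k f'"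
    and single: "\<And>c g. g \<in> carrier GL2 \<Longrightarrow> k (fun_scale (*) c (rtrans g (ind_Iw1 F))) = 0"
    and f: "f \<in> cInd"
  shows "k f = 0"
proof -
  let ?s = "\<lambda>X. fun_scale (*) (f (rcos_rep X)) (rtrans (matrix_inv (rcos_rep X)) (ind_Iw1 F))"
  have rep: "rcos_rep X \<in> carrier GL2" "rcos (rcos_rep X) = X" if "X \<in> csupp f" for X
  proof -
    obtain g where g: "X = rcos g" "g \<in> carrier GL2" using \<open>X \<in> csupp f\<close> by (auto simp: csupp_def)
    obtain h where "h \<in> Iw1 F" "rcos_rep (rcos g) = h ** g" by (rule rcos_rep)
    then show "rcos_rep X \<in> carrier GL2" "rcos (rcos_rep X) = X"
      using g by (simp_all add: rcos_mult Iw1_GL2)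
  qed
  have s: "?s X \<in> cInd" if "X \<in> csupp f" for X
    using rep[OF that] by (intro cInd_scale cInd_rtrans ind_cInd) simp
  have "sum ?s A \<in> cInd \<and> k (sum ?s A) = 0" if "finite A" "A \<subseteq> csupp f" for A
    using that
  proof (induction A)
    case empty
    have "k 0 = 0" using add[OF cInd_0 cInd_0] by simp
    with cInd_0 show ?case unfolding sum.empty by (rule conjI)
  next
    case (insert X A)
    have X: "X \<in> csupp f" and A: "A \<subseteq> csupp f" using insert.prems by auto
    note IH = insert.IH[OF A]
    have "k (?s X + sum ?s A) = 0"
      unfolding add[OF s[OF X] IH[THEN conjunct1]] IH[THEN conjunct2]
      using single[of "matrix_inv (rcos_rep X)"] rep[OF X] by simp
    with cInd_add[OF s[OF X] IH[THEN conjunct1]] show ?case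
      unfolding sum.insert[OF insert(1,2)] by (rule conjI)
  qed
  moreover have fin: "finite (csupp f)" using f by (simp add: cInd_iff)
  ultimately have "k (sum ?s (csupp f)) = 0" by blast
  moreover have "sum ?s (csupp f) = f"
  proof
    fix x
    have "sum ?s (csupp f) x = (\<Sum>X\<in>csupp f. ?s X x)"
      using fin by (induction rule: finite_induct) simp_all
    also have "\<dots> = f x"
    proof (cases "x \<in> carrier GL2")
      case True
      have "?s X x = (if X = rcos x then f x else 0)" if "X \<in> csupp f" for X
        using rcos_eq_iff[OF rep(1)[OF that], of x] rep(2)[OF that] f True left_inv_rep[of f x]
        by (auto simp: fun_scale_def rtrans_def ind_Iw1_def cInd_iff)
      then have "(\<Sum>X\<in>csupp f. ?s X x) = (\<Sum>X\<in>csupp f. if X = rcos x then f x else 0)"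
        by (rule sum.cong[OF refl])
      then show ?thesis using fin True by (auto simp: csupp_def)
    next
      case False
      have "?s X x = 0" if "X \<in> csupp f" for X
        using False rep[OF that] Iw1_GL2[of "x ** matrix_inv (rcos_rep X)"]
        by (auto simp: fun_scale_def rtrans_def ind_Iw1_def GL2_mult_iff)
      then show ?thesis using False f by (simp add: cInd_iff)
    qed
    finally show "sum ?s (csupp f) x = f x" .
  qed
  ultimately show ?thesis by metis
qed

lemma c_Ind_triv_sel: "rep_space (c_Ind_triv F) = cInd" "rep_add (c_Ind_triv F) = (+)"
    "rep_smul (c_Ind_triv F) = fun_scale (*)" "rep_act (c_Ind_triv F) = rtrans"
  by (simp_all add: c_Ind_triv_def rep_on_sel)

text \<open>The homomorphism sends \<open>f\<close> to the sum over cosets of \<open>f x\<close>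
  times the image of \<open>v\<close> under the inverse of \<open>x\<close>; the terms depend only
  on the coset because \<open>v\<close> is invariant. The target is a stable subset \<open>V\<close>
  rather than a whole type so that it can be the compact induction itself, which yields the Hecke
  operators.\<close>

lemma frobenius:
  fixes sc :: "'k::field \<Rightarrow> 'v::ab_group_add \<Rightarrow> 'v"
  assumes pi: "group_rep GL2 sc action"
    and V_add: "\<And>x y. x \<in> V \<Longrightarrow> y \<in> V \<Longrightarrow> x + y \<in> V" and V_0: "0 \<in> V"
    and V_scale: "\<And>c x. x \<in> V \<Longrightarrow> sc c x \<in> V"
    and V_act: "\<And>g x. g \<in> carrier GL2 \<Longrightarrow> x \<in> V \<Longrightarrow> action g x \<in> V"
    and v: "v \<in> V" "v \<in> invariants (Iw1 F) action"
  shows "\<exists>!\<phi>. \<phi> \<in> Hom_rep (carrier GL2) (c_Ind_triv F) (rep_on V sc action) \<and> \<phi> (ind_Iw1 F) = v"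
proof (rule ex_ex1I)
  note rep = group_rep_GL2D[OF pi]
  interpret pi: vector_space sc by (rule rep(1))
  define \<Phi> where "\<Phi> f x = sc (f x) (action (matrix_inv x) v)" for f x
  have inv: "left_inv (\<Phi> f)" if "f \<in> cInd" for f
  proof -
    have "action (matrix_inv (h ** g)) v = action (matrix_inv g) v" if "h \<in> Iw1 F" "g \<in> carrier GL2" for h g
      using that v(2) Iw1_inv[OF that(1)] by (simp add: matrix_inv_mult Iw1_GL2 rep(3) invariants_def)
    then show ?thesis using \<open>f \<in> cInd\<close> by (simp add: cInd_iff left_inv_def \<Phi>_def)
  qed
  have fin: "finite (csupp (\<Phi> f))" if "f \<in> cInd" for f
    by (rule finite_subset[of _ "csupp f"]) (use that in \<open>auto simp: csupp_def \<Phi>_def cInd_iff\<close>)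
  define \<phi> where "\<phi> f = (if f \<in> cInd then csum (\<Phi> f) else 0)" for f
  have V: "\<phi> f \<in> V" if "f \<in> cInd" for f
  proof -
    have mem: "\<Phi> f (rcos_rep X) \<in> V" if "X \<in> csupp (\<Phi> f)" for X
    proof -
      obtain g where g: "X = rcos g" "g \<in> carrier GL2" using \<open>X \<in> csupp (\<Phi> f)\<close> by (auto simp: csupp_def)
      then show ?thesis using left_inv_rep[OF inv[OF \<open>f \<in> cInd\<close>] g(2)] v
        by (simp add: \<Phi>_def V_scale V_act)
    qed
    have sumV: "sum h A \<in> V" if "\<And>X. X \<in> A \<Longrightarrow> h X \<in> V" for h :: "('f^2^2) set \<Rightarrow> 'v" and A
      using that by (induction A rule: infinite_finite_induct) (simp_all add: V_0 V_add)
    have "csum (\<Phi> f) \<in> V" unfolding csum_def by (rule sumV[OF mem])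
    then show ?thesis using that by (simp add: \<phi>_def)
  qed
  have add: "\<phi> (f + f') = \<phi> f + \<phi> f'" if "f \<in> cInd" "f' \<in> cInd" for f f'
  proof -
    have "\<Phi> (f + f') = (\<lambda>x. \<Phi> f x + \<Phi> f' x)" by (simp add: \<Phi>_def fun_eq_iff pi.scale_left_distrib)
    then show ?thesis using that cInd_add[OF that] by (simp add: \<phi>_def csum_add inv fin)
  qed
  have scale: "\<phi> (fun_scale (*) c f) = sc c (\<phi> f)" if "f \<in> cInd" for c f
  proof -
    have "\<Phi> (fun_scale (*) c f) = (\<lambda>x. sc c (\<Phi> f x))" by (simp add: \<Phi>_def fun_eq_iff fun_scale_def)
    then show ?thesis using that cInd_scale[OF that]
      by (simp add: \<phi>_def csum_linear inv fin pi.scale_right_distrib)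
  qed
  have act: "\<phi> (rtrans g f) = action g (\<phi> f)" if g: "g \<in> carrier GL2" and f: "f \<in> cInd" for g f
  proof -
    have i: "left_inv (\<lambda>x. action g (\<Phi> f x))" using inv[OF f] by (simp add: left_inv_def)
    have fi: "finite (csupp (\<lambda>x. action g (\<Phi> f x)))"
      by (rule finite_subset[OF _ fin[OF f]]) (use g in \<open>auto simp: csupp_def rep\<close>)
    have "csum (\<Phi> (rtrans g f)) = csum (\<lambda>x. action g (\<Phi> f (x ** g)))"
    proof -
      let ?L = "\<Phi> (rtrans g f)" and ?R = "\<lambda>x. action g (\<Phi> f (x ** g))"
      \<comment> \<open>The two functions need only agree on invertible matrices, where inverses
        multiply; the coset representatives occurring in the sums are invertible.\<close>
      have eq: "?L x = ?R x" if "x \<in> carrier GL2" for x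
      proof -
        have "action g (action (matrix_inv (x ** g)) v) = action (matrix_inv x) v"
          using g that by (simp add: matrix_inv_mult flip: rep(3))
        then show ?thesis using g by (simp add: \<Phi>_def rtrans_def rep(5))
      qed
      then have "csupp ?L = csupp ?R" unfolding csupp_def by (intro Collect_cong) auto
      then show ?thesis unfolding csum_def
      proof (rule sum.cong)
        fix X assume "X \<in> csupp ?R"
        then obtain y where y: "X = rcos y" "y \<in> carrier GL2" by (auto simp: csupp_def)
        obtain h where "h \<in> Iw1 F" "rcos_rep (rcos y) = h ** y" by (rule rcos_rep)
        then show "?L (rcos_rep X) = ?R (rcos_rep X)" using y by (intro eq) (simp add: Iw1_GL2)
      qed
    qed
    also have "\<dots> = csum (\<lambda>x. action g (\<Phi> f x))" by (rule csum_translate(1)[OF i g fi])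
    also have "\<dots> = action g (csum (\<Phi> f))" using g by (intro csum_linear inv fin f) (simp_all add: rep)
    finally show ?thesis using f cInd_rtrans[OF g f] by (simp add: \<phi>_def)
  qed
  have ind: "\<phi> (ind_Iw1 F) = v"
  proof -
    have "csum (\<Phi> (ind_Iw1 F)) = (\<Sum>X\<in>{rcos (mat 1)}. \<Phi> (ind_Iw1 F) (rcos_rep X))"
      using inv[OF ind_cInd] rcos_mult[of _ "mat 1"]
      by (intro csum_alt) (auto simp: csupp_def \<Phi>_def ind_Iw1_def split: if_splits)
    also have "\<dots> = v" using left_inv_rep[OF inv[OF ind_cInd], of "mat 1"] Iw1_one
      by (simp add: \<Phi>_def ind_Iw1_def rep(2))
    finally show ?thesis by (simp add: \<phi>_def ind_cInd)
  qed
  have "\<phi> \<in> Hom_rep (carrier GL2) (c_Ind_triv F) (rep_on V sc action)"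
    unfolding Hom_rep_def c_Ind_triv_sel rep_on_sel using V add scale act by (auto simp: \<phi>_def)
  with ind show "\<exists>\<phi>. \<phi> \<in> Hom_rep (carrier GL2) (c_Ind_triv F) (rep_on V sc action) \<and> \<phi> (ind_Iw1 F) = v"
    by blast
next
  note rep = group_rep_GL2D[OF pi]
  interpret pi: vector_space sc by (rule rep(1))
  fix \<phi> \<phi>'
  assume "\<phi> \<in> Hom_rep (carrier GL2) (c_Ind_triv F) (rep_on V sc action) \<and> \<phi> (ind_Iw1 F) = v"
    "\<phi>' \<in> Hom_rep (carrier GL2) (c_Ind_triv F) (rep_on V sc action) \<and> \<phi>' (ind_Iw1 F) = v"
  then have *: "\<And>f. f \<notin> cInd \<Longrightarrow> \<psi> f = 0"
      "\<And>f f'. f \<in> cInd \<Longrightarrow> f' \<in> cInd \<Longrightarrow> \<psi> (f + f') = \<psi> f + \<psi> f'"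
      "\<And>c f. f \<in> cInd \<Longrightarrow> \<psi> (fun_scale (*) c f) = sc c (\<psi> f)"
      "\<And>g f. g \<in> carrier GL2 \<Longrightarrow> f \<in> cInd \<Longrightarrow> \<psi> (rtrans g f) = action g (\<psi> f)"
      "\<psi> (ind_Iw1 F) = v" if "\<psi> \<in> {\<phi>, \<phi>'}" for \<psi>
    using that by (auto simp: Hom_rep_def c_Ind_triv_sel rep_on_sel)
  note a = *(2-)[of \<phi>, OF insertI1] and b = *(2-)[of \<phi>', OF insertI2[OF singletonI]]
  have "\<phi> f = \<phi>' f" if "f \<in> cInd" for f
  proof -
    have "\<phi> f - \<phi>' f = 0"
    proof (rule cInd_additive_eq_0[where k = "\<lambda>f. \<phi> f - \<phi>' f", OF _ _ that])
      fix c g assume g: "g \<in> carrier (GL2 :: ('f^2^2) monoid)"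
      show "\<phi> (fun_scale (*) c (rtrans g (ind_Iw1 F))) - \<phi>' (fun_scale (*) c (rtrans g (ind_Iw1 F))) = 0"
        using a(2)[OF cInd_rtrans[OF g ind_cInd], of c] b(2)[OF cInd_rtrans[OF g ind_cInd], of c]
          a(3)[OF g ind_cInd] b(3)[OF g ind_cInd] a(4) b(4) by simp
    qed (use a(1) b(1) in simp)
    then show ?thesis by simp
  qed
  then have "\<phi> f = \<phi>' f" for f using *(1)[of \<phi> f] *(1)[of \<phi>' f] by (cases "f \<in> cInd") auto
  then show "\<phi> = \<phi>'" by (rule ext)
qed

lemma group_rep_rtrans: "group_rep GL2 (fun_scale (*) :: 'k::field \<Rightarrow> _) (rtrans :: 'f^2^2 \<Rightarrow> _)"
proof -
  interpret vector_space "fun_scale (*) :: 'k \<Rightarrow> ('f^2^2 \<Rightarrow> 'k) \<Rightarrow> _"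
    by unfold_locales (simp_all add: fun_scale_def fun_eq_iff algebra_simps)
  show ?thesis
  proof (intro group_rep.intro group_GL2 vector_space_axioms group_rep_axioms.intro)
    fix g :: "'f^2^2"
    show "Vector_Spaces.linear (fun_scale (*)) (fun_scale (*)) (rtrans g :: ('f^2^2 \<Rightarrow> 'k) \<Rightarrow> _)"
      by unfold_locales (simp_all add: rtrans_def fun_scale_def fun_eq_iff)
  qed (simp_all add: rtrans_def matrix_mul_assoc)
qed

text \<open>Frobenius reciprocity with the compact induction as target. It shows that the definite
  description in \<open>Hecke_elt\<close> denotes as soon as \<open>w\<close> is invariant under
  \<open>Iw1 F\<close>.\<close>

lemma Hecke_elt:
  fixes w :: "'f^2^2 \<Rightarrow> 'k::field"
  assumes "w \<in> cInd" "\<And>h. h \<in> Iw1 F \<Longrightarrow> rtrans h w = w"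
  shows "Hecke_elt F w \<in> Hecke F" "Hecke_elt F w (ind_Iw1 F) = w"
proof -
  have "\<exists>!T. T \<in> Hom_rep (carrier GL2) (c_Ind_triv F) (rep_on cInd (fun_scale (*)) rtrans) \<and> T (ind_Iw1 F) = w"
    using assms by (intro frobenius[OF group_rep_rtrans] cInd_add cInd_0 cInd_scale cInd_rtrans)
      (auto simp: invariants_def)
  then have "\<exists>!T. T \<in> Hecke F \<and> T (ind_Iw1 F) = w" by (simp add: Hecke_def flip: c_Ind_triv_def)
  from theI'[OF this] show "Hecke_elt F w \<in> Hecke F" "Hecke_elt F w (ind_Iw1 F) = w"
    unfolding Hecke_elt_def by blast+
qed

lemma frob:
  fixes sc :: "'k::field \<Rightarrow> 'v::ab_group_add \<Rightarrow> 'v"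
  assumes pi: "group_rep GL2 sc action" and v: "v \<in> invariants (Iw1 F) action"
  shows "frob F sc action v (ind_Iw1 F) = v"
    and "f \<in> cInd \<Longrightarrow> f' \<in> cInd \<Longrightarrow> frob F sc action v (f + f') = frob F sc action v f + frob F sc action v f'"
    and "f \<in> cInd \<Longrightarrow> frob F sc action v (fun_scale (*) c f) = sc c (frob F sc action v f)"
    and "g \<in> carrier GL2 \<Longrightarrow> f \<in> cInd \<Longrightarrow> frob F sc action v (rtrans g f) = action g (frob F sc action v f)"
    and "(\<And>x. x \<in> A \<Longrightarrow> h x \<in> cInd) \<Longrightarrow> frob F sc action v (sum h A) = (\<Sum>x\<in>A. frob F sc action v (h x))"
proof -
  have "\<exists>!\<phi>. \<phi> \<in> Hom_rep (carrier GL2) (c_Ind_triv F) (rep_on UNIV sc action) \<and> \<phi> (ind_Iw1 F) = v"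
    using v by (intro frobenius[OF pi]) auto
  from theI'[OF this] have *: "frob F sc action v \<in> Hom_rep (carrier GL2) (c_Ind_triv F) (rep_on UNIV sc action)"
    "frob F sc action v (ind_Iw1 F) = v" unfolding frob_def by blast+
  then show "frob F sc action v (ind_Iw1 F) = v" by simp
  show add: "frob F sc action v (f + f') = frob F sc action v f + frob F sc action v f'"
    if "f \<in> cInd" "f' \<in> cInd" for f f' using *(1) that by (simp add: Hom_rep_def c_Ind_triv_sel rep_on_sel)
  show "frob F sc action v (fun_scale (*) c f) = sc c (frob F sc action v f)" if "f \<in> cInd"
    using *(1) that by (simp add: Hom_rep_def c_Ind_triv_sel rep_on_sel)
  show "frob F sc action v (rtrans g f) = action g (frob F sc action v f)" if "g \<in> carrier GL2" "f \<in> cInd"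
    using *(1) that by (simp add: Hom_rep_def c_Ind_triv_sel rep_on_sel)
  have zero: "frob F sc action v 0 = 0" using add[OF cInd_0 cInd_0] by simp
  show "frob F sc action v (sum h A) = (\<Sum>x\<in>A. frob F sc action v (h x))" if "\<And>x. x \<in> A \<Longrightarrow> h x \<in> cInd"
    using that
  proof (induction A rule: infinite_finite_induct)
    case (insert x A)
    have "frob F sc action v (sum h (insert x A)) = frob F sc action v (h x) + frob F sc action v (sum h A)"
      unfolding sum.insert[OF insert(1,2)] using insert.prems by (intro add cInd_sum) auto
    also have "\<dots> = (\<Sum>x\<in>insert x A. frob F sc action v (h x))" using insert by simp
    finally show ?case .
  qed (unfold sum.infinite sum.empty, rule zero, rule zero)
qed

section \<open>The operators \<open>T_Pi\<close>, \<open>T_ns\<close> and \<open>e_chi\<close> on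
  invariant vectors\<close>

lemma inv_act_Hecke_elt:
  assumes "w \<in> cInd" "\<And>h. h \<in> Iw1 F \<Longrightarrow> rtrans h w = w"
  shows "inv_act F sc action v (Hecke_elt F w) = frob F sc action v w"
  using Hecke_elt(2)[OF assms] by (simp add: inv_act_def)

text \<open>A set-theoretic section of reduction. It is not multiplicative, but on vectors invariant
  under \<open>K1 F\<close> the choice of lift is invisible.\<close>

definition lift :: "'q^2^2 \<Rightarrow> 'f^2^2" where
  "lift g = (SOME k. k \<in> K F \<and> red_mat F k = g)"

lemma lift: "g \<in> carrier GL2 \<Longrightarrow> lift g \<in> K F \<and> red_mat F (lift g) = g"
  unfolding lift_def using red_mat_surj by (metis (mono_tags, lifting) someI)

lemma K1_quotient:
  assumes "k \<in> K F" "l \<in> K F" "red_mat F k = red_mat F l"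
  shows "matrix_inv l ** k \<in> K1 F"
  using assms K_inv[of l] red_mat_GL2[of l] by (simp add: K1_def K_mult red_mat_mult_K red_mat_inv)

lemma K1_conj: "k \<in> K F \<Longrightarrow> h \<in> K1 F \<Longrightarrow> matrix_inv k ** h ** k \<in> K1 F"
  using K_inv[of k] red_mat_GL2[of k] by (simp add: K1_def K_mult red_mat_mult_K red_mat_inv)

lemma inv_n_s_K: "matrix_inv n_s \<in> K F" "red_mat F (matrix_inv n_s) = mat2 0 1 (-1) 0"
  unfolding inv_n_s by (auto simp: K_iff_red red_mat_mat2 forall_2 red_one red_minus ints_minus)

text \<open>Each coset is a fibre of the reduction map from \<open>Iw1 F\<close> onto
  \<open>Unip\<close>, whose kernel is \<open>K1 F\<close>.\<close>

lemma lcosets_K1: "bij_betw (\<lambda>g. {k \<in> K F. red_mat F k = g}) Unip (lcosets (Iw1 F) (K1 F))"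
proof (rule bij_betw_imageI)
  show "inj_on (\<lambda>g. {k \<in> K F. red_mat F k = g}) Unip"
  proof (rule inj_onI)
    fix g h :: "'q^2^2" assume "g \<in> Unip" "{k \<in> K F. red_mat F k = g} = {k \<in> K F. red_mat F k = h}"
    moreover have "lift g \<in> K F \<and> red_mat F (lift g) = g"
      using \<open>g \<in> Unip\<close> by (intro lift Borel_GL2 Unip_Borel)
    ultimately show "g = h" by auto
  qed
  have fibre: "{k \<in> K F. red_mat F k = red_mat F a} = {a ** n | n. n \<in> K1 F}" if a: "a \<in> K F" for a
  proof (intro Set.set_eqI iffI)
    fix k assume "k \<in> {k \<in> K F. red_mat F k = red_mat F a}"
    then show "k \<in> {a ** n | n. n \<in> K1 F}" using K1_quotient[of k a] a K_GL2
      by (intro CollectI exI[of _ "matrix_inv a ** k"]) auto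
  next
    fix k assume "k \<in> {a ** n | n. n \<in> K1 F}"
    then show "k \<in> {k \<in> K F. red_mat F k = red_mat F a}" using a
      by (auto simp: K1_def K_mult red_mat_mult_K)
  qed
  show "(\<lambda>g. {k \<in> K F. red_mat F k = g}) ` Unip = lcosets (Iw1 F) (K1 F)"
  proof (intro Set.set_eqI iffI)
    fix X assume "X \<in> (\<lambda>g. {k \<in> K F. red_mat F k = g}) ` Unip"
    then obtain g where g: "g \<in> Unip" "X = {k \<in> K F. red_mat F k = g}" by blast
    then have l: "lift g \<in> K F" "red_mat F (lift g) = g" using lift[of g] Unip_Borel Borel_GL2 by auto
    then show "X \<in> lcosets (Iw1 F) (K1 F)" using fibre[OF l(1)] g unfolding lcosets_def
      by (intro CollectI exI[of _ "lift g"]) (simp add: Iw1_def)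
  next
    fix X assume "X \<in> lcosets (Iw1 F) (K1 F)"
    then obtain a where a: "a \<in> Iw1 F" "X = {a ** n | n. n \<in> K1 F}" by (auto simp: lcosets_def)
    then show "X \<in> (\<lambda>g. {k \<in> K F. red_mat F k = g}) ` Unip" using fibre[of a]
      by (intro image_eqI[of _ _ "red_mat F a"]) (auto simp: Iw1_def)
  qed
qed

lemma sum_lcosets_K1:
  assumes "\<And>k l. k \<in> K F \<Longrightarrow> l \<in> K F \<Longrightarrow> red_mat F k = red_mat F l \<Longrightarrow> \<phi> k = \<phi> l"
  shows "(\<Sum>C\<in>lcosets (Iw1 F) (K1 F). \<phi> (SOME u. u \<in> C)) = (\<Sum>t\<in>UNIV. \<phi> (lift (mat2 1 t 0 1)))"
proof -
  have "(\<Sum>C\<in>lcosets (Iw1 F) (K1 F). \<phi> (SOME u. u \<in> C)) =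
      (\<Sum>g\<in>Unip. \<phi> (SOME u. u \<in> {k \<in> K F. red_mat F k = g}))"
    by (rule sum.reindex_bij_betw[OF lcosets_K1, symmetric])
  also have "\<dots> = (\<Sum>t\<in>UNIV. \<phi> (SOME u. u \<in> {k \<in> K F. red_mat F k = mat2 1 t 0 1}))"
    by (rule sum.reindex_bij_betw[OF Unip_bij, symmetric])
  also have "\<dots> = (\<Sum>t\<in>UNIV. \<phi> (lift (mat2 1 t 0 1)))" by (simp add: lift_def)
  finally show ?thesis .
qed

lemma inv_act_T_Pi:
  assumes pi: "group_rep GL2 sc action" and v: "v \<in> invariants (Iw1 F) action"
  shows "T_Pi F \<in> Hecke F" "inv_act F sc action v (T_Pi F) = action (matrix_inv (Pi_mat F)) v"
proof -
  let ?w = "rtrans (matrix_inv (Pi_mat F)) (ind_Iw1 F)"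
  have w: "?w \<in> cInd" by (intro cInd_rtrans ind_cInd) simp
  have inv: "rtrans h ?w = ?w" if "h \<in> Iw1 F" for h
  proof -
    let ?P = "Pi_mat F"
    \<comment> \<open>The square of \<open>Pi_mat F\<close> is a scalar, so conjugation by
      \<open>Pi_mat F\<close> and by its inverse coincide.\<close>
    have c: "?P ** h ** matrix_inv ?P = matrix_inv ?P ** h ** ?P"
    proof -
      have "?P ** (?P ** h) = (h ** ?P) ** ?P"
        by (metis Pi_Pi mat_mult_commute matrix_mul_assoc)
      then have "matrix_inv ?P ** (?P ** (?P ** h)) ** matrix_inv ?P = matrix_inv ?P ** ((h ** ?P) ** ?P) ** matrix_inv ?P"
        by simp
      then show ?thesis by (simp add: matrix_mul_assoc)
    qed
    have "rtrans h ?w = rtrans (matrix_inv ?P) (rtrans (?P ** h ** matrix_inv ?P) (ind_Iw1 F))"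
      by (simp add: rtrans_def matrix_mul_assoc)
    then show ?thesis using Pi_conj_Iw1[OF that] by (simp only: c rtrans_Iw1_ind)
  qed
  show "T_Pi F \<in> Hecke F" unfolding T_Pi_def by (rule Hecke_elt(1)[OF w inv])
  have "inv_act F sc action v (T_Pi F) = frob F sc action v ?w"
    unfolding T_Pi_def by (rule inv_act_Hecke_elt[OF w inv])
  then show "inv_act F sc action v (T_Pi F) = action (matrix_inv (Pi_mat F)) v"
    by (simp add: frob[OF pi v] ind_cInd)
qed

lemma inv_act_T_ns:
  fixes sc :: "'k::field \<Rightarrow> 'v::ab_group_add \<Rightarrow> 'v"
  assumes pi: "group_rep GL2 sc action" and v: "v \<in> invariants (Iw1 F) action"
  shows "(T_ns F :: ('f^2^2 \<Rightarrow> 'k) \<Rightarrow> _) \<in> Hecke F"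
    "inv_act F sc action v (T_ns F) = (\<Sum>t\<in>UNIV. action (lift (mat2 1 t 0 1) ** matrix_inv n_s) v)"
proof -
  let ?n = "matrix_inv n_s :: 'f^2^2"
  let ?\<phi> = "\<lambda>u. rtrans (u ** ?n) (ind_Iw1 F :: 'f^2^2 \<Rightarrow> 'k)"
  let ?u = "\<lambda>t. lift (mat2 1 t 0 1)"
  have u: "?u t \<in> K F" "red_mat F (?u t) = mat2 1 t 0 1" for t using lift[of "mat2 1 t 0 1"] by auto
  \<comment> \<open>Elements with the same reduction differ by \<open>K1 F\<close>, which is normal
    in \<open>K F\<close>; moved past the Weyl element, the difference still lies in
    \<open>Iw1 F\<close> and fixes the indicator function.\<close>
  have const: "?\<phi> k = ?\<phi> l" if "k \<in> K F" "l \<in> K F" "red_mat F k = red_mat F l" for k l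
  proof -
    let ?h = "matrix_inv l ** k"
    have "matrix_inv ?n ** ?h ** ?n \<in> Iw1 F" by (intro K1_Iw1 K1_conj inv_n_s_K K1_quotient that)
    moreover have "k ** ?n = l ** ?n ** (matrix_inv ?n ** ?h ** ?n)"
      using K_GL2[OF inv_n_s_K(1)] K_GL2[OF that(2)] by (simp flip: matrix_mul_assoc)
    then have "?\<phi> k = rtrans (l ** ?n) (rtrans (matrix_inv ?n ** ?h ** ?n) (ind_Iw1 F))"
      by (simp add: rtrans_def matrix_mul_assoc)
    ultimately show ?thesis by (simp only: rtrans_Iw1_ind)
  qed
  define w where "w = (\<Sum>t\<in>UNIV. ?\<phi> (?u t))"
  have T: "T_ns F = Hecke_elt F w"
    unfolding T_ns_def w_def using sum_lcosets_K1[of ?\<phi>, OF const] by (rule arg_cong)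
  have mem: "?\<phi> (?u t) \<in> cInd" for t
    using K_GL2[OF u(1)] K_GL2[OF inv_n_s_K(1)] by (intro cInd_rtrans ind_cInd) simp
  have w: "w \<in> cInd" unfolding w_def by (rule cInd_sum) (rule mem)
  have inv: "rtrans h w = w" if h: "h \<in> Iw1 F" for h
  proof -
    obtain t0 where t0: "red_mat F h = mat2 1 t0 0 1" using h by (auto simp: Iw1_def Unip_iff)
    have "rtrans h w x = w x" for x
    proof -
      have ev: "w y = (\<Sum>t\<in>UNIV. ?\<phi> (?u t) y)" for y
      proof -
        have "(\<Sum>t\<in>A. ?\<phi> (?u t)) y = (\<Sum>t\<in>A. ?\<phi> (?u t) y)" if "finite A" for A
          using that by (induction A) simp_all
        from this[OF finite] show ?thesis unfolding w_def .
      qed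
      have "rtrans h w x = (\<Sum>t\<in>UNIV. ?\<phi> (?u t) (x ** h))" by (simp add: rtrans_def ev)
      also have "\<dots> = (\<Sum>t\<in>UNIV. ?\<phi> (h ** ?u t) x)"
        by (simp add: rtrans_def matrix_mul_assoc)
      \<comment> \<open>Multiplication by \<open>h\<close> permutes the cosets of
        \<open>K1 F\<close> in \<open>Iw1 F\<close>; on reductions it is the shift by
        \<open>t0\<close>.\<close>
      also have "\<dots> = (\<Sum>t\<in>UNIV. ?\<phi> (?u (t + t0)) x)"
      proof (rule sum.cong[OF refl])
        fix t
        have "?\<phi> (h ** ?u t) = ?\<phi> (?u (t + t0))"
          using u Iw1_K[OF h] by (intro const) (simp_all add: K_mult red_mat_mult_K t0)
        then show "?\<phi> (h ** ?u t) x = ?\<phi> (?u (t + t0)) x" by simp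
      qed
      also have "\<dots> = (\<Sum>t\<in>UNIV. ?\<phi> (?u t) x)"
        by (rule sum.reindex_bij_witness[of _ "\<lambda>t. t - t0" "\<lambda>t. t + t0"]) simp_all
      finally show ?thesis by (simp add: ev)
    qed
    then show ?thesis by (rule ext)
  qed
  show "(T_ns F :: ('f^2^2 \<Rightarrow> 'k) \<Rightarrow> _) \<in> Hecke F" unfolding T by (rule Hecke_elt(1)[OF w inv])
  have "inv_act F sc action v (T_ns F) = frob F sc action v w"
    unfolding T by (rule inv_act_Hecke_elt[OF w inv])
  also have "\<dots> = (\<Sum>t\<in>UNIV. frob F sc action v (?\<phi> (?u t)))"
    unfolding w_def by (rule frob(5)[OF pi v mem])
  also have "\<dots> = (\<Sum>t\<in>UNIV. action (?u t ** ?n) v)"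
    using K_GL2[OF u(1)] K_GL2[OF inv_n_s_K(1)] by (simp add: frob[OF pi v] ind_cInd)
  finally show "inv_act F sc action v (T_ns F) = (\<Sum>t\<in>UNIV. action (lift (mat2 1 t 0 1) ** matrix_inv n_s) v)" .
qed

text \<open>Reduction followed by the diagonal part is a homomorphism from \<open>Iw F\<close> onto
  \<open>H\<close> with kernel \<open>Iw1 F\<close>.\<close>

lemma Iw1_quotient:
  assumes "k \<in> Iw F" "l \<in> Iw F"
  shows "matrix_inv l ** k \<in> Iw1 F \<longleftrightarrow> diag_part (red_mat F k) = diag_part (red_mat F l)"
proof -
  let ?k = "red_mat F k" and ?l = "red_mat F l"
  have B: "?k \<in> Borel" "?l \<in> Borel" using assms by (simp_all add: Iw_def)
  have d: "diag_part ?l \<in> carrier GL2" using B diag_part_Torus Torus_Borel Borel_GL2 by blast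
  have inv: "diag_part (matrix_inv ?l) = matrix_inv (diag_part ?l)"
  proof (rule matrix_inv_eqI[symmetric])
    show "diag_part ?l ** diag_part (matrix_inv ?l) = mat 1"
      using Borel_GL2[OF B(2)] B(2) by (simp flip: diag_part_mult[OF B(2) Borel_inv[OF B(2)]])
        (simp add: diag_part_conv mat_conv_mat2)
  qed
  have "matrix_inv l ** k \<in> Iw1 F \<longleftrightarrow> matrix_inv ?l ** ?k \<in> Unip"
    using assms Iw_K K_inv by (simp add: Iw1_def K_mult red_mat_mult_K red_mat_inv)
  also have "\<dots> \<longleftrightarrow> matrix_inv (diag_part ?l) ** diag_part ?k = mat 1"
    using B by (simp add: Borel_mult Borel_inv diag_part_mult inv flip: diag_part_one_iff)
  also have "\<dots> \<longleftrightarrow> diag_part ?k = diag_part ?l"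
    using d by (metis GL2_cancel(2) GL2_inv(1) matrix_mul_rid)
  finally show ?thesis .
qed

lemma lift_Borel: "b \<in> Borel \<Longrightarrow> lift b \<in> Iw F \<and> red_mat F (lift b) = b"
  using lift[of b] by (simp add: Iw_def Borel_GL2)

lemma lcosets_Iw1: "bij_betw (\<lambda>d. {k \<in> Iw F. diag_part (red_mat F k) = d}) Torus (lcosets (Iw F) (Iw1 F))"
proof (rule bij_betw_imageI)
  show "inj_on (\<lambda>d. {k \<in> Iw F. diag_part (red_mat F k) = d}) Torus"
  proof (rule inj_onI)
    fix g h :: "'q^2^2"
    assume g: "g \<in> Torus" and "{k \<in> Iw F. diag_part (red_mat F k) = g} = {k \<in> Iw F. diag_part (red_mat F k) = h}"
    moreover have "lift g \<in> Iw F \<and> diag_part (red_mat F (lift g)) = g"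
      using lift_Borel[OF Torus_Borel[OF g]] diag_part_Torus(2)[OF g] by simp
    ultimately show "g = h" by auto
  qed
  have fibre: "{k \<in> Iw F. diag_part (red_mat F k) = diag_part (red_mat F a)} = {a ** n | n. n \<in> Iw1 F}"
    if a: "a \<in> Iw F" for a
  proof (intro Set.set_eqI iffI)
    fix k assume "k \<in> {k \<in> Iw F. diag_part (red_mat F k) = diag_part (red_mat F a)}"
    then show "k \<in> {a ** n | n. n \<in> Iw1 F}" using Iw1_quotient[of k a] a K_GL2[OF Iw_K[OF a]]
      by (intro CollectI exI[of _ "matrix_inv a ** k"]) auto
  next
    fix k assume "k \<in> {a ** n | n. n \<in> Iw1 F}"
    then obtain n where n: "n \<in> Iw1 F" "k = a ** n" by blast
    then have "k \<in> Iw F" using a Iw1_Iw Iw_mult by blast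
    then show "k \<in> {k \<in> Iw F. diag_part (red_mat F k) = diag_part (red_mat F a)}"
      using Iw1_quotient[of k a] a n K_GL2[OF Iw_K[OF a]] by simp
  qed
  show "(\<lambda>d. {k \<in> Iw F. diag_part (red_mat F k) = d}) ` Torus = lcosets (Iw F) (Iw1 F)"
  proof (intro Set.set_eqI iffI)
    fix X assume "X \<in> (\<lambda>d. {k \<in> Iw F. diag_part (red_mat F k) = d}) ` Torus"
    then obtain g where g: "g \<in> Torus" "X = {k \<in> Iw F. diag_part (red_mat F k) = g}" by blast
    have "lift g \<in> Iw F" "diag_part (red_mat F (lift g)) = g"
      using lift_Borel[OF Torus_Borel[OF g(1)]] diag_part_Torus(2)[OF g(1)] by simp_all
    then show "X \<in> lcosets (Iw F) (Iw1 F)" using fibre[of "lift g"] g unfolding lcosets_def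
      by (intro CollectI exI[of _ "lift g"]) simp
  next
    fix X assume "X \<in> lcosets (Iw F) (Iw1 F)"
    then obtain a where a: "a \<in> Iw F" "X = {a ** n | n. n \<in> Iw1 F}" by (auto simp: lcosets_def)
    then show "X \<in> (\<lambda>d. {k \<in> Iw F. diag_part (red_mat F k) = d}) ` Torus" using fibre[of a]
      by (intro image_eqI[of _ _ "diag_part (red_mat F a)"]) (auto simp: Iw_def diag_part_Torus)
  qed
qed

lemma inv_act_e_chi:
  fixes sc :: "'k::field \<Rightarrow> 'v::ab_group_add \<Rightarrow> 'v" and chi :: "'q^2^2 \<Rightarrow> 'k"
  assumes pi: "group_rep GL2 sc action" and v: "v \<in> invariants (Iw1 F) action"
  shows "e_chi F chi \<in> Hecke F"
    "inv_act F sc action v (e_chi F chi) = sc (inverse (of_nat (card (Torus :: ('q^2^2) set))))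
       (\<Sum>d\<in>Torus. sc (inverse (chi d)) (action (lift d) v))"
proof -
  let ?\<phi> = "\<lambda>h. fun_scale (*) (inverse (chi (diag_part (red_mat F h)))) (rtrans h (ind_Iw1 F) :: 'f^2^2 \<Rightarrow> 'k)"
  let ?D = "\<lambda>d. {k \<in> Iw F. diag_part (red_mat F k) = d}"
  have const: "?\<phi> k = ?\<phi> l"
    if "k \<in> Iw F" "l \<in> Iw F" "diag_part (red_mat F k) = diag_part (red_mat F l)" for k l
  proof -
    have "matrix_inv l ** k \<in> Iw1 F" using Iw1_quotient that by blast
    moreover have "rtrans k (ind_Iw1 F) = rtrans l (rtrans (matrix_inv l ** k) (ind_Iw1 F :: 'f^2^2 \<Rightarrow> 'k))"
      using K_GL2[OF Iw_K[OF that(2)]] by (simp add: rtrans_def matrix_mul_assoc)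
    ultimately show ?thesis using that by (simp add: rtrans_Iw1_ind)
  qed
  have d: "lift d \<in> Iw F" "diag_part (red_mat F (lift d)) = d" "(SOME h. h \<in> ?D d) \<in> ?D d" if "d \<in> Torus" for d
  proof -
    show *: "lift d \<in> Iw F" "diag_part (red_mat F (lift d)) = d"
      using lift_Borel[OF Torus_Borel[OF that]] diag_part_Torus(2)[OF that] by simp_all
    then have "lift d \<in> ?D d" by simp
    then show "(SOME h. h \<in> ?D d) \<in> ?D d" by (rule someI[of "\<lambda>h. h \<in> ?D d"])
  qed
  let ?c = "inverse (of_nat (card (Torus :: ('q^2^2) set))) :: 'k"
  define w0 where "w0 = (\<Sum>d\<in>Torus. ?\<phi> (lift d))"
  define w where "w = fun_scale (*) ?c w0"
  have "(\<Sum>C\<in>lcosets (Iw F) (Iw1 F). ?\<phi> (SOME h. h \<in> C)) = (\<Sum>d\<in>Torus. ?\<phi> (SOME h. h \<in> ?D d))"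
    by (rule sum.reindex_bij_betw[OF lcosets_Iw1, symmetric])
  also have "\<dots> = w0" unfolding w0_def
  proof (rule sum.cong[OF refl])
    fix e :: "'q^2^2" assume e: "e \<in> Torus"
    show "?\<phi> (SOME h. h \<in> ?D e) = ?\<phi> (lift e)"
      using d(3)[OF e] d(1,2)[OF e] by (intro const) auto
  qed
  finally have T: "e_chi F chi = Hecke_elt F w" unfolding e_chi_def w_def Let_def by (rule arg_cong)
  have mem0: "rtrans (lift e) (ind_Iw1 F :: 'f^2^2 \<Rightarrow> 'k) \<in> cInd" if "e \<in> Torus" for e
    using K_GL2[OF Iw_K[OF d(1)[OF that]]] by (intro cInd_rtrans ind_cInd)
  have mem: "?\<phi> (lift e) \<in> cInd" if "e \<in> Torus" for e
    by (intro cInd_scale mem0 that)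
  have w0: "w0 \<in> cInd" unfolding w0_def by (rule cInd_sum) (rule mem)
  then have w: "w \<in> cInd" unfolding w_def by (rule cInd_scale)
  have inv: "rtrans h w = w" if h: "h \<in> Iw1 F" for h
  proof -
    \<comment> \<open>Multiplying a lift by \<open>h\<close> does not change its diagonal part
      modulo the maximal ideal, so each term is already invariant.\<close>
    have t: "rtrans h (?\<phi> (lift e)) = ?\<phi> (lift e)" if e: "e \<in> Torus" for e
    proof -
      let ?l = "lift e"
      have B: "e \<in> Borel" "red_mat F ?l = e" using lift_Borel[of e] Torus_Borel[OF e] by auto
      have rh: "red_mat F h \<in> Borel" "diag_part (red_mat F h) = mat 1"
        using h by (auto simp: Iw1_def Unip_Borel diag_part_one_iff)
      have "diag_part (red_mat F (h ** ?l)) = diag_part (red_mat F ?l)"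
        using Iw1_K[OF h] Iw_K[OF d(1)[OF e]] B rh by (simp add: red_mat_mult_K diag_part_mult)
      then have "?\<phi> (h ** ?l) = ?\<phi> ?l" using Iw1_Iw[OF h] d(1)[OF e] by (intro const Iw_mult)
      moreover have "rtrans h (?\<phi> ?l) = ?\<phi> (h ** ?l)"
        using \<open>diag_part (red_mat F (h ** ?l)) = diag_part (red_mat F ?l)\<close>
        by (simp add: rtrans_def fun_scale_def matrix_mul_assoc)
      ultimately show ?thesis by simp
    qed
    have "rtrans h (\<Sum>e\<in>A. ?\<phi> (lift e)) = (\<Sum>e\<in>A. rtrans h (?\<phi> (lift e)))" if "finite A" for A
      using that
    proof (induction A)
      case (insert x A)
      have "rtrans h (?\<phi> (lift x) + (\<Sum>e\<in>A. ?\<phi> (lift e))) = rtrans h (?\<phi> (lift x)) + rtrans h (\<Sum>e\<in>A. ?\<phi> (lift e))"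
        by (simp add: rtrans_def fun_eq_iff)
      then show ?case unfolding sum.insert[OF insert(1,2)] insert.IH .
    qed (simp add: rtrans_def fun_eq_iff)
    from this[OF finite] have "rtrans h w0 = (\<Sum>e\<in>Torus. rtrans h (?\<phi> (lift e)))" unfolding w0_def .
    also have "\<dots> = w0" unfolding w0_def by (intro sum.cong refl t)
    finally have "rtrans h w0 = w0" .
    moreover have "rtrans h w = fun_scale (*) ?c (rtrans h w0)" by (simp add: w_def rtrans_def fun_scale_def)
    ultimately show ?thesis by (simp add: w_def)
  qed
  show "e_chi F chi \<in> Hecke F" unfolding T by (rule Hecke_elt(1)[OF w inv])
  have "inv_act F sc action v (e_chi F chi) = frob F sc action v w"
    unfolding T by (rule inv_act_Hecke_elt[OF w inv])
  also have "\<dots> = sc ?c (frob F sc action v w0)" unfolding w_def by (rule frob(3)[OF pi v w0])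
  also have "frob F sc action v w0 = (\<Sum>e\<in>Torus. frob F sc action v (?\<phi> (lift e)))"
    unfolding w0_def by (rule frob(5)[OF pi v mem])
  also have "\<dots> = (\<Sum>e\<in>Torus. sc (inverse (chi e)) (action (lift e) v))"
    using K_GL2[OF Iw_K[OF d(1)]]
    by (intro sum.cong refl) (simp add: frob(1,3,4)[OF pi v] ind_cInd d(2) mem0)
  finally show "inv_act F sc action v (e_chi F chi) =
      sc ?c (\<Sum>d\<in>Torus. sc (inverse (chi d)) (action (lift d) v))" .
qed

end

section \<open>Representations of the finite group\<close>

lemma char_finite_field:
  "prime CHAR('q::{field,finite})" "of_nat CARD('q) = (0 :: 'q)"
proof -
  show "prime CHAR('q)" by (rule prime_CHAR_semidom) (simp add: finite_imp_CHAR_pos)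
  \<comment> \<open>Translation by 1 permutes the field, so the sum of the constant 1 over all its
    elements vanishes.\<close>
  have "(\<Sum>x\<in>(UNIV :: 'q set). x) = (\<Sum>x\<in>UNIV. x + 1)"
    by (rule sum.reindex_bij_witness[of _ "\<lambda>x. x + 1" "\<lambda>x. x - 1"]) simp_all
  then show "of_nat CARD('q) = (0 :: 'q)" by (simp add: sum.distrib)
qed

text \<open>The unipotent elements, the inverse of the Weyl element \<open>n_s\<close>, and the
  diagonal matrices.\<close>

abbreviation "um t \<equiv> mat2 1 t 0 1"
abbreviation "nm \<equiv> mat2 0 1 (-1) 0"
abbreviation "dg a b \<equiv> mat2 a 0 0 b"

lemma bruhat:
  fixes g :: "'q::field^2^2"
  assumes "g \<in> carrier GL2"
  shows "g \<in> Borel \<or> (\<exists>t b. b \<in> Borel \<and> g = um t ** nm ** b)"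
proof (cases "g$2$1 = 0")
  case False
  \<comment> \<open>The parameter \<open>g$1$1 / g$2$1\<close> is the one for which the inverse of
    \<open>um t ** nm\<close>, multiplied by \<open>g\<close>, is upper triangular;
    \<open>?b\<close> is that product.\<close>
  let ?b = "mat2 (- g$2$1) (- g$2$2) 0 (g$1$2 - g$1$1 * g$2$2 / g$2$1)"
  have "g = um (g$1$1 / g$2$1) ** nm ** ?b" using False by (simp add: mat_eq2_iff)
  moreover have "g$1$2 - g$1$1 * g$2$2 / g$2$1 \<noteq> 0"
  proof
    assume "g$1$2 - g$1$1 * g$2$2 / g$2$1 = 0"
    then have "det g = 0" using False by (simp add: det_2 field_simps)
    with assms show False by (simp add: GL2_iff)
  qed
  then have "?b \<in> Borel" using False by (simp add: Borel_iff)
  ultimately show ?thesis by blast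
qed (use assms in \<open>simp add: Borel_def\<close>)

lemma Borel_decomp: "b \<in> Borel \<Longrightarrow> b = um (b$1$2 / b$2$2) ** dg (b$1$1) (b$2$2)"
  by (simp add: mat_eq2_iff Borel_iff)

text \<open>The carrier \<open>W\<close> is a subspace so that the locale covers both an irreducible
  representation on a whole type and the invariants of \<open>K1 F\<close> inside a larger
  representation. The equality of characteristics makes q = 0 and q - 1 = -1 available in the
  coefficients.\<close>

locale gl2_rep = vector_space sc
  for sc :: "'k::field \<Rightarrow> 'v::ab_group_add \<Rightarrow> 'v" +
  fixes W :: "'v set" and act :: "'q::{field,finite}^2^2 \<Rightarrow> 'v \<Rightarrow> 'v"
  assumes char_eq: "CHAR('k) = CHAR('q)"
    and W_subspace: "subspace W"
    and act_closed: "g \<in> carrier GL2 \<Longrightarrow> v \<in> W \<Longrightarrow> act g v \<in> W"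
    and act_add: "g \<in> carrier GL2 \<Longrightarrow> v \<in> W \<Longrightarrow> w \<in> W \<Longrightarrow> act g (v + w) = act g v + act g w"
    and act_scale: "g \<in> carrier GL2 \<Longrightarrow> v \<in> W \<Longrightarrow> act g (sc c v) = sc c (act g v)"
    and act_one: "v \<in> W \<Longrightarrow> act (mat 1) v = v"
    and act_mult: "g \<in> carrier GL2 \<Longrightarrow> h \<in> carrier GL2 \<Longrightarrow> v \<in> W \<Longrightarrow> act (g ** h) v = act g (act h v)"
begin

lemma W_0 [simp]: "0 \<in> W" and W_add: "v \<in> W \<Longrightarrow> w \<in> W \<Longrightarrow> v + w \<in> W"
  and W_scale: "v \<in> W \<Longrightarrow> sc c v \<in> W" and W_sum: "(\<And>x. x \<in> A \<Longrightarrow> f x \<in> W) \<Longrightarrow> sum f A \<in> W"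
  and W_diff: "v \<in> W \<Longrightarrow> w \<in> W \<Longrightarrow> v - w \<in> W" and W_neg: "v \<in> W \<Longrightarrow> - v \<in> W"
  using W_subspace
  by (auto simp: subspace_0 subspace_add subspace_scale subspace_sum subspace_diff subspace_neg)

lemma act_0 [simp]: "g \<in> carrier GL2 \<Longrightarrow> act g 0 = 0"
  using act_scale[of g 0 0] by simp

lemma act_neg: "g \<in> carrier GL2 \<Longrightarrow> v \<in> W \<Longrightarrow> act g (- v) = - act g v"
  using act_scale[of g v "-1"] by simp

lemma act_diff: "g \<in> carrier GL2 \<Longrightarrow> v \<in> W \<Longrightarrow> w \<in> W \<Longrightarrow> act g (v - w) = act g v - act g w"
  using act_add[of g v "- w"] by (simp add: act_neg W_neg)

lemma act_sum: "g \<in> carrier GL2 \<Longrightarrow> (\<And>x. x \<in> A \<Longrightarrow> f x \<in> W) \<Longrightarrow> act g (sum f A) = (\<Sum>x\<in>A. act g (f x))"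
  by (induction A rule: infinite_finite_induct) (simp_all add: act_add W_sum)

lemma card_zero: "of_nat CARD('q) = (0 :: 'k)"
  using char_finite_field(2)[where 'q = 'q] by (simp add: of_nat_eq_0_iff_char_dvd char_eq)

lemma card_units: "of_nat (card (- {0 :: 'q})) = (-1 :: 'k)"
proof -
  have "card (- {0 :: 'q}) = CARD('q) - 1" by (simp add: card_Diff_singleton Compl_eq_Diff_UNIV)
  moreover have "CARD('q) \<ge> 1" by (simp add: Suc_leI One_nat_def)
  ultimately show ?thesis by (simp add: of_nat_diff card_zero)
qed

definition gen :: "'v \<Rightarrow> 'v set" where "gen w = span {act g w | g. g \<in> carrier GL2}"

text \<open>The operator \<open>T_ns\<close> as seen by the finite group; on invariants of
  \<open>Iw1 F\<close> the two coincide.\<close>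

definition Tn :: "'v \<Rightarrow> 'v" where "Tn v = (\<Sum>t\<in>UNIV. act (um t) (act nm v))"

definition U_inv :: "'v \<Rightarrow> bool" where "U_inv v \<longleftrightarrow> (\<forall>t. act (um t) v = v)"

definition weight :: "('q^2^2 \<Rightarrow> 'k) \<Rightarrow> 'v \<Rightarrow> bool" where
  "weight chi v \<longleftrightarrow> (\<forall>d\<in>Torus. act d v = sc (chi d) v)"

definition B_eigen :: "('q^2^2 \<Rightarrow> 'k) \<Rightarrow> 'v \<Rightarrow> bool" where
  "B_eigen chi v \<longleftrightarrow> (\<forall>b\<in>Borel. act b v = sc (chi (diag_part b)) v)"

lemma gen_W: "w \<in> W \<Longrightarrow> gen w \<subseteq> W"
  unfolding gen_def by (rule span_minimal[OF _ W_subspace]) (auto simp: act_closed)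

lemma gen_subspace: "subspace (gen w)" by (simp add: gen_def)

lemma gen_act_self: "g \<in> carrier GL2 \<Longrightarrow> act g w \<in> gen w"
  unfolding gen_def by (rule span_base) auto

lemma gen_self: "w \<in> W \<Longrightarrow> w \<in> gen w"
  using gen_act_self[of "mat 1" w] by (simp add: act_one)

lemma gen_stable:
  assumes w: "w \<in> W" and g: "g \<in> carrier GL2" and v: "v \<in> gen w"
  shows "act g v \<in> gen w"
proof -
  have "gen w \<subseteq> {v \<in> W. act g v \<in> gen w}" unfolding gen_def[of w]
  proof (rule span_minimal)
    show "{act g w | g. g \<in> carrier GL2} \<subseteq> {v \<in> W. act g v \<in> span {act g w | g. g \<in> carrier GL2}}"
      using gen_act_self[of "g ** _" w] g w by (auto simp: act_closed act_mult[symmetric] simp flip: gen_def)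
    show "subspace {v \<in> W. act g v \<in> span {act g w | g. g \<in> carrier GL2}}"
      using W_subspace g by (auto simp: subspace_def act_add act_scale intro: span_add span_scale span_zero)
  qed
  with v show ?thesis by blast
qed

lemma B_eigen_iff: "v \<in> W \<Longrightarrow> chi (mat 1) = 1 \<Longrightarrow> B_eigen chi v \<longleftrightarrow> weight chi v \<and> U_inv v"
proof
  assume "chi (mat 1) = 1" "B_eigen chi v"
  moreover have "um t \<in> Borel" "diag_part (um t) = (mat 1 :: 'q^2^2)" for t :: 'q
    by (simp_all add: Borel_iff diag_part_conv mat_conv_mat2)
  ultimately show "weight chi v \<and> U_inv v"
    by (auto simp: B_eigen_def weight_def U_inv_def Torus_Borel diag_part_Torus)
next
  assume v: "v \<in> W" and a: "weight chi v \<and> U_inv v"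
  show "B_eigen chi v" unfolding B_eigen_def
  proof
    fix b :: "'q^2^2" assume b: "b \<in> Borel"
    have d: "diag_part b \<in> Torus" using b by (rule diag_part_Torus)
    have "act b v = act (um (b$1$2 / b$2$2)) (act (diag_part b) v)"
      using v Borel_decomp[OF b] d Borel_GL2[OF Torus_Borel[OF d]]
      by (simp flip: act_mult add: diag_part_conv[symmetric])
    then show "act b v = sc (chi (diag_part b)) v"
      using a d v by (simp add: weight_def U_inv_def act_scale)
  qed
qed

text \<open>By the Bruhat decomposition a group element acts on a \<open>B\<close>-eigenvector
  either by a scalar or, up to a scalar, as \<open>um t ** nm\<close>.\<close>

lemma gen_B_eigen:
  assumes w: "w \<in> W" and B: "B_eigen chi w"
  shows "gen w \<subseteq> span (insert w (range (\<lambda>t. act (um t) (act nm w))))" (is "_ \<subseteq> span ?S")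
  unfolding gen_def
proof (rule span_minimal)
  show "{act g w | g. g \<in> carrier GL2} \<subseteq> span ?S"
  proof clarify
    fix g :: "'q^2^2" assume "g \<in> carrier GL2"
    then consider "g \<in> Borel" | t b where "b \<in> Borel" "g = um t ** nm ** b" using bruhat by blast
    then show "act g w \<in> span ?S"
    proof cases
      case 1
      then show ?thesis using B by (auto simp: B_eigen_def intro: span_scale span_base)
    next
      case 2
      then have "act g w = act (um t) (act nm (act b w))"
        using w Borel_GL2[of b] by (simp add: act_mult act_closed del: mat2_mult)
      also have "\<dots> = act (um t) (act nm (sc (chi (diag_part b)) w))"
        using B 2 by (simp add: B_eigen_def)
      finally have "act g w = act (um t) (act nm (sc (chi (diag_part b)) w))" .
      then have "act g w = sc (chi (diag_part b)) (act (um t) (act nm w))"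
        using w by (simp add: act_scale act_closed)
      then show ?thesis by (simp add: span_scale span_base)
    qed
  qed
qed simp

lemma Tn_scale: "v \<in> W \<Longrightarrow> Tn (sc c v) = sc c (Tn v)"
  by (simp add: Tn_def act_scale act_closed scale_sum_right)

lemma Tn_U_inv: "v \<in> W \<Longrightarrow> U_inv (Tn v)"
  unfolding U_inv_def
proof
  fix t assume v: "v \<in> W"
  have "act (um t) (Tn v) = (\<Sum>s\<in>UNIV. act (um (s + t)) (act nm v))"
    using v unfolding Tn_def by (simp add: act_sum act_closed act_mult[symmetric])
  also have "\<dots> = Tn v" unfolding Tn_def
    by (rule sum.reindex_bij_witness[of _ "\<lambda>s. s - t" "\<lambda>s. s + t"]) simp_all
  finally show "act (um t) (Tn v) = Tn v" .
qed

lemma act_dg_um_nm: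
  assumes v: "v \<in> W" and a: "a \<noteq> 0" "b \<noteq> 0"
  shows "act (dg a b) (act (um t) (act nm v)) = act (um (a * t / b)) (act nm (act (dg b a) v))"
proof -
  have "dg a b ** um t ** nm = um (a * t / b) ** nm ** dg b a"
    using a by simp
  then show ?thesis using v a by (simp flip: act_mult add: act_closed del: mat2_mult)
      (simp only: matrix_mul_assoc)
qed

text \<open>Moving \<open>dg a b\<close> past \<open>um t\<close> and \<open>nm\<close> turns it
  into \<open>dg b a\<close> acting on \<open>v\<close>, while \<open>t\<close> is only rescaled,
  which permutes the summands.\<close>

lemma Tn_weight:
  assumes v: "v \<in> W" and wt: "weight chi v" shows "weight (conj_s chi) (Tn v)"
  unfolding weight_def
proof
  fix d :: "'q^2^2" assume "d \<in> Torus"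
  then obtain a b where ab: "a \<noteq> 0" "b \<noteq> 0" "d = dg a b" by (auto simp: Torus_iff)
  have dba: "dg b a \<in> Torus" using ab by (auto simp: Torus_iff)
  have "act d (Tn v) = (\<Sum>t\<in>UNIV. act (um (a * t / b)) (act nm (act (dg b a) v)))"
    using v ab by (simp add: Tn_def act_sum act_closed act_dg_um_nm)
  also have "\<dots> = (\<Sum>t\<in>UNIV. act (um t) (act nm (act (dg b a) v)))"
    by (rule sum.reindex_bij_witness[of _ "\<lambda>t. b * t / a" "\<lambda>t. a * t / b"]) (use ab in simp_all)
  also have "\<dots> = Tn (sc (chi (dg b a)) v)" using wt dba by (simp add: Tn_def weight_def)
  finally show "act d (Tn v) = sc (conj_s chi d) (Tn v)"
    using v ab by (simp add: Tn_scale conj_s_mat2)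
qed

text \<open>Apply \<open>n\<close> to \<open>T w = 0\<close> and rewrite \<open>n u(t) n = u(-1/t) n b\<close> with \<open>b\<close> upper triangular.\<close>

lemma nm_Tn:
  assumes w: "w \<in> W" and B: "B_eigen chi w" and T: "Tn w = 0"
  shows "(\<Sum>a\<in>-{0}. sc (chi (dg (inverse a) a)) (act (um a) (act nm w))) = - sc (chi (dg (-1) (-1))) w"
proof -
  let ?f = "\<lambda>t. act nm (act (um t) (act nm w))"
  let ?g = "\<lambda>a. sc (chi (dg (inverse a) a)) (act (um a) (act nm w))"
  have "0 = act nm (Tn w)" using T by simp
  also have "\<dots> = (\<Sum>t\<in>UNIV. ?f t)" using w unfolding Tn_def by (simp add: act_sum act_closed)
  also have "\<dots> = ?f 0 + (\<Sum>t\<in>-{0}. ?f t)"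
    using sum.remove[of UNIV 0 ?f] by (simp add: Compl_eq_Diff_UNIV)
  \<comment> \<open>The square of \<open>nm\<close> is minus the identity; this is where the value
    of chi at \<open>dg (-1) (-1)\<close> comes from.\<close>
  also have "?f 0 = sc (chi (dg (-1) (-1))) w"
  proof -
    have "?f 0 = act (dg (-1) (-1)) w" using w by (simp add: act_mult[symmetric] act_closed)
    moreover have "dg (-1) (-1 :: 'q) \<in> Borel" "diag_part (dg (-1) (-1 :: 'q)) = dg (-1) (-1)"
      by (simp_all add: Borel_iff diag_part_conv)
    ultimately show ?thesis using B by (simp add: B_eigen_def)
  qed
  also have "(\<Sum>t\<in>-{0}. ?f t) = (\<Sum>a\<in>-{0}. ?g a)"
  proof (rule sum.reindex_bij_witness[of _ "\<lambda>a. - inverse a" "\<lambda>t. - inverse t"])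
    fix t :: 'q assume t: "t \<in> -{0}"
    let ?b = "mat2 (- t) 1 0 (- inverse t)"
    have b: "?b \<in> Borel" "diag_part ?b = dg (- t) (- inverse t)" using t by (simp_all add: Borel_iff diag_part_conv)
    have eq: "nm ** (um t ** nm) = um (- inverse t) ** (nm ** ?b)" using t by simp
    have "?f t = act (nm ** (um t ** nm)) w" using w by (simp add: act_mult act_closed del: mat2_mult)
    also have "\<dots> = act (um (- inverse t)) (act nm (act ?b w))"
      unfolding eq using w t by (simp add: act_mult act_closed del: mat2_mult)
    also have "\<dots> = ?g (- inverse t)"
      using B b w by (simp add: B_eigen_def act_scale act_closed)
    finally show "?g (- inverse t) = ?f t" by simp
  qed auto
  finally show ?thesis by (simp add: eq_neg_iff_add_eq_0 add.commute)
qed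

section \<open>Characters of the torus and projections onto their eigenspaces\<close>

lemma torus_charD:
  assumes "torus_char (chi :: 'q^2^2 \<Rightarrow> 'k)"
  shows "a \<noteq> 0 \<Longrightarrow> b \<noteq> 0 \<Longrightarrow> chi (dg a b) \<noteq> 0"
    "a \<noteq> 0 \<Longrightarrow> b \<noteq> 0 \<Longrightarrow> c \<noteq> 0 \<Longrightarrow> d \<noteq> 0 \<Longrightarrow> chi (dg (a * c) (b * d)) = chi (dg a b) * chi (dg c d)"
    "chi (dg 1 1) = 1" "chi (mat 1) = 1"
proof -
  have h: "chi x \<noteq> 0" "y \<in> Torus \<Longrightarrow> chi (x ** y) = chi x * chi y" if "x \<in> Torus" for x y
    using assms that by (auto simp: torus_char_def hom_def units_group_def GL2_def)
  show nz: "chi (dg a b) \<noteq> 0" if "a \<noteq> 0" "b \<noteq> 0" for a b using that by (intro h) (auto simp: Torus_iff)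
  show m: "chi (dg (a * c) (b * d)) = chi (dg a b) * chi (dg c d)"
    if "a \<noteq> 0" "b \<noteq> 0" "c \<noteq> 0" "d \<noteq> 0" for a b c d
    using h(2)[of "dg a b" "dg c d"] that by (auto simp: Torus_iff)
  show one: "chi (dg 1 1) = 1" using m[of 1 1 1 1] nz[of 1 1] by simp
  then show "chi (mat 1) = 1" by (simp add: mat_conv_mat2)
qed

text \<open>A character of the torus is a product of a function of each diagonal entry. If it
  differs from its conjugate, the two factors differ, so the one-parameter subgroup of the matrices
  \<open>dg a 1\<close> already separates the two weights.\<close>

lemma not_s_invariantE:
  assumes chi: "torus_char (chi :: 'q^2^2 \<Rightarrow> 'k)" and ns: "\<not> s_invariant chi"
  obtains a where "a \<noteq> 0" "chi (dg a 1) \<noteq> chi (dg 1 a)"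
proof -
  obtain h where "h \<in> Torus" "chi h \<noteq> conj_s chi h" using ns by (auto simp: s_invariant_def)
  then obtain a b where ab: "a \<noteq> 0" "b \<noteq> 0" "chi (dg a b) \<noteq> chi (dg b a)"
    by (auto simp: Torus_iff conj_s_mat2)
  have "chi (dg a b) = chi (dg a 1) * chi (dg 1 b)" "chi (dg b a) = chi (dg 1 a) * chi (dg b 1)"
    using torus_charD(2)[OF chi, of a 1 1 b] torus_charD(2)[OF chi, of 1 a b 1] ab by simp_all
  then have "chi (dg a 1) \<noteq> chi (dg 1 a) \<or> chi (dg b 1) \<noteq> chi (dg 1 b)" using ab by auto
  then show thesis using that ab by blast
qed

lemma orthogonality:
  assumes m: "\<And>a b. a \<noteq> 0 \<Longrightarrow> b \<noteq> 0 \<Longrightarrow> \<psi> (a * b) = \<psi> a * \<psi> b" and a: "a \<noteq> (0 :: 'q)" "\<psi> a \<noteq> 1"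
  shows "(\<Sum>x\<in>-{0}. \<psi> x) = (0 :: 'k)"
proof -
  have "(\<Sum>x\<in>-{0}. \<psi> x) = (\<Sum>x\<in>-{0}. \<psi> (a * x))"
    by (rule sum.reindex_bij_witness[of _ "\<lambda>x. a * x" "\<lambda>x. x / a"]) (use a in auto)
  also have "\<dots> = \<psi> a * (\<Sum>x\<in>-{0}. \<psi> x)" using m a by (simp add: sum_distrib_left)
  finally show ?thesis using a by simp
qed

text \<open>The sign is the inverse of the order \<open>q - 1 = -1\<close> of the group of matrices \<open>diag(a, 1)\<close>.\<close>

definition proj :: "('q \<Rightarrow> 'k) \<Rightarrow> 'v \<Rightarrow> 'v" where
  "proj \<psi> v = - (\<Sum>a\<in>-{0}. sc (inverse (\<psi> a)) (act (dg a 1) v))"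

lemma proj_eq:
  assumes "\<And>a. a \<noteq> 0 \<Longrightarrow> act (dg a 1) v = sc (\<psi>' a) v"
  shows "proj \<psi> v = - sc (\<Sum>a\<in>-{0}. inverse (\<psi> a) * \<psi>' a) v"
  unfolding proj_def using assms by (simp add: scale_sum_left)

lemma proj_id:
  assumes "\<And>a. a \<noteq> 0 \<Longrightarrow> act (dg a 1) v = sc (\<psi> a) v" "\<And>a. a \<noteq> 0 \<Longrightarrow> \<psi> a \<noteq> 0"
  shows "proj \<psi> v = v"
proof -
  have "(\<Sum>a\<in>-{0}. inverse (\<psi> a) * \<psi> a) = (\<Sum>a\<in>-{0 :: 'q}. 1)" using assms by (intro sum.cong) auto
  then show ?thesis using proj_eq[of v \<psi>, OF assms(1)] card_units by simp
qed

lemma proj_span_le: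
  assumes S: "S \<subseteq> W" "\<And>x. x \<in> S \<Longrightarrow> proj \<psi> x \<in> span R" and v: "v \<in> span S"
  shows "proj \<psi> v \<in> span R"
proof -
  have "span S \<subseteq> {v \<in> W. proj \<psi> v \<in> span R}"
  proof (rule span_minimal)
    have add: "proj \<psi> (v + w) = proj \<psi> v + proj \<psi> w" if "v \<in> W" "w \<in> W" for v w
      using that by (simp add: proj_def act_add scale_right_distrib sum.distrib)
    have scale: "proj \<psi> (sc c v) = sc c (proj \<psi> v)" if "v \<in> W" for c v
    proof -
      have "proj \<psi> (sc c v) = - (\<Sum>a\<in>-{0}. sc c (sc (inverse (\<psi> a)) (act (dg a 1) v)))"
        unfolding proj_def using that by (intro arg_cong[where f = uminus] sum.cong) (simp_all add: act_scale mult.commute)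
      then show ?thesis by (simp only: proj_def scale_sum_right scale_minus_right)
    qed
    show "subspace {v \<in> W. proj \<psi> v \<in> span R}"
      using W_subspace by (auto simp: subspace_def add scale intro: span_add span_scale)
        (simp add: proj_def span_zero)
  qed (use S in blast)
  with v show ?thesis by blast
qed

text \<open>On the spanning set of \<open>gen w\<close> from \<open>gen_B_eigen\<close>, the
  projection for \<open>\<psi>1\<close> lands in the line of \<open>w\<close> by
  \<open>nm_Tn\<close>, and the one for \<open>\<psi>2\<close> in the line of
  \<open>act nm w\<close> because \<open>Tn w = 0\<close>. Applied to \<open>v\<close>, the first
  gives that \<open>x\<close> is a multiple of \<open>w\<close>. Then \<open>y\<close> lies in
  \<open>gen w\<close>, is \<open>U\<close>-invariant, and is a multiple of \<open>act nm w\<close>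
  by the second. Were \<open>y\<close> nonzero, \<open>act nm w\<close> would be
  \<open>U\<close>-invariant, so orthogonality would make the sum in \<open>nm_Tn\<close> vanish,
  and with it \<open>w\<close>.\<close>

lemma gen_U_inv:
  assumes chi: "torus_char chi" "\<not> s_invariant chi"
    and w: "w \<in> W" "B_eigen chi w" "Tn w = 0"
    and v: "v \<in> gen w" "U_inv v" "v = x + y" "x \<in> W" "y \<in> W" "weight chi x" "weight (conj_s chi) y"
  shows "v \<in> span {w}"
proof -
  define \<psi>1 \<psi>2 where "\<psi>1 a = chi (dg a 1)" and "\<psi>2 a = chi (dg 1 a)" for a
  have nz: "\<psi>1 a \<noteq> 0" "\<psi>2 a \<noteq> 0" if "a \<noteq> 0" for a
    using torus_charD(1)[OF chi(1)] that by (simp_all add: \<psi>1_def \<psi>2_def)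
  have mult: "\<psi>1 (a * b) = \<psi>1 a * \<psi>1 b" "\<psi>2 (a * b) = \<psi>2 a * \<psi>2 b" if "a \<noteq> 0" "b \<noteq> 0" for a b
    using torus_charD(2)[OF chi(1), of a 1 b 1] torus_charD(2)[OF chi(1), of 1 a 1 b] that
    by (simp_all add: \<psi>1_def \<psi>2_def)
  have one: "\<psi>1 1 = 1" using torus_charD(3)[OF chi(1)] by (simp add: \<psi>1_def)
  have inv1: "\<psi>1 (inverse a) = inverse (\<psi>1 a)" if "a \<noteq> 0" for a
    using mult(1)[of a "inverse a"] that one nz by (simp add: field_simps)
  obtain a0 where a0: "a0 \<noteq> 0" "\<psi>1 a0 \<noteq> \<psi>2 a0"
    using not_s_invariantE[OF chi] by (auto simp: \<psi>1_def \<psi>2_def)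
  have orth12: "(\<Sum>a\<in>-{0}. inverse (\<psi>1 a) * \<psi>2 a) = 0"
    by (rule orthogonality[of _ a0]) (use mult nz a0 in \<open>auto simp: field_simps\<close>)
  have orth21: "(\<Sum>a\<in>-{0}. inverse (\<psi>2 a) * \<psi>1 a) = 0"
    by (rule orthogonality[of _ a0]) (use mult nz a0 in \<open>auto simp: field_simps\<close>)
  let ?nw = "act nm w"
  have nw: "?nw \<in> W" using w by (simp add: act_closed)
  have aw: "act (dg a 1) w = sc (\<psi>1 a) w" and aw': "act (dg 1 a) w = sc (\<psi>2 a) w" if "a \<noteq> 0" for a
  proof -
    have "dg a 1 \<in> Borel" "dg 1 a \<in> Borel" using that by (simp_all add: Borel_iff)
    then show "act (dg a 1) w = sc (\<psi>1 a) w" "act (dg 1 a) w = sc (\<psi>2 a) w"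
      using w(2) by (simp_all add: B_eigen_def \<psi>1_def \<psi>2_def diag_part_conv)
  qed
  have au: "act (dg a 1) (act (um t) ?nw) = sc (\<psi>2 a) (act (um (a * t)) ?nw)" if "a \<noteq> 0" for a t
    using act_dg_um_nm[OF w(1) that one_neq_zero] aw'[OF that] w nw by (simp add: act_scale act_closed)
  have an: "act (dg a 1) ?nw = sc (\<psi>2 a) ?nw" if "a \<noteq> 0" for a
    using au[OF that, of 0] nw by (simp add: act_one flip: mat_conv_mat2)
  have um0: "act (um 0) ?nw = ?nw" using nw by (simp add: act_one flip: mat_conv_mat2)
  \<comment> \<open>This is the sum in \<open>nm_Tn\<close>, its coefficients written in terms of
    the two factors of chi.\<close>
  define m where "m = (\<Sum>a\<in>-{0}. sc (inverse (\<psi>1 a) * \<psi>2 a) (act (um a) ?nw))"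
  have m: "m = - sc (chi (dg (-1) (-1))) w"
  proof -
    have "chi (dg (inverse a) a) = inverse (\<psi>1 a) * \<psi>2 a" if "a \<noteq> 0" for a
      using torus_charD(2)[OF chi(1), of "inverse a" 1 1 a] that inv1[OF that]
      by (simp add: \<psi>1_def \<psi>2_def)
    then have "m = (\<Sum>a\<in>-{0}. sc (chi (dg (inverse a) a)) (act (um a) (act nm w)))"
      unfolding m_def by (intro sum.cong) auto
    then show ?thesis using nm_Tn[OF w] by simp
  qed
  let ?S = "insert w (range (\<lambda>t. act (um t) ?nw))"
  have SW: "?S \<subseteq> W" using w nw by (auto simp: act_closed)
  have gS: "gen w \<subseteq> span ?S" by (rule gen_B_eigen[OF w(1,2)])
  have p1: "proj \<psi>1 z \<in> span {w}" if z: "z \<in> ?S" for z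
  proof -
    from z have "z = w \<or> (\<exists>t. z = act (um t) ?nw)" by blast
    then consider "z = w" | "z = ?nw" | t where "t \<noteq> 0" "z = act (um t) ?nw"
      using um0 by metis
    then show ?thesis
    proof cases
      case 1
      then show ?thesis using proj_id[of w \<psi>1] aw nz by (simp add: span_base)
    next
      case 2
      then show ?thesis using proj_eq[of ?nw \<psi>2 \<psi>1] an orth12 by (simp add: span_zero)
    next
      case (3 t)
      have "proj \<psi>1 z = - (\<Sum>a\<in>-{0}. sc (inverse (\<psi>1 a) * \<psi>2 a) (act (um (a * t)) ?nw))"
        unfolding proj_def 3 by (intro arg_cong[where f = uminus] sum.cong) (simp_all add: au)
      \<comment> \<open>The substitution \<open>b = a * t\<close> turns the sum into a multiple of
        \<open>m\<close>, hence of \<open>w\<close>.\<close>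
      also have "(\<Sum>a\<in>-{0}. sc (inverse (\<psi>1 a) * \<psi>2 a) (act (um (a * t)) ?nw)) =
          (\<Sum>b\<in>-{0}. sc (\<psi>1 t * inverse (\<psi>2 t)) (sc (inverse (\<psi>1 b) * \<psi>2 b) (act (um b) ?nw)))"
      proof (rule sum.reindex_bij_witness[of _ "\<lambda>b. b / t" "\<lambda>a. a * t"])
        fix a assume "a \<in> -{0 :: 'q}"
        then show "sc (\<psi>1 t * inverse (\<psi>2 t)) (sc (inverse (\<psi>1 (a * t)) * \<psi>2 (a * t)) (act (um (a * t)) ?nw)) =
            sc (inverse (\<psi>1 a) * \<psi>2 a) (act (um (a * t)) ?nw)"
          using 3(1) mult nz by (simp add: field_simps)
      qed (use 3(1) in auto)
      also have "\<dots> = sc (\<psi>1 t * inverse (\<psi>2 t)) m" by (simp only: m_def scale_sum_right)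
      finally show ?thesis by (simp add: m span_neg span_scale span_base)
    qed
  qed
  have p2: "proj \<psi>2 z \<in> span {?nw}" if z: "z \<in> ?S" for z
  proof -
    from z have "z = w \<or> (\<exists>t. z = act (um t) ?nw)" by blast
    then consider "z = w" | "z = ?nw" | t where "t \<noteq> 0" "z = act (um t) ?nw"
      using um0 by metis
    then show ?thesis
    proof cases
      case 1
      then show ?thesis using proj_eq[of w \<psi>1 \<psi>2] aw orth21 by (simp add: span_zero)
    next
      case 2
      then show ?thesis using proj_id[of ?nw \<psi>2] an nz by (simp add: span_base)
    next
      case (3 t)
      have "proj \<psi>2 z = - (\<Sum>a\<in>-{0}. act (um (a * t)) ?nw)"
        unfolding proj_def 3 by (intro arg_cong[where f = uminus] sum.cong) (simp_all add: au nz)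
      also have "(\<Sum>a\<in>-{0}. act (um (a * t)) ?nw) = (\<Sum>b\<in>-{0}. act (um b) ?nw)"
        by (rule sum.reindex_bij_witness[of _ "\<lambda>b. b / t" "\<lambda>a. a * t"]) (use 3(1) in auto)
      \<comment> \<open>The coefficients have cancelled, so all terms of \<open>Tn w\<close> except
        the one for 0 remain; since \<open>Tn w = 0\<close>, the projection is
        \<open>act nm w\<close>.\<close>
      also have "\<dots> = Tn w - act (um 0) ?nw"
        using sum.remove[of UNIV 0 "\<lambda>b. act (um b) ?nw"] by (simp add: Tn_def Compl_eq_Diff_UNIV)
      finally show ?thesis using w(3) nw by (simp add: act_one span_base flip: mat_conv_mat2)
    qed
  qed
  have T1: "dg a 1 \<in> Torus" if "a \<noteq> 0" for a :: 'q using that by (auto simp: Torus_iff)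
  have x1: "act (dg a 1) x = sc (\<psi>1 a) x" and y2: "act (dg a 1) y = sc (\<psi>2 a) y" if "a \<noteq> 0" for a
    using v(6,7) T1[OF that] by (simp_all add: weight_def conj_s_mat2 \<psi>1_def \<psi>2_def)
  have "proj \<psi>1 x = x" using proj_id[of x \<psi>1] x1 nz by simp
  moreover have "proj \<psi>1 y = 0" using proj_eq[of y \<psi>2 \<psi>1] y2 orth12 by simp
  moreover have "proj \<psi>1 v = proj \<psi>1 x + proj \<psi>1 y"
    unfolding v(3) using v(4,5) by (simp add: proj_def act_add scale_right_distrib sum.distrib)
  ultimately have "x \<in> span {w}"
    using proj_span_le[OF SW p1, of v] gS v(1) by auto
  then obtain c where c: "x = sc c w" by (auto simp: span_singleton)
  have Uw: "U_inv w" using w torus_charD(4)[OF chi(1)] by (simp add: B_eigen_iff)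
  have "y = v - x" using v(3) by simp
  then have yg: "y \<in> gen w"
    using v(1) gen_self[OF w(1)] gen_subspace c by (simp add: subspace_diff subspace_scale)
  have vW: "v \<in> W" using v(3-5) W_add by simp
  have Uy: "U_inv y" using v(2) Uw w(1) v(4) vW unfolding U_inv_def \<open>y = v - x\<close>
    by (simp add: act_diff c act_scale)
  have "proj \<psi>2 y = y" using proj_id[of y \<psi>2] y2 nz by simp
  then have "y \<in> span {?nw}" using proj_span_le[OF SW p2, of y] gS yg by auto
  then obtain e where e: "y = sc e ?nw" by (auto simp: span_singleton)
  have "y = 0"
  proof (cases "e = 0")
    case False
    then have "?nw = sc (inverse e) y" using e by simp
    then have "act (um t) ?nw = ?nw" for t using Uy v(5) by (simp add: U_inv_def act_scale)
    then have "m = sc (\<Sum>a\<in>-{0}. inverse (\<psi>1 a) * \<psi>2 a) ?nw" by (simp add: m_def scale_sum_left)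
    then have "sc (chi (dg (-1) (-1))) w = 0" using orth12 m by simp
    then have "w = 0" using torus_charD(1)[OF chi(1), of "-1" "-1"] by simp
    then show ?thesis using e by simp
  qed (simp add: e)
  then show ?thesis using v(3) \<open>x \<in> span {w}\<close> by simp
qed

end

context gl2_rep
begin

text \<open>Pascal's rule, as the induction step for the binomial expansion of a power of
  \<open>1 + D\<close>, with \<open>y i\<close> standing for the \<open>i\<close>-th iterate of
  \<open>D\<close> on a vector.\<close>

lemma pascal_sum:
  fixes y :: "nat \<Rightarrow> 'v"
  shows "(\<Sum>i\<le>Suc m. sc (of_nat (Suc m choose i)) (y i)) =
    (\<Sum>i\<le>m. sc (of_nat (m choose i)) (y i + y (Suc i)))"
proof -
  let ?c = "\<lambda>m i. of_nat (m choose i) :: 'k"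
  have "(\<Sum>i\<le>Suc m. sc (?c m i) (y i)) = y 0 + (\<Sum>i\<le>m. sc (?c m (Suc i)) (y (Suc i)))"
    by (subst sum.atMost_Suc_shift) simp
  moreover have "(\<Sum>i\<le>Suc m. sc (?c m i) (y i)) = (\<Sum>i\<le>m. sc (?c m i) (y i))"
    by (simp add: binomial_eq_0)
  ultimately have a: "y 0 + (\<Sum>i\<le>m. sc (?c m (Suc i)) (y (Suc i))) = (\<Sum>i\<le>m. sc (?c m i) (y i))" by simp
  have "(\<Sum>i\<le>Suc m. sc (?c (Suc m) i) (y i)) =
      y 0 + (\<Sum>i\<le>m. sc (?c m i) (y (Suc i)) + sc (?c m (Suc i)) (y (Suc i)))"
    by (subst sum.atMost_Suc_shift) (simp add: scale_left_distrib)
  then show ?thesis using a by (simp add: sum.distrib scale_right_distrib algebra_simps)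
qed

text \<open>In characteristic \<open>p\<close> the operator \<open>u - 1\<close> satisfies \<open>(u - 1)\<^sup>p = u\<^sup>p - 1 = 0\<close> on \<open>U\<close>, so
  the commuting elements of \<open>U\<close> can be made to fix a vector one after the other.\<close>

lemma U_fixed_vector:
  assumes N: "subspace N" "N \<subseteq> W" "\<And>t v. v \<in> N \<Longrightarrow> act (um t) v \<in> N" and nz: "\<exists>v\<in>N. v \<noteq> 0"
  shows "\<exists>v\<in>N. v \<noteq> 0 \<and> U_inv v"
proof -
  have "\<exists>v\<in>N. v \<noteq> 0 \<and> (\<forall>t\<in>S. act (um t) v = v)" if "finite S" for S :: "'q set"
    using that
  proof (induction S)
    case (insert t S)
    then obtain v where v: "v \<in> N" "v \<noteq> 0" "\<And>s. s \<in> S \<Longrightarrow> act (um s) v = v" by blast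
    define D where "D x = act (um t) x - x" for x
    define y where "y i = (D ^^ i) v" for i
    have yN: "y i \<in> N \<and> (\<forall>s\<in>S. act (um s) (y i) = y i)" for i
    proof (induction i)
      case (Suc i)
      have y: "y (Suc i) = act (um t) (y i) - y i" by (simp add: y_def D_def)
      have W: "y i \<in> W" "act (um t) (y i) \<in> W" using Suc N by auto
      have "act (um s) (act (um t) (y i)) = act (um t) (act (um s) (y i))" for s
        using W by (simp add: act_mult[symmetric] add.commute)
      then show ?case using Suc W N by (simp add: y act_diff subspace_diff)
    qed (use v in \<open>simp add: y_def\<close>)
    \<comment> \<open>The binomial expansion of \<open>um t = 1 + D\<close> raised to the power
      \<open>m\<close>.\<close>
    have pow: "act (um (of_nat m * t)) v = (\<Sum>i\<le>m. sc (of_nat (m choose i)) (y i))" for m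
    proof (induction m)
      case 0
      then show ?case using v N by (auto simp: y_def act_one subset_iff simp flip: mat_conv_mat2)
    next
      case (Suc m)
      have W: "y i \<in> W" for i using yN N by auto
      have "act (um (of_nat (Suc m) * t)) v = act (um t) (act (um (of_nat m * t)) v)"
        using v N by (auto simp: act_mult[symmetric] algebra_simps subset_iff)
      also have "\<dots> = (\<Sum>i\<le>m. sc (of_nat (m choose i)) (act (um t) (y i)))"
        using W by (simp add: Suc act_sum act_scale W_scale)
      also have "\<dots> = (\<Sum>i\<le>m. sc (of_nat (m choose i)) (y i + y (Suc i)))"
        by (simp add: y_def D_def)
      finally show ?case by (simp only: pascal_sum)
    qed
    define p where "p = CHAR('q)"
    have p: "prime p" unfolding p_def by (rule char_finite_field)
    have p0: "of_nat p = (0 :: 'q)" "of_nat p = (0 :: 'k)"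
      by (simp_all add: p_def of_nat_eq_0_iff_char_dvd char_eq)
    have "v = (\<Sum>i\<le>p. sc (of_nat (p choose i)) (y i))"
      using pow[of p] v N p0 by (auto simp: act_one subset_iff simp flip: mat_conv_mat2)
    also have "\<dots> = (\<Sum>i\<in>{0, p}. sc (of_nat (p choose i)) (y i))"
    proof (rule sum.mono_neutral_right)
      show "\<forall>i\<in>{..p} - {0, p}. sc (of_nat (p choose i)) (y i) = 0"
      proof
        fix i assume "i \<in> {..p} - {0, p}"
        then have "p dvd (p choose i)" using p by (intro dvd_choose_prime) auto
        then have "of_nat (p choose i) = (0 :: 'k)"
          by (simp add: of_nat_eq_0_iff_char_dvd char_eq p_def)
        then show "sc (of_nat (p choose i)) (y i) = 0" by simp
      qed
    qed auto
    also have "\<dots> = v + y p" using p prime_gt_0_nat[OF p] by (simp add: y_def)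
    finally have yp: "y p = 0" by simp
    \<comment> \<open>The last nonzero iterate of \<open>D\<close> on \<open>v\<close> is killed by
      \<open>D\<close>, that is, fixed by \<open>um t\<close>; it remains fixed by the elements for
      \<open>S\<close> because \<open>U\<close> is commutative.\<close>
    define j where "j = (LEAST j. y j = 0)"
    have j: "y j = 0" unfolding j_def using yp by (rule LeastI)
    moreover have "y 0 = v" by (simp add: y_def)
    ultimately have "j \<noteq> 0" using v(2) by metis
    then obtain i where i: "j = Suc i" by (cases j) auto
    then have "y i \<noteq> 0" using not_less_Least[of i "\<lambda>j. y j = 0"] by (simp add: j_def)
    moreover have "act (um t) (y i) = y i" using j i by (simp add: y_def D_def)
    ultimately show ?case using yN by blast
  qed (use nz in blast)
  from this[of UNIV] show ?thesis by (auto simp: U_inv_def)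
qed

lemma gen_minimal: "subspace N \<Longrightarrow> (\<And>g. g \<in> carrier GL2 \<Longrightarrow> act g w \<in> N) \<Longrightarrow> gen w \<subseteq> N"
  unfolding gen_def by (rule span_minimal) auto

end

text \<open>The submodule of \<open>A \<times> W\<close> generated by \<open>(vA, w)\<close> is the graph of a homomorphism as soon as it
  meets \<open>0 \<times> W\<close> trivially.\<close>

locale gl2_rep_pair = A: gl2_rep scA UNIV actA + M: gl2_rep sc W act
  for scA :: "'k::field \<Rightarrow> 'a::ab_group_add \<Rightarrow> 'a" and actA :: "'q::{field,finite}^2^2 \<Rightarrow> 'a \<Rightarrow> 'a"
    and sc :: "'k \<Rightarrow> 'v::ab_group_add \<Rightarrow> 'v" and W :: "'v set" and act :: "'q^2^2 \<Rightarrow> 'v \<Rightarrow> 'v"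
begin

sublocale P: gl2_rep "prod_scale scA sc" "UNIV \<times> W" "\<lambda>g. map_prod (actA g) (act g)"
proof -
  interpret P: vector_space "prod_scale scA sc"
    by unfold_locales (auto simp: prod_scale_def A.scale_right_distrib M.scale_right_distrib
        A.scale_left_distrib M.scale_left_distrib)
  show "gl2_rep (prod_scale scA sc) (UNIV \<times> W) (\<lambda>g. map_prod (actA g) (act g))"
  proof
    show "P.subspace (UNIV \<times> W)"
      unfolding P.subspace_def by (auto simp: prod_scale_def zero_prod_def M.W_add M.W_scale)
  qed (auto simp: A.char_eq prod_scale_def A.act_add M.act_add A.act_scale M.act_scale
      A.act_one M.act_one A.act_mult M.act_mult M.act_closed)
qed

lemma P_Tn: "P.Tn (a, w) = (A.Tn a, M.Tn w)"
proof -
  have "(\<Sum>t\<in>S. (f t, g t)) = (sum f S, sum g S)" for S :: "'q set" and f :: "'q \<Rightarrow> 'a" and g :: "'q \<Rightarrow> 'v"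
    by (induction S rule: infinite_finite_induct) (simp_all add: zero_prod_def)
  then show ?thesis by (simp add: P.Tn_def A.Tn_def M.Tn_def)
qed

lemma P_B_eigen: "A.B_eigen chi a \<Longrightarrow> M.B_eigen chi w \<Longrightarrow> P.B_eigen chi (a, w)"
  by (simp add: P.B_eigen_def A.B_eigen_def M.B_eigen_def prod_scale_def)

lemma extension:
  assumes w: "w \<in> W" and A: "A.gen vA = UNIV"
    and triv: "\<And>y. (0, y) \<in> P.gen (vA, w) \<Longrightarrow> y = 0"
  shows "\<exists>\<psi>. (\<forall>x y. \<psi> (x + y) = \<psi> x + \<psi> y) \<and> (\<forall>c x. \<psi> (scA c x) = sc c (\<psi> x)) \<and>
    (\<forall>g\<in>carrier GL2. \<forall>x. \<psi> (actA g x) = act g (\<psi> x)) \<and> (\<forall>x. \<psi> x \<in> W) \<and> \<psi> vA = w"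
proof -
  let ?G = "P.gen (vA, w)"
  have pw: "(vA, w) \<in> UNIV \<times> W" using w by simp
  note sub = P.gen_subspace[of "(vA, w)"] and GW = P.gen_W[OF pw]
  \<comment> \<open>The first projection of the submodule is stable and contains \<open>vA\<close>,
    which generates everything.\<close>
  have ex: "\<exists>y. (x, y) \<in> ?G" for x
  proof -
    have "A.subspace (fst ` ?G)"
      unfolding A.subspace_def
    proof (intro conjI ballI allI)
      show "0 \<in> fst ` ?G" by (rule image_eqI[OF _ P.subspace_0[OF sub]]) simp
      show "x + y \<in> fst ` ?G" if xy: "x \<in> fst ` ?G" "y \<in> fst ` ?G" for x y
      proof -
        obtain p p' where "p \<in> ?G" "x = fst p" "p' \<in> ?G" "y = fst p'" using xy by (elim imageE)
        then show ?thesis using P.subspace_add[OF sub, of p p']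
          by (intro image_eqI[of _ _ "p + p'"]) simp_all
      qed
      show "scA c x \<in> fst ` ?G" if xG: "x \<in> fst ` ?G" for c x
      proof -
        obtain p where "p \<in> ?G" "x = fst p" using xG by (elim imageE)
        then show ?thesis using P.subspace_scale[OF sub, of p c]
          by (intro image_eqI[of _ _ "prod_scale scA sc c p"]) (simp_all add: prod_scale_def)
      qed
    qed
    moreover have "actA g vA \<in> fst ` ?G" if "g \<in> carrier GL2" for g
      by (rule image_eqI[OF _ P.gen_act_self[OF that, of "(vA, w)"]]) simp
    ultimately have "A.gen vA \<subseteq> fst ` ?G" by (rule A.gen_minimal)
    then have "x \<in> fst ` ?G" using A by blast
    then show ?thesis by (elim imageE) (metis prod.collapse)
  qed
  have uniq: "y = z" if "(x, y) \<in> ?G" "(x, z) \<in> ?G" for x y z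
    using P.subspace_diff[OF sub that] triv[of "y - z"] by simp
  define \<psi> where "\<psi> x = (THE y. (x, y) \<in> ?G)" for x
  have \<psi>: "\<psi> x = y \<longleftrightarrow> (x, y) \<in> ?G" for x y
  proof
    have "\<exists>!y. (x, y) \<in> ?G" using ex[of x] uniq[of x] by blast
    from theI'[OF this] have *: "(x, \<psi> x) \<in> ?G" unfolding \<psi>_def .
    then show "(x, y) \<in> ?G" if "\<psi> x = y" using that by simp
    show "\<psi> x = y" if "(x, y) \<in> ?G" using uniq[OF * that] .
  qed
  then have G: "(x, \<psi> x) \<in> ?G" for x by blast
  have "\<psi> (x + y) = \<psi> x + \<psi> y" for x y
    unfolding \<psi> using P.subspace_add[OF sub G[of x] G[of y]] by simp
  moreover have "\<psi> (scA c x) = sc c (\<psi> x)" for c x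
    unfolding \<psi> using P.subspace_scale[OF sub G[of x], of c] by (simp add: prod_scale_def)
  moreover have "\<psi> (actA g x) = act g (\<psi> x)" if "g \<in> carrier GL2" for g x
    unfolding \<psi> using P.gen_stable[OF pw that G[of x]] by simp
  moreover have "\<psi> x \<in> W" for x using G[of x] GW by auto
  moreover have "\<psi> vA = w" unfolding \<psi> using P.gen_self[OF pw] .
  ultimately show ?thesis by blast
qed

end

context gl2_rep
begin

text \<open>Since chi factors through the determinant, all coefficients in \<open>nm_Tn\<close> are
  1, so the terms of \<open>Tn w\<close> for nonzero parameters add up to \<open>- w\<close>. As
  \<open>Tn w = 0\<close>, the remaining term gives \<open>act nm w = w\<close>, and the line of
  \<open>w\<close> is stable.\<close>

lemma gen_det_char:
  assumes w: "w \<in> W" "B_eigen chi w" "Tn w = 0"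
    and chi': "\<And>h. h \<in> Torus \<Longrightarrow> chi h = chi' (det h)" "chi' 1 = 1"
  shows "gen w \<subseteq> span {w}"
proof -
  have det: "chi (dg (inverse a) a) = 1" "chi (dg (-1) (-1)) = 1" if "a \<noteq> 0" for a
    using chi' that by (auto simp: Torus_iff)
  have "(\<Sum>a\<in>-{0}. act (um a) (act nm w)) = (\<Sum>a\<in>-{0}. sc (chi (dg (inverse a) a)) (act (um a) (act nm w)))"
    by (intro sum.cong) (auto simp: det)
  also have "\<dots> = - w" using nm_Tn[OF w] det[of 1] by simp
  finally have "Tn w = act (um 0) (act nm w) + - w"
    using sum.remove[of UNIV 0 "\<lambda>t. act (um t) (act nm w)"] by (simp add: Tn_def Compl_eq_Diff_UNIV)
  then have nw: "act nm w = w" using w(1,3) by (simp add: act_one act_closed flip: mat_conv_mat2)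
  have "chi (mat 1) = 1" using chi' by (simp add: mat_conv_mat2 Torus_iff)
  then have "U_inv w" using B_eigen_iff w by blast
  then have "act (um t) (act nm w) = w" for t using nw by (simp add: U_inv_def)
  then have "insert w (range (\<lambda>t. act (um t) (act nm w))) = {w}" by auto
  then show ?thesis using gen_B_eigen[OF w(1,2)] by metis
qed

text \<open>The eigenvalue -1 expresses \<open>w\<close> itself through the q vectors
  \<open>act (um t) (act nm w)\<close>, which therefore span. For a pair, linear independence in the
  first component then excludes a nonzero element with first component 0.\<close>

lemma gen_Steinberg:
  assumes w: "w \<in> W" "B_eigen chi w" "Tn w = - w" and v: "v \<in> gen w"
  shows "\<exists>c. v = (\<Sum>t\<in>UNIV. sc (c t) (act (um t) (act nm w)))"
proof -
  let ?u = "\<lambda>t. act (um t) (act nm w)"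
  let ?R = "{\<Sum>t\<in>UNIV. sc (c t) (?u t) | c. True}"
  have sub: "subspace ?R"
    unfolding subspace_def
  proof (intro conjI ballI allI)
    show "0 \<in> ?R" by (intro CollectI exI[of _ "\<lambda>_. 0"]) simp
    show "x + y \<in> ?R" if "x \<in> ?R" "y \<in> ?R" for x y
    proof -
      obtain c d where "x = (\<Sum>t\<in>UNIV. sc (c t) (?u t))" "y = (\<Sum>t\<in>UNIV. sc (d t) (?u t))"
        using \<open>x \<in> ?R\<close> \<open>y \<in> ?R\<close> by blast
      then show ?thesis
        by (intro CollectI exI[of _ "\<lambda>t. c t + d t"]) (simp add: scale_left_distrib sum.distrib)
    qed
    show "sc a x \<in> ?R" if "x \<in> ?R" for a x
    proof -
      obtain c where "x = (\<Sum>t\<in>UNIV. sc (c t) (?u t))" using \<open>x \<in> ?R\<close> by blast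
      then show ?thesis by (intro CollectI exI[of _ "\<lambda>t. a * c t"]) (simp add: scale_sum_right)
    qed
  qed
  have u: "?u s \<in> ?R" for s
  proof (intro CollectI exI conjI)
    have "(\<Sum>t\<in>UNIV. sc (if t = s then 1 else 0) (?u t)) = (\<Sum>t\<in>UNIV. if t = s then ?u t else 0)"
      by (intro sum.cong) auto
    then show "?u s = (\<Sum>t\<in>UNIV. sc (if t = s then 1 else 0) (?u t))" by simp
  qed simp
  have "w \<in> ?R"
  proof (intro CollectI exI conjI)
    have "w = - Tn w" using w(3) by simp
    then show "w = (\<Sum>t\<in>UNIV. sc (-1) (?u t))" by (simp add: Tn_def sum_negf)
  qed simp
  then have "span (insert w (range ?u)) \<subseteq> ?R" using u by (intro span_minimal sub) auto
  then have "v \<in> ?R" using gen_B_eigen[OF w(1,2)] v by blast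
  then show ?thesis by blast
qed

end

text \<open>The value is -1 for a twisted Steinberg representation. It is 0 for a character, where T
  is multiplication by q, and 0 when chi differs from its conjugate, where T changes the
  weight.\<close>

definition T_eigenvalue :: "('q::field^2^2 \<Rightarrow> 'k::field) \<Rightarrow> ('q^2^2) set \<Rightarrow> 'k" where
  "T_eigenvalue chi J = (if s_invariant chi \<and> J \<noteq> {s_mat} then -1 else 0)"

lemma gl2_repI:
  assumes "group_rep GL2 sc act" "CHAR('k::field) = CHAR('q::{field,finite})"
  shows "gl2_rep (sc :: 'k \<Rightarrow> _) UNIV (act :: 'q^2^2 \<Rightarrow> _)"
proof -
  note rep = group_rep_GL2D[OF assms(1)]
  interpret vector_space sc by (rule rep(1))
  show ?thesis by unfold_locales (use assms(2) rep in auto)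
qed

text \<open>What is used of \<open>\<rho>\<^bsub>chi,J\<^esub>\<close> with its invariant vector: \<open>indep\<close> makes \<open>(vA, w)\<close> generate the graph
  of a homomorphism.\<close>

locale rho_rep = A: gl2_rep scA UNIV actA
  for scA :: "'k::field \<Rightarrow> 'a::ab_group_add \<Rightarrow> 'a" and actA :: "'q::{field,finite}^2^2 \<Rightarrow> 'a \<Rightarrow> 'a" +
  fixes chi :: "'q^2^2 \<Rightarrow> 'k" and J :: "('q^2^2) set" and vA :: 'a
  assumes vA: "vA \<noteq> 0" and B_eigen: "A.B_eigen chi vA" and generates: "A.gen vA = UNIV"
    and U_inv_span: "A.U_inv a \<Longrightarrow> \<exists>c. a = scA c vA"
    and Tn_vA: "A.Tn vA = scA (T_eigenvalue chi J) vA"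
    and indep: "s_invariant chi \<and> J \<noteq> {s_mat} \<Longrightarrow>
      (\<Sum>t\<in>UNIV. scA (c t) (actA (um t) (actA nm vA))) = 0 \<Longrightarrow> c t = 0"
    and det_char: "s_invariant chi \<Longrightarrow> \<exists>chi'. chi' 1 = 1 \<and> (\<forall>h\<in>Torus. chi h = chi' (det h))"
begin

text \<open>By \<open>extension\<close> only elements \<open>(0, y)\<close> of the generated
  submodule need attention. The assumption \<open>inv\<close> serves the generic case: it splits a
  \<open>U\<close>-invariant vector of \<open>W\<close> into two weight vectors, as
  \<open>gen_U_inv\<close> demands.\<close>

lemma hom_exists:
  assumes W: "gl2_rep sc W act" and chi: "torus_char chi"
    and w: "w \<in> W" "gl2_rep.B_eigen sc act chi w" "gl2_rep.Tn act w = sc (T_eigenvalue chi J) w"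
    and inv: "\<And>v. \<not> s_invariant chi \<Longrightarrow> v \<in> W \<Longrightarrow> gl2_rep.U_inv act v \<Longrightarrow>
      \<exists>x\<in>W. \<exists>y\<in>W. v = x + y \<and> gl2_rep.weight sc act chi x \<and> gl2_rep.weight sc act (conj_s chi) y"
  shows "\<exists>\<psi>. (\<forall>x y. \<psi> (x + y) = \<psi> x + \<psi> y) \<and> (\<forall>c x. \<psi> (scA c x) = sc c (\<psi> x)) \<and>
    (\<forall>g\<in>carrier GL2. \<forall>x. \<psi> (actA g x) = act g (\<psi> x)) \<and> (\<forall>x. \<psi> x \<in> W) \<and> \<psi> vA = w"
proof -
  interpret M: gl2_rep sc W act by (rule W)
  interpret gl2_rep_pair scA actA sc W act ..
  let ?p = "(vA, w)"
  have pW: "?p \<in> UNIV \<times> W" using w by simp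
  have PB: "P.B_eigen chi ?p" using B_eigen w(2) by (rule P_B_eigen)
  have PT: "P.Tn ?p = prod_scale scA sc (T_eigenvalue chi J) ?p"
    by (simp add: P_Tn Tn_vA w(3) prod_scale_def)
  have line: "y = 0" if "(0, y) \<in> P.span {?p}" for y
    using that vA by (auto simp: P.span_singleton prod_scale_def)
  show ?thesis
  proof (rule extension[OF w(1) generates])
    fix y assume y: "(0, y) \<in> P.gen ?p"
    consider (St) "s_invariant chi" "J \<noteq> {s_mat}" | (det) "s_invariant chi" "J = {s_mat}"
      | (generic) "\<not> s_invariant chi" by blast
    then show "y = 0"
    proof cases
      case St
      then have "P.Tn ?p = - ?p" using PT by (simp add: T_eigenvalue_def prod_scale_def)
      then obtain c where c: "(0, y) =
          (\<Sum>t\<in>UNIV. prod_scale scA sc (c t) (map_prod (actA (um t)) (act (um t)) (map_prod (actA nm) (act nm) ?p)))"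
        using P.gen_Steinberg[OF pW PB _ y] by blast
      have "(\<Sum>t\<in>UNIV. scA (c t) (actA (um t) (actA nm vA))) = 0"
        using arg_cong[OF c, of fst] by (simp add: fst_sum prod_scale_def)
      then have "c t = 0" for t using indep St by blast
      then show ?thesis using arg_cong[OF c, of snd] by (simp add: snd_sum prod_scale_def)
    next
      case det
      then have T: "P.Tn ?p = 0" using PT by (simp add: T_eigenvalue_def prod_scale_def zero_prod_def)
      obtain chi' where "chi' 1 = 1" "\<And>h. h \<in> Torus \<Longrightarrow> chi h = chi' (det h)" using det_char det(1) by blast
      then show ?thesis using P.gen_det_char[OF pW PB T] y line by blast
    next
      case generic
      then have T: "P.Tn ?p = 0" using PT by (simp add: T_eigenvalue_def prod_scale_def zero_prod_def)
      note sub = P.gen_subspace[of ?p]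
      let ?N = "{q \<in> P.gen ?p. fst q = 0}"
      show ?thesis
      proof (rule ccontr)
        assume "y \<noteq> 0"
        then have "\<exists>q\<in>?N. q \<noteq> 0" using y by (intro bexI[of _ "(0, y)"]) (auto simp: zero_prod_def)
        moreover have "P.subspace ?N" using sub
          by (auto simp: P.subspace_def prod_scale_def)
        moreover have "?N \<subseteq> UNIV \<times> W" using P.gen_W[OF pW] by blast
        moreover have "map_prod (actA (um t)) (act (um t)) q \<in> ?N" if "q \<in> ?N" for t q
          using P.gen_stable[OF pW, of "um t" q] that by (simp add: fst_map_prod)
        ultimately obtain q where q: "q \<in> ?N" "q \<noteq> 0" "P.U_inv q"
          using P.U_fixed_vector[of ?N] by blast
        obtain z where z: "q = (0, z)" using q(1) by (cases q) auto
        have "z \<in> W" "M.U_inv z" using q z P.gen_W[OF pW] by (auto simp: P.U_inv_def M.U_inv_def)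
        then obtain x y' where xy: "x \<in> W" "y' \<in> W" "z = x + y'" "M.weight chi x" "M.weight (conj_s chi) y'"
          using inv[OF generic] by blast
        have "q \<in> P.span {?p}"
        proof (rule P.gen_U_inv[OF chi generic pW PB T _ q(3), of "(0, x)" "(0, y')"])
          have d: "d \<in> carrier GL2" if "d \<in> Torus" for d :: "'q^2^2"
            using that Torus_Borel Borel_GL2 by blast
          show "P.weight chi (0, x)" "P.weight (conj_s chi) (0, y')"
            using xy d by (simp_all add: P.weight_def M.weight_def prod_scale_def)
        qed (use q z xy in auto)
        then show False using line q z by (simp add: zero_prod_def)
      qed
    qed
  qed
qed

end

section \<open>The three kinds of irreducible representations\<close>

lemma U_inv_iff_invariants:
  "v \<in> invariants Unip act \<longleftrightarrow> (\<forall>t. act (mat2 1 t 0 1) v = v)"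
  by (auto simp: invariants_def Unip_iff)

text \<open>Irreducibility makes \<open>vA\<close> a generator. The vector \<open>A.Tn vA\<close> is
  \<open>U\<close>-invariant, hence a multiple of \<open>vA\<close>, but its weight is the conjugate
  character; as the two differ, it is zero.\<close>

lemma rho_rep_generic:
  fixes scA :: "'k::field \<Rightarrow> 'a::ab_group_add \<Rightarrow> 'a" and actA :: "'q::{field,finite}^2^2 \<Rightarrow> 'a \<Rightarrow> 'a"
  assumes chi: "torus_char chi" and char: "CHAR('k) = CHAR('q)" and ns: "\<not> s_invariant chi"
    and rho: "is_rho chi J scA actA" and vA: "vA \<in> invariants Unip actA" "vA \<noteq> 0"
  shows "rho_rep scA actA chi J vA"
proof -
  have rep: "group_rep GL2 scA actA" and irr: "irreducible_rep GL2 scA actA"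
    and dim: "vector_space.dim scA (invariants Unip actA) = 1"
    and B: "\<And>b v. b \<in> Borel \<Longrightarrow> v \<in> invariants Unip actA \<Longrightarrow> actA b v = scA (chi (diag_part b)) v"
    using rho ns by (auto simp: is_rho_def)
  interpret A: gl2_rep scA UNIV actA by (rule gl2_repI[OF rep char])
  have inv: "v \<in> invariants Unip actA \<longleftrightarrow> A.U_inv v" for v
    by (simp add: U_inv_iff_invariants A.U_inv_def)
  have Be: "A.B_eigen chi vA" using B vA by (simp add: A.B_eigen_def)
  have span: "\<exists>c. a = scA c vA" if "A.U_inv a" for a
  proof -
    obtain S where S: "S \<subseteq> invariants Unip actA" "A.independent S" "invariants Unip actA \<subseteq> A.span S" "card S = 1"
      using A.basis_exists[of "invariants Unip actA"] dim by metis
    then obtain b where "S = {b}" by (auto simp: card_1_singleton_iff One_nat_def)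
    then have "a \<in> A.span {b}" "vA \<in> A.span {b}" using S(3) vA(1) that inv by auto
    then obtain c d where cd: "a = scA c b" "vA = scA d b"
      unfolding A.span_singleton by (elim rangeE) blast
    then have "d \<noteq> 0" using vA(2) by auto
    then have "a = scA (c / d) vA" using cd by simp
    then show ?thesis by blast
  qed
  have gen: "A.gen vA = UNIV"
  proof -
    have "A.subspace (A.gen vA)" by (rule A.gen_subspace)
    moreover have "actA g ` A.gen vA \<subseteq> A.gen vA" if "g \<in> carrier GL2" for g
      using A.gen_stable[OF _ that] by auto
    ultimately have "A.gen vA = {0} \<or> A.gen vA = UNIV" using irr unfolding irreducible_rep_def by blast
    then show ?thesis using A.gen_self[of vA] vA(2) by auto
  qed
  have one: "chi (mat 1) = 1" by (rule A.torus_charD(4)[OF chi])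
  have wt: "A.weight chi vA" using Be A.B_eigen_iff[of vA chi] one by simp
  have "A.Tn vA = 0"
  proof (rule ccontr)
    assume nz: "A.Tn vA \<noteq> 0"
    obtain c where c: "A.Tn vA = scA c vA" using span[OF A.Tn_U_inv] by auto
    then have c0: "c \<noteq> 0" using nz by auto
    have "chi h = conj_s chi h" if h: "h \<in> Torus" for h
    proof -
      have hG: "h \<in> carrier GL2" using h Torus_Borel Borel_GL2 by blast
      have "scA (chi h) (A.Tn vA) = actA h (A.Tn vA)"
        using wt h hG by (simp add: c A.weight_def A.act_scale mult.commute)
      also have "\<dots> = scA (conj_s chi h) (A.Tn vA)"
        using A.Tn_weight[OF _ wt] h by (simp add: A.weight_def)
      finally show ?thesis using nz by simp
    qed
    with ns show False by (simp add: s_invariant_def)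
  qed
  then show ?thesis
    by unfold_locales (use vA Be gen span ns in \<open>auto simp: T_eigenvalue_def\<close>)
qed

lemma units_homD:
  assumes "chi' \<in> hom units_group units_group"
  shows "x \<noteq> 0 \<Longrightarrow> chi' x \<noteq> 0" "x \<noteq> 0 \<Longrightarrow> y \<noteq> 0 \<Longrightarrow> chi' (x * y) = chi' x * chi' y" "chi' 1 = 1"
proof -
  show nz: "x \<noteq> 0 \<Longrightarrow> chi' x \<noteq> 0" and m: "x \<noteq> 0 \<Longrightarrow> y \<noteq> 0 \<Longrightarrow> chi' (x * y) = chi' x * chi' y" for x y
    using assms by (auto simp: hom_def units_group_def)
  show "chi' 1 = 1" using nz[of 1] m[of 1 1] by simp
qed

lemma det_diag_part: "b \<in> Borel \<Longrightarrow> det (diag_part b) = det b"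
  by (simp add: diag_part_conv det_2 Borel_iff)

text \<open>The matrices in \<open>A.Tn\<close> have determinant 1, so the operator is
  multiplication by the number of unipotent elements, which is zero in the coefficients.\<close>

lemma rho_rep_char:
  fixes scA :: "'k::field \<Rightarrow> 'a::ab_group_add \<Rightarrow> 'a" and actA :: "'q::{field,finite}^2^2 \<Rightarrow> 'a \<Rightarrow> 'a"
  assumes char: "CHAR('k) = CHAR('q)" and s: "s_invariant chi" and J: "J = {s_mat}"
    and rho: "is_rho chi J scA actA" and vA: "vA \<noteq> 0"
  shows "rho_rep scA actA chi J vA"
proof -
  obtain chi' where rep: "group_rep GL2 scA actA" and chi': "chi' \<in> hom units_group units_group"
    "\<And>h. h \<in> Torus \<Longrightarrow> chi h = chi' (det h)"
    and iso: "iso_rep (carrier GL2) (char_rep (chi' \<circ> det)) (rep_on UNIV scA actA)"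
    using rho s J by (auto simp: is_rho_def)
  interpret A: gl2_rep scA UNIV actA by (rule gl2_repI[OF rep char])
  obtain f where f: "bij f" "\<And>c x. f (c * x) = scA c (f x)"
    "\<And>g x. g \<in> carrier GL2 \<Longrightarrow> f (chi' (det g) * x) = actA g (f x)"
    using iso by (auto simp: iso_rep_def Hom_rep_def char_rep_def rep_on_sel)
  have f1: "f x = scA x (f 1)" for x using f(2)[of x 1] by simp
  have act: "actA g a = scA (chi' (det g)) a" if "g \<in> carrier GL2" for g a
  proof -
    obtain x where "a = f x" using f(1) by (metis bij_pointE)
    then show ?thesis using f(2) f(3)[OF that, of x] by simp
  qed
  obtain x0 where x0: "vA = f x0" using f(1) by (metis bij_pointE)
  have "x0 \<noteq> 0" using vA f1[of 0] by (auto simp: x0)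
  have all: "\<exists>c. a = scA c vA" for a
  proof -
    obtain x where "a = f x" using f(1) by (metis bij_pointE)
    then have "a = scA (x / x0) vA" using \<open>x0 \<noteq> 0\<close> f(2)[of "x / x0" x0] by (simp add: x0)
    then show ?thesis by blast
  qed
  have one: "chi' 1 = 1" by (rule units_homD(3)[OF chi'(1)])
  have gen: "A.gen vA = UNIV"
  proof -
    have "a \<in> A.gen vA" for a
      using all[of a] A.gen_self[of vA] A.subspace_scale[OF A.gen_subspace] by auto
    then show ?thesis by auto
  qed
  have Be: "A.B_eigen chi vA"
    by (auto simp: A.B_eigen_def act Borel_GL2 chi'(2) diag_part_Torus det_diag_part)
  have "A.Tn vA = scA (of_nat CARD('q)) vA"
    by (simp add: A.Tn_def act one A.scale_sum_left[symmetric] sum_constant_scale) (simp add: A.sum_constant_scale)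
  then have T: "A.Tn vA = 0" by (simp add: A.card_zero)
  show ?thesis
    by unfold_locales (use vA Be gen all T J s chi' one in \<open>auto simp: T_eigenvalue_def\<close>)
qed

text \<open>Computations are done with functions on the projective line, through the map
  \<open>\<theta>\<close> to the quotient by constants. The invariant vector comes from the
  indicator \<open>e\<close> of the Borel subgroup, and its translates \<open>en t\<close> are the
  indicators of the other points.\<close>

lemma rho_rep_Steinberg:
  fixes scA :: "'k::field \<Rightarrow> 'a::ab_group_add \<Rightarrow> 'a" and actA :: "'q::{field,finite}^2^2 \<Rightarrow> 'a \<Rightarrow> 'a"
  assumes char: "CHAR('k) = CHAR('q)" and s: "s_invariant chi" and J: "J \<noteq> {s_mat}"
    and rho: "is_rho chi J scA actA" and vA: "vA \<in> invariants Unip actA" "vA \<noteq> 0"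
  shows "rho_rep scA actA chi J vA"
proof -
  obtain chi' where rep: "group_rep GL2 scA actA" and chi': "chi' \<in> hom units_group units_group"
    "\<And>h. h \<in> Torus \<Longrightarrow> chi h = chi' (det h)"
    and iso: "iso_rep (carrier GL2) (twist (chi' \<circ> det) Steinberg) (rep_on UNIV scA actA)"
    using rho s J by (auto simp: is_rho_def)
  interpret A: gl2_rep scA UNIV actA by (rule gl2_repI[OF rep char])
  have one: "chi' 1 = 1" by (rule units_homD(3)[OF chi'(1)])
  define IB :: "('q^2^2 \<Rightarrow> 'k) set" where "IB = {f. (\<forall>g. g \<notin> carrier GL2 \<longrightarrow> f g = 0) \<and>
      (\<forall>b\<in>Borel. \<forall>g\<in>carrier GL2. f (b ** g) = f g)}"
  define cst :: "'k \<Rightarrow> 'q^2^2 \<Rightarrow> 'k" where "cst c = (\<lambda>g. if g \<in> carrier GL2 then c else 0)" for c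
  have IB: "f g = 0" if "f \<in> IB" "g \<notin> carrier GL2" for f g using that by (simp add: IB_def)
  have IB': "f (b ** g) = f g" if "f \<in> IB" "b \<in> Borel" "g \<in> carrier GL2" for f b g using that by (simp add: IB_def)
  have cst_IB: "cst c \<in> IB" for c by (auto simp: IB_def cst_def Borel_GL2)
  interpret Q: stable_subspace IB "range cst" "fun_scale (*)" rtrans "carrier GL2"
  proof
    show "x + y \<in> IB" if "x \<in> IB" "y \<in> IB" for x y using that by (auto simp: IB_def)
    show "fun_scale (*) c x \<in> IB" if "x \<in> IB" for c x using that by (auto simp: IB_def fun_scale_def)
    show "rtrans g x \<in> IB" if "g \<in> carrier GL2" "x \<in> IB" for g x
      using that by (auto simp: IB_def rtrans_def GL2_mult_iff simp flip: matrix_mul_assoc)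
    show "range cst \<subseteq> IB" using cst_IB by auto
    show "0 \<in> range cst" by (rule range_eqI[of _ _ 0]) (simp add: cst_def fun_eq_iff)
    show "x + y \<in> range cst" if "x \<in> range cst" "y \<in> range cst" for x y
    proof -
      from that obtain c d where "x = cst c" "y = cst d" by auto
      then show ?thesis by (intro range_eqI[of _ _ "c + d"]) (simp add: cst_def fun_eq_iff)
    qed
    show "- x \<in> range cst" if "x \<in> range cst" for x
    proof -
      from that obtain c where "x = cst c" by auto
      then show ?thesis by (intro range_eqI[of _ _ "- c"]) (simp add: cst_def fun_eq_iff)
    qed
    show "fun_scale (*) a x \<in> range cst" if "x \<in> range cst" for a x
    proof -
      from that obtain c where "x = cst c" by auto
      then show ?thesis by (intro range_eqI[of _ _ "a * c"]) (simp add: cst_def fun_eq_iff fun_scale_def)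
    qed
    have r: "rtrans g (cst c) = cst c" if "g \<in> carrier GL2" for g c
      using that by (simp add: rtrans_def cst_def GL2_mult_iff)
    show "rtrans g x \<in> range cst" if "g \<in> carrier GL2" "x \<in> range cst" for g x
      using that r by auto
    show "\<exists>y\<in>range cst. rtrans g y = x" if "g \<in> carrier GL2" "x \<in> range cst" for g x
      using that r by auto
    show "fun_scale (*) c (x + y) = fun_scale (*) c x + fun_scale (*) c y" for c and x y :: "'q^2^2 \<Rightarrow> 'k"
      by (simp add: fun_scale_def fun_eq_iff distrib_left)
    show "rtrans g (x + y) = rtrans g x + rtrans g y" for g and x y :: "'q^2^2 \<Rightarrow> 'k"
      by (simp add: rtrans_def fun_eq_iff)
  qed
  have "range cst = {\<lambda>g. if g \<in> carrier GL2 then c else 0 | c. True}" by (auto simp: cst_def)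
  then have St: "Steinberg = quot_rep (rep_on IB (fun_scale (*)) rtrans) (range cst)"
    by (simp add: Steinberg_def Ind_Borel_def IB_def)
  obtain f where f: "f \<in> Hom_rep (carrier GL2) (twist (chi' \<circ> det) Steinberg) (rep_on UNIV scA actA)"
    and bij: "bij_betw f (Q.coset ` IB) UNIV"
    using iso by (auto simp: iso_rep_def St twist_def Q.Q_space rep_on_sel)
  define \<theta> where "\<theta> x = f (Q.coset x)" for x
  have add: "\<theta> (x + y) = \<theta> x + \<theta> y" if "x \<in> IB" "y \<in> IB" for x y
    using f that by (simp add: Hom_rep_def St twist_def Q.Q_space Q.Q_add rep_on_sel \<theta>_def)
  have scale: "\<theta> (fun_scale (*) c x) = scA c (\<theta> x)" if "x \<in> IB" for c x
    using f that by (simp add: Hom_rep_def St twist_def Q.Q_space Q.Q_smul rep_on_sel \<theta>_def)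
  have "\<theta> (fun_scale (*) (chi' (det g)) (rtrans g x)) = actA g (\<theta> x)" if "g \<in> carrier GL2" "x \<in> IB" for g x
    using f that by (simp add: Hom_rep_def St twist_def Q.Q_space Q.Q_smul Q.Q_act rep_on_sel \<theta>_def)
  then have act: "actA g (\<theta> x) = scA (chi' (det g)) (\<theta> (rtrans g x))" if "g \<in> carrier GL2" "x \<in> IB" for g x
    using that scale Q.C_act by metis
  have surj: "\<exists>x\<in>IB. a = \<theta> x" for a
  proof -
    have "a \<in> f ` Q.coset ` IB" using bij by (auto simp: bij_betw_def)
    then show ?thesis by (auto simp: \<theta>_def)
  qed
  have IB0: "0 \<in> IB" using Q.W_0 Q.W_sub by blast
  have \<theta>0: "\<theta> 0 = 0" using add[OF IB0 IB0] by simp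
  have ker: "\<theta> x = 0 \<longleftrightarrow> x \<in> range cst" if x: "x \<in> IB" for x
  proof -
    have "\<theta> x = 0 \<longleftrightarrow> f (Q.coset x) = f (Q.coset 0)" using \<theta>0 by (simp add: \<theta>_def)
    also have "\<dots> \<longleftrightarrow> Q.coset x = Q.coset 0"
      using bij_betw_imp_inj_on[OF bij] by (rule inj_on_eq_iff) (use x IB0 in auto)
    finally show ?thesis by (simp add: Q.coset_eq_iff)
  qed
  have IBsum: "sum h S \<in> IB \<and> \<theta> (sum h S) = (\<Sum>t\<in>S. \<theta> (h t))" if "\<And>t. h t \<in> IB"
    for h :: "'q \<Rightarrow> 'q^2^2 \<Rightarrow> 'k" and S
  proof (induction S rule: infinite_finite_induct)
    case (insert t S)
    note IH1 = insert.IH[THEN conjunct1] and IH2 = insert.IH[THEN conjunct2]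
    have "\<theta> (h t + sum h S) = (\<Sum>t\<in>insert t S. \<theta> (h t))"
      unfolding add[OF that IH1] IH2 using insert(1,2) by simp
    with Q.C_add[OF that IH1] show ?case unfolding sum.insert[OF insert(1,2)] by (rule conjI)
  qed (unfold sum.infinite sum.empty, rule conjI[OF IB0 \<theta>0], rule conjI[OF IB0 \<theta>0])
  have sum_apply: "sum h S g = (\<Sum>t\<in>S. h t g)" for h :: "'q \<Rightarrow> 'q^2^2 \<Rightarrow> 'k" and S g
    by (induction S rule: infinite_finite_induct) simp_all
  define e :: "'q^2^2 \<Rightarrow> 'k" where "e = (\<lambda>g. if g \<in> Borel then 1 else 0)"
  have Bmult: "b ** g \<in> Borel \<longleftrightarrow> g \<in> Borel" if b: "b \<in> Borel" for b g :: "'q^2^2"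
    using b Borel_mult[OF b] Borel_mult[OF Borel_inv[OF b], of "b ** g"] Borel_GL2[OF b] by auto
  have e: "e \<in> IB" using Bmult Borel_GL2 by (auto simp: IB_def e_def)
  define en where "en t = rtrans (um t ** nm) e" for t
  have en: "en t \<in> IB" for t unfolding en_def by (intro Q.C_act e) simp
  \<comment> \<open>A coset of the Borel subgroup corresponds to the point of the projective line
    given by the bottom row (c : d). The function \<open>e\<close> is the indicator of the point
    with c = 0, and \<open>en t\<close> that of the point with c t + d = 0.\<close>
  have en_val: "en t g = (if g$2$1 * t + g$2$2 = 0 then 1 else 0)" if g: "g \<in> carrier GL2" for t g
  proof -
    have "g ** (um t ** nm) \<in> carrier GL2" using g by (intro GL2_mult) simp_all
    moreover have "(g ** (um t ** nm))$2$1 = - (g$2$1 * t + g$2$2)" by (simp add: mult2_nth)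
    ultimately have "g ** (um t ** nm) \<in> Borel \<longleftrightarrow> g$2$1 * t + g$2$2 = 0"
      unfolding Borel_def by (simp add: neg_eq_iff_add_eq_0 del: mat2_mult)
    then show ?thesis by (simp add: en_def e_def rtrans_def)
  qed
  have act_en: "actA (um t) (actA nm (\<theta> e)) = \<theta> (en t)" for t
  proof -
    have "actA (um t) (actA nm (\<theta> e)) = actA (um t ** nm) (\<theta> e)" by (rule A.act_mult[symmetric]) simp_all
    then show ?thesis using act[OF _ e, of "um t ** nm"] by (simp add: one en_def det_mul)
  qed
  have Borel22: "g$2$2 \<noteq> 0" if "g \<in> Borel" for g :: "'q^2^2" using that by (simp add: Borel_iff)
  have solve: "g$2$1 * t + g$2$2 = 0 \<longleftrightarrow> t = - g$2$2 / g$2$1" if "g$2$1 \<noteq> 0" for t and g :: "'q^2^2"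
    using that by (auto simp: field_simps eq_neg_iff_add_eq_0)
  have Tn_e: "A.Tn (\<theta> e) = - \<theta> e"
  proof -
    \<comment> \<open>Every point of the projective line other than that of \<open>e\<close>
      supports exactly one \<open>en t\<close>. The constant 1 dies in the quotient, which leaves
      the eigenvalue -1.\<close>
    have "sum en UNIV g = (cst 1 + fun_scale (*) (-1) e) g" for g
    proof (cases "g \<in> carrier GL2")
      case True
      then have "sum en UNIV g = (\<Sum>t\<in>UNIV. if g$2$1 * t + g$2$2 = 0 then 1 else 0)"
        by (simp add: sum_apply en_val)
      also have "\<dots> = (if g$2$1 = 0 then 0 else 1)"
      proof (cases "g$2$1 = 0")
        case False
        then show ?thesis by (simp add: solve)
      next
        case 0: True
        then have "g$2$2 \<noteq> 0" using True by (auto simp: GL2_iff det_2)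
        then show ?thesis using 0 by simp
      qed
      finally show ?thesis using True by (simp add: cst_def e_def fun_scale_def Borel_def)
    next
      case False
      then show ?thesis using IB[OF IBsum[OF en, THEN conjunct1] False] IB[OF e False]
        by (simp add: cst_def fun_scale_def)
    qed
    then have eq: "sum en UNIV = cst 1 + fun_scale (*) (-1) e" by (rule ext)
    have "A.Tn (\<theta> e) = \<theta> (sum en UNIV)"
      using IBsum[OF en, where S = UNIV] by (simp add: A.Tn_def act_en)
    also have "\<dots> = \<theta> (cst 1) + \<theta> (fun_scale (*) (-1) e)"
      unfolding eq by (rule add[OF cst_IB Q.C_scale[OF e]])
    also have "\<dots> = - \<theta> e" using ker[OF cst_IB] scale[OF e] by simp
    finally show ?thesis .
  qed
  have inv: "\<exists>\<kappa>. a = scA \<kappa> (\<theta> e)" if a: "A.U_inv a" for a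
  proof -
    obtain x where x: "x \<in> IB" "a = \<theta> x" using surj by blast
    \<comment> \<open>Invariance in the quotient only says that translation changes \<open>x\<close>
      by a constant. At the identity the translating matrix can be absorbed on the left, so the
      constant is 0 and \<open>x\<close> itself is invariant.\<close>
    have xu: "x (g ** um t) = x g" if g: "g \<in> carrier GL2" for g t
    proof -
      have r: "rtrans (um t) x \<in> IB" by (rule Q.C_act[OF _ x(1)]) simp
      have m: "fun_scale (*) (-1) x \<in> IB" by (rule Q.C_scale[OF x(1)])
      have "\<theta> (rtrans (um t) x) = \<theta> x" using a act[OF _ x(1), of "um t"] x one by (simp add: A.U_inv_def)
      then have "\<theta> (rtrans (um t) x + fun_scale (*) (-1) x) = 0" using add[OF r m] scale[OF x(1)] by simp
      then obtain c where c0: "rtrans (um t) x + fun_scale (*) (-1) x = cst c" using ker[OF Q.C_add[OF r m]] by auto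
      have c: "x (h ** um t) - x h = c" if "h \<in> carrier GL2" for h
        using that fun_cong[OF c0, of h] by (simp add: rtrans_def fun_scale_def cst_def)
      have "x (um t ** mat 1) = x (mat 1)" by (rule IB'[OF x(1)]) (simp_all add: Borel_iff)
      then have "c = 0" using c[of "mat 1"] by simp
      then show ?thesis using c[OF g] by simp
    qed
    \<comment> \<open>Left invariant under the Borel subgroup and right invariant under
      \<open>U\<close>, the function \<open>x\<close> is determined by its values at
      \<open>mat 1\<close> and \<open>nm\<close>, one for each Bruhat cell.\<close>
    let ?\<kappa> = "x (mat 1) - x nm"
    have "x g = (fun_scale (*) ?\<kappa> e + cst (x nm)) g" for g
    proof (cases "g \<in> carrier GL2")
      case g: True
      show ?thesis
      proof (cases "g \<in> Borel")
        case True
        then have "x (g ** mat 1) = x (mat 1)" by (intro IB'[OF x(1)]) simp_all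
        then show ?thesis using True g by (simp add: fun_scale_def e_def cst_def)
      next
        case False
        \<comment> \<open>The decomposition in \<open>bruhat\<close> has the Borel factor on the
          right; applied to the inverse of \<open>g\<close> it puts that factor on the left, where
          \<open>x\<close> is invariant.\<close>
        have "matrix_inv g \<notin> Borel" using False Borel_inv[of "matrix_inv g"] g by auto
        then obtain t b where tb: "b \<in> Borel" "matrix_inv g = um t ** nm ** b"
          using bruhat[of "matrix_inv g"] g by auto
        have bG: "b \<in> carrier GL2" using tb(1) by (rule Borel_GL2)
        have "g = matrix_inv (um t ** nm ** b)" unfolding tb(2)[symmetric] using g by simp
        also have "\<dots> = matrix_inv b ** (dg (-1) (-1) ** (nm ** um (- t)))"
          using bG by (simp add: matrix_inv_mult matrix_inv_mat2)
        finally have "x g = x (matrix_inv b ** (dg (-1) (-1) ** (nm ** um (- t))))" by simp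
        also have "\<dots> = x (dg (-1) (-1) ** (nm ** um (- t)))"
          by (rule IB'[OF x(1) Borel_inv[OF tb(1)]]) (intro GL2_mult, simp_all)
        also have "\<dots> = x (nm ** um (- t))"
          by (rule IB'[OF x(1)]) (simp_all add: Borel_iff)
        also have "\<dots> = x nm" by (rule xu) simp
        finally show ?thesis using False g by (simp add: fun_scale_def e_def cst_def)
      qed
    next
      case False
      then show ?thesis using IB[OF x(1) False] IB[OF e False] by (simp add: fun_scale_def cst_def)
    qed
    then have "x = fun_scale (*) ?\<kappa> e + cst (x nm)" by (rule ext)
    then have "\<theta> x = \<theta> (fun_scale (*) ?\<kappa> e + cst (x nm))" by (rule arg_cong)
    also have "\<dots> = \<theta> (fun_scale (*) ?\<kappa> e) + \<theta> (cst (x nm))"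
      by (rule add[OF Q.C_scale[OF e] cst_IB])
    finally have "a = scA ?\<kappa> (\<theta> e)" using ker[OF cst_IB] scale[OF e] x by simp
    then show ?thesis by blast
  qed
  have "A.U_inv vA" using vA(1) by (simp add: U_inv_iff_invariants A.U_inv_def)
  then obtain \<kappa> where \<kappa>: "vA = scA \<kappa> (\<theta> e)" using inv by blast
  then have k0: "\<kappa> \<noteq> 0" using vA(2) by auto
  have e_vA: "\<theta> e = scA (inverse \<kappa>) vA" using k0 by (simp add: \<kappa>)
  have act_en_vA: "actA (um t) (actA nm vA) = scA \<kappa> (\<theta> (en t))" for t
    by (simp add: \<kappa> A.act_scale act_en)
  have gen: "A.gen vA = UNIV"
  proof -
    have ge: "\<theta> e \<in> A.gen vA" unfolding e_vA
      by (intro A.subspace_scale[OF A.gen_subspace] A.gen_self) simp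
    have gen_en: "\<theta> (en t) \<in> A.gen vA" for t
      unfolding act_en[symmetric] by (intro A.gen_stable ge) simp_all
    have "\<theta> x \<in> A.gen vA" if x: "x \<in> IB" for x
    proof -
      \<comment> \<open>The matrix \<open>mat2 0 (-1) 1 (- t)\<close> represents the point
        supporting \<open>en t\<close>, so these are the coefficients of \<open>x\<close> in the
        basis of indicator functions.\<close>
      let ?h = "\<lambda>t. fun_scale (*) (x (mat2 0 (-1) 1 (- t))) (en t)"
      have h: "?h t \<in> IB" for t by (intro Q.C_scale en)
      have "x g = (fun_scale (*) (x (mat 1)) e + sum ?h UNIV) g" for g
      proof (cases "g \<in> carrier GL2")
        case g: True
        have s: "sum ?h UNIV g = (\<Sum>t\<in>UNIV. if g$2$1 * t + g$2$2 = 0 then x (mat2 0 (-1) 1 (- t)) else 0)"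
          unfolding sum_apply by (intro sum.cong refl) (simp add: fun_scale_def en_val g)
        show ?thesis
        proof (cases "g \<in> Borel")
          case True
          then have "x (g ** mat 1) = x (mat 1)" by (intro IB'[OF x(1)]) simp_all
          moreover have "sum ?h UNIV g = 0" using True Borel22[OF True] unfolding s by (simp add: Borel_iff)
          ultimately show ?thesis using True by (simp add: fun_scale_def e_def)
        next
          case False
          then have c: "g$2$1 \<noteq> 0" using g by (simp add: Borel_def)
          let ?t = "- g$2$2 / g$2$1" and ?i = "mat2 0 (-1) 1 (g$2$2 / g$2$1)"
          have "g = mat2 (- g$1$1 * (- g$2$2 / g$2$1) - g$1$2) (g$1$1) 0 (g$2$1) ** ?i"
            using c by (simp add: mat_eq2_iff)
          moreover have "mat2 (- g$1$1 * (- g$2$2 / g$2$1) - g$1$2) (g$1$1) 0 (g$2$1) \<in> Borel"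
          proof -
            have "- g$1$1 * (- g$2$2 / g$2$1) - g$1$2 = det g / g$2$1" using c by (simp add: det_2 field_simps)
            then show ?thesis using c g by (simp add: Borel_iff GL2_iff)
          qed
          moreover have "?i \<in> carrier GL2" by simp
          ultimately have "x g = x ?i" using IB'[OF x(1)] by metis
          moreover have "sum ?h UNIV g = x (mat2 0 (-1) 1 (- ?t))" unfolding s using c by (simp add: solve)
          ultimately show ?thesis using False by (simp add: fun_scale_def e_def)
        qed
      next
        case False
        then show ?thesis using IB[OF x(1) False] IB[OF e False] IB[OF IBsum[OF h, THEN conjunct1] False]
          by (simp add: fun_scale_def)
      qed
      then have "x = fun_scale (*) (x (mat 1)) e + sum ?h UNIV" by (rule ext)
      then have "\<theta> x = \<theta> (fun_scale (*) (x (mat 1)) e + sum ?h UNIV)" by (rule arg_cong)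
      also have "\<dots> = \<theta> (fun_scale (*) (x (mat 1)) e) + \<theta> (sum ?h UNIV)"
        by (rule add[OF Q.C_scale[OF e] IBsum[OF h, THEN conjunct1]])
      also have "\<theta> (fun_scale (*) (x (mat 1)) e) = scA (x (mat 1)) (\<theta> e)" by (rule scale[OF e])
      also have "\<theta> (sum ?h UNIV) = (\<Sum>t\<in>UNIV. \<theta> (?h t))" by (rule IBsum[OF h, THEN conjunct2])
      also have "\<dots> = (\<Sum>t\<in>UNIV. scA (x (mat2 0 (-1) 1 (- t))) (\<theta> (en t)))"
        by (intro sum.cong refl scale en)
      finally show ?thesis
        by (simp add: A.subspace_add A.subspace_scale A.subspace_sum A.gen_subspace ge gen_en)
    qed
    then show ?thesis using surj by (metis UNIV_eq_I)
  qed
  have Be: "A.B_eigen chi vA"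
    unfolding A.B_eigen_def
  proof
    fix b :: "'q^2^2" assume b: "b \<in> Borel"
    have "g ** b \<in> Borel \<longleftrightarrow> g \<in> Borel" for g
      using Borel_mult[OF _ b, of g] Borel_mult[OF _ Borel_inv[OF b], of "g ** b"] Borel_GL2[OF b] by auto
    then have "rtrans b e = e" by (simp add: rtrans_def e_def)
    then have "actA b (\<theta> e) = scA (chi' (det b)) (\<theta> e)" using act[OF Borel_GL2[OF b] e] by simp
    then show "actA b vA = scA (chi (diag_part b)) vA"
      using b by (simp add: \<kappa> A.act_scale Borel_GL2 chi'(2) diag_part_Torus det_diag_part mult.commute)
  qed
  \<comment> \<open>A combination of the \<open>en t\<close> that is zero in the quotient is
    constant. At \<open>mat 1\<close> every \<open>en t\<close> vanishes, so the constant is 0; at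
    the point of \<open>en t\<close> only one term is left.\<close>
  have indep: "c t = 0" if "(\<Sum>t\<in>UNIV. scA (c t) (actA (um t) (actA nm vA))) = 0" for c t
  proof -
    let ?h = "\<lambda>t. fun_scale (*) (c t * \<kappa>) (en t)"
    have h: "?h t \<in> IB" for t by (intro Q.C_scale en)
    have "\<theta> (sum ?h UNIV) = (\<Sum>t\<in>UNIV. \<theta> (?h t))" by (rule IBsum[OF h, THEN conjunct2])
    also have "\<dots> = 0" using that scale[OF en] by (simp add: act_en_vA)
    finally have "sum ?h UNIV \<in> range cst" by (simp only: ker[OF IBsum[OF h, THEN conjunct1]])
    then obtain d where d0: "sum ?h UNIV = cst d" by (elim rangeE)
    have d: "(\<Sum>t\<in>UNIV. ?h t g) = d" if "g \<in> carrier GL2" for g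
      using fun_cong[OF d0, of g] that unfolding sum_apply cst_def by simp
    have "d = 0" using d[of "mat 1"] by (simp add: fun_scale_def en_val) (simp add: mat_def)
    moreover have "(\<Sum>s\<in>UNIV. ?h s (mat2 0 (-1) 1 (- t))) = (\<Sum>s\<in>UNIV. if s = t then c t * \<kappa> else 0)"
      by (intro sum.cong refl) (simp add: fun_scale_def en_val)
    ultimately have "c t * \<kappa> = 0" using d[of "mat2 0 (-1) 1 (- t)"] by simp
    then show ?thesis using k0 by simp
  qed
  have T: "A.Tn vA = - vA" by (simp add: \<kappa> A.Tn_scale Tn_e)
  have span: "\<exists>c. a = scA c vA" if "A.U_inv a" for a
  proof -
    obtain \<mu> where "a = scA \<mu> (\<theta> e)" using inv[OF \<open>A.U_inv a\<close>] by blast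
    then have "a = scA (\<mu> * inverse \<kappa>) vA" by (simp add: e_vA)
    then show ?thesis by blast
  qed
  show ?thesis
    by unfold_locales (use vA Be gen span T J s chi'(2) one indep in \<open>auto simp: T_eigenvalue_def\<close>)
qed

section \<open>The diagram of a pair of irreducible representations\<close>

lemma s_invariant_conj_s [simp]: "s_invariant (conj_s chi) \<longleftrightarrow> s_invariant chi"
  by (auto simp: s_invariant_def)

lemma torus_char_conj_s:
  assumes "torus_char chi" shows "torus_char (conj_s chi)"
proof -
  have h: "chi x \<noteq> 0" "y \<in> Torus \<Longrightarrow> chi (x ** y) = chi x * chi y" if "x \<in> Torus" for x y
    using assms that by (auto simp: torus_char_def hom_def units_group_def GL2_def)
  show ?thesis unfolding torus_char_def hom_def units_group_def GL2_def
  proof (simp, intro conjI ballI)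
    show "conj_s chi \<in> Torus \<rightarrow> - {0}"
      using h(1) by (fastforce simp: Torus_iff conj_s_mat2)
    fix x y :: "'a^2^2" assume "x \<in> Torus" "y \<in> Torus"
    then obtain a b c d where *: "a \<noteq> 0" "b \<noteq> 0" "c \<noteq> 0" "d \<noteq> 0" "x = dg a b" "y = dg c d"
      by (auto simp: Torus_iff)
    then show "conj_s chi (x ** y) = conj_s chi x * conj_s chi y"
      using h(2)[of "dg b a" "dg d c"] by (auto simp: Torus_iff conj_s_mat2)
  qed
qed

context nonarch_local_field
begin

declare unif_nonzero [simp]

lemma scalar_decomp:
  assumes "c \<noteq> 0"
  obtains n u where "u \<noteq> 0" "val F u = 0" "c = unif F powi n * u"
proof (rule that)
  show "c / unif F powi val F c \<noteq> 0" using assms by simp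
  show "val F (c / unif F powi val F c) = 0" using assms by (simp add: val_divide val_powi)
  show "c = unif F powi val F c * (c / unif F powi val F c)" by simp
qed

lemma unit_scalar_K: "u \<noteq> 0 \<Longrightarrow> val F u = 0 \<Longrightarrow> mat u \<in> Iw F"
  by (simp add: Iw_iff K_iff mat_conv_mat2 forall_2 ints_def val_mult)

text \<open>The unit part of the scalar is absorbed into \<open>k\<close>, which leaves the normal
  form on which \<open>tilde\<close> is defined.\<close>

lemma stab0_decomp:
  assumes "g \<in> stab (\<sigma>0 F)"
  obtains n k where "k \<in> K F" "g = mat (unif F powi n) ** k"
proof -
  obtain c k where ck: "c \<noteq> 0" "k \<in> K F" "g = mat c ** k"
    using assms move_vertex0_eq_iff by (auto simp: stab0_iff)
  obtain n u where u: "u \<noteq> 0" "val F u = 0" "c = unif F powi n * u" by (rule scalar_decomp[OF ck(1)])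
  then have "mat u ** k \<in> K F" using ck unit_scalar_K Iw_K K_mult by blast
  moreover have "g = mat (unif F powi n) ** (mat u ** k)"
    using ck u by (simp add: matrix_mul_assoc mat_mult_mat)
  ultimately show thesis by (rule that)
qed

lemma ZI_decomp:
  assumes "g \<in> ZI F"
  obtains n k where "k \<in> Iw F" "g = mat (unif F powi n) ** k"
proof -
  obtain c k where ck: "c \<noteq> 0" "k \<in> Iw F" "g = mat c ** k" using assms by (auto simp: ZI_def)
  obtain n u where u: "u \<noteq> 0" "val F u = 0" "c = unif F powi n * u" by (rule scalar_decomp[OF ck(1)])
  then have "mat u ** k \<in> Iw F" using ck unit_scalar_K Iw_mult by blast
  moreover have "g = mat (unif F powi n) ** (mat u ** k)"
    using ck u by (simp add: matrix_mul_assoc mat_mult_mat)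
  ultimately show thesis by (rule that)
qed

lemma tilde_eq:
  assumes "k \<in> K F" shows "tilde F act (mat (unif F powi n) ** k) = act (red_mat F k)"
proof -
  have "(THE l. l \<in> K F \<and> (\<exists>m::int. mat (unif F powi n) ** k = mat (unif F powi m) ** l)) = k"
  proof (rule the_equality)
    show "k \<in> K F \<and> (\<exists>m::int. mat (unif F powi n) ** k = mat (unif F powi m) ** k)" using assms by auto
    fix l assume "l \<in> K F \<and> (\<exists>m::int. mat (unif F powi n) ** k = mat (unif F powi m) ** l)"
    then obtain m where l: "l \<in> K F" and m: "mat (unif F powi n) ** k = mat (unif F powi m) ** l" by blast
    \<comment> \<open>The valuation of the determinant is twice the exponent, so the exponent is
      unique.\<close>
    have "val F (det (mat (unif F powi n) ** k)) = 2 * n" "val F (det (mat (unif F powi m) ** l)) = 2 * m"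
      using assms l by (simp_all add: det_mat_mult val_mult val_powi K_iff)
    then have "2 * n = 2 * m" unfolding m by (metis (no_types))
    then have "mat (unif F powi n) ** k = mat (unif F powi n) ** l" using m by simp
    then have "matrix_inv (mat (unif F powi n)) ** (mat (unif F powi n) ** k) =
        matrix_inv (mat (unif F powi n)) ** (mat (unif F powi n) ** l)" by (rule arg_cong)
    then show "l = k" by simp
  qed
  then show ?thesis by (simp add: tilde_def inflate_def)
qed

lemma scalar_prod: "(mat c ** k) ** (mat d ** l) = mat (c * d) ** (k ** l)"
  for c d :: 'f and k l :: "'f^2^2"
proof -
  have "(mat c ** k) ** (mat d ** l) = mat c ** (k ** mat d) ** l" by (simp add: matrix_mul_assoc)
  also have "k ** mat d = mat d ** k" by (rule mat_mult_commute[symmetric])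
  finally show ?thesis by (simp add: matrix_mul_assoc mat_mult_mat)
qed

lemma scalar_prod_powi: "(mat (unif F powi n) ** k) ** (mat (unif F powi m) ** l) = mat (unif F powi (n + m)) ** (k ** l)"
  for k l :: "'f^2^2"
  using unif_nonzero by (simp add: scalar_prod power_int_add)

lemma tilde_mult:
  assumes "gl2_rep sc UNIV act" "g \<in> stab (\<sigma>0 F)" "h \<in> stab (\<sigma>0 F)"
  shows "tilde F act (g ** h) v = tilde F act g (tilde F act h v)"
proof -
  interpret gl2_rep sc UNIV act by fact
  obtain n k where k: "k \<in> K F" "g = mat (unif F powi n) ** k" by (rule stab0_decomp[OF assms(2)])
  obtain m l where l: "l \<in> K F" "h = mat (unif F powi m) ** l" by (rule stab0_decomp[OF assms(3)])
  show ?thesis using k l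
    by (simp only: scalar_prod_powi tilde_eq K_mult) (simp add: red_mat_mult_K act_mult red_mat_GL2)
qed

lemma tilde_K: "k \<in> K F \<Longrightarrow> tilde F act k = act (red_mat F k)"
  using tilde_eq[of k act 0] by simp

lemma tilde_linear:
  assumes "gl2_rep sc UNIV act" "g \<in> stab (\<sigma>0 F)"
  shows "tilde F act g (v + w) = tilde F act g v + tilde F act g w"
    "tilde F act g (sc c v) = sc c (tilde F act g v)"
proof -
  interpret gl2_rep sc UNIV act by fact
  obtain n k where k: "k \<in> K F" "g = mat (unif F powi n) ** k" by (rule stab0_decomp[OF assms(2)])
  show "tilde F act g (v + w) = tilde F act g v + tilde F act g w"
    "tilde F act g (sc c v) = sc c (tilde F act g v)"
    using k by (simp_all add: tilde_eq act_add act_scale red_mat_GL2)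
qed

lemma ZI_GL2: "g \<in> ZI F \<Longrightarrow> g \<in> carrier GL2"
  using Iw_K K_GL2 by (auto simp: ZI_def)

lemma ZI_fixes: "g \<in> ZI F \<Longrightarrow> move g (vertex0 F) = vertex0 F \<and> move g (vertex1 F) = vertex1 F"
  using ZI_iff ZI_GL2 by blast

lemma ZI_stab: "g \<in> ZI F \<Longrightarrow> g \<in> stab (\<sigma>0 F)" "g \<in> ZI F \<Longrightarrow> g \<in> stab (\<sigma>1 F)"
  using ZI_fixes ZI_GL2 by (simp_all add: stab0_iff stab1_iff)

lemma stab1_cases:
  assumes "g \<in> stab (\<sigma>1 F)"
  shows "g \<notin> ZI F \<longleftrightarrow> move g (vertex0 F) = vertex1 F \<and> move g (vertex1 F) = vertex0 F"
  using assms ZI_iff vertex0_neq_vertex1 by (auto simp: stab1_iff)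

lemma Iw_ZI: "k \<in> Iw F \<Longrightarrow> k \<in> ZI F"
  unfolding ZI_def by (intro CollectI exI[of _ 1] exI[of _ k]) simp

lemma stab1_Pi: "g \<in> stab (\<sigma>1 F) \<Longrightarrow> g \<notin> ZI F \<Longrightarrow> g ** Pi_mat F \<in> ZI F"
  using stab1_cases[of g] ZI_iff[of "g ** Pi_mat F"]
  by (simp add: stab1_iff move_mult move_Pi_vertex1 flip: vertex1_eq)

lemma stab1_mult: "g \<in> stab (\<sigma>1 F) \<Longrightarrow> h \<in> stab (\<sigma>1 F) \<Longrightarrow> g ** h \<in> stab (\<sigma>1 F)"
  by (auto simp: stab1_iff move_mult)

text \<open>Flipping or not flipping the base edge is a homomorphism to the group of order two, with
  kernel \<open>ZI F\<close>.\<close>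

lemma stab1_mult_ZI:
  assumes "g \<in> stab (\<sigma>1 F)" "h \<in> stab (\<sigma>1 F)"
  shows "g ** h \<in> ZI F \<longleftrightarrow> (g \<in> ZI F \<longleftrightarrow> h \<in> ZI F)"
  using assms stab1_cases[OF stab1_mult[OF assms]] stab1_cases[OF assms(1)] stab1_cases[OF assms(2)]
    ZI_fixes[of g] ZI_fixes[of h] vertex0_neq_vertex1 by (auto simp: move_mult)

lemma stab_inv: "g \<in> stab \<sigma> \<Longrightarrow> matrix_inv g \<in> stab \<sigma>"
proof -
  assume g: "g \<in> stab \<sigma>"
  then have G: "g \<in> carrier GL2" and eq: "move g ` \<sigma> = \<sigma>" by (auto simp: stab_def)
  have "move (matrix_inv g) ` move g ` \<sigma> = \<sigma>" using G by (simp add: image_image)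
  then show ?thesis using G by (simp only: eq) (simp add: stab_def)
qed

end

section \<open>The concrete diagram built from two irreducible representations\<close>

locale rho_pair = nonarch_local_field F + A: rho_rep scA actA chi J vA + B: rho_rep scB actB "conj_s chi" J' vB
  for F :: "('f::field, 'q::{field, finite}) valued_field"
    and scA :: "'k::field \<Rightarrow> 'a::ab_group_add \<Rightarrow> 'a" and actA :: "'q^2^2 \<Rightarrow> 'a \<Rightarrow> 'a" and chi J vA
    and scB :: "'k \<Rightarrow> 'b::ab_group_add \<Rightarrow> 'b" and actB :: "'q^2^2 \<Rightarrow> 'b \<Rightarrow> 'b" and J' vB +
  assumes chi: "torus_char chi"
begin

lemma chi_one: "chi (mat 1) = 1" "conj_s chi (mat 1) = 1"
  using A.A.torus_charD(4)[OF chi] A.A.torus_charD(4)[OF torus_char_conj_s[OF chi]] by auto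

abbreviation "a0 \<equiv> D0_act F actA actB"
abbreviation "a1 \<equiv> D1_act F scA actA vA scB actB vB"
abbreviation "E \<equiv> D1 F actA actB"
abbreviation "swap \<equiv> D1_swap scA scB vA vB"
abbreviation "sd \<equiv> prod_scale scA scB"

lemma repA: "gl2_rep scA UNIV actA" and repB: "gl2_rep scB UNIV actB"
  by (rule A.A.gl2_rep_axioms, rule B.A.gl2_rep_axioms)

lemma a0_powi: "k \<in> K F \<Longrightarrow> a0 (mat (unif F powi n) ** k) d = (actA (red_mat F k) (fst d), actB (red_mat F k) (snd d))"
  by (cases d) (simp add: D0_act_def tilde_eq)

lemma a0_K: "k \<in> K F \<Longrightarrow> a0 k (x, y) = (actA (red_mat F k) x, actB (red_mat F k) y)"
  by (simp add: D0_act_def tilde_K)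

lemma a0_mult: "g \<in> stab (\<sigma>0 F) \<Longrightarrow> h \<in> stab (\<sigma>0 F) \<Longrightarrow> a0 (g ** h) d = a0 g (a0 h d)"
  by (cases d) (simp add: D0_act_def tilde_mult[OF repA] tilde_mult[OF repB])

lemma vector_space_sd: "vector_space sd"
  by unfold_locales (auto simp: prod_scale_def A.A.scale_right_distrib B.A.scale_right_distrib
      A.A.scale_left_distrib B.A.scale_left_distrib)

sublocale C0: coset_action F sd "stab (\<sigma>0 F)" UNIV a0
proof -
  interpret sd: vector_space sd by (rule vector_space_sd)
  show "coset_action F sd (stab (\<sigma>0 F)) UNIV a0"
  proof unfold_locales
    show "sd.subspace UNIV" by simp
    show "a0 k d = d" if "k \<in> K1 F" for k d
      using that a0_K[of k "fst d" "snd d"] A.A.act_one B.A.act_one by (simp add: K1_iff)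
    show "k \<in> stab (\<sigma>0 F)" if "k \<in> K1 F" for k
      using that K_fix K_GL2 by (simp add: K1_iff stab0_iff)
    show "a0 g (d + d') = a0 g d + a0 g d'" if "g \<in> stab (\<sigma>0 F)" for g d d'
      using that by (cases d; cases d') (simp add: D0_act_def tilde_linear[OF repA] tilde_linear[OF repB])
    show "a0 g (sd c d) = sd c (a0 g d)" if "g \<in> stab (\<sigma>0 F)" for g c d
      using that by (cases d) (simp add: D0_act_def prod_scale_def tilde_linear[OF repA] tilde_linear[OF repB])
  qed (auto simp: stab0_iff move_mult a0_mult move_eq_iff stab_inv)
qed

text \<open>On \<open>D_0\<close> the group \<open>Iw1 F\<close> acts through \<open>U\<close>, and
  the \<open>U\<close>-invariants of each summand form a line.\<close>

lemma E_eq: "E = {(scA x vA, scB y vB) | x y. True}"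
proof (intro Set.set_eqI iffI)
  fix d assume d: "d \<in> E"
  have fx: "(actA (um t) (fst d), actB (um t) (snd d)) = d" for t
  proof -
    have l: "lift (um t) \<in> K F" "red_mat F (lift (um t)) = um t" using lift[of "um t"] by simp_all
    then have "lift (um t) \<in> Iw1 F" by (simp add: Iw1_def Unip_iff)
    then have "a0 (lift (um t)) d = d" using d unfolding D1_def invariants_def by blast
    then show ?thesis using a0_K[OF l(1), of "fst d" "snd d"] l by simp
  qed
  have "A.A.U_inv (fst d)" using arg_cong[OF fx, of fst] by (simp add: A.A.U_inv_def)
  moreover have "B.A.U_inv (snd d)" using arg_cong[OF fx, of snd] by (simp add: B.A.U_inv_def)
  ultimately obtain x y where "fst d = scA x vA" "snd d = scB y vB"
    using A.U_inv_span B.U_inv_span by blast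
  then show "d \<in> {(scA x vA, scB y vB) | x y. True}" by (cases d) auto
next
  fix d assume "d \<in> {(scA x vA, scB y vB) | x y. True}"
  then obtain x y where d: "d = (scA x vA, scB y vB)" by blast
  have "a0 k d = d" if k: "k \<in> Iw1 F" for k
  proof -
    have u: "red_mat F k \<in> Unip" using k by (simp add: Iw1_def)
    have "actA (red_mat F k) vA = vA" "actB (red_mat F k) vB = vB"
      using A.B_eigen B.B_eigen Unip_Borel[OF u] diag_part_one_iff[of "red_mat F k"] u chi_one
      by (simp_all add: A.A.B_eigen_def B.A.B_eigen_def)
    then show ?thesis using red_mat_GL2[OF Iw1_K[OF k]]
      by (simp add: d a0_K Iw1_K[OF k] A.A.act_scale B.A.act_scale)
  qed
  then show "d \<in> E" by (simp add: D1_def invariants_def)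
qed

lemma swap_eq: "swap (scA x vA, scB y vB) = (scA y vA, scB x vB)"
  unfolding D1_swap_def
proof (rule the_equality)
  fix d' assume "\<exists>a b. (scA x vA, scB y vB) = (scA a vA, scB b vB) \<and> d' = (scA b vA, scB a vB)"
  then show "d' = (scA y vA, scB x vB)" using A.vA B.vA by auto
qed auto

lemma a0_E:
  assumes "k \<in> Iw F"
  shows "a0 (mat (unif F powi n) ** k) (scA x vA, scB y vB) =
    (scA (chi (diag_part (red_mat F k)) * x) vA, scB (conj_s chi (diag_part (red_mat F k)) * y) vB)"
proof -
  have b: "red_mat F k \<in> Borel" and K: "k \<in> K F" using assms by (simp_all add: Iw_def)
  then show ?thesis using A.B_eigen B.B_eigen Borel_GL2[OF b]
    by (simp add: a0_powi A.A.B_eigen_def B.A.B_eigen_def A.A.act_scale B.A.act_scale mult.commute)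
qed

text \<open>Conjugation by \<open>Pi_mat F\<close> exchanges the two diagonal residues, hence chi
  and its conjugate. Exchanging the two lines of \<open>E\<close> therefore intertwines the action
  with its conjugate, the relation that makes \<open>D1_act\<close> an action.\<close>

lemma swap_a0:
  assumes g: "g \<in> ZI F" and d: "d \<in> E"
  shows "swap (a0 g d) = a0 (matrix_inv (Pi_mat F) ** g ** Pi_mat F) (swap d)"
    "a0 g d \<in> E" "matrix_inv (Pi_mat F) ** g ** Pi_mat F \<in> ZI F"
proof -
  let ?P = "Pi_mat F"
  obtain n k where k: "k \<in> Iw F" "g = mat (unif F powi n) ** k" by (rule ZI_decomp[OF g])
  obtain x y where xy: "d = (scA x vA, scB y vB)" using d by (auto simp: E_eq)
  let ?l = "matrix_inv ?P ** k ** ?P"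
  have l: "?l \<in> Iw F" by (rule Pi_conj_Iw[OF k(1)])
  have conj: "matrix_inv ?P ** g ** ?P = mat (unif F powi n) ** ?l"
    unfolding k(2) by (metis mat_mult_commute matrix_mul_assoc)
  have "red_mat F k \<in> Borel" using k by (simp add: Iw_def)
  then have "diag_part (red_mat F ?l) = dg (red_mat F k $ 2 $ 2) (red_mat F k $ 1 $ 1)"
    by (simp add: Pi_conj red_mat_mat2 diag_part_conv red_mat_nth)
  then have c: "chi (diag_part (red_mat F ?l)) = conj_s chi (diag_part (red_mat F k))"
      "conj_s chi (diag_part (red_mat F ?l)) = chi (diag_part (red_mat F k))"
    by (simp_all add: conj_s_mat2 diag_part_conv)
  show "swap (a0 g d) = a0 (matrix_inv ?P ** g ** ?P) (swap d)"
    unfolding conj by (simp add: k xy swap_eq a0_E l c)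
  show "a0 g d \<in> E" unfolding k(2) xy a0_E[OF k(1)] E_eq by blast
  show "matrix_inv ?P ** g ** ?P \<in> ZI F" unfolding conj ZI_def using l by (intro CollectI exI conjI) auto
qed

lemma swap_E: "d \<in> E \<Longrightarrow> swap d \<in> E" "d \<in> E \<Longrightarrow> swap (swap d) = d"
  "d \<in> E \<Longrightarrow> d' \<in> E \<Longrightarrow> swap (d + d') = swap d + swap d'"
  "d \<in> E \<Longrightarrow> swap (sd c d) = sd c (swap d)"
proof -
  show "d \<in> E \<Longrightarrow> swap d \<in> E" unfolding E_eq by (force simp: swap_eq)
  show "d \<in> E \<Longrightarrow> swap (swap d) = d" unfolding E_eq by (force simp: swap_eq)
  show "d \<in> E \<Longrightarrow> swap (sd c d) = sd c (swap d)" unfolding E_eq by (force simp: swap_eq prod_scale_def)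
  show "d \<in> E \<Longrightarrow> d' \<in> E \<Longrightarrow> swap (d + d') = swap d + swap d'"
    unfolding E_eq by (force simp: swap_eq simp flip: A.A.scale_left_distrib B.A.scale_left_distrib)
qed

lemma a1_ZI: "g \<in> ZI F \<Longrightarrow> a1 g d = a0 g d"
  and a1_not_ZI: "g \<notin> ZI F \<Longrightarrow> a1 g d = a0 (g ** Pi_mat F) (swap d)"
  by (simp_all add: D1_act_def)

lemma a1_closed: "g \<in> stab (\<sigma>1 F) \<Longrightarrow> d \<in> E \<Longrightarrow> a1 g d \<in> E"
  using swap_a0(2)[of g d] swap_a0(2)[of "g ** Pi_mat F" "swap d"] swap_E(1)[of d] stab1_Pi[of g]
  by (cases "g \<in> ZI F") (simp_all add: a1_ZI a1_not_ZI)

lemma a0_Pi_Pi: "a0 (mat (unif F)) d = d"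
proof -
  have "a0 (mat (unif F powi 1) ** mat 1) d = d"
    using a0_powi[OF K_one, of 1 d] A.A.act_one B.A.act_one by simp
  then show ?thesis by simp
qed

text \<open>The cases follow whether each factor flips the edge. If the left factor flips,
  \<open>swap_a0\<close> moves the swap past the right one; if both flip, the two swaps cancel and
  the square of \<open>Pi_mat F\<close> is the uniformiser, which acts trivially.\<close>

lemma a1_mult:
  assumes g: "g \<in> stab (\<sigma>1 F)" and h: "h \<in> stab (\<sigma>1 F)" and d: "d \<in> E"
  shows "a1 (g ** h) d = a1 g (a1 h d)"
proof -
  let ?P = "Pi_mat F"
  have PG: "?P \<in> carrier GL2" by simp
  note iff = stab1_mult_ZI[OF g h]
  show ?thesis
  proof (cases "g \<in> ZI F"; cases "h \<in> ZI F")
    assume gh: "g \<in> ZI F" "h \<in> ZI F"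
    then show ?thesis using iff a0_mult ZI_stab(1) by (simp add: a1_ZI)
  next
    assume gh: "g \<in> ZI F" "h \<notin> ZI F"
    have "a1 (g ** h) d = a0 (g ** (h ** ?P)) (swap d)"
      using gh iff by (simp add: a1_not_ZI matrix_mul_assoc)
    also have "\<dots> = a0 g (a0 (h ** ?P) (swap d))"
      by (intro a0_mult ZI_stab(1) gh stab1_Pi h)
    finally show ?thesis using gh by (simp add: a1_ZI a1_not_ZI)
  next
    assume gh: "g \<notin> ZI F" "h \<in> ZI F"
    have "a1 g (a1 h d) = a0 (g ** ?P) (a0 (matrix_inv ?P ** h ** ?P) (swap d))"
      using gh d by (simp add: a1_ZI a1_not_ZI swap_a0)
    also have "\<dots> = a0 ((g ** ?P) ** (matrix_inv ?P ** h ** ?P)) (swap d)"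
      by (rule a0_mult[symmetric]) (intro ZI_stab(1) stab1_Pi g gh swap_a0(3)[OF _ d])+
    also have "(g ** ?P) ** (matrix_inv ?P ** h ** ?P) = g ** h ** ?P"
      using PG by (simp flip: matrix_mul_assoc)
    also have "a0 (g ** h ** ?P) (swap d) = a1 (g ** h) d" using gh iff by (simp add: a1_not_ZI)
    finally show ?thesis by simp
  next
    assume gh: "g \<notin> ZI F" "h \<notin> ZI F"
    have sd: "swap d \<in> E" by (rule swap_E(1)[OF d])
    have hP: "h ** ?P \<in> ZI F" by (rule stab1_Pi[OF h gh(2)])
    have "a1 g (a1 h d) = a0 (g ** ?P) (a0 (matrix_inv ?P ** (h ** ?P) ** ?P) d)"
      using gh swap_a0(1)[OF hP sd] swap_E(2)[OF d] by (simp add: a1_not_ZI)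
    also have "\<dots> = a0 ((g ** ?P) ** (matrix_inv ?P ** (h ** ?P) ** ?P)) d"
      by (rule a0_mult[symmetric]) (intro ZI_stab(1) stab1_Pi g gh swap_a0(3)[OF hP d])+
    also have "(g ** ?P) ** (matrix_inv ?P ** (h ** ?P) ** ?P) = (g ** h) ** mat (unif F)"
      using PG by (simp flip: matrix_mul_assoc Pi_Pi)
    also have "a0 ((g ** h) ** mat (unif F)) d = a0 (g ** h) (a0 (mat (unif F)) d)"
    proof (rule a0_mult)
      show "g ** h \<in> stab (\<sigma>0 F)" using gh iff ZI_stab by simp
      show "mat (unif F) \<in> stab (\<sigma>0 F)" using scalar_fix[of "unif F"] by (simp add: stab0_iff)
    qed
    also have "\<dots> = a1 (g ** h) d" using gh iff by (simp add: a0_Pi_Pi a1_ZI)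
    finally show ?thesis by simp
  qed
qed

sublocale C1: coset_action F sd "stab (\<sigma>1 F)" E a1
proof -
  have K1: "k \<in> ZI F" if "k \<in> K1 F" for k using that K1_Iw1 Iw1_Iw Iw_ZI by blast
  show "coset_action F sd (stab (\<sigma>1 F)) E a1"
  proof unfold_locales
    have z: "(scA 0 vA, scB 0 vB) = 0" by (simp add: zero_prod_def)
    show "C0.subspace E" unfolding C0.subspace_def
    proof (intro conjI ballI allI)
      show "0 \<in> E" unfolding E_eq z[symmetric] by blast
      show "d + d' \<in> E" if "d \<in> E" "d' \<in> E" for d d'
        using that unfolding E_eq by (auto simp flip: A.A.scale_left_distrib B.A.scale_left_distrib)
      show "sd c d \<in> E" if "d \<in> E" for c d
        using that unfolding E_eq by (auto simp: prod_scale_def)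
    qed
    show "a1 k d = d" if "k \<in> K1 F" "d \<in> E" for k d
      using that K1 C0.act_K1 by (simp add: a1_ZI)
    show "a1 g (d + d') = a1 g d + a1 g d'" if g: "g \<in> stab (\<sigma>1 F)" and d: "d \<in> E" "d' \<in> E" for g d d'
      using C0.act_add ZI_stab(1) stab1_Pi[OF g] swap_E(3)[OF d]
      by (cases "g \<in> ZI F") (simp_all add: a1_ZI a1_not_ZI)
    show "a1 g (sd c d) = sd c (a1 g d)" if g: "g \<in> stab (\<sigma>1 F)" and d: "d \<in> E" for g c d
      using C0.act_scale ZI_stab(1) stab1_Pi[OF g] swap_E(4)[OF d]
      by (cases "g \<in> ZI F") (simp_all add: a1_ZI a1_not_ZI)
    show "k \<in> stab (\<sigma>1 F)" if "k \<in> K1 F" for k using that K1 ZI_stab by blast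
  qed (auto simp: a1_closed a1_mult stab1_mult stab_inv stab1_iff[of "mat 1"] dest: stab1_iff[THEN iffD1])
qed

sublocale diagram F sd a0 E a1
proof
  fix g d assume g: "g \<in> stab (\<sigma>0 F)" "g \<in> stab (\<sigma>1 F)"
  then have "g \<in> ZI F" using stab1_cases[OF g(2)] vertex0_neq_vertex1 by (auto simp: stab0_iff)
  then show "a1 g d = a0 g d" by (rule a1_ZI)
qed

end

section \<open>Representations with invariants isomorphic to a supersingular module\<close>

context gl2_rep
begin

text \<open>Substituting a torus element times \<open>d\<close> for \<open>d\<close> pulls its
  character value out of the sum, whatever the normalising constant.\<close>

lemma weight_of_projection:
  assumes chi: "torus_char chi" and v: "v \<in> W"
    and eq: "v = sc c (\<Sum>d\<in>Torus. sc (inverse (chi d)) (act d v))"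
  shows "weight chi v"
  unfolding weight_def
proof
  fix e :: "'q^2^2" assume e: "e \<in> Torus"
  then obtain a b where ab: "a \<noteq> 0" "b \<noteq> 0" "e = dg a b" by (auto simp: Torus_iff)
  have TG: "d \<in> carrier GL2" if "d \<in> Torus" for d :: "'q^2^2" using that Torus_Borel Borel_GL2 by blast
  have mult: "chi (e ** d) = chi e * chi d" "e ** d \<in> Torus" if d: "d \<in> Torus" for d
    using torus_charD(2)[OF chi] ab d by (auto simp: Torus_iff)
  have nz: "chi d \<noteq> 0" if "d \<in> Torus" for d
    using torus_charD(1)[OF chi] that by (auto simp: Torus_iff)
  let ?S = "\<Sum>d\<in>Torus. sc (inverse (chi d)) (act d v)"
  have "act e ?S = (\<Sum>d\<in>Torus. sc (inverse (chi d)) (act (e ** d) v))"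
    using v TG TG[OF e] by (simp add: act_sum act_scale act_closed W_scale act_mult)
  also have "\<dots> = (\<Sum>d\<in>Torus. sc (chi e) (sc (inverse (chi d)) (act d v)))"
  proof (rule sum.reindex_bij_witness[of _ "\<lambda>d. matrix_inv e ** d" "\<lambda>d. e ** d"])
    fix d assume d: "d \<in> (Torus :: ('q^2^2) set)"
    show "sc (chi e) (sc (inverse (chi (e ** d))) (act (e ** d) v)) = sc (inverse (chi d)) (act (e ** d) v)"
      using mult[OF d] nz[OF e] by simp
    show "matrix_inv e ** d \<in> Torus" using d ab by (auto simp: Torus_iff matrix_inv_mat2)
  qed (use TG[OF e] mult in auto)
  also have "\<dots> = sc (chi e) ?S" by (simp only: scale_sum_right)
  finally have "act e (sc c ?S) = sc (chi e) (sc c ?S)"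
    using v TG TG[OF e] by (simp add: act_scale W_sum W_scale act_closed mult.commute)
  then show "act e v = sc (chi e) v" by (simp only: eq[symmetric])
qed

text \<open>A linear condition that holds on all translates of a generator holds everywhere; it
  serves to compare two linear maps on a generated representation.\<close>

lemma subspace_fixed_gen:
  assumes "subspace {x \<in> W. P x}" "\<And>g. g \<in> carrier GL2 \<Longrightarrow> P (act g w)" "w \<in> W" "x \<in> gen w"
  shows "P x"
proof -
  have "gen w \<subseteq> {x \<in> W. P x}" using assms by (intro gen_minimal) (auto simp: act_closed)
  then show ?thesis using assms by blast
qed

end

context nonarch_local_field
begin

lemma lift_red:
  assumes pi: "group_rep GL2 sc action" and k: "k \<in> K F" and v: "v \<in> invariants (K1 F) action"
  shows "action (lift (red_mat F k)) v = action k v"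
proof -
  let ?l = "lift (red_mat F k)"
  have l: "?l \<in> K F" "red_mat F ?l = red_mat F k" using lift[OF red_mat_GL2[OF k]] by auto
  have h: "matrix_inv ?l ** k \<in> K1 F" using K1_quotient[OF k l(1)] l(2) by simp
  have "action k v = action (?l ** (matrix_inv ?l ** k)) v" using K_GL2[OF l(1)] by simp
  also have "\<dots> = action ?l (action (matrix_inv ?l ** k) v)"
    using K_GL2[OF l(1)] K_GL2[OF k] by (intro group_rep_GL2D(3)[OF pi]) simp_all
  also have "\<dots> = action ?l v" using h v by (simp add: invariants_def)
  finally show ?thesis by simp
qed

text \<open>Since \<open>K1 F\<close> is normal in \<open>K F\<close>, the quotient acts on its
  invariants. By \<open>lift_red\<close> the choice of lifts is immaterial, so \<open>lift\<close>
  yields an action although it is not a homomorphism.\<close>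

lemma K1_invariants_rep:
  fixes sc :: "'k::field \<Rightarrow> 'v::ab_group_add \<Rightarrow> 'v"
  assumes pi: "group_rep GL2 sc action" and char: "CHAR('k) = CHAR('q)"
  shows "gl2_rep sc (invariants (K1 F) action) (\<lambda>g :: 'q^2^2. action (lift g))"
proof -
  note rep = group_rep_GL2D[OF pi]
  interpret vector_space sc by (rule rep(1))
  have lG: "lift g \<in> carrier GL2" and lK: "lift g \<in> K F" if "g \<in> carrier GL2" for g :: "'q^2^2"
    using lift[OF that] K_GL2 by auto
  have KG: "k \<in> K1 F \<Longrightarrow> k \<in> carrier GL2" for k by (simp add: K1_def K_GL2)
  show ?thesis
  proof
    show "subspace (invariants (K1 F) action)"
      using KG by (auto simp: subspace_def invariants_def rep)
    show "action (lift g) v \<in> invariants (K1 F) action"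
      if g: "g \<in> carrier GL2" and v: "v \<in> invariants (K1 F) action" for g :: "'q^2^2" and v
      unfolding invariants_def
    proof (intro CollectI ballI)
      fix k assume k: "k \<in> K1 F"
      have "matrix_inv (lift g) ** k ** lift g \<in> K1 F" by (rule K1_conj[OF lK[OF g] k])
      then have "action (lift g) (action (matrix_inv (lift g) ** k ** lift g) v) = action (lift g) v"
        using v by (simp add: invariants_def)
      moreover have "lift g ** (matrix_inv (lift g) ** k ** lift g) = k ** lift g"
        using lG[OF g] by (simp flip: matrix_mul_assoc)
      ultimately show "action k (action (lift g) v) = action (lift g) v"
        using lG[OF g] KG[OF k] by (simp flip: rep(3))
    qed
    show "action (lift (mat 1 :: 'q^2^2)) v = v" if "v \<in> invariants (K1 F) action" for v
      using lift_red[OF pi K_one that] by (simp add: rep)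
    show "action (lift (g ** h)) v = action (lift g) (action (lift h) v)"
      if g: "g \<in> carrier GL2" "h \<in> carrier GL2" and v: "v \<in> invariants (K1 F) action" for g h :: "'q^2^2" and v
      using lift_red[OF pi K_mult[OF lK[OF g(1)] lK[OF g(2)]] v] lift[OF g(1)] lift[OF g(2)] lG[OF g(1)] lG[OF g(2)]
      by (simp add: red_mat_mult_K rep)
  qed (use char lG rep in auto)
qed

lemma Iw1_invariants_K1: "v \<in> invariants (Iw1 F) action \<Longrightarrow> v \<in> invariants (K1 F) action"
  using K1_Iw1 by (auto simp: invariants_def)

text \<open>The operator \<open>T\<close> is equivariant, so it sends the
  \<open>Iw1 F\<close>-invariant function \<open>ind_Iw1 F\<close> to an invariant one.\<close>

lemma inv_act_invariant:
  fixes sc :: "'k::field \<Rightarrow> 'v::ab_group_add \<Rightarrow> 'v"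
  assumes pi: "group_rep GL2 sc action" and v: "v \<in> invariants (Iw1 F) action" and T: "T \<in> Hecke F"
  shows "inv_act F sc action v T \<in> invariants (Iw1 F) action"
  unfolding invariants_def
proof (intro CollectI ballI)
  fix h assume h: "h \<in> Iw1 F"
  have T_ind: "T (ind_Iw1 F) \<in> cInd" "T (rtrans h (ind_Iw1 F)) = rtrans h (T (ind_Iw1 F))"
    using T Iw1_GL2[OF h] by (simp_all add: Hecke_def Hom_rep_def c_Ind_triv_sel ind_cInd)
  show "action h (inv_act F sc action v T) = inv_act F sc action v T"
    using frob(4)[OF pi v Iw1_GL2[OF h] T_ind(1)] T_ind(2)
    by (simp add: inv_act_def rtrans_Iw1_ind[OF h])
qed

text \<open>The basis of the module is pulled back along the isomorphism. There \<open>T_Pi\<close>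
  becomes the action of the inverse of \<open>Pi_mat F\<close>, \<open>T_ns\<close> becomes the
  operator of the finite group, and being fixed by \<open>e_chi\<close> becomes a weight
  condition.\<close>

lemma supersingular_vectors:
  fixes sc :: "'k::field \<Rightarrow> 'v::ab_group_add \<Rightarrow> 'v" and chi :: "'q^2^2 \<Rightarrow> 'k"
  assumes pi: "group_rep GL2 sc action" and char: "CHAR('k) = CHAR('q)" and chi: "torus_char chi"
    and M: "is_M_gamma F chi scaleM ract" and iso: "invariants_iso F sc action scaleM ract"
  defines "act \<equiv> \<lambda>g :: 'q^2^2. action (lift g)"
  obtains w1 w2 where "w1 \<noteq> 0" "w2 \<noteq> 0" "w1 \<in> invariants (Iw1 F) action" "w2 \<in> invariants (Iw1 F) action"
    "\<And>v. v \<in> invariants (Iw1 F) action \<Longrightarrow> \<exists>a b. v = sc a w1 + sc b w2"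
    "action (matrix_inv (Pi_mat F)) w1 = w2" "action (matrix_inv (Pi_mat F)) w2 = w1"
    "gl2_rep.weight sc act chi w1" "gl2_rep.weight sc act (conj_s chi) w2"
    "gl2_rep.Tn act w1 = (if s_invariant chi then - w1 else 0)" "gl2_rep.Tn act w2 = 0"
proof -
  let ?V = "invariants (Iw1 F) action"
  note rep = group_rep_GL2D[OF pi]
  interpret G: gl2_rep sc "invariants (K1 F) action" act
    unfolding act_def by (rule K1_invariants_rep[OF pi char])
  interpret M: right_Hecke_module F scaleM ract using M by (simp add: is_M_gamma_def)
  obtain v1 v2 where v: "v1 \<noteq> v2" "\<not> M.dependent {v1, v2}" "M.span {v1, v2} = UNIV"
    "ract v1 (T_Pi F) = v2" "ract v2 (T_Pi F) = v1"
    "ract v1 (e_chi F chi) = v1" "ract v2 (e_chi F (conj_s chi)) = v2"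
    "ract v2 (T_ns F) = 0" "ract v1 (T_ns F) = (if s_invariant chi then - v1 else 0)"
    using M unfolding is_M_gamma_def by blast
  obtain f where f: "bij_betw f ?V UNIV" "\<And>x y. x \<in> ?V \<Longrightarrow> y \<in> ?V \<Longrightarrow> f (x + y) = f x + f y"
    "\<And>c x. x \<in> ?V \<Longrightarrow> f (sc c x) = scaleM c (f x)"
    "\<And>T x. T \<in> Hecke F \<Longrightarrow> x \<in> ?V \<Longrightarrow> f (inv_act F sc action x T) = ract (f x) T"
    using iso unfolding invariants_iso_def Let_def by blast
  have inj: "x = y" if "x \<in> ?V" "y \<in> ?V" "f x = f y" for x y
    by (rule inj_onD[OF bij_betw_imp_inj_on[OF f(1)] that(3,1,2)])
  have V0: "0 \<in> ?V" and Vadd: "x \<in> ?V \<Longrightarrow> y \<in> ?V \<Longrightarrow> x + y \<in> ?V" and Vsc: "x \<in> ?V \<Longrightarrow> sc c x \<in> ?V"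
    and Vneg: "x \<in> ?V \<Longrightarrow> - x \<in> ?V" for x y c
    using Iw1_GL2 by (simp_all add: invariants_def rep)
  have f0: "f 0 = 0" using f(2)[OF V0 V0] by simp
  have fneg: "f (- x) = - f x" if "x \<in> ?V" for x
    using f(3)[OF that, of "-1"] by simp
  obtain w1 where w1: "w1 \<in> ?V" "f w1 = v1" using f(1) by (metis UNIV_I bij_betw_imp_surj_on imageE)
  obtain w2 where w2: "w2 \<in> ?V" "f w2 = v2" using f(1) by (metis UNIV_I bij_betw_imp_surj_on imageE)
  have V: "\<exists>a b. x = sc a w1 + sc b w2" if x: "x \<in> ?V" for x
  proof -
    have "f x \<in> M.span {v1, v2}" using v(3) by simp
    then obtain a b where "f x = scaleM a v1 + scaleM b v2"
      by (auto simp: M.span_insert M.span_singleton M.span_breakdown_eq) (metis add.commute diff_add_cancel)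
    then have "f x = f (sc a w1 + sc b w2)" using w1 w2 by (simp add: f Vsc)
    then have "x = sc a w1 + sc b w2" using x w1 w2 by (intro inj) (simp_all add: Vadd Vsc)
    then show ?thesis by blast
  qed
  have "v1 \<noteq> 0" "v2 \<noteq> 0" using v(2) M.dependent_zero by auto
  then have nz: "w1 \<noteq> 0" "w2 \<noteq> 0" using f0 w1 w2 by auto
  have act: "inv_act F sc action x T = y" if "x \<in> ?V" "y \<in> ?V" "T \<in> Hecke F" "ract (f x) T = f y" for x y T
    using that f(4) inv_act_invariant[OF pi] by (intro inj) auto
  have Pi: "action (matrix_inv (Pi_mat F)) x = y" if "x \<in> ?V" "y \<in> ?V" "ract (f x) (T_Pi F) = f y" for x y
    using act[OF that(1,2) inv_act_T_Pi(1)[OF pi that(1)] that(3)] inv_act_T_Pi(2)[OF pi that(1)] by simp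
  have Tn: "G.Tn x = y" if x: "x \<in> ?V" and y: "y \<in> ?V" "ract (f x) (T_ns F) = f y" for x y
  proof -
    have xK: "x \<in> invariants (K1 F) action" using x by (rule Iw1_invariants_K1)
    have "G.Tn x = (\<Sum>t\<in>UNIV. action (lift (um t) ** matrix_inv n_s) x)"
      unfolding G.Tn_def
    proof (rule sum.cong[OF refl])
      fix t :: 'q
      have "act nm x = action (matrix_inv n_s) x"
        using lift_red[OF pi inv_n_s_K(1) xK] inv_n_s_K by (simp add: act_def)
      moreover have "lift (um t) \<in> carrier GL2" "matrix_inv n_s \<in> (carrier GL2 :: ('f^2^2) set)"
        using K_GL2[OF inv_n_s_K(1)] K_GL2 lift[of "um t"] by simp_all
      ultimately show "act (um t) (act nm x) = action (lift (um t) ** matrix_inv n_s) x"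
        by (simp add: rep(3)) (simp add: act_def)
    qed
    then show ?thesis
      using act[OF x y(1) inv_act_T_ns(1)[OF pi x] y(2)] inv_act_T_ns(2)[OF pi x] by simp
  qed
  have wt: "G.weight psi x" if psi: "torus_char psi" and x: "x \<in> ?V" "ract (f x) (e_chi F psi) = f x" for psi x
    using act[OF x(1,1) inv_act_e_chi(1)[OF pi x(1)] x(2)] inv_act_e_chi(2)[OF pi x(1), of psi]
      Iw1_invariants_K1[OF x(1)]
    by (intro G.weight_of_projection[OF psi, where c = "inverse (of_nat (card (Torus :: ('q^2^2) set)))"])
      (auto simp: act_def)
  show thesis
  proof (rule that[OF nz w1(1) w2(1) V])
    show "action (matrix_inv (Pi_mat F)) w1 = w2" "action (matrix_inv (Pi_mat F)) w2 = w1"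
      using w1 w2 v by (auto intro: Pi)
    show "G.weight chi w1" "G.weight (conj_s chi) w2"
      using w1 w2 v chi torus_char_conj_s[OF chi] by (auto intro: wt)
    show "G.Tn w1 = (if s_invariant chi then - w1 else 0)" "G.Tn w2 = 0"
      using w1 w2 v by (auto intro!: Tn simp: V0 Vneg f0 fneg)
  qed
qed

end

context rho_pair
begin

text \<open>The two vectors are called \<open>wA\<close> and \<open>wB\<close> because either order
  of the basis of the module may occur. The assumption \<open>distinct\<close> separates their lines
  when the weights agree.\<close>

lemma dim_Hom_eq_1:
  fixes sc :: "'k \<Rightarrow> 'v::ab_group_add \<Rightarrow> 'v"
  assumes pi: "group_rep GL2 sc action"
  defines "act \<equiv> \<lambda>g :: 'q^2^2. action (lift g)"
  assumes nz: "wA \<noteq> 0" "wB \<noteq> 0"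
    and inv: "wA \<in> invariants (Iw1 F) action" "wB \<in> invariants (Iw1 F) action"
      "\<And>v. v \<in> invariants (Iw1 F) action \<Longrightarrow> \<exists>a b. v = sc a wA + sc b wB"
    and Pi: "action (matrix_inv Pm) wA = wB" "action (matrix_inv Pm) wB = wA"
    and weight: "gl2_rep.weight sc act chi wA" "gl2_rep.weight sc act (conj_s chi) wB"
    and Tn: "gl2_rep.Tn act wA = sc (T_eigenvalue chi J) wA"
      "gl2_rep.Tn act wB = sc (T_eigenvalue (conj_s chi) J') wB"
    and distinct: "s_invariant chi \<Longrightarrow> T_eigenvalue chi J \<noteq> T_eigenvalue (conj_s chi) J'"
  shows "vector_space.dim (fun_scale sc)
    (Hom_rep (carrier GL2) (H0 F (fun_scale sd) V) (rep_on UNIV sc action)) = 1"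
proof -
  note rep = group_rep_GL2D[OF pi]
  let ?W = "invariants (K1 F) action"
  let ?V = "invariants (Iw1 F) action"
  interpret T: diagram_target F sd a0 E a1 sc action by (intro diagram_target.intro diagram_target_axioms.intro diagram_axioms pi)
  interpret G: gl2_rep sc ?W act unfolding act_def by (rule K1_invariants_rep[OF pi A.A.char_eq])
  have WK: "v \<in> ?V \<Longrightarrow> v \<in> ?W" for v by (rule Iw1_invariants_K1)
  have act_K: "action k v = act (red_mat F k) v" if "k \<in> K F" "v \<in> ?W" for k v
    using lift_red[OF pi that] by (simp add: act_def)
  have Uinv: "G.U_inv v \<longleftrightarrow> v \<in> ?V" if v: "v \<in> ?W" for v
  proof
    assume U: "G.U_inv v"
    have "action k v = v" if "k \<in> Iw1 F" for k
      using that U act_K[OF Iw1_K[OF that] v] by (auto simp: Iw1_def Unip_iff G.U_inv_def)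
    then show "v \<in> ?V" by (simp add: invariants_def)
  next
    assume V: "v \<in> ?V"
    have "lift (um t) \<in> Iw1 F" for t using lift[of "um t"] by (auto simp: Iw1_def Unip_iff)
    then show "G.U_inv v" using V unfolding G.U_inv_def by (auto simp: act_def invariants_def)
  qed
  have BA: "G.B_eigen chi wA" and BB: "G.B_eigen (conj_s chi) wB"
    using weight inv Uinv WK chi_one by (simp_all add: G.B_eigen_iff)
  have split: "\<exists>x\<in>?W. \<exists>y\<in>?W. v = x + y \<and> G.weight chi x \<and> G.weight (conj_s chi) y"
    if v: "v \<in> ?W" "G.U_inv v" for v
  proof -
    obtain a b where "v = sc a wA + sc b wB" using inv(3) v Uinv by blast
    moreover have "G.weight psi (sc c w)" if "w \<in> ?W" "G.weight psi w" for psi c w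
      unfolding G.weight_def
    proof
      fix d :: "'q^2^2" assume d: "d \<in> Torus"
      then have "act d (sc c w) = sc c (act d w)"
        by (intro G.act_scale that Borel_GL2 Torus_Borel)
      also have "act d w = sc (psi d) w" using that(2) d by (simp add: G.weight_def)
      finally show "act d (sc c w) = sc (psi d) (sc c w)" by (simp add: mult.commute)
    qed
    ultimately show ?thesis using inv(1,2) WK weight G.W_scale by blast
  qed
  obtain \<psi>A where \<psi>A: "\<And>x y. \<psi>A (x + y) = \<psi>A x + \<psi>A y" "\<And>c x. \<psi>A (scA c x) = sc c (\<psi>A x)"
    "\<And>g x. g \<in> carrier GL2 \<Longrightarrow> \<psi>A (actA g x) = act g (\<psi>A x)" "\<And>x. \<psi>A x \<in> ?W" "\<psi>A vA = wA"
    using A.hom_exists[OF G.gl2_rep_axioms chi WK[OF inv(1)] BA Tn(1) split] by blast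
  have split': "\<exists>x\<in>?W. \<exists>y\<in>?W. v = x + y \<and> G.weight (conj_s chi) x \<and> G.weight (conj_s (conj_s chi)) y"
    if "v \<in> ?W" "G.U_inv v" for v
    using split[OF that] by (metis add.commute conj_s_conj_s)
  obtain \<psi>B where \<psi>B: "\<And>x y. \<psi>B (x + y) = \<psi>B x + \<psi>B y" "\<And>c x. \<psi>B (scB c x) = sc c (\<psi>B x)"
    "\<And>g x. g \<in> carrier GL2 \<Longrightarrow> \<psi>B (actB g x) = act g (\<psi>B x)" "\<And>x. \<psi>B x \<in> ?W" "\<psi>B vB = wB"
    using B.hom_exists[OF G.gl2_rep_axioms torus_char_conj_s[OF chi] WK[OF inv(2)] BB Tn(2) split'] by blast
  define \<psi> where "\<psi> d = \<psi>A (fst d) + \<psi>B (snd d)" for d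
  have PiG: "matrix_inv Pm \<in> carrier GL2" "Pm \<in> carrier GL2" by simp_all
  \<comment> \<open>The inverse of \<open>Pm\<close> exchanges the two vectors, so its square fixes
    both, and this square is the inverse of the uniformiser.\<close>
  have central: "action (mat (unif F)) w = w" if "w \<in> {wA, wB}" for w
  proof -
    have "w = action (matrix_inv Pm) (action (matrix_inv Pm) w)" using that Pi by auto
    then have "action (mat (unif F)) w = action (Pm ** Pm) (action (matrix_inv Pm) (action (matrix_inv Pm) w))"
      by (simp add: Pi_Pi)
    then show ?thesis using PiG by (simp add: rep(3,11))
  qed
  have unif_fixes: "action (mat (unif F powi n)) v = v" if v: "action (mat (unif F)) v = v" for n v
  proof -
    have mG: "mat (unif F ^ m) \<in> carrier GL2" for m by simp
    have pow: "action (mat (unif F ^ m)) v = v" for m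
    proof (induction m)
      case (Suc m)
      have "action (mat (unif F ^ Suc m)) v = action (mat (unif F) ** mat (unif F ^ m)) v"
        by (simp add: mat_mult_mat)
      also have "\<dots> = action (mat (unif F)) (action (mat (unif F ^ m)) v)" by (rule rep(3)) simp_all
      finally show ?case using Suc v by simp
    qed (simp add: rep)
    have inv: "action (mat (inverse (unif F ^ m))) v = v" for m
    proof -
      have "matrix_inv (mat (unif F ^ m)) = (mat (inverse (unif F ^ m)) :: 'f^2^2)"
        using unif_nonzero by (intro matrix_inv_eqI) (simp add: mat_mult_mat)
      then show ?thesis using rep(10)[OF mG[of m], of v] pow[of m] by simp
    qed
    show ?thesis using pow inv by (cases "n \<ge> 0") (simp_all add: power_int_def power_inverse)
  qed
  have commute: "action (mat (unif F)) (act g v) = act g (action (mat (unif F)) v)" if "g \<in> carrier GL2" for g v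
  proof -
    have "lift g \<in> carrier GL2" using lift[OF that] K_GL2 by blast
    then show ?thesis unfolding act_def by (simp add: mat_mult_commute flip: rep(3))
  qed
  \<comment> \<open>The uniformiser is central, so it fixes the whole image once it fixes the image
    of the generator.\<close>
  have centralA: "action (mat (unif F)) (\<psi>A x) = \<psi>A x" for x
  proof (rule A.A.subspace_fixed_gen[where P = "\<lambda>x. action (mat (unif F)) (\<psi>A x) = \<psi>A x" and w = vA])
    show "A.A.subspace {x \<in> UNIV. action (mat (unif F)) (\<psi>A x) = \<psi>A x}"
      using \<psi>A(2)[of 0 0] by (auto simp: A.A.subspace_def \<psi>A(1,2) rep)
    show "action (mat (unif F)) (\<psi>A (actA g vA)) = \<psi>A (actA g vA)" if "g \<in> carrier GL2" for g
      using that central by (simp add: \<psi>A commute)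
  qed (simp_all add: A.generates)
  have centralB: "action (mat (unif F)) (\<psi>B x) = \<psi>B x" for x
  proof (rule B.A.subspace_fixed_gen[where P = "\<lambda>x. action (mat (unif F)) (\<psi>B x) = \<psi>B x" and w = vB])
    show "B.A.subspace {x \<in> UNIV. action (mat (unif F)) (\<psi>B x) = \<psi>B x}"
      using \<psi>B(2)[of 0 0] by (auto simp: B.A.subspace_def \<psi>B(1,2) rep)
    show "action (mat (unif F)) (\<psi>B (actB g vB)) = \<psi>B (actB g vB)" if "g \<in> carrier GL2" for g
      using that central by (simp add: \<psi>B commute)
  qed (simp_all add: B.generates)
  have hom: "T.diagram_hom \<psi>"
    unfolding T.diagram_hom_def
  proof (intro conjI allI ballI)
    show "\<psi> (d + d') = \<psi> d + \<psi> d'" for d d' by (simp add: \<psi>_def \<psi>A \<psi>B)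
    show "\<psi> (sd c d) = sc c (\<psi> d)" for c d
      by (cases d) (simp add: \<psi>_def \<psi>A \<psi>B prod_scale_def T.pi.scale_right_distrib)
    show "\<psi> (a0 g d) = action g (\<psi> d)" if g: "g \<in> S0" for g d
    proof -
      obtain n k where k: "k \<in> K F" "g = mat (unif F powi n) ** k" by (rule stab0_decomp[OF g])
      have kG: "red_mat F k \<in> carrier GL2" by (rule red_mat_GL2[OF k(1)])
      have "\<psi> (a0 g d) = action k (\<psi>A (fst d)) + action k (\<psi>B (snd d))"
        using k kG by (simp add: \<psi>_def a0_powi \<psi>A \<psi>B act_K)
      also have "\<dots> = action k (\<psi> d)" using K_GL2[OF k(1)] by (simp add: \<psi>_def rep)
      finally have eq: "\<psi> (a0 g d) = action k (\<psi> d)" .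
      have "action (mat (unif F)) (\<psi> d) = \<psi> d" by (simp add: \<psi>_def rep centralA centralB)
      moreover have "action g (\<psi> d) = action k (action (mat (unif F powi n)) (\<psi> d))"
        using K_GL2[OF k(1)] unfolding k(2) mat_mult_commute by (intro rep(3)) simp_all
      ultimately show ?thesis using eq unif_fixes by simp
    qed
    show "\<psi> d = action Pm (\<psi> (a1 (matrix_inv Pm) d))" if d: "d \<in> E" for d
    proof -
      obtain x y where xy: "d = (scA x vA, scB y vB)" using d by (auto simp: E_eq)
      have ni: "matrix_inv Pm \<notin> ZI F"
        using ZI_fixes[of "matrix_inv Pm"] x0_neq_x1 by (auto simp: move_eq_iff)
      have "a1 (matrix_inv Pm) d = swap d" using ni C0.act_one by (simp add: a1_not_ZI)
      moreover have "action Pm wA = wB" "action Pm wB = wA"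
        using Pi rep(11)[OF PiG(2), of wA] rep(11)[OF PiG(2), of wB] by simp_all
      ultimately show ?thesis
        using PiG by (simp add: xy swap_eq \<psi>_def \<psi>A \<psi>B rep add.commute)
    qed
  qed
  have A0: "\<psi>A 0 = 0" "\<psi>B 0 = 0" using \<psi>A(2)[of 0 0] \<psi>B(2)[of 0 0] by simp_all
  \<comment> \<open>The component of \<open>v\<close> along \<open>wB\<close> is excluded by the
    eigenvalue of T if the two weights agree, and by the weight otherwise.\<close>
  have unique: "\<exists>c. v = sc c wA"
    if v: "v \<in> ?V" "G.weight chi v" "G.Tn v = sc (T_eigenvalue chi J) v" for v
  proof -
    obtain a b where ab: "v = sc a wA + sc b wB" using inv(3) v(1) by blast
    have W: "wA \<in> ?W" "wB \<in> ?W" using inv WK by auto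
    have "b = 0"
    proof (cases "s_invariant chi")
      case True
      let ?eA = "T_eigenvalue chi J" and ?eB = "T_eigenvalue (conj_s chi) J'"
      have "G.Tn v = sc a (G.Tn wA) + sc b (G.Tn wB)"
        using W by (simp add: ab G.Tn_def G.act_add G.act_scale G.act_closed G.W_scale sum.distrib T.pi.scale_sum_right)
      then have "sc (b * ?eB) wB = sc (b * ?eA) wB"
        using v(3) by (simp add: Tn ab T.pi.scale_right_distrib mult.commute)
      then show ?thesis using nz(2) distinct[OF True] by auto
    next
      case False
      then obtain h where h: "h \<in> Torus" "chi h \<noteq> conj_s chi h" by (auto simp: s_invariant_def)
      then have hG: "h \<in> carrier GL2" using Torus_Borel Borel_GL2 by blast
      have "act h v = sc (chi h * a) wA + sc (conj_s chi h * b) wB"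
        using W weight h(1) hG by (simp add: ab G.act_add G.act_scale G.W_scale G.weight_def mult.commute)
      moreover have "act h v = sc (chi h * a) wA + sc (chi h * b) wB"
        using v(2) h(1) by (simp add: G.weight_def ab T.pi.scale_right_distrib)
      ultimately have "sc (conj_s chi h * b) wB = sc (chi h * b) wB" by (metis add_left_cancel)
      then show ?thesis using nz(2) h(2) by auto
    qed
    then show ?thesis using ab by auto
  qed
  show ?thesis
  proof (rule T.dim_HomH_eq_1[OF hom])
    show "\<psi> (vA, 0) \<noteq> 0" using nz by (simp add: \<psi>_def \<psi>A A0)
    fix \<phi> assume \<phi>: "T.diagram_hom \<phi>"
    note phi = T.psi[OF \<phi>]
    have phi0: "\<phi> 0 = 0" using phi(1)[of 0 0] by simp
    define p where "p = \<phi> (vA, 0)"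
    have Z: "scB c 0 = 0" "scA c 0 = 0" for c by simp_all
    have phiA: "\<phi> (x + y, 0) = \<phi> (x, 0) + \<phi> (y, 0)" "\<phi> (scA c x, 0) = sc c (\<phi> (x, 0))"
      and phiB: "\<phi> (0, x' + y') = \<phi> (0, x') + \<phi> (0, y')" "\<phi> (0, scB c x') = sc c (\<phi> (0, x'))" for x y c x' y'
      using phi(1)[of "(x, 0)" "(y, 0)"] phi(2)[of c "(x, 0)"] phi(1)[of "(0, x')" "(0, y')"] phi(2)[of c "(0, x')"]
      by (simp_all add: prod_scale_def)
    have phi_K: "action k (\<phi> (x, y)) = \<phi> (actA (red_mat F k) x, actB (red_mat F k) y)" if "k \<in> K F" for k x y
      using phi(3)[of k "(x, y)"] K_fix[OF that] K_GL2[OF that] a0_K[OF that, of x y] by (simp add: stab0_iff)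
    have phi_act: "act g (\<phi> (x, y)) = \<phi> (actA g x, actB g y)" if "g \<in> carrier GL2" for g x y
      using phi_K[of "lift g" x y] lift[OF that] by (simp add: act_def)
    \<comment> \<open>Elements of \<open>K1 F\<close> reduce to the identity and hence act trivially
      on \<open>D_0\<close>.\<close>
    have phi_W: "\<phi> d \<in> ?W" for d
      using phi_K[of _ "fst d" "snd d"] A.A.act_one B.A.act_one by (auto simp: invariants_def K1_def)
    have "A.A.weight chi vA" "A.A.U_inv vA"
      using A.B_eigen chi_one A.A.B_eigen_iff[of vA chi] by auto
    then have "G.weight chi p" "G.U_inv p"
      using phi_act[of _ vA 0, OF Borel_GL2[OF Torus_Borel]] phi_act[of "um _" vA 0] B.A.act_0[OF Borel_GL2[OF Torus_Borel]] B.A.act_0[of "um _"]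
      by (auto simp: p_def G.weight_def A.A.weight_def G.U_inv_def A.A.U_inv_def phiA(2))
    moreover have "G.Tn p = \<phi> (A.A.Tn vA, 0)"
    proof -
      have sumA: "\<phi> (sum f S, 0) = (\<Sum>t\<in>S. \<phi> (f t, 0))" for f :: "'q \<Rightarrow> 'a" and S
        using phi0 by (induction S rule: infinite_finite_induct) (simp_all add: phiA(1) zero_prod_def)
      show ?thesis by (simp add: G.Tn_def A.A.Tn_def p_def phi_act sumA B.A.act_0)
    qed
    ultimately have "\<exists>c. p = sc c wA"
      using Uinv[OF phi_W] by (intro unique) (auto simp: p_def A.Tn_vA phiA(2))
    then obtain c where c: "p = sc c wA" by blast
    have vAE: "(vA, 0) \<in> E" unfolding E_eq by (intro CollectI exI[of _ 1] exI[of _ 0]) simp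
    \<comment> \<open>This couples the two summands: the value at \<open>(0, vB)\<close> is obtained
      from the value at \<open>(vA, 0)\<close> and so involves the same scalar
      \<open>c\<close>.\<close>
    have "a1 (matrix_inv Pm) (vA, 0) = (0, vB)"
    proof -
      have "matrix_inv Pm \<notin> ZI F"
        using ZI_fixes[of "matrix_inv Pm"] x0_neq_x1 by (auto simp: move_eq_iff)
      then have "a1 (matrix_inv Pm) (vA, 0) = swap (vA, 0)" using C0.act_one by (simp add: a1_not_ZI)
      then show ?thesis using swap_eq[of 1 0] by simp
    qed
    then have "action Pm (\<phi> (0, vB)) = p" using phi(4)[OF vAE] by (simp add: p_def)
    then have q: "\<phi> (0, vB) = sc c wB"
      using rep(10)[OF PiG(2), of "\<phi> (0, vB)"] PiG Pi by (simp add: c rep(5))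
    have "\<phi> (x, 0) = sc c (\<psi>A x)" for x
    proof (rule A.A.subspace_fixed_gen[where P = "\<lambda>x. \<phi> (x, 0) = sc c (\<psi>A x)" and w = vA])
      show "A.A.subspace {x \<in> UNIV. \<phi> (x, 0) = sc c (\<psi>A x)}"
        using phi0 A0 by (auto simp: A.A.subspace_def phiA \<psi>A T.pi.scale_right_distrib zero_prod_def mult.commute)
      show "\<phi> (actA g vA, 0) = sc c (\<psi>A (actA g vA))" if g: "g \<in> carrier GL2" for g
        using phi_act[OF g, of vA 0] g WK[OF inv(1)] c by (simp add: \<psi>A B.A.act_0 G.act_scale p_def)
    qed (simp_all add: A.generates)
    moreover have "\<phi> (0, y) = sc c (\<psi>B y)" for y
    proof (rule B.A.subspace_fixed_gen[where P = "\<lambda>x. \<phi> (0, x) = sc c (\<psi>B x)" and w = vB])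
      show "B.A.subspace {x \<in> UNIV. \<phi> (0, x) = sc c (\<psi>B x)}"
        using phi0 A0 by (auto simp: B.A.subspace_def phiB \<psi>B T.pi.scale_right_distrib zero_prod_def mult.commute)
      show "\<phi> (0, actB g vB) = sc c (\<psi>B (actB g vB))" if g: "g \<in> carrier GL2" for g
        using phi_act[OF g, of 0 vB] g WK[OF inv(2)] q by (simp add: \<psi>B A.A.act_0 G.act_scale)
    qed (simp_all add: B.generates)
    moreover have "\<phi> d = \<phi> (fst d, 0) + \<phi> (0, snd d)" for d
      using phi(1)[of "(fst d, 0)" "(0, snd d)"] by simp
    ultimately have "\<phi> d = sc c (\<psi>A (fst d)) + sc c (\<psi>B (snd d))" for d by metis
    then have "\<phi> d = sc c (\<psi> d)" for d by (simp add: \<psi>_def T.pi.scale_right_distrib)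
    then show "\<exists>c. \<forall>d. \<phi> d = sc c (\<psi> d)" by blast
  qed
qed

end

lemma rho_rep_if_is_rho:
  fixes scA :: "'k::field \<Rightarrow> 'a::ab_group_add \<Rightarrow> 'a" and actA :: "'q::{field,finite}^2^2 \<Rightarrow> 'a \<Rightarrow> 'a"
  assumes "torus_char chi" "CHAR('k) = CHAR('q)" "is_rho chi J scA actA" "vA \<in> invariants Unip actA" "vA \<noteq> 0"
  shows "rho_rep scA actA chi J vA"
proof (cases "s_invariant chi")
  case True
  show ?thesis
  proof (cases "J = {s_mat}")
    case True
    show ?thesis by (rule rho_rep_char[OF assms(2) \<open>s_invariant chi\<close> True assms(3,5)])
  next
    case False
    show ?thesis by (rule rho_rep_Steinberg[OF assms(2) \<open>s_invariant chi\<close> False assms(3-5)])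
  qed
next
  case False
  show ?thesis by (rule rho_rep_generic[OF assms(1,2) False assms(3-5)])
qed

lemma (in nonarch_local_field) invariants_inflate:
  "invariants (Iw1 F) (inflate F act) = invariants Unip act"
proof -
  have "\<exists>k\<in>Iw1 F. red_mat F k = u" if "u \<in> Unip" for u :: "'q^2^2"
    using lift[of u] that by (auto simp: Iw1_def Unip_iff)
  then show ?thesis by (force simp: invariants_def inflate_def Iw1_def)
qed

theorem corollary6p10:
  fixes F :: "('f::field, 'q::{field, finite}) valued_field"
    and chi :: "'q^2^2 \<Rightarrow> 'k::alg_closed_field"
    and sc :: "'k \<Rightarrow> 'v::ab_group_add \<Rightarrow> 'v" and action :: "'f^2^2 \<Rightarrow> 'v \<Rightarrow> 'v"
    and scaleM :: "'k \<Rightarrow> 'm::ab_group_add \<Rightarrow> 'm"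
    and ract :: "'m \<Rightarrow> (('f^2^2 \<Rightarrow> 'k) \<Rightarrow> 'f^2^2 \<Rightarrow> 'k) \<Rightarrow> 'm"
    and J :: "('q^2^2) set"
    and scaleA :: "'k \<Rightarrow> 'a::ab_group_add \<Rightarrow> 'a" and actA :: "'q^2^2 \<Rightarrow> 'a \<Rightarrow> 'a" and vA :: 'a
    and scaleB :: "'k \<Rightarrow> 'b::ab_group_add \<Rightarrow> 'b" and actB :: "'q^2^2 \<Rightarrow> 'b \<Rightarrow> 'b" and vB :: 'b
  assumes F: "nonarch_local_field F"
    and k: "is_Fp_bar TYPE('k)" "CHAR('k) = CHAR('q)"
    and chi: "torus_char chi"
    and rhoA: "is_rho chi J scaleA actA"
      "vA \<in> invariants (Iw1 F) (inflate F actA)" "vA \<noteq> 0"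
    and rhoB: "is_rho (conj_s chi) (J0 chi - J) scaleB actB"
      "vB \<in> invariants (Iw1 F) (inflate F actB)" "vB \<noteq> 0"
    and J: "J \<subseteq> J0 chi"
    and M: "is_M_gamma F chi scaleM ract"
    and pi: "smooth_rep F sc action"
    and iso: "invariants_iso F sc action scaleM ract"
  shows "vector_space.dim (fun_scale sc)
           (Hom_rep (carrier GL2)
             (H0 F (fun_scale (prod_scale scaleA scaleB))
               (V_gamma F scaleA actA vA scaleB actB vB))
             (rep_on UNIV sc action)) = 1"
proof -
  interpret nonarch_local_field F by (rule F)
  let ?J' = "J0 chi - J"
  have A: "rho_rep scaleA actA chi J vA"
    using rhoA by (intro rho_rep_if_is_rho chi k(2)) (simp_all add: invariants_inflate)
  have B: "rho_rep scaleB actB (conj_s chi) ?J' vB"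
    using rhoB by (intro rho_rep_if_is_rho torus_char_conj_s chi k(2)) (simp_all add: invariants_inflate)
  interpret rho_pair F scaleA actA chi J vA scaleB actB ?J' vB
    by (intro rho_pair.intro rho_pair_axioms.intro F A B chi)
  have rep: "group_rep GL2 sc action" using pi by (simp add: smooth_rep_def)
  let ?act = "\<lambda>g :: 'q^2^2. action (lift g)"
  interpret G: gl2_rep sc "invariants (K1 F) action" ?act
    by (rule K1_invariants_rep[OF rep k(2)])
  obtain w1 w2 where w: "w1 \<noteq> 0" "w2 \<noteq> 0" "w1 \<in> invariants (Iw1 F) action" "w2 \<in> invariants (Iw1 F) action"
    "\<And>v. v \<in> invariants (Iw1 F) action \<Longrightarrow> \<exists>a b. v = sc a w1 + sc b w2"
    "action (matrix_inv (Pi_mat F)) w1 = w2" "action (matrix_inv (Pi_mat F)) w2 = w1"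
    and wt: "G.weight chi w1" "G.weight (conj_s chi) w2"
    and Tn: "G.Tn w1 = (if s_invariant chi then - w1 else 0)" "G.Tn w2 = 0"
  proof (rule supersingular_vectors[OF rep k(2) chi M iso], goal_cases)
    case (1 w1 w2)
    show ?case by (rule 1(1)[OF 1(2-)])
  qed
  show ?thesis unfolding V_gamma_eq
  proof (cases "s_invariant chi \<and> J = {s_mat}")
    case True
    \<comment> \<open>The first summand is now the character, with eigenvalue 0, and the second the
      Steinberg representation. So \<open>vA\<close> must be paired with \<open>w2\<close>, and
      \<open>w1\<close>, which carries the eigenvalue -1, with \<open>vB\<close>.\<close>
    have w5: "\<exists>a b. v = sc a w2 + sc b w1" if "v \<in> invariants (Iw1 F) action" for v
      using w(5)[OF that] by (metis add.commute)
    have wt': "G.weight chi w2" "G.weight (conj_s chi) w1"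
      using wt True by (auto simp: G.weight_def s_invariant_def)
    show "vector_space.dim (fun_scale sc) (Hom_rep (carrier GL2) (H0 F (fun_scale sd) V) (rep_on UNIV sc action)) = 1"
      by (rule dim_Hom_eq_1[OF rep w(2,1,4,3) w5 w(7,6) wt'])
        (use True J Tn in \<open>simp_all add: T_eigenvalue_def J0_def\<close>)
  next
    case False
    \<comment> \<open>Either chi equals its conjugate and \<open>J\<close> is empty, in which case
      the second summand is the character, or the two weights differ and every eigenvalue is
      0.\<close>
    have "T_eigenvalue (conj_s chi) ?J' = 0"
      using False J by (auto simp: T_eigenvalue_def J0_def)
    moreover have "s_invariant chi \<Longrightarrow> T_eigenvalue chi J = -1" "\<not> s_invariant chi \<Longrightarrow> T_eigenvalue chi J = 0"
      using False by (auto simp: T_eigenvalue_def)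
    ultimately show "vector_space.dim (fun_scale sc) (Hom_rep (carrier GL2) (H0 F (fun_scale sd) V) (rep_on UNIV sc action)) = 1"
      by (intro dim_Hom_eq_1[OF rep w(1,2,3,4,5,6,7) wt]) (simp_all add: Tn)
  qed
qed

end
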